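(* Let $\mathcal{C}$ be a suitable model category. Then $\mathbf{HoF}_{fb}(\mathcal{C}_{fb})$ is an $h^=$-fibration, and the localization morphism $\gamma:\mathbf{F}_{fb}(\mathcal{C}_{fb})\to\mathbf{HoF}_{fb}(\mathcal{C}_{fb})$ (over $\mathcal{C}_{fb}$) is a morphism of $h$-fibrations.
   Context: A model category $\mathcal{C}$ is suitable if (i) it is right proper (weak equivalences are stable under pullback along fibrations); (ii) the cofibrations are exactly the monomorphisms; (iii) $[f,g]:A+B\to C$ is a fibration whenever $f:A\to C$ and $g:B\to C$ are, and $0\to A$ is always a fibration; (iv) $\mathcal{C}$ is locally cartesian closed (has a terminal object and every slice is cartesian closed). $\mathcal{C}_{fb}$ is the full subcategory of fibrant objects. $\mathbf{F}_{fb}(\mathcal{C}_{fb})$ is the functor $(\mathcal{C}_{fb}^{\to})_{fb}\to\mathcal{C}_{fb}$ where $(\mathcal{C}_{fb}^{\to})_{fb}$ has objects the fibrations $x:X\to A$ with $A$ fibrant and morphisms commutative squares, the functor taking the codomain. $\mathbf{HoF}_{fb}(\mathcal{C}_{fb})$ is the functor $\mathrm{Ho}(\mathcal{C}_{fb}^{\to})_{fb}\to\mathcal{C}_{fb}$ obtained by localizing $(\mathcal{C}_{fb}^{\to})_{fb}$ at the vertical weak equivalences (squares whose bottom map is an identity and whose top map is a weak equivalence), the functor being induced by the codomain; $\gamma$ is the localization functor (it is a fibration and $\gamma$ a morphism of fibrations). Fibration terminology: objects/morphisms lie over their images; the fiber over $A$ consists of objects over $A$ and morphisms over $\mathrm{id}_A$.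 Cartesian morphism $q:Q\to R$ over $g$: every $r:P\to R$ over $gf$ factors uniquely as $qp$ with $p$ over $f$; cocartesian is dual. A product/coproduct/exponential diagram in a fiber is stable (along $f$) if pulling all its objects back along cartesian lifts of $f$ yields a diagram of the same kind. A $\prod$-diagram over $f:A\to B$ based on $P\in\mathcal{C}^A$: a cartesian $c:f^*R\to R$ over $f$ and $\varepsilon:f^*R\to P$ over $\mathrm{id}_A$ such that for every cartesian $c':S\to Q$ over $f$ and $p:S\to P$ over $\mathrm{id}_A$ there is a unique $\tilde p:Q\to R$ over $\mathrm{id}_B$ with $\varepsilon\circ u=p$, where $u$ is the unique morphism over $\mathrm{id}_A$ with $cu=\tilde p c'$. For a pullback square $gh=kf$ in the base: a cocartesian morphism over $g$ is stable along $k$ if the morphism between the domains of cartesian lifts of its domain (over $h$) and codomain (over $k$) induced over $f$ is cocartesian; a $\prod$-diagram over $g$ is stable along $k$ if the analogously induced diagram over $f$ is a $\prod$-diagram. An $h$-fibration is a fibration whose fibers have stable finite products, coproducts and exponentials, whose base has finite products, such that over every product projection $\pi_2:A\times B\to B$ and every $P$ over $A\times B$ there is a cocartesian lift with domain $P$ and a $\prod$-diagram based on $P$, all such being stable along all morphisms. An $h^=$-fibration additionally has, for every diagonal $\Delta_B$, a cocartesian lift with domain any terminal object of the fiber over $B$. A morphism of $h$-fibrations over a base is a functor commuting with the projections, preserving cartesian morphisms, inducing bicartesian closed functors on fibers, and preserving cocartesian morphisms and $\prod$-diagrams over product projections. *)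

theory Defs
  imports Main
begin

section \<open>Categories and functors\<close>

record ('o, 'a) cat =
  Obj :: "'o set"
  Arr :: "'a set"
  Dom :: "'a \<Rightarrow> 'o"
  Cod :: "'a \<Rightarrow> 'o"
  Idt :: "'o \<Rightarrow> 'a"
  Cmp :: "'a \<Rightarrow> 'a \<Rightarrow> 'a"  (infixl "\<cdot>\<index>" 70)

definition hom :: "('o, 'a, 'm) cat_scheme \<Rightarrow> 'o \<Rightarrow> 'o \<Rightarrow> 'a set" where
  "hom C A B = {f \<in> Arr C. Dom C f = A \<and> Cod C f = B}"

text \<open>Composition is in the usual applicative order: \<open>g \<cdot> f\<close> is \<open>f\<close> followed by \<open>g\<close>.
  The values of the operations outside \<open>Obj\<close> and \<open>Arr\<close> are irrelevant.\<close>

locale category =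
  fixes C :: "('o, 'a, 'm) cat_scheme" (structure)
  assumes dom_obj: "f \<in> Arr C \<Longrightarrow> Dom C f \<in> Obj C"
    and cod_obj: "f \<in> Arr C \<Longrightarrow> Cod C f \<in> Obj C"
    and idt_hom: "A \<in> Obj C \<Longrightarrow> Idt C A \<in> hom C A A"
    and cmp_hom: "f \<in> hom C A B \<Longrightarrow> g \<in> hom C B D \<Longrightarrow> g \<cdot> f \<in> hom C A D"
    and idt_left: "f \<in> hom C A B \<Longrightarrow> Idt C B \<cdot> f = f"
    and idt_right: "f \<in> hom C A B \<Longrightarrow> f \<cdot> Idt C A = f"
    and cmp_assoc: "f \<in> hom C A B \<Longrightarrow> g \<in> hom C B D \<Longrightarrow> h \<in> hom C D E \<Longrightarrow>
      (h \<cdot> g) \<cdot> f = h \<cdot> (g \<cdot> f)"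

definition opp :: "('o, 'a, 'm) cat_scheme \<Rightarrow> ('o, 'a) cat" where
  "opp C = \<lparr>Obj = Obj C, Arr = Arr C, Dom = Cod C, Cod = Dom C, Idt = Idt C,
    Cmp = (\<lambda>g f. f \<cdot>\<^bsub>C\<^esub> g)\<rparr>"

definition full_subcat :: "('o, 'a, 'm) cat_scheme \<Rightarrow> 'o set \<Rightarrow> ('o, 'a) cat" where
  "full_subcat C S = \<lparr>Obj = Obj C \<inter> S, Arr = {f \<in> Arr C. Dom C f \<in> S \<and> Cod C f \<in> S},
    Dom = Dom C, Cod = Cod C, Idt = Idt C, Cmp = Cmp C\<rparr>"

text \<open>A commutative square \<open>y \<cdot> t = b \<cdot> x\<close> is encoded as \<open>(x, t, b, y)\<close>: it goes from the
  arrow \<open>x\<close> to the arrow \<open>y\<close>, with top side \<open>t\<close> and bottom side \<open>b\<close>.\<close>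

definition arrow_cat :: "('o, 'a, 'm) cat_scheme \<Rightarrow> ('a, 'a \<times> 'a \<times> 'a \<times> 'a) cat" where
  "arrow_cat C = \<lparr>Obj = Arr C,
    Arr = {(x, t, b, y). x \<in> Arr C \<and> y \<in> Arr C \<and> t \<in> hom C (Dom C x) (Dom C y) \<and>
      b \<in> hom C (Cod C x) (Cod C y) \<and> y \<cdot>\<^bsub>C\<^esub> t = b \<cdot>\<^bsub>C\<^esub> x},
    Dom = (\<lambda>(x, t, b, y). x), Cod = (\<lambda>(x, t, b, y). y),
    Idt = (\<lambda>x. (x, Idt C (Dom C x), Idt C (Cod C x), x)),
    Cmp = (\<lambda>(y, t', b', z) (x, t, b, y'). (x, t' \<cdot>\<^bsub>C\<^esub> t, b' \<cdot>\<^bsub>C\<^esub> b, z))\<rparr>"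

definition slice :: "('o, 'a, 'm) cat_scheme \<Rightarrow> 'o \<Rightarrow> ('a, 'a \<times> 'a \<times> 'a) cat" where
  "slice C A = \<lparr>Obj = {x \<in> Arr C. Cod C x = A},
    Arr = {(x, t, y). x \<in> Arr C \<and> Cod C x = A \<and> y \<in> Arr C \<and> Cod C y = A \<and>
      t \<in> hom C (Dom C x) (Dom C y) \<and> y \<cdot>\<^bsub>C\<^esub> t = x},
    Dom = (\<lambda>(x, t, y). x), Cod = (\<lambda>(x, t, y). y),
    Idt = (\<lambda>x. (x, Idt C (Dom C x), x)),
    Cmp = (\<lambda>(y, s, z) (x, t, y'). (x, s \<cdot>\<^bsub>C\<^esub> t, z))\<rparr>"

record ('o, 'a, 'p, 'b) ftr =
  Src :: "('o, 'a) cat"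
  Tgt :: "('p, 'b) cat"
  OMap :: "'o \<Rightarrow> 'p"
  AMap :: "'a \<Rightarrow> 'b"

locale cat_functor =
  fixes F :: "('o, 'a, 'p, 'b) ftr"
  assumes src_category: "category (Src F)"
    and tgt_category: "category (Tgt F)"
    and omap_obj: "A \<in> Obj (Src F) \<Longrightarrow> OMap F A \<in> Obj (Tgt F)"
    and amap_hom: "f \<in> hom (Src F) A B \<Longrightarrow> AMap F f \<in> hom (Tgt F) (OMap F A) (OMap F B)"
    and amap_idt: "A \<in> Obj (Src F) \<Longrightarrow> AMap F (Idt (Src F) A) = Idt (Tgt F) (OMap F A)"
    and amap_cmp: "f \<in> hom (Src F) A B \<Longrightarrow> g \<in> hom (Src F) B D \<Longrightarrow>
      AMap F (g \<cdot>\<^bsub>Src F\<^esub> f) = AMap F g \<cdot>\<^bsub>Tgt F\<^esub> AMap F f"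

definition opp_ftr :: "('o, 'a, 'p, 'b) ftr \<Rightarrow> ('o, 'a, 'p, 'b) ftr" where
  "opp_ftr F = \<lparr>Src = opp (Src F), Tgt = opp (Tgt F), OMap = OMap F, AMap = AMap F\<rparr>"

section \<open>Limits, colimits and exponentials\<close>

definition is_mono :: "('o, 'a, 'm) cat_scheme \<Rightarrow> 'a \<Rightarrow> bool" where
  "is_mono C f \<longleftrightarrow> f \<in> Arr C \<and>
    (\<forall>X. \<forall>g \<in> hom C X (Dom C f). \<forall>h \<in> hom C X (Dom C f). f \<cdot>\<^bsub>C\<^esub> g = f \<cdot>\<^bsub>C\<^esub> h \<longrightarrow> g = h)"

definition inverse_arrows :: "('o, 'a, 'm) cat_scheme \<Rightarrow> 'a \<Rightarrow> 'a \<Rightarrow> bool" where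
  "inverse_arrows C f g \<longleftrightarrow> f \<in> Arr C \<and> g \<in> hom C (Cod C f) (Dom C f) \<and>
    g \<cdot>\<^bsub>C\<^esub> f = Idt C (Dom C f) \<and> f \<cdot>\<^bsub>C\<^esub> g = Idt C (Cod C f)"

definition is_iso :: "('o, 'a, 'm) cat_scheme \<Rightarrow> 'a \<Rightarrow> bool" where
  "is_iso C f \<longleftrightarrow> (\<exists>g. inverse_arrows C f g)"

definition is_terminal :: "('o, 'a, 'm) cat_scheme \<Rightarrow> 'o \<Rightarrow> bool" where
  "is_terminal C T \<longleftrightarrow> T \<in> Obj C \<and> (\<forall>X \<in> Obj C. \<exists>!u. u \<in> hom C X T)"

definition is_initial :: "('o, 'a, 'm) cat_scheme \<Rightarrow> 'o \<Rightarrow> bool" where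
  "is_initial C Z \<longleftrightarrow> is_terminal (opp C) Z"

text \<open>\<open>R\<close> with projections \<open>p1 : R \<rightarrow> P\<close> and \<open>p2 : R \<rightarrow> Q\<close> is a product of \<open>P\<close> and \<open>Q\<close>.\<close>

definition is_product ::
  "('o, 'a, 'm) cat_scheme \<Rightarrow> 'o \<Rightarrow> 'o \<Rightarrow> 'o \<Rightarrow> 'a \<Rightarrow> 'a \<Rightarrow> bool" where
  "is_product C P Q R p1 p2 \<longleftrightarrow> p1 \<in> hom C R P \<and> p2 \<in> hom C R Q \<and>
    (\<forall>X. \<forall>f \<in> hom C X P. \<forall>g \<in> hom C X Q.
      \<exists>!u. u \<in> hom C X R \<and> p1 \<cdot>\<^bsub>C\<^esub> u = f \<and> p2 \<cdot>\<^bsub>C\<^esub> u = g)"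

definition is_coproduct ::
  "('o, 'a, 'm) cat_scheme \<Rightarrow> 'o \<Rightarrow> 'o \<Rightarrow> 'o \<Rightarrow> 'a \<Rightarrow> 'a \<Rightarrow> bool" where
  "is_coproduct C P Q S i1 i2 \<longleftrightarrow> is_product (opp C) P Q S i1 i2"

text \<open>An exponential diagram: a product \<open>R\<close> of \<open>E\<close> and \<open>P\<close> together with an evaluation arrow
  \<open>e : R \<rightarrow> Q\<close>. The arrow \<open>v\<close> below is \<open>u \<times> P\<close>.\<close>

definition is_exponential ::
  "('o, 'a, 'm) cat_scheme \<Rightarrow> 'o \<Rightarrow> 'o \<Rightarrow> 'o \<Rightarrow> 'o \<Rightarrow> 'a \<Rightarrow> 'a \<Rightarrow> 'a \<Rightarrow> bool" where
  "is_exponential C P Q E R p1 p2 e \<longleftrightarrow> is_product C E P R p1 p2 \<and> e \<in> hom C R Q \<and>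
    (\<forall>X S q1 q2 f. is_product C X P S q1 q2 \<and> f \<in> hom C S Q \<longrightarrow>
      (\<exists>!u. u \<in> hom C X E \<and>
        (\<exists>v \<in> hom C S R. p1 \<cdot>\<^bsub>C\<^esub> v = u \<cdot>\<^bsub>C\<^esub> q1 \<and> p2 \<cdot>\<^bsub>C\<^esub> v = q2 \<and> e \<cdot>\<^bsub>C\<^esub> v = f)))"

text \<open>\<open>is_pullback C g h k f\<close>: the square \<open>g \<cdot> h = k \<cdot> f\<close> is a pullback.\<close>

definition is_pullback ::
  "('o, 'a, 'm) cat_scheme \<Rightarrow> 'a \<Rightarrow> 'a \<Rightarrow> 'a \<Rightarrow> 'a \<Rightarrow> bool" where
  "is_pullback C g h k f \<longleftrightarrow> g \<in> Arr C \<and> k \<in> hom C (Dom C k) (Cod C g) \<and>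
    h \<in> hom C (Dom C h) (Dom C g) \<and> f \<in> hom C (Dom C h) (Dom C k) \<and>
    g \<cdot>\<^bsub>C\<^esub> h = k \<cdot>\<^bsub>C\<^esub> f \<and>
    (\<forall>X. \<forall>a \<in> hom C X (Dom C g). \<forall>b \<in> hom C X (Dom C k). g \<cdot>\<^bsub>C\<^esub> a = k \<cdot>\<^bsub>C\<^esub> b \<longrightarrow>
      (\<exists>!u. u \<in> hom C X (Dom C h) \<and> h \<cdot>\<^bsub>C\<^esub> u = a \<and> f \<cdot>\<^bsub>C\<^esub> u = b))"

definition has_finite_products :: "('o, 'a, 'm) cat_scheme \<Rightarrow> bool" where
  "has_finite_products C \<longleftrightarrow> (\<exists>T. is_terminal C T) \<and>
    (\<forall>P \<in> Obj C. \<forall>Q \<in> Obj C. \<exists>R p1 p2. is_product C P Q R p1 p2)"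

definition has_finite_coproducts :: "('o, 'a, 'm) cat_scheme \<Rightarrow> bool" where
  "has_finite_coproducts C \<longleftrightarrow> (\<exists>Z. is_initial C Z) \<and>
    (\<forall>P \<in> Obj C. \<forall>Q \<in> Obj C. \<exists>S i1 i2. is_coproduct C P Q S i1 i2)"

definition has_exponentials :: "('o, 'a, 'm) cat_scheme \<Rightarrow> bool" where
  "has_exponentials C \<longleftrightarrow>
    (\<forall>P \<in> Obj C. \<forall>Q \<in> Obj C. \<exists>E R p1 p2 e. is_exponential C P Q E R p1 p2 e)"

definition cartesian_closed :: "('o, 'a, 'm) cat_scheme \<Rightarrow> bool" where
  "cartesian_closed C \<longleftrightarrow> has_finite_products C \<and> has_exponentials C"

definition locally_cartesian_closed :: "('o, 'a, 'm) cat_scheme \<Rightarrow> bool" where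
  "locally_cartesian_closed C \<longleftrightarrow>
    (\<exists>T. is_terminal C T) \<and> (\<forall>A \<in> Obj C. cartesian_closed (slice C A))"

definition is_cone :: "('j, 'u, 'o, 'a) ftr \<Rightarrow> 'o \<Rightarrow> ('j \<Rightarrow> 'a) \<Rightarrow> bool" where
  "is_cone D L l \<longleftrightarrow> L \<in> Obj (Tgt D) \<and>
    (\<forall>j \<in> Obj (Src D). l j \<in> hom (Tgt D) L (OMap D j)) \<and>
    (\<forall>u \<in> Arr (Src D). AMap D u \<cdot>\<^bsub>Tgt D\<^esub> l (Dom (Src D) u) = l (Cod (Src D) u))"

definition is_limit :: "('j, 'u, 'o, 'a) ftr \<Rightarrow> 'o \<Rightarrow> ('j \<Rightarrow> 'a) \<Rightarrow> bool" where
  "is_limit D L l \<longleftrightarrow> is_cone D L l \<and>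
    (\<forall>X m. is_cone D X m \<longrightarrow>
      (\<exists>!u. u \<in> hom (Tgt D) X L \<and> (\<forall>j \<in> Obj (Src D). l j \<cdot>\<^bsub>Tgt D\<^esub> u = m j)))"

text \<open>Every finite category is isomorphic to one whose objects and arrows are natural numbers.\<close>

definition has_finite_limits :: "('o, 'a) cat \<Rightarrow> bool" where
  "has_finite_limits C \<longleftrightarrow>
    (\<forall>D :: (nat, nat, 'o, 'a) ftr. cat_functor D \<and> Tgt D = C \<and>
      finite (Obj (Src D)) \<and> finite (Arr (Src D)) \<longrightarrow> (\<exists>L l. is_limit D L l))"

definition has_finite_colimits :: "('o, 'a) cat \<Rightarrow> bool" where
  "has_finite_colimits C \<longleftrightarrow> has_finite_limits (opp C)"

section \<open>Model categories\<close>

record ('o, 'a) model_cat = "('o, 'a) cat" +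
  WE :: "'a set"
  Cof :: "'a set"
  Fib :: "'a set"

definition is_retract :: "('o, 'a, 'm) cat_scheme \<Rightarrow> 'a \<Rightarrow> 'a \<Rightarrow> bool" where
  "is_retract C f g \<longleftrightarrow> f \<in> Arr C \<and> g \<in> Arr C \<and>
    (\<exists>i \<in> hom C (Dom C f) (Dom C g). \<exists>r \<in> hom C (Dom C g) (Dom C f).
     \<exists>j \<in> hom C (Cod C f) (Cod C g). \<exists>s \<in> hom C (Cod C g) (Cod C f).
      r \<cdot>\<^bsub>C\<^esub> i = Idt C (Dom C f) \<and> s \<cdot>\<^bsub>C\<^esub> j = Idt C (Cod C f) \<and>
      g \<cdot>\<^bsub>C\<^esub> i = j \<cdot>\<^bsub>C\<^esub> f \<and> f \<cdot>\<^bsub>C\<^esub> r = s \<cdot>\<^bsub>C\<^esub> g)"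

definition has_lifting :: "('o, 'a, 'm) cat_scheme \<Rightarrow> 'a \<Rightarrow> 'a \<Rightarrow> bool" where
  "has_lifting C i p \<longleftrightarrow>
    (\<forall>a \<in> hom C (Dom C i) (Dom C p). \<forall>b \<in> hom C (Cod C i) (Cod C p).
      p \<cdot>\<^bsub>C\<^esub> a = b \<cdot>\<^bsub>C\<^esub> i \<longrightarrow>
      (\<exists>l \<in> hom C (Cod C i) (Dom C p). l \<cdot>\<^bsub>C\<^esub> i = a \<and> p \<cdot>\<^bsub>C\<^esub> l = b))"

text \<open>Quillen's axioms for a closed model category: only finite limits and colimits are demanded,
  and factorizations need not be functorial.\<close>

locale model_category = category M for M :: "('o, 'a) model_cat" (structure) +
  assumes we_arr: "WE M \<subseteq> Arr M" and cof_arr: "Cof M \<subseteq> Arr M" and fib_arr: "Fib M \<subseteq> Arr M"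
    and finite_limits: "has_finite_limits (cat.truncate M)"
    and finite_colimits: "has_finite_colimits (cat.truncate M)"
    and two_of_three_cmp: "f \<in> hom M A B \<Longrightarrow> g \<in> hom M B D \<Longrightarrow>
      f \<in> WE M \<Longrightarrow> g \<in> WE M \<Longrightarrow> g \<cdot> f \<in> WE M"
    and two_of_three_left: "f \<in> hom M A B \<Longrightarrow> g \<in> hom M B D \<Longrightarrow>
      f \<in> WE M \<Longrightarrow> g \<cdot> f \<in> WE M \<Longrightarrow> g \<in> WE M"
    and two_of_three_right: "f \<in> hom M A B \<Longrightarrow> g \<in> hom M B D \<Longrightarrow>
      g \<in> WE M \<Longrightarrow> g \<cdot> f \<in> WE M \<Longrightarrow> f \<in> WE M"
    and retract_we: "is_retract M f g \<Longrightarrow> g \<in> WE M \<Longrightarrow> f \<in> WE M"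
    and retract_cof: "is_retract M f g \<Longrightarrow> g \<in> Cof M \<Longrightarrow> f \<in> Cof M"
    and retract_fib: "is_retract M f g \<Longrightarrow> g \<in> Fib M \<Longrightarrow> f \<in> Fib M"
    and lifting_acyclic_cof: "i \<in> Cof M \<Longrightarrow> i \<in> WE M \<Longrightarrow> p \<in> Fib M \<Longrightarrow> has_lifting M i p"
    and lifting_acyclic_fib: "i \<in> Cof M \<Longrightarrow> p \<in> Fib M \<Longrightarrow> p \<in> WE M \<Longrightarrow> has_lifting M i p"
    and factor_acyclic_cof: "f \<in> hom M A B \<Longrightarrow>
      \<exists>X. \<exists>i \<in> hom M A X. \<exists>p \<in> hom M X B. i \<in> Cof M \<and> i \<in> WE M \<and> p \<in> Fib M \<and> p \<cdot> i = f"
    and factor_acyclic_fib: "f \<in> hom M A B \<Longrightarrow>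
      \<exists>X. \<exists>i \<in> hom M A X. \<exists>p \<in> hom M X B. i \<in> Cof M \<and> p \<in> Fib M \<and> p \<in> WE M \<and> p \<cdot> i = f"

locale suitable_model_category = model_category M for M :: "('o, 'a) model_cat" (structure) +
  assumes right_proper: "is_pullback M p h w q \<Longrightarrow> p \<in> Fib M \<Longrightarrow> w \<in> WE M \<Longrightarrow> h \<in> WE M"
    and cof_iff_mono: "f \<in> Cof M \<longleftrightarrow> is_mono M f"
    and copair_fib: "is_coproduct M A B S i j \<Longrightarrow> u \<in> hom M S D \<Longrightarrow>
      u \<cdot> i \<in> Fib M \<Longrightarrow> u \<cdot> j \<in> Fib M \<Longrightarrow> u \<in> Fib M"
    and initial_fib: "is_initial M Z \<Longrightarrow> u \<in> hom M Z A \<Longrightarrow> u \<in> Fib M"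
    and locally_ccc: "locally_cartesian_closed M"

definition fibrant :: "('o, 'a) model_cat \<Rightarrow> 'o \<Rightarrow> bool" where
  "fibrant M A \<longleftrightarrow> A \<in> Obj M \<and> (\<forall>T u. is_terminal M T \<and> u \<in> hom M A T \<longrightarrow> u \<in> Fib M)"

definition fibrant_cat :: "('o, 'a) model_cat \<Rightarrow> ('o, 'a) cat" where
  "fibrant_cat M = full_subcat M {A. fibrant M A}"

section \<open>Localization of a category\<close>

text \<open>The localization of \<open>C\<close> at a set \<open>W\<close> of arrows has the objects of \<open>C\<close>; its arrows are
  zigzags of arrows of \<open>C\<close> and formal inverses of arrows in \<open>W\<close>, modulo the congruence generated
  by functoriality of \<open>Fwd\<close> and by \<open>Bwd w\<close> being inverse to \<open>Fwd w\<close>. Zigzags are lists in order of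
  traversal, that is, opposite to the order of composition. The universal property is proved
  below, with the target category ranging over arbitrary types.\<close>

datatype 'a step = Fwd 'a | Bwd 'a

fun zigzag :: "('o, 'a) cat \<Rightarrow> 'a set \<Rightarrow> 'o \<Rightarrow> 'a step list \<Rightarrow> 'o \<Rightarrow> bool" where
  "zigzag C W x [] y \<longleftrightarrow> x \<in> Obj C \<and> x = y"
| "zigzag C W x (Fwd f # p) y \<longleftrightarrow> f \<in> Arr C \<and> Dom C f = x \<and> zigzag C W (Cod C f) p y"
| "zigzag C W x (Bwd w # p) y \<longleftrightarrow> w \<in> Arr C \<inter> W \<and> Cod C w = x \<and> zigzag C W (Dom C w) p y"

inductive zz_eq ::
  "('o, 'a) cat \<Rightarrow> 'a set \<Rightarrow> 'o \<Rightarrow> 'a step list \<Rightarrow> 'a step list \<Rightarrow> 'o \<Rightarrow> bool"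
  for C W where
  zz_refl: "zigzag C W x p y \<Longrightarrow> zz_eq C W x p p y"
| zz_sym: "zz_eq C W x p q y \<Longrightarrow> zz_eq C W x q p y"
| zz_trans: "zz_eq C W x p q y \<Longrightarrow> zz_eq C W x q r y \<Longrightarrow> zz_eq C W x p r y"
| zz_append: "zz_eq C W x p q y \<Longrightarrow> zz_eq C W y p' q' z \<Longrightarrow> zz_eq C W x (p @ p') (q @ q') z"
| zz_idt: "x \<in> Obj C \<Longrightarrow> zz_eq C W x [Fwd (Idt C x)] [] x"
| zz_cmp: "f \<in> hom C x y \<Longrightarrow> g \<in> hom C y z \<Longrightarrow> zz_eq C W x [Fwd f, Fwd g] [Fwd (g \<cdot>\<^bsub>C\<^esub> f)] z"
| zz_inv1: "w \<in> Arr C \<inter> W \<Longrightarrow> zz_eq C W (Dom C w) [Fwd w, Bwd w] [] (Dom C w)"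
| zz_inv2: "w \<in> Arr C \<inter> W \<Longrightarrow> zz_eq C W (Cod C w) [Bwd w, Fwd w] [] (Cod C w)"

type_synonym ('o, 'a) zz_arrow = "'o \<times> 'a step list set \<times> 'o"

definition zz_class ::
  "('o, 'a) cat \<Rightarrow> 'a set \<Rightarrow> 'o \<Rightarrow> 'a step list \<Rightarrow> 'o \<Rightarrow> ('o, 'a) zz_arrow" where
  "zz_class C W x p y = (x, {q. zz_eq C W x p q y}, y)"

definition localization :: "('o, 'a) cat \<Rightarrow> 'a set \<Rightarrow> ('o, ('o, 'a) zz_arrow) cat" where
  "localization C W = \<lparr>Obj = Obj C,
    Arr = {zz_class C W x p y |x p y. zigzag C W x p y},
    Dom = (\<lambda>(x, K, y). x), Cod = (\<lambda>(x, K, y). y),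
    Idt = (\<lambda>x. zz_class C W x [] x),
    Cmp = (\<lambda>(y, L, z) (x, K, y'). (x, {r. \<exists>p \<in> K. \<exists>q \<in> L. zz_eq C W x (p @ q) r z}, z))\<rparr>"

definition loc_ftr :: "('o, 'a) cat \<Rightarrow> 'a set \<Rightarrow> ('o, 'a, 'o, ('o, 'a) zz_arrow) ftr" where
  "loc_ftr C W = \<lparr>Src = C, Tgt = localization C W, OMap = (\<lambda>x. x),
    AMap = (\<lambda>f. zz_class C W (Dom C f) [Fwd f] (Cod C f))\<rparr>"

fun zz_eval :: "('o, 'a, 'p, 'b) ftr \<Rightarrow> 'o \<Rightarrow> 'a step list \<Rightarrow> 'b" where
  "zz_eval F x [] = Idt (Tgt F) (OMap F x)"
| "zz_eval F x (Fwd f # p) = zz_eval F (Cod (Src F) f) p \<cdot>\<^bsub>Tgt F\<^esub> AMap F f"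
| "zz_eval F x (Bwd w # p) =
    zz_eval F (Dom (Src F) w) p \<cdot>\<^bsub>Tgt F\<^esub> (THE v. inverse_arrows (Tgt F) (AMap F w) v)"

text \<open>The functor out of the localization induced by a functor inverting \<open>W\<close>.\<close>

definition loc_lift ::
  "('o, 'a, 'p, 'b) ftr \<Rightarrow> 'a set \<Rightarrow> ('o, ('o, 'a) zz_arrow, 'p, 'b) ftr" where
  "loc_lift F W = \<lparr>Src = localization (Src F) W, Tgt = Tgt F, OMap = OMap F,
    AMap = (\<lambda>(x, K, y). the_elem (zz_eval F x ` K))\<rparr>"

context category
begin

lemma homD: "f \<in> hom C A B \<Longrightarrow> f \<in> Arr C \<and> Dom C f = A \<and> Cod C f = B"
  and homI: "f \<in> Arr C \<Longrightarrow> f \<in> hom C (Dom C f) (Cod C f)"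
  by (auto simp: hom_def)

lemma inverse_unique:
  assumes "inverse_arrows C f g" "inverse_arrows C f h"
  shows "g = h"
proof -
  let ?A = "Dom C f" and ?B = "Cod C f"
  have f: "f \<in> hom C ?A ?B" and g: "g \<in> hom C ?B ?A" and h: "h \<in> hom C ?B ?A"
    and gf: "g \<cdot> f = Idt C ?A" and fh: "f \<cdot> h = Idt C ?B"
    using assms by (auto simp: inverse_arrows_def intro: homI)
  have "g = g \<cdot> (f \<cdot> h)" using idt_right[OF g] fh by simp
  also have "\<dots> = (g \<cdot> f) \<cdot> h" using cmp_assoc[OF h f g] by simp
  also have "\<dots> = h" using idt_left[OF h] gf by simp
  finally show ?thesis .
qed

lemma inverse_arrows_iff:
  "f \<in> hom C A B \<Longrightarrow> inverse_arrows C f g \<longleftrightarrow>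
    g \<in> hom C B A \<and> g \<cdot> f = Idt C A \<and> f \<cdot> g = Idt C B"
  by (auto simp: inverse_arrows_def hom_def)

lemma the_inverse: "inverse_arrows C f g \<Longrightarrow> (THE v. inverse_arrows C f v) = g"
  using inverse_unique by blast

end

lemma hom_full_subcat:
  "f \<in> hom (full_subcat C S) A B \<longleftrightarrow> f \<in> hom C A B \<and> A \<in> S \<and> B \<in> S"
  by (auto simp: full_subcat_def hom_def)

lemma category_full_subcat:
  assumes "category C"
  shows "category (full_subcat C S)"
proof -
  interpret category C by fact
  have s: "Idt (full_subcat C S) = Idt C" "Cmp (full_subcat C S) = Cmp C"
    by (simp_all add: full_subcat_def)
  show ?thesis
  proof (rule category.intro)
    show "Dom (full_subcat C S) f \<in> Obj (full_subcat C S)"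
      "Cod (full_subcat C S) f \<in> Obj (full_subcat C S)" if "f \<in> Arr (full_subcat C S)" for f
      using that by (auto simp: full_subcat_def dom_obj cod_obj)
    show "Idt (full_subcat C S) A \<in> hom (full_subcat C S) A A"
      if "A \<in> Obj (full_subcat C S)" for A
      using that idt_hom[of A] unfolding hom_full_subcat s by (simp add: full_subcat_def)
  qed (use cmp_hom idt_left idt_right cmp_assoc in \<open>unfold hom_full_subcat s, blast+\<close>)
qed

lemma hom_arrow_cat:
  assumes "category C"
  shows "f \<in> hom (arrow_cat C) x y \<longleftrightarrow> (\<exists>t b. f = (x, t, b, y) \<and> x \<in> Arr C \<and> y \<in> Arr C \<and>
    t \<in> hom C (Dom C x) (Dom C y) \<and> b \<in> hom C (Cod C x) (Cod C y) \<and> y \<cdot>\<^bsub>C\<^esub> t = b \<cdot>\<^bsub>C\<^esub> x)"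
  by (cases f) (auto simp: hom_def arrow_cat_def)

lemma category_arrow_cat:
  assumes "category C"
  shows "category (arrow_cat C)"
proof -
  interpret category C by fact
  have s: "Idt (arrow_cat C) x = (x, Idt C (Dom C x), Idt C (Cod C x), x)"
    "(y, t', b', z) \<cdot>\<^bsub>arrow_cat C\<^esub> (x, t, b, y') = (x, t' \<cdot>\<^bsub>C\<^esub> t, b' \<cdot>\<^bsub>C\<^esub> b, z)"
    "Obj (arrow_cat C) = Arr C" for x y z y' t b t' b'
    by (simp_all add: arrow_cat_def)
  note h = hom_arrow_cat[OF assms]
  show ?thesis
  proof (rule category.intro)
    show "Dom (arrow_cat C) f \<in> Obj (arrow_cat C)" "Cod (arrow_cat C) f \<in> Obj (arrow_cat C)"
      if "f \<in> Arr (arrow_cat C)" for f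
      using that by (auto simp: arrow_cat_def)
    show "Idt (arrow_cat C) A \<in> hom (arrow_cat C) A A" if "A \<in> Obj (arrow_cat C)" for A
    proof -
      have A: "A \<in> Arr C" using that by (simp add: s)
      then show ?thesis
        by (simp add: h s idt_hom dom_obj cod_obj idt_left[OF homI[OF A]] idt_right[OF homI[OF A]])
    qed
    show "g \<cdot>\<^bsub>arrow_cat C\<^esub> f \<in> hom (arrow_cat C) x z"
      if fg: "f \<in> hom (arrow_cat C) x y" "g \<in> hom (arrow_cat C) y z" for f g x y z
    proof -
      obtain t b where f: "f = (x, t, b, y)" "t \<in> hom C (Dom C x) (Dom C y)"
        "b \<in> hom C (Cod C x) (Cod C y)" "y \<cdot>\<^bsub>C\<^esub> t = b \<cdot>\<^bsub>C\<^esub> x" "x \<in> Arr C" "y \<in> Arr C"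
        using fg(1) unfolding h by blast
      obtain t' b' where g: "g = (y, t', b', z)" "t' \<in> hom C (Dom C y) (Dom C z)"
        "b' \<in> hom C (Cod C y) (Cod C z)" "z \<cdot>\<^bsub>C\<^esub> t' = b' \<cdot>\<^bsub>C\<^esub> y" "z \<in> Arr C"
        using fg(2) unfolding h by blast
      have "z \<cdot>\<^bsub>C\<^esub> (t' \<cdot>\<^bsub>C\<^esub> t) = (b' \<cdot>\<^bsub>C\<^esub> b) \<cdot>\<^bsub>C\<^esub> x"
        using cmp_assoc[OF f(2) g(2) homI[OF g(5)]] cmp_assoc[OF f(2) homI[OF f(6)] g(3)]
          cmp_assoc[OF homI[OF f(5)] f(3) g(3)] f(4) g(4) by simp
      then show ?thesis unfolding h f(1) g(1) s
        using f(5) g(5) cmp_hom[OF f(2) g(2)] cmp_hom[OF f(3) g(3)] by simp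
    qed
    show "Idt (arrow_cat C) y \<cdot>\<^bsub>arrow_cat C\<^esub> f = f" "f \<cdot>\<^bsub>arrow_cat C\<^esub> Idt (arrow_cat C) x = f"
      if "f \<in> hom (arrow_cat C) x y" for f x y
      using that unfolding h by (auto simp: s idt_left idt_right)
    show "(k \<cdot>\<^bsub>arrow_cat C\<^esub> g) \<cdot>\<^bsub>arrow_cat C\<^esub> f = k \<cdot>\<^bsub>arrow_cat C\<^esub> (g \<cdot>\<^bsub>arrow_cat C\<^esub> f)"
      if "f \<in> hom (arrow_cat C) x y" "g \<in> hom (arrow_cat C) y z" "k \<in> hom (arrow_cat C) z w"
      for f g k x y z w
      using that unfolding h by (auto simp: s cmp_assoc)
  qed
qed

lemma zigzag_objs:
  assumes "category C"
  shows "zigzag C W x p y \<Longrightarrow> x \<in> Obj C \<and> y \<in> Obj C"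
proof (induction p arbitrary: x)
  case (Cons s p)
  then show ?case using category.dom_obj[OF assms] category.cod_obj[OF assms] by (cases s) auto
qed simp

lemma zigzag_append:
  assumes "category C"
  shows "zigzag C W x (p @ q) z \<longleftrightarrow> (\<exists>y. zigzag C W x p y \<and> zigzag C W y q z)"
proof (induction p arbitrary: x)
  case Nil
  then show ?case using zigzag_objs[OF assms] by auto
next
  case (Cons s p)
  then show ?case by (cases s) auto
qed

lemma zz_eq_zigzag:
  assumes "category C"
  shows "zz_eq C W x p q y \<Longrightarrow> zigzag C W x p y \<and> zigzag C W x q y"
proof (induction rule: zz_eq.induct)
  case (zz_append x p q y p' q' z)
  then show ?case by (auto simp: zigzag_append[OF assms])
next
  case (zz_idt x)
  then show ?case using category.idt_hom[OF assms, of x] by (auto simp: hom_def)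
next
  case (zz_cmp f x y g z)
  then show ?case using category.cmp_hom[OF assms, of f x y g z] category.cod_obj[OF assms, of g]
    by (auto simp: hom_def)
qed (auto simp: category.dom_obj[OF assms] category.cod_obj[OF assms])

lemma zz_class_eq_iff:
  assumes "zigzag C W x p y"
  shows "zz_class C W x p y = zz_class C W x q y \<longleftrightarrow> zz_eq C W x p q y"
  unfolding zz_class_def using zz_refl[OF assms] by (auto intro: zz_trans zz_sym)

lemma loc_simps:
  "Obj (localization C W) = Obj C"
  "Dom (localization C W) (zz_class C W x p y) = x"
  "Cod (localization C W) (zz_class C W x p y) = y"
  "Idt (localization C W) x = zz_class C W x [] x"
  by (simp_all add: localization_def zz_class_def)

lemma loc_hom:
  "h \<in> hom (localization C W) x y \<longleftrightarrow> (\<exists>p. zigzag C W x p y \<and> h = zz_class C W x p y)"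
  by (auto simp: hom_def localization_def zz_class_def)

lemma loc_cmp:
  assumes p: "zigzag C W x p y" and q: "zigzag C W y q z"
  shows "zz_class C W y q z \<cdot>\<^bsub>localization C W\<^esub> zz_class C W x p y = zz_class C W x (p @ q) z"
proof -
  have "(\<exists>p' \<in> {p'. zz_eq C W x p p' y}. \<exists>q' \<in> {q'. zz_eq C W y q q' z}. zz_eq C W x (p' @ q') r z)
      \<longleftrightarrow> zz_eq C W x (p @ q) r z" for r
    using zz_refl[OF p] zz_refl[OF q] by (auto intro: zz_trans zz_append)
  then show ?thesis by (simp add: localization_def zz_class_def)
qed

theorem category_localization:
  assumes C: "category C"
  shows "category (localization C W)"
proof
  note za = zigzag_append[OF C] and objs = zigzag_objs[OF C]
  show "Dom (localization C W) f \<in> Obj (localization C W)"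
    "Cod (localization C W) f \<in> Obj (localization C W)"
    if "f \<in> Arr (localization C W)" for f
    using that objs by (auto simp: localization_def zz_class_def)
  show "Idt (localization C W) A \<in> hom (localization C W) A A"
    if "A \<in> Obj (localization C W)" for A
  proof -
    have "zigzag C W A [] A" using that by (simp add: loc_simps)
    then show ?thesis unfolding loc_hom loc_simps by blast
  qed
  show "g \<cdot>\<^bsub>localization C W\<^esub> f \<in> hom (localization C W) A D"
    if "f \<in> hom (localization C W) A B" "g \<in> hom (localization C W) B D" for f g A B D
  proof -
    note fg = that
    obtain p q where "zigzag C W A p B" "f = zz_class C W A p B"
      "zigzag C W B q D" "g = zz_class C W B q D"
      using fg unfolding loc_hom by blast
    moreover from this have "zigzag C W A (p @ q) D" using za by blast
    ultimately show ?thesis using loc_cmp[of C W A p B q D] by (auto simp: loc_hom)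
  qed
  show "Idt (localization C W) B \<cdot>\<^bsub>localization C W\<^esub> f = f"
    "f \<cdot>\<^bsub>localization C W\<^esub> Idt (localization C W) A = f"
    if "f \<in> hom (localization C W) A B" for f A B
  proof -
    note fg = that
    obtain p where p: "zigzag C W A p B" "f = zz_class C W A p B" using fg unfolding loc_hom by blast
    then have "zigzag C W A [] A" "zigzag C W B [] B" using objs by auto
    then show "Idt (localization C W) B \<cdot>\<^bsub>localization C W\<^esub> f = f"
      "f \<cdot>\<^bsub>localization C W\<^esub> Idt (localization C W) A = f"
      using p loc_cmp[of C W A p B "[]" B] loc_cmp[of C W A "[]" A p B] by (auto simp: loc_simps)
  qed
  show "(h \<cdot>\<^bsub>localization C W\<^esub> g) \<cdot>\<^bsub>localization C W\<^esub> f =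
      h \<cdot>\<^bsub>localization C W\<^esub> (g \<cdot>\<^bsub>localization C W\<^esub> f)"
    if "f \<in> hom (localization C W) A B" "g \<in> hom (localization C W) B D"
      "h \<in> hom (localization C W) D E" for f g h A B D E
  proof -
    note fg = that
    obtain p q r where *: "zigzag C W A p B" "f = zz_class C W A p B"
      "zigzag C W B q D" "g = zz_class C W B q D" "zigzag C W D r E" "h = zz_class C W D r E"
      using fg unfolding loc_hom by blast
    moreover from this have "zigzag C W A (p @ q) D" "zigzag C W B (q @ r) E" using za by blast+
    ultimately show ?thesis by (simp add: loc_cmp)
  qed
qed

theorem cat_functor_loc_ftr:
  assumes C: "category C"
  shows "cat_functor (loc_ftr C W)"
proof -
  have 1: "AMap (loc_ftr C W) f = zz_class C W A [Fwd f] B" "zigzag C W A [Fwd f] B"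
    if "f \<in> hom C A B" for f A B
    using that category.cod_obj[OF C] by (auto simp: loc_ftr_def hom_def)
  show ?thesis
  proof (rule cat_functor.intro)
    show "category (Src (loc_ftr C W))" "category (Tgt (loc_ftr C W))"
      using C category_localization[OF C] by (simp_all add: loc_ftr_def)
    show "OMap (loc_ftr C W) A \<in> Obj (Tgt (loc_ftr C W))" if "A \<in> Obj (Src (loc_ftr C W))" for A
      using that by (simp add: loc_ftr_def loc_simps)
    show "AMap (loc_ftr C W) f \<in> hom (Tgt (loc_ftr C W)) (OMap (loc_ftr C W) A) (OMap (loc_ftr C W) B)"
      if "f \<in> hom (Src (loc_ftr C W)) A B" for f A B
    proof -
      have f: "f \<in> hom C A B" using that by (simp add: loc_ftr_def)
      have "AMap (loc_ftr C W) f \<in> hom (localization C W) A B"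
        unfolding loc_hom using 1[OF f] by blast
      then show ?thesis by (simp add: loc_ftr_def)
    qed
    show "AMap (loc_ftr C W) (Idt (Src (loc_ftr C W)) A) =
        Idt (Tgt (loc_ftr C W)) (OMap (loc_ftr C W) A)" if "A \<in> Obj (Src (loc_ftr C W))" for A
    proof -
      have A: "A \<in> Obj C" using that by (simp add: loc_ftr_def)
      note i = 1[OF category.idt_hom[OF C A]]
      show ?thesis using i zz_class_eq_iff[OF i(2)] zz_idt[OF A]
        by (simp add: loc_ftr_def loc_simps)
    qed
    show "AMap (loc_ftr C W) (g \<cdot>\<^bsub>Src (loc_ftr C W)\<^esub> f) =
        AMap (loc_ftr C W) g \<cdot>\<^bsub>Tgt (loc_ftr C W)\<^esub> AMap (loc_ftr C W) f"
      if "f \<in> hom (Src (loc_ftr C W)) A B" "g \<in> hom (Src (loc_ftr C W)) B D" for f g A B D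
    proof -
      have f: "f \<in> hom C A B" and g: "g \<in> hom C B D" using that by (simp_all add: loc_ftr_def)
      have e: "zz_eq C W A [Fwd (g \<cdot>\<^bsub>C\<^esub> f)] [Fwd f, Fwd g] D"
        using zz_sym[OF zz_cmp[OF f g]] .
      have "AMap (loc_ftr C W) (g \<cdot>\<^bsub>C\<^esub> f) = zz_class C W A ([Fwd f] @ [Fwd g]) D"
        using 1(1)[OF category.cmp_hom[OF C f g]]
          zz_class_eq_iff[THEN iffD2, OF 1(2)[OF category.cmp_hom[OF C f g]] e] by simp
      also have "\<dots> = AMap (loc_ftr C W) g \<cdot>\<^bsub>localization C W\<^esub> AMap (loc_ftr C W) f"
        unfolding 1(1)[OF f] 1(1)[OF g] loc_cmp[OF 1(2)[OF f] 1(2)[OF g]] ..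
      finally show ?thesis by (simp add: loc_ftr_def)
    qed
  qed
qed

lemma loc_ftr_inverse:
  assumes C: "category C" and w: "w \<in> Arr C \<inter> W"
  shows "inverse_arrows (localization C W) (AMap (loc_ftr C W) w)
    (zz_class C W (Cod C w) [Bwd w] (Dom C w))"
proof -
  let ?x = "Dom C w" and ?y = "Cod C w"
  have o: "?x \<in> Obj C" "?y \<in> Obj C" using w C by (auto simp: category.dom_obj category.cod_obj)
  then have z: "zigzag C W ?x [Fwd w] ?y" "zigzag C W ?y [Bwd w] ?x" using w by auto
  have "zigzag C W ?x ([Fwd w] @ [Bwd w]) ?x" "zigzag C W ?y ([Bwd w] @ [Fwd w]) ?y"
    using w o by auto
  then have "zz_class C W ?x ([Fwd w] @ [Bwd w]) ?x = zz_class C W ?x [] ?x"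
    "zz_class C W ?y ([Bwd w] @ [Fwd w]) ?y = zz_class C W ?y [] ?y"
    using zz_inv1[OF w] zz_inv2[OF w] by (simp_all add: zz_class_eq_iff)
  note classes = this
  have f: "zz_class C W ?x [Fwd w] ?y \<in> hom (localization C W) ?x ?y"
    and b: "zz_class C W ?y [Bwd w] ?x \<in> hom (localization C W) ?y ?x"
    unfolding loc_hom using z by blast+
  have a: "AMap (loc_ftr C W) w = zz_class C W ?x [Fwd w] ?y" by (simp add: loc_ftr_def)
  show ?thesis
    unfolding a category.inverse_arrows_iff[OF category_localization[OF C] f]
    using b by (simp only: loc_cmp[OF z] loc_cmp[OF z(2) z(1)] classes loc_simps simp_thms)
qed

theorem loc_ftr_inverts:
  "category C \<Longrightarrow> w \<in> Arr C \<inter> W \<Longrightarrow> is_iso (localization C W) (AMap (loc_ftr C W) w)"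
  unfolding is_iso_def by (rule exI, rule loc_ftr_inverse)

context cat_functor
begin

interpretation S: category "Src F" by (rule src_category)
interpretation T: category "Tgt F" by (rule tgt_category)

context
  fixes W
  assumes inv: "\<And>w. w \<in> Arr (Src F) \<inter> W \<Longrightarrow> is_iso (Tgt F) (AMap F w)"
begin

lemma inv_hom:
  assumes "w \<in> Arr (Src F) \<inter> W"
  shows "inverse_arrows (Tgt F) (AMap F w) (THE v. inverse_arrows (Tgt F) (AMap F w) v)"
    "(THE v. inverse_arrows (Tgt F) (AMap F w) v)
      \<in> hom (Tgt F) (OMap F (Cod (Src F) w)) (OMap F (Dom (Src F) w))"
proof -
  show 1: "inverse_arrows (Tgt F) (AMap F w) (THE v. inverse_arrows (Tgt F) (AMap F w) v)"
    using inv[OF assms] T.the_inverse by (auto simp: is_iso_def)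
  have "AMap F w \<in> hom (Tgt F) (OMap F (Dom (Src F) w)) (OMap F (Cod (Src F) w))"
    using assms by (auto intro: amap_hom S.homI)
  then show "(THE v. inverse_arrows (Tgt F) (AMap F w) v)
      \<in> hom (Tgt F) (OMap F (Cod (Src F) w)) (OMap F (Dom (Src F) w))"
    using 1 by (simp add: inverse_arrows_def hom_def)
qed

lemma zz_eval_hom:
  "zigzag (Src F) W x p y \<Longrightarrow> zz_eval F x p \<in> hom (Tgt F) (OMap F x) (OMap F y)"
proof (induction p arbitrary: x)
  case Nil
  then show ?case by (auto intro: T.idt_hom omap_obj)
next
  case (Cons s p)
  show ?case
  proof (cases s)
    case (Fwd f)
    then have "f \<in> hom (Src F) x (Cod (Src F) f)" using Cons.prems by (auto simp: hom_def)
    from amap_hom[OF this] show ?thesis using Cons Fwd by (auto intro: T.cmp_hom)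
  next
    case (Bwd w)
    then have "w \<in> Arr (Src F) \<inter> W" "Cod (Src F) w = x" using Cons.prems by auto
    then show ?thesis using Cons Bwd inv_hom(2)[of w] by (auto intro: T.cmp_hom)
  qed
qed

lemma zz_eval_append:
  "zigzag (Src F) W x p y \<Longrightarrow> zigzag (Src F) W y q z \<Longrightarrow>
    zz_eval F x (p @ q) = zz_eval F y q \<cdot>\<^bsub>Tgt F\<^esub> zz_eval F x p"
proof (induction p arbitrary: x)
  case Nil
  then show ?case using T.idt_right[OF zz_eval_hom[OF Nil(2)]] by auto
next
  case (Cons s p)
  show ?case
  proof (cases s)
    case (Fwd f)
    then have f: "f \<in> hom (Src F) x (Cod (Src F) f)" and p: "zigzag (Src F) W (Cod (Src F) f) p y"
      using Cons.prems by (auto simp: hom_def)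
    show ?thesis using T.cmp_assoc[OF amap_hom[OF f] zz_eval_hom[OF p] zz_eval_hom[OF Cons(3)]]
      Cons.IH[OF p Cons(3)] Fwd by simp
  next
    case (Bwd w)
    then have w: "w \<in> Arr (Src F) \<inter> W" "Cod (Src F) w = x"
      and p: "zigzag (Src F) W (Dom (Src F) w) p y"
      using Cons.prems by auto
    show ?thesis using T.cmp_assoc[OF inv_hom(2)[OF w(1)] zz_eval_hom[OF p] zz_eval_hom[OF Cons(3)]]
      Cons.IH[OF p Cons(3)] Bwd by simp
  qed
qed

lemma zz_eval_Fwd: "f \<in> hom (Src F) x y \<Longrightarrow> zz_eval F x [Fwd f] = AMap F f"
  using amap_hom[of f x y] T.idt_left by (fastforce simp: hom_def)

lemma zz_eval_Bwd:
  "w \<in> Arr (Src F) \<inter> W \<Longrightarrow> zz_eval F x [Bwd w] = (THE v. inverse_arrows (Tgt F) (AMap F w) v)"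
  using inv_hom(2)[of w] T.idt_left by fastforce

lemma zz_eval_cong: "zz_eq (Src F) W x p q y \<Longrightarrow> zz_eval F x p = zz_eval F x q"
proof (induction rule: zz_eq.induct)
  case (zz_append x p q y p' q' z)
  then show ?case using zz_eq_zigzag[OF src_category] zz_eval_append by metis
next
  case (zz_idt x)
  then show ?case using zz_eval_Fwd[OF S.idt_hom[OF zz_idt]] amap_idt by simp
next
  case (zz_cmp f x y g z)
  have z: "zigzag (Src F) W x [Fwd f] y" "zigzag (Src F) W y [Fwd g] z"
    using zz_cmp S.cod_obj by (auto simp: hom_def)
  show ?case using zz_eval_append[OF z] zz_eval_Fwd[OF zz_cmp(1)] zz_eval_Fwd[OF zz_cmp(2)]
    zz_eval_Fwd[OF S.cmp_hom[OF zz_cmp]] amap_cmp[OF zz_cmp] by simp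
next
  case (zz_inv1 w)
  let ?x = "Dom (Src F) w" and ?y = "Cod (Src F) w"
  have z: "zigzag (Src F) W ?x [Fwd w] ?y" "zigzag (Src F) W ?y [Bwd w] ?x"
    using zz_inv1 S.cod_obj S.dom_obj by auto
  have h: "w \<in> hom (Src F) ?x ?y" using zz_inv1 by (auto intro: S.homI)
  show ?case using zz_eval_append[OF z] zz_eval_Fwd[OF h] zz_eval_Bwd[OF zz_inv1]
    T.inverse_arrows_iff[OF amap_hom[OF h], THEN iffD1, OF inv_hom(1)[OF zz_inv1]] by (simp del: zz_eval.simps(2,3))
next
  case (zz_inv2 w)
  let ?x = "Dom (Src F) w" and ?y = "Cod (Src F) w"
  have z: "zigzag (Src F) W ?x [Fwd w] ?y" "zigzag (Src F) W ?y [Bwd w] ?x"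
    using zz_inv2 S.cod_obj S.dom_obj by auto
  have h: "w \<in> hom (Src F) ?x ?y" using zz_inv2 by (auto intro: S.homI)
  show ?case using zz_eval_append[OF z(2) z(1)] zz_eval_Fwd[OF h] zz_eval_Bwd[OF zz_inv2]
    T.inverse_arrows_iff[OF amap_hom[OF h], THEN iffD1, OF inv_hom(1)[OF zz_inv2]] by (simp del: zz_eval.simps(2,3))
qed auto

lemma loc_lift_class:
  assumes "zigzag (Src F) W x p y"
  shows "AMap (loc_lift F W) (zz_class (Src F) W x p y) = zz_eval F x p"
proof -
  have "zz_eval F x ` {q. zz_eq (Src F) W x p q y} = {zz_eval F x p}"
    by (blast intro: zz_eval_cong[symmetric] zz_refl[OF assms])
  then show ?thesis by (simp add: loc_lift_def zz_class_def)
qed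

theorem cat_functor_loc_lift: "cat_functor (loc_lift F W)"
proof (rule cat_functor.intro)
  have s: "Src (loc_lift F W) = localization (Src F) W" "Tgt (loc_lift F W) = Tgt F"
    "OMap (loc_lift F W) = OMap F" by (simp_all add: loc_lift_def)
  show "category (Src (loc_lift F W))" "category (Tgt (loc_lift F W))"
    using category_localization[OF src_category] tgt_category by (simp_all add: s)
  show "OMap (loc_lift F W) A \<in> Obj (Tgt (loc_lift F W))" if "A \<in> Obj (Src (loc_lift F W))" for A
    using that omap_obj by (simp add: s loc_simps)
  show "AMap (loc_lift F W) f \<in> hom (Tgt (loc_lift F W)) (OMap (loc_lift F W) A) (OMap (loc_lift F W) B)"
    if "f \<in> hom (Src (loc_lift F W)) A B" for f A B
    using that loc_lift_class zz_eval_hom by (auto simp: s loc_hom)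
  show "AMap (loc_lift F W) (Idt (Src (loc_lift F W)) A) =
      Idt (Tgt (loc_lift F W)) (OMap (loc_lift F W) A)" if "A \<in> Obj (Src (loc_lift F W))" for A
    using that loc_lift_class[of A "[]" A] by (simp add: s loc_simps)
  show "AMap (loc_lift F W) (g \<cdot>\<^bsub>Src (loc_lift F W)\<^esub> f) =
      AMap (loc_lift F W) g \<cdot>\<^bsub>Tgt (loc_lift F W)\<^esub> AMap (loc_lift F W) f"
    if "f \<in> hom (Src (loc_lift F W)) A B" "g \<in> hom (Src (loc_lift F W)) B D" for f g A B D
  proof -
    note fg = that
    obtain p q where *: "zigzag (Src F) W A p B" "f = zz_class (Src F) W A p B"
      "zigzag (Src F) W B q D" "g = zz_class (Src F) W B q D"
      using fg unfolding s loc_hom by blast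
    moreover from this have "zigzag (Src F) W A (p @ q) D"
      using zigzag_append[OF src_category] by blast
    ultimately show ?thesis
      by (simp add: s loc_cmp loc_lift_class zz_eval_append[OF *(1) *(3)])
  qed
qed

theorem loc_lift_factors:
  "OMap (loc_lift F W) (OMap (loc_ftr (Src F) W) A) = OMap F A"
  "f \<in> Arr (Src F) \<Longrightarrow> AMap (loc_lift F W) (AMap (loc_ftr (Src F) W) f) = AMap F f"
proof -
  show "OMap (loc_lift F W) (OMap (loc_ftr (Src F) W) A) = OMap F A"
    by (simp add: loc_lift_def loc_ftr_def)
  assume f: "f \<in> Arr (Src F)"
  then have "zigzag (Src F) W (Dom (Src F) f) [Fwd f] (Cod (Src F) f)"
    using S.cod_obj by simp
  from loc_lift_class[OF this] zz_eval_Fwd[OF S.homI[OF f]]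
  show "AMap (loc_lift F W) (AMap (loc_ftr (Src F) W) f) = AMap F f"
    by (simp add: loc_ftr_def)
qed

theorem loc_lift_unique:
  assumes G: "cat_functor G" "Src G = localization (Src F) W" "Tgt G = Tgt F"
    and go: "\<And>A. A \<in> Obj (Src F) \<Longrightarrow> OMap G (OMap (loc_ftr (Src F) W) A) = OMap F A"
    and ga: "\<And>f. f \<in> Arr (Src F) \<Longrightarrow> AMap G (AMap (loc_ftr (Src F) W) f) = AMap F f"
  shows "A \<in> Obj (localization (Src F) W) \<Longrightarrow> OMap G A = OMap (loc_lift F W) A"
    and "h \<in> Arr (localization (Src F) W) \<Longrightarrow> AMap G h = AMap (loc_lift F W) h"
proof -
  let ?L = "localization (Src F) W"
  interpret G: cat_functor G by (rule G)
  show "A \<in> Obj ?L \<Longrightarrow> OMap G A = OMap (loc_lift F W) A"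
    using go by (simp add: loc_simps loc_lift_def loc_ftr_def)
  have fwd: "AMap G (zz_class (Src F) W x [Fwd f] (Cod (Src F) f)) = zz_eval F x [Fwd f]"
    if "f \<in> Arr (Src F)" "Dom (Src F) f = x" for f x
    using ga[OF that(1)] that zz_eval_Fwd[OF S.homI[OF that(1)]] by (simp add: loc_ftr_def)
  have bwd: "AMap G (zz_class (Src F) W (Cod (Src F) w) [Bwd w] (Dom (Src F) w))
      = zz_eval F (Cod (Src F) w) [Bwd w]" if w: "w \<in> Arr (Src F) \<inter> W" for w
  proof -
    let ?x = "Dom (Src F) w" and ?y = "Cod (Src F) w"
    let ?b = "zz_class (Src F) W ?y [Bwd w] ?x" and ?f = "AMap (loc_ftr (Src F) W) w"
    have i: "inverse_arrows ?L ?f ?b" using loc_ftr_inverse[OF src_category w] .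
    have iG: "inverse_arrows (Src G) ?f ?b" using i by (simp only: G)
    have o: "?x \<in> Obj (Src G)" "?y \<in> Obj (Src G)"
      using w S.dom_obj S.cod_obj by (auto simp: G loc_simps)
    have f: "?f \<in> hom (Src G) ?x ?y"
      using i by (auto simp: inverse_arrows_def hom_def loc_ftr_def loc_simps G)
    have b: "?b \<in> hom (Src G) ?y ?x" and bf: "?b \<cdot>\<^bsub>Src G\<^esub> ?f = Idt (Src G) ?x"
      and fb: "?f \<cdot>\<^bsub>Src G\<^esub> ?b = Idt (Src G) ?y"
      using category.inverse_arrows_iff[OF G.src_category f, THEN iffD1, OF iG] by blast+
    have "inverse_arrows (Tgt G) (AMap G ?f) (AMap G ?b)"
      unfolding category.inverse_arrows_iff[OF G.tgt_category G.amap_hom[OF f]]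
      using G.amap_hom[OF b] G.amap_cmp[OF f b] G.amap_cmp[OF b f]
      by (simp only: bf fb G.amap_idt[OF o(1)] G.amap_idt[OF o(2)] simp_thms)
    then have "inverse_arrows (Tgt F) (AMap G ?f) (AMap G ?b)" by (simp only: G)
    then have "inverse_arrows (Tgt F) (AMap F w) (AMap G ?b)" using ga w by simp
    then show ?thesis using zz_eval_Bwd[OF w] T.the_inverse by simp
  qed
  have gz: "zigzag (Src F) W x p y \<Longrightarrow> AMap G (zz_class (Src F) W x p y) = zz_eval F x p" for x p y
  proof (induction p arbitrary: x)
    case Nil
    then show ?case using G.amap_idt[of x] go[of x] by (auto simp: G loc_simps loc_ftr_def)
  next
    case (Cons s p)
    obtain x' where s: "zigzag (Src F) W x [s] x'" "zigzag (Src F) W x' p y"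
      using zigzag_append[OF src_category, of W x "[s]" p y] Cons.prems by auto
    have "AMap G (zz_class (Src F) W x [s] x') = zz_eval F x [s]"
      using s(1) fwd bwd by (cases s) auto
    note gs = this
    let ?c = "zz_class (Src F) W x [s] x'" and ?d = "zz_class (Src F) W x' p y"
    have c: "?c \<in> hom (Src G) x x'" and d: "?d \<in> hom (Src G) x' y"
      unfolding G loc_hom using s by blast+
    have "AMap G (zz_class (Src F) W x ([s] @ p) y) = AMap G (?d \<cdot>\<^bsub>Src G\<^esub> ?c)"
      by (simp only: loc_cmp[OF s] G)
    also have "\<dots> = AMap G ?d \<cdot>\<^bsub>Tgt F\<^esub> AMap G ?c"
      using G.amap_cmp[OF c d] by (simp only: G)
    also have "\<dots> = zz_eval F x ([s] @ p)"
      by (simp only: gs Cons.IH[OF s(2)] zz_eval_append[OF s])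
    finally show ?case by simp
  qed
  assume "h \<in> Arr ?L"
  then obtain x p y where "zigzag (Src F) W x p y" "h = zz_class (Src F) W x p y"
    by (auto simp: localization_def)
  then show "AMap G h = AMap (loc_lift F W) h" using gz loc_lift_class by simp
qed

end

end

section \<open>Fibrations\<close>

text \<open>A functor \<open>\<pi>\<close> is viewed as displaying \<open>Src \<pi>\<close> over \<open>Tgt \<pi>\<close>.\<close>

definition is_cartesian :: "('o, 'a, 'p, 'b) ftr \<Rightarrow> 'a \<Rightarrow> bool" where
  "is_cartesian \<pi> q \<longleftrightarrow> q \<in> Arr (Src \<pi>) \<and>
    (\<forall>f r. f \<in> Arr (Tgt \<pi>) \<and> Cod (Tgt \<pi>) f = Dom (Tgt \<pi>) (AMap \<pi> q) \<and>
      r \<in> Arr (Src \<pi>) \<and> Cod (Src \<pi>) r = Cod (Src \<pi>) q \<and> AMap \<pi> r = AMap \<pi> q \<cdot>\<^bsub>Tgt \<pi>\<^esub> f \<longrightarrow>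
      (\<exists>!s. s \<in> hom (Src \<pi>) (Dom (Src \<pi>) r) (Dom (Src \<pi>) q) \<and> AMap \<pi> s = f \<and>
        q \<cdot>\<^bsub>Src \<pi>\<^esub> s = r))"

definition is_cocartesian :: "('o, 'a, 'p, 'b) ftr \<Rightarrow> 'a \<Rightarrow> bool" where
  "is_cocartesian \<pi> q \<longleftrightarrow> is_cartesian (opp_ftr \<pi>) q"

text \<open>\<open>c\<close> is a cartesian lift of \<open>f\<close> with codomain \<open>Q\<close>.\<close>

definition cart_lift :: "('o, 'a, 'p, 'b) ftr \<Rightarrow> 'b \<Rightarrow> 'o \<Rightarrow> 'a \<Rightarrow> bool" where
  "cart_lift \<pi> f Q c \<longleftrightarrow> is_cartesian \<pi> c \<and> Cod (Src \<pi>) c = Q \<and> AMap \<pi> c = f"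

definition fiber :: "('o, 'a, 'p, 'b) ftr \<Rightarrow> 'p \<Rightarrow> ('o, 'a) cat" where
  "fiber \<pi> A = \<lparr>Obj = {X \<in> Obj (Src \<pi>). OMap \<pi> X = A},
    Arr = {f \<in> Arr (Src \<pi>). AMap \<pi> f = Idt (Tgt \<pi>) A},
    Dom = Dom (Src \<pi>), Cod = Cod (Src \<pi>), Idt = Idt (Src \<pi>), Cmp = Cmp (Src \<pi>)\<rparr>"

locale fibration = cat_functor \<pi> for \<pi> :: "('o, 'a, 'p, 'b) ftr" +
  assumes cart_lift_ex: "f \<in> Arr (Tgt \<pi>) \<Longrightarrow> Q \<in> Obj (Src \<pi>) \<Longrightarrow> OMap \<pi> Q = Cod (Tgt \<pi>) f \<Longrightarrow>
    \<exists>c. cart_lift \<pi> f Q c"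

text \<open>\<open>u'\<close> is the arrow over \<open>b\<close> which \<open>u\<close> induces between the domains of \<open>c\<close> and \<open>d\<close>
  (unique if \<open>d\<close> is cartesian).\<close>

definition induced :: "('o, 'a, 'p, 'b) ftr \<Rightarrow> 'b \<Rightarrow> 'a \<Rightarrow> 'a \<Rightarrow> 'a \<Rightarrow> 'a \<Rightarrow> bool" where
  "induced \<pi> b c u d u' \<longleftrightarrow> u' \<in> hom (Src \<pi>) (Dom (Src \<pi>) c) (Dom (Src \<pi>) d) \<and>
    AMap \<pi> u' = b \<and> d \<cdot>\<^bsub>Src \<pi>\<^esub> u' = u \<cdot>\<^bsub>Src \<pi>\<^esub> c"

definition stable_terminal :: "('o, 'a, 'p, 'b) ftr \<Rightarrow> 'b \<Rightarrow> 'o \<Rightarrow> bool" where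
  "stable_terminal \<pi> f T \<longleftrightarrow>
    (\<forall>c. cart_lift \<pi> f T c \<longrightarrow> is_terminal (fiber \<pi> (Dom (Tgt \<pi>) f)) (Dom (Src \<pi>) c))"

definition stable_initial :: "('o, 'a, 'p, 'b) ftr \<Rightarrow> 'b \<Rightarrow> 'o \<Rightarrow> bool" where
  "stable_initial \<pi> f Z \<longleftrightarrow>
    (\<forall>c. cart_lift \<pi> f Z c \<longrightarrow> is_initial (fiber \<pi> (Dom (Tgt \<pi>) f)) (Dom (Src \<pi>) c))"

definition stable_product ::
  "('o, 'a, 'p, 'b) ftr \<Rightarrow> 'b \<Rightarrow> 'o \<Rightarrow> 'o \<Rightarrow> 'o \<Rightarrow> 'a \<Rightarrow> 'a \<Rightarrow> bool" where
  "stable_product \<pi> f P Q R p1 p2 \<longleftrightarrow>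
    (let A = Dom (Tgt \<pi>) f; I = Idt (Tgt \<pi>) A; d = Dom (Src \<pi>) in
    \<forall>cP cQ cR p1' p2'.
      cart_lift \<pi> f P cP \<and> cart_lift \<pi> f Q cQ \<and> cart_lift \<pi> f R cR \<and>
      induced \<pi> I cR p1 cP p1' \<and> induced \<pi> I cR p2 cQ p2' \<longrightarrow>
      is_product (fiber \<pi> A) (d cP) (d cQ) (d cR) p1' p2')"

definition stable_coproduct ::
  "('o, 'a, 'p, 'b) ftr \<Rightarrow> 'b \<Rightarrow> 'o \<Rightarrow> 'o \<Rightarrow> 'o \<Rightarrow> 'a \<Rightarrow> 'a \<Rightarrow> bool" where
  "stable_coproduct \<pi> f P Q S i1 i2 \<longleftrightarrow>
    (let A = Dom (Tgt \<pi>) f; I = Idt (Tgt \<pi>) A; d = Dom (Src \<pi>) in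
    \<forall>cP cQ cS i1' i2'.
      cart_lift \<pi> f P cP \<and> cart_lift \<pi> f Q cQ \<and> cart_lift \<pi> f S cS \<and>
      induced \<pi> I cP i1 cS i1' \<and> induced \<pi> I cQ i2 cS i2' \<longrightarrow>
      is_coproduct (fiber \<pi> A) (d cP) (d cQ) (d cS) i1' i2')"

definition stable_exponential ::
  "('o, 'a, 'p, 'b) ftr \<Rightarrow> 'b \<Rightarrow> 'o \<Rightarrow> 'o \<Rightarrow> 'o \<Rightarrow> 'o \<Rightarrow> 'a \<Rightarrow> 'a \<Rightarrow> 'a \<Rightarrow> bool" where
  "stable_exponential \<pi> f P Q E R p1 p2 e \<longleftrightarrow>
    (let A = Dom (Tgt \<pi>) f; I = Idt (Tgt \<pi>) A; d = Dom (Src \<pi>) in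
    \<forall>cP cQ cE cR p1' p2' e'.
      cart_lift \<pi> f P cP \<and> cart_lift \<pi> f Q cQ \<and> cart_lift \<pi> f E cE \<and> cart_lift \<pi> f R cR \<and>
      induced \<pi> I cR p1 cE p1' \<and> induced \<pi> I cR p2 cP p2' \<and> induced \<pi> I cR e cQ e' \<longrightarrow>
      is_exponential (fiber \<pi> A) (d cP) (d cQ) (d cE) (d cR) p1' p2' e')"

text \<open>\<open>c\<close> is the cartesian arrow \<open>f\<^sup>*R \<rightarrow> R\<close> over \<open>f\<close> and \<open>e\<close> the arrow \<open>f\<^sup>*R \<rightarrow> P\<close> of a
  \<open>\<Prod>\<close>-diagram based on \<open>P\<close>.\<close>

definition is_Pi_diagram :: "('o, 'a, 'p, 'b) ftr \<Rightarrow> 'b \<Rightarrow> 'o \<Rightarrow> 'a \<Rightarrow> 'a \<Rightarrow> bool" where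
  "is_Pi_diagram \<pi> f P c e \<longleftrightarrow>
    (let E = Src \<pi>; I = Idt (Tgt \<pi>) (Dom (Tgt \<pi>) f); J = Idt (Tgt \<pi>) (Cod (Tgt \<pi>) f) in
    f \<in> Arr (Tgt \<pi>) \<and> is_cartesian \<pi> c \<and> AMap \<pi> c = f \<and>
    e \<in> hom E (Dom E c) P \<and> AMap \<pi> e = I \<and>
    (\<forall>c' t. is_cartesian \<pi> c' \<and> AMap \<pi> c' = f \<and> t \<in> hom E (Dom E c') P \<and> AMap \<pi> t = I \<longrightarrow>
      (\<exists>!s. s \<in> hom E (Cod E c') (Cod E c) \<and> AMap \<pi> s = J \<and>
        (\<exists>u. induced \<pi> I c' s c u \<and> e \<cdot>\<^bsub>E\<^esub> u = t))))"

definition stable_cocartesian :: "('o, 'a, 'p, 'b) ftr \<Rightarrow> 'a \<Rightarrow> bool" where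
  "stable_cocartesian \<pi> q \<longleftrightarrow>
    (\<forall>h k f c d q'. is_pullback (Tgt \<pi>) (AMap \<pi> q) h k f \<and>
      cart_lift \<pi> h (Dom (Src \<pi>) q) c \<and> cart_lift \<pi> k (Cod (Src \<pi>) q) d \<and>
      induced \<pi> f c q d q' \<longrightarrow> is_cocartesian \<pi> q')"

definition stable_Pi_diagram :: "('o, 'a, 'p, 'b) ftr \<Rightarrow> 'b \<Rightarrow> 'o \<Rightarrow> 'a \<Rightarrow> 'a \<Rightarrow> bool" where
  "stable_Pi_diagram \<pi> g P c e \<longleftrightarrow>
    (\<forall>h k f cP cS cR c' e'. is_pullback (Tgt \<pi>) g h k f \<and>
      cart_lift \<pi> h P cP \<and> cart_lift \<pi> h (Dom (Src \<pi>) c) cS \<and> cart_lift \<pi> k (Cod (Src \<pi>) c) cR \<and>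
      induced \<pi> f cS c cR c' \<and> induced \<pi> (Idt (Tgt \<pi>) (Dom (Tgt \<pi>) f)) cS e cP e' \<longrightarrow>
      is_Pi_diagram \<pi> f (Dom (Src \<pi>) cP) c' e')"

definition product_projection :: "('o, 'a, 'm) cat_scheme \<Rightarrow> 'a \<Rightarrow> bool" where
  "product_projection C g \<longleftrightarrow> (\<exists>A B R p1. is_product C A B R p1 g)"

definition is_diagonal :: "('o, 'a, 'm) cat_scheme \<Rightarrow> 'o \<Rightarrow> 'a \<Rightarrow> bool" where
  "is_diagonal C B \<delta> \<longleftrightarrow> (\<exists>R p1 p2. is_product C B B R p1 p2 \<and> \<delta> \<in> hom C B R \<and>
    p1 \<cdot>\<^bsub>C\<^esub> \<delta> = Idt C B \<and> p2 \<cdot>\<^bsub>C\<^esub> \<delta> = Idt C B)"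

locale h_fibration = fibration \<pi> for \<pi> :: "('o, 'a, 'p, 'b) ftr" +
  assumes base_products: "has_finite_products (Tgt \<pi>)"
    and fiber_products: "A \<in> Obj (Tgt \<pi>) \<Longrightarrow> has_finite_products (fiber \<pi> A)"
    and fiber_coproducts: "A \<in> Obj (Tgt \<pi>) \<Longrightarrow> has_finite_coproducts (fiber \<pi> A)"
    and fiber_exponentials: "A \<in> Obj (Tgt \<pi>) \<Longrightarrow> has_exponentials (fiber \<pi> A)"
    and terminal_stable: "f \<in> Arr (Tgt \<pi>) \<Longrightarrow> is_terminal (fiber \<pi> (Cod (Tgt \<pi>) f)) T \<Longrightarrow>
      stable_terminal \<pi> f T"
    and initial_stable: "f \<in> Arr (Tgt \<pi>) \<Longrightarrow> is_initial (fiber \<pi> (Cod (Tgt \<pi>) f)) Z \<Longrightarrow>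
      stable_initial \<pi> f Z"
    and product_stable: "f \<in> Arr (Tgt \<pi>) \<Longrightarrow>
      is_product (fiber \<pi> (Cod (Tgt \<pi>) f)) P Q R p1 p2 \<Longrightarrow> stable_product \<pi> f P Q R p1 p2"
    and coproduct_stable: "f \<in> Arr (Tgt \<pi>) \<Longrightarrow>
      is_coproduct (fiber \<pi> (Cod (Tgt \<pi>) f)) P Q S i1 i2 \<Longrightarrow> stable_coproduct \<pi> f P Q S i1 i2"
    and exponential_stable: "f \<in> Arr (Tgt \<pi>) \<Longrightarrow>
      is_exponential (fiber \<pi> (Cod (Tgt \<pi>) f)) P Q E R p1 p2 e \<Longrightarrow>
      stable_exponential \<pi> f P Q E R p1 p2 e"
    and cocartesian_ex: "product_projection (Tgt \<pi>) g \<Longrightarrow> P \<in> Obj (Src \<pi>) \<Longrightarrow>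
      OMap \<pi> P = Dom (Tgt \<pi>) g \<Longrightarrow>
      \<exists>q. is_cocartesian \<pi> q \<and> Dom (Src \<pi>) q = P \<and> AMap \<pi> q = g"
    and Pi_diagram_ex: "product_projection (Tgt \<pi>) g \<Longrightarrow> P \<in> Obj (Src \<pi>) \<Longrightarrow>
      OMap \<pi> P = Dom (Tgt \<pi>) g \<Longrightarrow> \<exists>c e. is_Pi_diagram \<pi> g P c e"
    and cocartesian_stable: "is_cocartesian \<pi> q \<Longrightarrow> product_projection (Tgt \<pi>) (AMap \<pi> q) \<Longrightarrow>
      stable_cocartesian \<pi> q"
    and Pi_diagram_stable: "is_Pi_diagram \<pi> g P c e \<Longrightarrow> product_projection (Tgt \<pi>) g \<Longrightarrow>
      stable_Pi_diagram \<pi> g P c e"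

locale h_eq_fibration = h_fibration \<pi> for \<pi> :: "('o, 'a, 'p, 'b) ftr" +
  assumes equality_ex: "is_diagonal (Tgt \<pi>) B \<delta> \<Longrightarrow> is_terminal (fiber \<pi> B) T \<Longrightarrow>
    \<exists>q. is_cocartesian \<pi> q \<and> Dom (Src \<pi>) q = T \<and> AMap \<pi> q = \<delta>"

locale h_fibration_morphism =
  source: h_fibration \<pi> + target: h_fibration \<rho> + cat_functor F
  for \<pi> :: "('o, 'a, 'p, 'b) ftr" and \<rho> :: "('q, 'c, 'p, 'b) ftr" and F :: "('o, 'a, 'q, 'c) ftr" +
  assumes same_base: "Tgt \<rho> = Tgt \<pi>"
    and src_eq: "Src F = Src \<pi>"
    and tgt_eq: "Tgt F = Src \<rho>"
    and over_obj: "X \<in> Obj (Src \<pi>) \<Longrightarrow> OMap \<rho> (OMap F X) = OMap \<pi> X"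
    and over_arr: "f \<in> Arr (Src \<pi>) \<Longrightarrow> AMap \<rho> (AMap F f) = AMap \<pi> f"
    and cartesian_pres: "is_cartesian \<pi> c \<Longrightarrow> is_cartesian \<rho> (AMap F c)"
    and terminal_pres: "A \<in> Obj (Tgt \<pi>) \<Longrightarrow> is_terminal (fiber \<pi> A) T \<Longrightarrow>
      is_terminal (fiber \<rho> A) (OMap F T)"
    and initial_pres: "A \<in> Obj (Tgt \<pi>) \<Longrightarrow> is_initial (fiber \<pi> A) Z \<Longrightarrow>
      is_initial (fiber \<rho> A) (OMap F Z)"
    and product_pres: "A \<in> Obj (Tgt \<pi>) \<Longrightarrow> is_product (fiber \<pi> A) P Q R p1 p2 \<Longrightarrow>
      is_product (fiber \<rho> A) (OMap F P) (OMap F Q) (OMap F R) (AMap F p1) (AMap F p2)"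
    and coproduct_pres: "A \<in> Obj (Tgt \<pi>) \<Longrightarrow> is_coproduct (fiber \<pi> A) P Q S i1 i2 \<Longrightarrow>
      is_coproduct (fiber \<rho> A) (OMap F P) (OMap F Q) (OMap F S) (AMap F i1) (AMap F i2)"
    and exponential_pres: "A \<in> Obj (Tgt \<pi>) \<Longrightarrow> is_exponential (fiber \<pi> A) P Q E R p1 p2 e \<Longrightarrow>
      is_exponential (fiber \<rho> A) (OMap F P) (OMap F Q) (OMap F E) (OMap F R)
        (AMap F p1) (AMap F p2) (AMap F e)"
    and cocartesian_pres: "is_cocartesian \<pi> q \<Longrightarrow> product_projection (Tgt \<pi>) (AMap \<pi> q) \<Longrightarrow>
      is_cocartesian \<rho> (AMap F q)"
    and Pi_diagram_pres: "is_Pi_diagram \<pi> g P c e \<Longrightarrow> product_projection (Tgt \<pi>) g \<Longrightarrow>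
      is_Pi_diagram \<rho> g (OMap F P) (AMap F c) (AMap F e)"

section \<open>The fibrations of fibrant objects\<close>

definition fibrant_arrow_cat :: "('o, 'a) model_cat \<Rightarrow> ('a, 'a \<times> 'a \<times> 'a \<times> 'a) cat" where
  "fibrant_arrow_cat M = full_subcat (arrow_cat M) {x. x \<in> Fib M \<and> fibrant M (Cod M x)}"

definition F_fb :: "('o, 'a) model_cat \<Rightarrow> ('a, 'a \<times> 'a \<times> 'a \<times> 'a, 'o, 'a) ftr" where
  "F_fb M = \<lparr>Src = fibrant_arrow_cat M, Tgt = fibrant_cat M, OMap = Cod M,
    AMap = (\<lambda>(x, t, b, y). b)\<rparr>"

definition vertical_WE :: "('o, 'a) model_cat \<Rightarrow> ('a \<times> 'a \<times> 'a \<times> 'a) set" where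
  "vertical_WE M =
    {(x, t, b, y) \<in> Arr (fibrant_arrow_cat M). b = Idt M (Cod M x) \<and> t \<in> WE M}"

definition HoF_fb ::
  "('o, 'a) model_cat \<Rightarrow> ('a, ('a, 'a \<times> 'a \<times> 'a \<times> 'a) zz_arrow, 'o, 'a) ftr" where
  "HoF_fb M = loc_lift (F_fb M) (vertical_WE M)"

definition gamma_fb :: "('o, 'a) model_cat \<Rightarrow>
    ('a, 'a \<times> 'a \<times> 'a \<times> 'a, 'a, ('a, 'a \<times> 'a \<times> 'a \<times> 'a) zz_arrow) ftr" where
  "gamma_fb M = loc_ftr (fibrant_arrow_cat M) (vertical_WE M)"

theorem cat_functor_F_fb:
  assumes "category M"
  shows "cat_functor (F_fb M)"
proof (rule cat_functor.intro)
  note a = hom_arrow_cat[OF assms]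
  have s: "Src (F_fb M) = fibrant_arrow_cat M" "Tgt (F_fb M) = fibrant_cat M"
    "OMap (F_fb M) = Cod M" "AMap (F_fb M) (x, t, b, y) = b" for x t b y
    by (simp_all add: F_fb_def)
  have h: "f \<in> hom (fibrant_arrow_cat M) x y \<longleftrightarrow> (\<exists>t b. f = (x, t, b, y) \<and>
      x \<in> Arr M \<and> y \<in> Arr M \<and> t \<in> hom M (Dom M x) (Dom M y) \<and> b \<in> hom M (Cod M x) (Cod M y) \<and>
      y \<cdot>\<^bsub>M\<^esub> t = b \<cdot>\<^bsub>M\<^esub> x) \<and> x \<in> Fib M \<and> fibrant M (Cod M x) \<and> y \<in> Fib M \<and> fibrant M (Cod M y)"
    for f x y
    unfolding fibrant_arrow_cat_def hom_full_subcat a by blast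
  have h': "f \<in> hom (fibrant_cat M) x y \<longleftrightarrow> f \<in> hom M x y \<and> fibrant M x \<and> fibrant M y" for f x y
    unfolding fibrant_cat_def hom_full_subcat by blast
  have c: "Cmp (fibrant_cat M) = Cmp M" "Idt (fibrant_cat M) = Idt M"
    "(y, t', b', z) \<cdot>\<^bsub>fibrant_arrow_cat M\<^esub> (x, t, b, y') = (x, t' \<cdot>\<^bsub>M\<^esub> t, b' \<cdot>\<^bsub>M\<^esub> b, z)"
    "Idt (fibrant_arrow_cat M) x = (x, Idt M (Dom M x), Idt M (Cod M x), x)"
    for x y z y' t b t' b'
    by (simp_all add: fibrant_cat_def fibrant_arrow_cat_def full_subcat_def arrow_cat_def)
  show "category (Src (F_fb M))" "category (Tgt (F_fb M))"
    unfolding s fibrant_arrow_cat_def fibrant_cat_def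
    using assms by (auto intro: category_full_subcat category_arrow_cat)
  show "OMap (F_fb M) A \<in> Obj (Tgt (F_fb M))" if "A \<in> Obj (Src (F_fb M))" for A
    using that unfolding s
    by (simp add: fibrant_arrow_cat_def fibrant_cat_def full_subcat_def fibrant_def)
  show "AMap (F_fb M) f \<in> hom (Tgt (F_fb M)) (OMap (F_fb M) A) (OMap (F_fb M) B)"
    if "f \<in> hom (Src (F_fb M)) A B" for f A B
    using that unfolding s h h' by (auto simp: s)
  show "AMap (F_fb M) (Idt (Src (F_fb M)) A) = Idt (Tgt (F_fb M)) (OMap (F_fb M) A)" for A
    by (simp add: s c)
  show "AMap (F_fb M) (g \<cdot>\<^bsub>Src (F_fb M)\<^esub> f) =
      AMap (F_fb M) g \<cdot>\<^bsub>Tgt (F_fb M)\<^esub> AMap (F_fb M) f"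
    if "f \<in> hom (Src (F_fb M)) A B" "g \<in> hom (Src (F_fb M)) B D" for f g A B D
    using that unfolding s h by (auto simp: s c)
qed

lemma F_fb_vertical_WE:
  assumes "category M" and "w \<in> vertical_WE M"
  shows "is_iso (Tgt (F_fb M)) (AMap (F_fb M) w)"
proof -
  interpret F: cat_functor "F_fb M" by (rule cat_functor_F_fb) fact
  interpret B: category "Tgt (F_fb M)" by (rule F.tgt_category)
  obtain x where x: "fibrant M (Cod M x)" "AMap (F_fb M) w = Idt M (Cod M x)"
    using assms(2)
    by (auto simp: vertical_WE_def F_fb_def fibrant_arrow_cat_def full_subcat_def arrow_cat_def)
  let ?A = "Cod M x" and ?I = "Idt (Tgt (F_fb M)) (Cod M x)"
  have "?A \<in> Obj (Tgt (F_fb M))" "?I = Idt M ?A"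
    using x(1) by (simp_all add: F_fb_def fibrant_cat_def full_subcat_def fibrant_def)
  with B.idt_hom[of ?A] B.idt_left[of ?I ?A ?A] show ?thesis
    unfolding is_iso_def inverse_arrows_def x(2) hom_def by (intro exI[of _ ?I]) auto
qed

theorem cat_functor_HoF_fb: "category M \<Longrightarrow> cat_functor (HoF_fb M)"
  unfolding HoF_fb_def
  by (rule cat_functor.cat_functor_loc_lift[OF cat_functor_F_fb]) (auto intro: F_fb_vertical_WE)

theorem cat_functor_gamma_fb: "category M \<Longrightarrow> cat_functor (gamma_fb M)"
  using cat_functor_loc_ftr[OF cat_functor.src_category[OF cat_functor_F_fb]]
  by (simp add: gamma_fb_def F_fb_def)

end

theory Submission
  imports Defs
begin

text \<open>Let \<open>I\<close> be an interval: \<open>1 + 1 \<rightarrow> I\<close> a cofibration and \<open>I \<rightarrow> 1\<close> an acyclic fibration. For fibrations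
  over a fibrant object, fibrewise homotopy with respect to the cylinders \<open>X \<times> I\<close> is an equivalence
  relation compatible with composition, and a vertical weak equivalence is invertible up to such
  homotopies. Hence the localization is the quotient of the category of fibrations by homotopy. Since
  the projections \<open>X \<times> I \<rightarrow> X\<close> are cartesian natural transformations, the usual constructions with
  pullbacks, coproducts and dependent products have universal properties that are respected by
  homotopies, so they descend to the quotient. Replacing \<open>X \<times> I\<close> by \<open>X\<close> turns homotopy into equality, so the
  same argument applies to the fibration of fibrations itself, and \<open>\<gamma>\<close> carries one set of standard
  diagrams to the other. In the localization, fibrant replacement even yields cocartesian lifts along all arrows,
  in particular along diagonals.\<close>

section \<open>Universal constructions in a category\<close>

text \<open>Stability is demanded of every diagram and every choice of cartesian lifts, while in the
  localization arrows are only homotopy classes. For products, exponentials and dependent products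
  the universal property is therefore proved in a form tested against arrows over all arrows of the
  base (\<open>strong_terminal\<close>, \<open>fibred_product\<close>,
  \<open>strong_exponential\<close>, \<open>strong_Pi\<close>). Such a form is inherited by
  cartesian lifts, and every other diagram in the fibre is isomorphic to the chosen one.

  The hypotheses enter as follows. Local cartesian closedness yields dependent products, universal
  coproducts and a strict initial object. Cofibrations being the monomorphisms, every object is
  cofibrant and cofibrations are stable under pullback. Right properness then makes pullback along a
  fibration preserve acyclic cofibrations, so dependent products along fibrations preserve
  fibrations. The conditions on copairs and on initial arrows put the standard coproducts and
  initial objects into the total category.\<close>

lemma in_hom [simp]: "f \<in> hom C A B \<longleftrightarrow> f \<in> Arr C \<and> Dom C f = A \<and> Cod C f = B"
  by (simp add: hom_def)

section \<open>Composition, isomorphisms and terminal objects\<close>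

context category
begin

lemma cmp_simps [simp]:
  assumes "f \<in> Arr C" "g \<in> Arr C" "Cod C f = Dom C g"
  shows "g \<cdot> f \<in> Arr C" "Dom C (g \<cdot> f) = Dom C f" "Cod C (g \<cdot> f) = Cod C g"
  using cmp_hom[of f "Dom C f" "Cod C f" g "Cod C g"] assms by auto

lemma idt_simps [simp]:
  assumes "A \<in> Obj C"
  shows "Idt C A \<in> Arr C" "Dom C (Idt C A) = A" "Cod C (Idt C A) = A"
  using idt_hom[OF assms] by auto

lemma assoc [simp]:
  "f \<in> Arr C \<Longrightarrow> g \<in> Arr C \<Longrightarrow> h \<in> Arr C \<Longrightarrow> Cod C f = Dom C g \<Longrightarrow> Cod C g = Dom C h \<Longrightarrow>
    (h \<cdot> g) \<cdot> f = h \<cdot> (g \<cdot> f)"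
  using cmp_assoc[of f "Dom C f" "Cod C f" g "Cod C g" h "Cod C h"] by auto

lemma idl [simp]: "f \<in> Arr C \<Longrightarrow> Cod C f = B \<Longrightarrow> Idt C B \<cdot> f = f"
  and idr [simp]: "f \<in> Arr C \<Longrightarrow> Dom C f = A \<Longrightarrow> f \<cdot> Idt C A = f"
  using idt_left[of f "Dom C f" "Cod C f"] idt_right[of f "Dom C f" "Cod C f"] by auto

declare dom_obj [simp] cod_obj [simp]

text \<open>The rule \<open>assoc\<close> normalises composites to the right, after which an
  equation for \<open>g \<cdot> f\<close> no longer matches inside
  \<open>g \<cdot> (f \<cdot> x)\<close>. This is the form of the equation that still rewrites
  there.\<close>

lemma reassoc:
  assumes "g \<cdot> f = k"
  shows "x \<in> Arr C \<Longrightarrow> Cod C x = Dom C f \<Longrightarrow> f \<in> Arr C \<Longrightarrow> Cod C f = Dom C g \<Longrightarrow> g \<in> Arr C \<Longrightarrow>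
    g \<cdot> (f \<cdot> x) = k \<cdot> x"
  using assms by auto

lemma category_opp: "category (opp C)"
  by standard (auto simp: opp_def)

lemma iso_inverse:
  assumes "is_iso C f"
  shows "\<exists>g. f \<in> Arr C \<and>
    g \<in> Arr C \<and>
    Dom C g = Cod C f \<and>
    Cod C g = Dom C f \<and>
    g \<cdot> f = Idt C (Dom C f) \<and>
    f \<cdot> g = Idt C (Cod C f) \<and>
    is_iso C g"
proof -
  obtain g where g: "inverse_arrows C f g" using assms by (auto simp: is_iso_def)
  then have "inverse_arrows C g f" by (auto simp: inverse_arrows_def)
  then show ?thesis using g by (intro exI[of _ g]) (auto simp: inverse_arrows_def is_iso_def)
qed

lemma isoI:
  assumes "f \<in> Arr C" "g \<in> Arr C" "Dom C g = Cod C f" "Cod C g = Dom C f"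
    "g \<cdot> f = Idt C (Dom C f)" "f \<cdot> g = Idt C (Cod C f)"
  shows "is_iso C f"
  using assms by (auto simp: is_iso_def inverse_arrows_def)

lemma iso_arr: "is_iso C f \<Longrightarrow> f \<in> Arr C"
  by (auto simp: is_iso_def inverse_arrows_def)

lemma iso_idt: "A \<in> Obj C \<Longrightarrow> is_iso C (Idt C A)"
  by (rule isoI[of _ "Idt C A"]) auto

lemma iso_cancel_left:
  assumes "is_iso C g" "x \<in> Arr C" "y \<in> Arr C" "Cod C x = Dom C g" "Cod C y = Dom C g" "g \<cdot> x = g \<cdot> y"
  shows "x = y"
proof -
  obtain g' where g: "g \<in> Arr C" "g' \<in> Arr C" "Dom C g' = Cod C g" "Cod C g' = Dom C g"
    "g' \<cdot> g = Idt C (Dom C g)"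
    using iso_inverse[OF assms(1)] by metis
  have "g' \<cdot> (g \<cdot> x) = x" "g' \<cdot> (g \<cdot> y) = y" using g assms(2-5) by (simp_all add: reassoc[OF g(5)])
  then show ?thesis using assms(6) by metis
qed

lemma terminal_map: "is_terminal C T \<Longrightarrow> X \<in> Obj C \<Longrightarrow> \<exists>u. u \<in> Arr C \<and> Dom C u = X \<and> Cod C u = T"
  by (auto simp: is_terminal_def)

lemma terminal_eq:
  assumes "is_terminal C T" "f \<in> Arr C" "g \<in> Arr C" "Cod C f = T" "Cod C g = T" "Dom C f = Dom C g"
  shows "f = g"
proof -
  have "\<exists>!u. u \<in> hom C (Dom C g) T" using assms by (auto simp: is_terminal_def simp del: in_hom)
  then show ?thesis using assms by auto
qed

lemma terminal_obj: "is_terminal C T \<Longrightarrow> T \<in> Obj C"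
  by (simp add: is_terminal_def)

lemma terminal_iso:
  assumes "is_terminal C T" "u \<in> Arr C" "Dom C u = T" "Cod C u = X" "is_iso C u"
  shows "is_terminal C X"
proof -
  obtain v where v: "v \<in> Arr C" "Dom C v = X" "Cod C v = T" "u \<cdot> v = Idt C X"
    using iso_inverse[OF assms(5)] assms by metis
  have X: "X \<in> Obj C" using assms by auto
  have "\<exists>!w. w \<in> Arr C \<and> Dom C w = Y \<and> Cod C w = X" if Y: "Y \<in> Obj C" for Y
  proof -
    obtain t where t: "t \<in> Arr C" "Dom C t = Y" "Cod C t = T" using terminal_map[OF assms(1) Y] by auto
    show ?thesis
    proof (rule ex1I[of _ "u \<cdot> t"])
      fix w assume w: "w \<in> Arr C \<and> Dom C w = Y \<and> Cod C w = X"
      have "v \<cdot> w = t" by (rule terminal_eq[OF assms(1)]) (use w v t in auto)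
      then have "u \<cdot> t = u \<cdot> (v \<cdot> w)" by simp
      also have "\<dots> = w" using w v assms by (simp add: reassoc[OF v(4)])
      finally show "w = u \<cdot> t" by simp
    qed (use t assms in auto)
  qed
  then show ?thesis using X by (simp add: is_terminal_def)
qed

lemma terminal_unique_iso:
  assumes "is_terminal C T" "is_terminal C T'"
  shows "\<exists>u. is_iso C u \<and> u \<in> Arr C \<and> Dom C u = T \<and> Cod C u = T'"
proof -
  have o: "T \<in> Obj C" "T' \<in> Obj C" using assms by (auto simp: is_terminal_def)
  obtain u v where uv: "u \<in> Arr C" "Dom C u = T" "Cod C u = T'" "v \<in> Arr C" "Dom C v = T'" "Cod C v = T"
    using terminal_map[OF assms(1) o(2)] terminal_map[OF assms(2) o(1)] by auto
  have "v \<cdot> u = Idt C T" by (rule terminal_eq[OF assms(1)]) (use uv o in auto)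
  moreover have "u \<cdot> v = Idt C T'" by (rule terminal_eq[OF assms(2)]) (use uv o in auto)
  ultimately have "is_iso C u" by (intro isoI[of u v]) (use uv in auto)
  then show ?thesis using uv by blast
qed

section \<open>Binary products\<close>

lemma productD:
  assumes "is_product C P Q R p1 p2"
  shows "p1 \<in> Arr C" "Dom C p1 = R" "Cod C p1 = P" "p2 \<in> Arr C" "Dom C p2 = R" "Cod C p2 = Q"
  using assms by (auto simp: is_product_def)

lemma product_ex:
  assumes "is_product C P Q R p1 p2" "f \<in> Arr C" "g \<in> Arr C" "Dom C f = Dom C g" "Cod C f = P" "Cod C g = Q"
  shows "\<exists>u. u \<in> Arr C \<and>
    Dom C u = Dom C g \<and>
    Cod C u = R \<and>
    p1 \<cdot> u = f \<and>
    p2 \<cdot> u = g"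
proof -
  have "\<exists>!u. u \<in> hom C (Dom C g) R \<and> p1 \<cdot> u = f \<and> p2 \<cdot> u = g"
    using assms unfolding is_product_def by auto
  then show ?thesis by auto
qed

lemma product_eq:
  assumes P: "is_product C P Q R p1 p2"
    and uv: "u \<in> Arr C" "v \<in> Arr C" "Dom C u = Dom C v" "Cod C u = R" "Cod C v = R"
      "p1 \<cdot> u = p1 \<cdot> v" "p2 \<cdot> u = p2 \<cdot> v"
  shows "u = v"
proof -
  note p = productD[OF P]
  have "\<exists>!w. w \<in> hom C (Dom C v) R \<and> p1 \<cdot> w = p1 \<cdot> v \<and> p2 \<cdot> w = p2 \<cdot> v"
    using P uv p unfolding is_product_def by auto
  then show ?thesis using uv by auto
qed

lemma productI:
  assumes "p1 \<in> Arr C" "Dom C p1 = R" "Cod C p1 = P" "p2 \<in> Arr C" "Dom C p2 = R" "Cod C p2 = Q"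
    and "\<And>f g. f \<in> Arr C \<Longrightarrow> g \<in> Arr C \<Longrightarrow> Dom C f = Dom C g \<Longrightarrow> Cod C f = P \<Longrightarrow> Cod C g = Q \<Longrightarrow>
      \<exists>u. u \<in> Arr C \<and> Dom C u = Dom C g \<and> Cod C u = R \<and> p1 \<cdot> u = f \<and> p2 \<cdot> u = g"
    and "\<And>u v. u \<in> Arr C \<Longrightarrow> v \<in> Arr C \<Longrightarrow> Dom C u = Dom C v \<Longrightarrow> Cod C u = R \<Longrightarrow> Cod C v = R \<Longrightarrow>
      p1 \<cdot> u = p1 \<cdot> v \<Longrightarrow> p2 \<cdot> u = p2 \<cdot> v \<Longrightarrow> u = v"
  shows "is_product C P Q R p1 p2"
  unfolding is_product_def
proof (intro conjI allI ballI)
  fix X f g assume "f \<in> hom C X P" "g \<in> hom C X Q"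
  then obtain u where "u \<in> Arr C \<and> Dom C u = Dom C g \<and> Cod C u = R \<and> p1 \<cdot> u = f \<and> p2 \<cdot> u = g"
    using assms(7)[of f g] by auto
  then show "\<exists>!u. u \<in> hom C X R \<and> p1 \<cdot> u = f \<and> p2 \<cdot> u = g"
    using assms(8) \<open>g \<in> hom C X Q\<close> by (intro ex1I[of _ u]) auto
qed (use assms in auto)

text \<open>Mediating arrows are transported along the inverses of the three isomorphisms. All three
  objects vary because a change of cartesian lifts changes the factors as well as the product;
  coproducts use it in the opposite category.\<close>

lemma product_iso_invariant:
  assumes P: "is_product C P Q R p1 p2"
    and a: "is_iso C a" "Dom C a = P" "Cod C a = P'" and b: "is_iso C b" "Dom C b = Q" "Cod C b = Q'"
    and r: "is_iso C r" "Dom C r = R'" "Cod C r = R"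
    and p1': "p1' = a \<cdot> (p1 \<cdot> r)" and p2': "p2' = b \<cdot> (p2 \<cdot> r)"
  shows "is_product C P' Q' R' p1' p2'"
proof -
  note p = productD[OF P] and [simp] = iso_arr[OF a(1)] iso_arr[OF b(1)] iso_arr[OF r(1)]
  note [simp] = p a(2,3) b(2,3) r(2,3)
  obtain a' where a': "a' \<in> Arr C" "Dom C a' = P'" "Cod C a' = P" "a' \<cdot> a = Idt C P" "a \<cdot> a' = Idt C P'"
    using iso_inverse[OF a(1)] by (metis a)
  obtain b' where b': "b' \<in> Arr C" "Dom C b' = Q'" "Cod C b' = Q" "b' \<cdot> b = Idt C Q" "b \<cdot> b' = Idt C Q'"
    using iso_inverse[OF b(1)] by (metis b)
  obtain r' where r': "r' \<in> Arr C" "Dom C r' = R" "Cod C r' = R'" "r' \<cdot> r = Idt C R'" "r \<cdot> r' = Idt C R"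
    using iso_inverse[OF r(1)] by (metis r)
  show ?thesis
  proof (rule productI)
    fix f g assume fg: "f \<in> Arr C" "g \<in> Arr C" "Dom C f = Dom C g" "Cod C f = P'" "Cod C g = Q'"
    obtain u where u: "u \<in> Arr C" "Dom C u = Dom C g" "Cod C u = R" "p1 \<cdot> u = a' \<cdot> f" "p2 \<cdot> u = b' \<cdot> g"
      using product_ex[OF P, of "a' \<cdot> f" "b' \<cdot> g"] fg a' b' by auto
    show "\<exists>u. u \<in> Arr C \<and> Dom C u = Dom C g \<and> Cod C u = R' \<and> p1' \<cdot> u = f \<and> p2' \<cdot> u = g"
      by (rule exI[of _ "r' \<cdot> u"])
        (use u fg a' b' r' in \<open>simp add: p1' p2' reassoc[OF r'(5)] reassoc[OF a'(5)] reassoc[OF b'(5)]\<close>)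
  next
    fix u v assume uv: "u \<in> Arr C" "v \<in> Arr C" "Dom C u = Dom C v" "Cod C u = R'" "Cod C v = R'"
      "p1' \<cdot> u = p1' \<cdot> v" "p2' \<cdot> u = p2' \<cdot> v"
    have e: "a \<cdot> (p1 \<cdot> (r \<cdot> u)) = a \<cdot> (p1 \<cdot> (r \<cdot> v))" "b \<cdot> (p2 \<cdot> (r \<cdot> u)) = b \<cdot> (p2 \<cdot> (r \<cdot> v))"
      using uv by (simp_all add: p1' p2')
    have "p1 \<cdot> (r \<cdot> u) = p1 \<cdot> (r \<cdot> v)" "p2 \<cdot> (r \<cdot> u) = p2 \<cdot> (r \<cdot> v)"
      by (rule iso_cancel_left[OF a(1) _ _ _ _ e(1)], simp_all add: uv)
        (rule iso_cancel_left[OF b(1) _ _ _ _ e(2)], simp_all add: uv)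
    then have "r \<cdot> u = r \<cdot> v" using uv by - (rule product_eq[OF P], auto)
    then show "u = v" using uv by - (rule iso_cancel_left[OF r(1)], auto)
  qed (simp_all add: p1' p2')
qed

lemma product_iso:
  assumes P: "is_product C P Q R p1 p2" and P': "is_product C P Q R' p1' p2'"
  shows "\<exists>r. is_iso C r \<and>
    Dom C r = R' \<and>
    Cod C r = R \<and>
    p1' = p1 \<cdot> r \<and>
    p2' = p2 \<cdot> r"
proof -
  note [simp] = productD[OF P] productD[OF P']
  obtain u where u: "u \<in> Arr C" "Dom C u = R'" "Cod C u = R" "p1 \<cdot> u = p1'" "p2 \<cdot> u = p2'"
    using product_ex[OF P, of p1' p2'] by auto
  obtain v where v: "v \<in> Arr C" "Dom C v = R" "Cod C v = R'" "p1' \<cdot> v = p1" "p2' \<cdot> v = p2"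
    using product_ex[OF P', of p1 p2] by auto
  note [simp] = u v
  have o [simp]: "R \<in> Obj C" "R' \<in> Obj C" using dom_obj[of v] dom_obj[of u] by simp_all
  have "u \<cdot> v = Idt C R" by (rule product_eq[OF P]) (simp_all add: reassoc[OF u(4)] reassoc[OF u(5)])
  moreover have "v \<cdot> u = Idt C R'"
    by (rule product_eq[OF P']) (simp_all add: reassoc[OF v(4)] reassoc[OF v(5)])
  ultimately show ?thesis using isoI[of u v] by (intro exI[of _ u]) simp
qed

lemma product_comp_iso:
  assumes P: "is_product C P Q R p1 p2" and r: "is_iso C r" "Dom C r = R'" "Cod C r = R"
  shows "is_product C P Q R' (p1 \<cdot> r) (p2 \<cdot> r)"
proof (rule product_iso_invariant[OF P _ _ _ _ _ _ r])
  note [simp] = productD[OF P] iso_arr[OF r(1)] r(2,3)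
  have "P \<in> Obj C" "Q \<in> Obj C" using cod_obj[of p1] cod_obj[of p2] by simp_all
  note [simp] = this
  show "is_iso C (Idt C P)" "is_iso C (Idt C Q)" by (simp_all add: iso_idt)
  show "Dom C (Idt C P) = P" "Cod C (Idt C P) = P" "Dom C (Idt C Q) = Q" "Cod C (Idt C Q) = Q" by simp_all
  show "p1 \<cdot> r = Idt C P \<cdot> (p1 \<cdot> r)" "p2 \<cdot> r = Idt C Q \<cdot> (p2 \<cdot> r)" by simp_all
qed

section \<open>Exponentials\<close>

lemma exponentialD:
  assumes "is_exponential C P Q E R p1 p2 e"
  shows "is_product C E P R p1 p2" "e \<in> Arr C" "Dom C e = R" "Cod C e = Q"
proof -
  have "is_product C E P R p1 p2 \<and> e \<in> hom C R Q" using assms unfolding is_exponential_def by blast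
  then show "is_product C E P R p1 p2" "e \<in> Arr C" "Dom C e = R" "Cod C e = Q" by simp_all
qed

lemma exponential_ex1:
  assumes "is_exponential C P Q E R p1 p2 e" "is_product C X P S q1 q2"
    "f \<in> Arr C" "Dom C f = S" "Cod C f = Q"
  shows "\<exists>!u. u \<in> hom C X E \<and> (\<exists>v \<in> hom C S R. p1 \<cdot> v = u \<cdot> q1 \<and> p2 \<cdot> v = q2 \<and> e \<cdot> v = f)"
proof -
  have "f \<in> hom C S Q" using assms by simp
  then show ?thesis using assms(1,2) unfolding is_exponential_def by blast
qed

lemma exponential_ex:
  assumes "is_exponential C P Q E R p1 p2 e" "is_product C X P S q1 q2"
    "f \<in> Arr C" "Dom C f = S" "Cod C f = Q"
  shows "\<exists>u v. u \<in> Arr C \<and> Dom C u = X \<and> Cod C u = E \<and> v \<in> Arr C \<and> Dom C v = S \<and> Cod C v = R \<and>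
    p1 \<cdot> v = u \<cdot> q1 \<and> p2 \<cdot> v = q2 \<and> e \<cdot> v = f"
  using ex1_implies_ex[OF exponential_ex1[OF assms]] unfolding Bex_def in_hom by blast

lemma exponential_eq:
  assumes "is_exponential C P Q E R p1 p2 e" "is_product C X P S q1 q2"
    "u \<in> Arr C" "Dom C u = X" "Cod C u = E" "v \<in> Arr C" "Dom C v = S" "Cod C v = R"
    "p1 \<cdot> v = u \<cdot> q1" "p2 \<cdot> v = q2" "e \<cdot> v = f"
    "u' \<in> Arr C" "Dom C u' = X" "Cod C u' = E" "v' \<in> Arr C" "Dom C v' = S" "Cod C v' = R"
    "p1 \<cdot> v' = u' \<cdot> q1" "p2 \<cdot> v' = q2" "e \<cdot> v' = f"
  shows "u = u'"
proof -
  have "f \<in> Arr C" "Dom C f = S" "Cod C f = Q" using assms(6-8,11) exponentialD[OF assms(1)] by auto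
  note ex1 = exponential_ex1[OF assms(1,2) this]
  have "u \<in> hom C X E \<and> (\<exists>v \<in> hom C S R. p1 \<cdot> v = u \<cdot> q1 \<and> p2 \<cdot> v = q2 \<and> e \<cdot> v = f)"
    using assms(3-11) unfolding Bex_def in_hom by blast
  moreover have "u' \<in> hom C X E \<and> (\<exists>v \<in> hom C S R. p1 \<cdot> v = u' \<cdot> q1 \<and> p2 \<cdot> v = q2 \<and> e \<cdot> v = f)"
    using assms(12-20) unfolding Bex_def in_hom by blast
  ultimately show ?thesis using ex1 by blast
qed

text \<open>Any two products of \<open>X\<close> and \<open>P\<close> are isomorphic over their
  projections, so the universal property need only be checked on one product for each
  \<open>X\<close>, whereas \<open>is_exponential\<close> quantifies over all of them.\<close>

lemma exponentialI:
  assumes P: "is_product C E P R p1 p2" and e: "e \<in> Arr C" "Dom C e = R" "Cod C e = Q"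
    and X: "\<And>X. X \<in> Obj C \<Longrightarrow> \<exists>S q1 q2. is_product C X P S q1 q2 \<and> (\<forall>f \<in> hom C S Q.
      \<exists>!u. u \<in> hom C X E \<and> (\<exists>v \<in> hom C S R. p1 \<cdot> v = u \<cdot> q1 \<and> p2 \<cdot> v = q2 \<and> e \<cdot> v = f))"
  shows "is_exponential C P Q E R p1 p2 e"
  unfolding is_exponential_def
proof (intro conjI allI impI)
  fix X S q1 q2 f assume a: "is_product C X P S q1 q2 \<and> f \<in> hom C S Q"
  then have S: "is_product C X P S q1 q2" and f: "f \<in> Arr C" "Dom C f = S" "Cod C f = Q" by auto
  note [simp] = productD[OF S] productD[OF P] f e
  have "X \<in> Obj C" using cod_obj[of q1] by simp
  then obtain S0 r1 r2 where S0: "is_product C X P S0 r1 r2"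
    and u0: "\<forall>f \<in> hom C S0 Q. \<exists>!u. u \<in> hom C X E \<and>
      (\<exists>v \<in> hom C S0 R. p1 \<cdot> v = u \<cdot> r1 \<and> p2 \<cdot> v = r2 \<and> e \<cdot> v = f)"
    using X[OF \<open>X \<in> Obj C\<close>] by (elim exE conjE)
  note u = u0[THEN bspec]
  note [simp] = productD[OF S0]
  obtain a where a: "is_iso C a" "Dom C a = S" "Cod C a = S0" "q1 = r1 \<cdot> a" "q2 = r2 \<cdot> a"
    using product_iso[OF S0 S] by auto
  obtain b where b: "b \<in> Arr C" "Dom C b = S0" "Cod C b = S" "b \<cdot> a = Idt C S" "a \<cdot> b = Idt C S0"
    using iso_inverse[OF a(1)] by (metis a(2,3))
  note [simp] = iso_arr[OF a(1)] a(2,3) b(1-3)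
  have rq: "r1 = q1 \<cdot> b" "r2 = q2 \<cdot> b" using b(5) by (simp_all add: a(4,5))
  have fb: "f \<cdot> b \<in> hom C S0 Q" by simp
  \<comment> \<open>Precomposition with the mutually inverse \<open>a\<close> and \<open>b\<close>
    matches the arrows \<open>v\<close> on the two products; \<open>u\<close> is the same on both
    sides.\<close>
  have "(\<exists>v \<in> hom C S R. p1 \<cdot> v = u \<cdot> q1 \<and> p2 \<cdot> v = q2 \<and> e \<cdot> v = f) \<longleftrightarrow>
    (\<exists>v \<in> hom C S0 R. p1 \<cdot> v = u \<cdot> r1 \<and> p2 \<cdot> v = r2 \<and> e \<cdot> v = f \<cdot> b)" (is "?L \<longleftrightarrow> ?R")
    if "u \<in> hom C X E" for u
  proof
    assume ?L
    then obtain v where v: "v \<in> Arr C" "Dom C v = S" "Cod C v = R" "p1 \<cdot> v = u \<cdot> q1" "p2 \<cdot> v = q2" "e \<cdot> v = f"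
      by auto
    show ?R using that
      by (intro bexI[of _ "v \<cdot> b"]) (simp_all add: v(1-3) reassoc[OF v(4)] reassoc[OF v(5)] reassoc[OF v(6)] rq)
  next
    assume ?R
    then obtain v where v: "v \<in> Arr C" "Dom C v = S0" "Cod C v = R" "p1 \<cdot> v = u \<cdot> r1" "p2 \<cdot> v = r2"
      "e \<cdot> v = f \<cdot> b"
      by auto
    show ?L using that
      by (intro bexI[of _ "v \<cdot> a"]) (simp_all add: v(1-3) b(4) reassoc[OF v(4)] reassoc[OF v(5)] reassoc[OF v(6)] a(4,5))
  qed
  then have "u \<in> hom C X E \<and> (\<exists>v \<in> hom C S R. p1 \<cdot> v = u \<cdot> q1 \<and> p2 \<cdot> v = q2 \<and> e \<cdot> v = f) \<longleftrightarrow>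
    u \<in> hom C X E \<and> (\<exists>v \<in> hom C S0 R. p1 \<cdot> v = u \<cdot> r1 \<and> p2 \<cdot> v = r2 \<and> e \<cdot> v = f \<cdot> b)" for u
    by (rule conj_cong[OF refl])
  then show "\<exists>!u. u \<in> hom C X E \<and> (\<exists>v \<in> hom C S R. p1 \<cdot> v = u \<cdot> q1 \<and> p2 \<cdot> v = q2 \<and> e \<cdot> v = f)"
    using u[OF fb] by (simp only:)
qed (use P e in simp_all)

text \<open>Each diagram is tested against the other, and uniqueness of transposes makes the
  composites identities. The comparison \<open>r\<close> of the two products is returned as well,
  since stability and preservation concern the whole diagram.\<close>

lemma exponential_iso:
  assumes X: "is_exponential C P Q E R p1 p2 e" and X': "is_exponential C P Q E' R' p1' p2' e'"
  shows "\<exists>a r. is_iso C a \<and>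
    Dom C a = E' \<and>
    Cod C a = E \<and>
    is_iso C r \<and>
    Dom C r = R' \<and>
    Cod C r = R \<and>
    p1 \<cdot> r = a \<cdot> p1' \<and>
    p2 \<cdot> r = p2' \<and>
    e \<cdot> r = e'"
proof -
  note P = exponentialD[OF X] and P' = exponentialD[OF X']
  note [simp] = productD[OF P(1)] productD[OF P'(1)] P(2-4) P'(2-4)
  obtain u v where u: "u \<in> Arr C" "Dom C u = E'" "Cod C u = E" "v \<in> Arr C" "Dom C v = R'" "Cod C v = R"
    "p1 \<cdot> v = u \<cdot> p1'" "p2 \<cdot> v = p2'" "e \<cdot> v = e'"
    using exponential_ex[OF X P'(1), of e'] by auto
  obtain u' v' where u': "u' \<in> Arr C" "Dom C u' = E" "Cod C u' = E'" "v' \<in> Arr C" "Dom C v' = R" "Cod C v' = R'"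
    "p1' \<cdot> v' = u' \<cdot> p1" "p2' \<cdot> v' = p2" "e' \<cdot> v' = e"
    using exponential_ex[OF X' P(1), of e] by auto
  have [simp]: "E \<in> Obj C" "R \<in> Obj C" "E' \<in> Obj C" "R' \<in> Obj C" using u u' by auto
  note [simp] = u(1-6) u'(1-6)
  note c = reassoc[OF u(7)] reassoc[OF u(8)] reassoc[OF u(9)] reassoc[OF u'(7)] reassoc[OF u'(8)] reassoc[OF u'(9)]
  have 1: "u \<cdot> u' = Idt C E"
    by (rule exponential_eq[OF X P(1), of _ "v \<cdot> v'" e _ "Idt C R"]) (simp_all add: c u u')
  have 2: "u' \<cdot> u = Idt C E'"
    by (rule exponential_eq[OF X' P'(1), of _ "v' \<cdot> v" e' _ "Idt C R'"]) (simp_all add: c u u')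
  have "v \<cdot> v' = Idt C R"
    by (rule product_eq[OF P(1)]) (simp_all add: c u' reassoc[OF 1])
  moreover have "v' \<cdot> v = Idt C R'"
    by (rule product_eq[OF P'(1)]) (simp_all add: c u reassoc[OF 2])
  ultimately show ?thesis
    using 1 2 isoI[of u u'] isoI[of v v'] u by (intro exI[of _ u] exI[of _ v]) simp
qed

lemma exponential_comp_iso:
  assumes X: "is_exponential C P Q E R p1 p2 e"
    and a: "is_iso C a" "Dom C a = E'" "Cod C a = E" and r: "is_iso C r" "Dom C r = R'" "Cod C r = R"
    and p1': "p1' \<in> Arr C" "Dom C p1' = R'" "Cod C p1' = E'" "p1 \<cdot> r = a \<cdot> p1'"
    and p2': "p2' = p2 \<cdot> r" and e': "e' = e \<cdot> r"
  shows "is_exponential C P Q E' R' p1' p2' e'"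
proof -
  note P = exponentialD[OF X]
  note [simp] = productD[OF P(1)] P(2-4) iso_arr[OF a(1)] a(2,3) iso_arr[OF r(1)] r(2,3) p1'(1-3)
  obtain b where b: "is_iso C b" "b \<in> Arr C" "Dom C b = E" "Cod C b = E'" "b \<cdot> a = Idt C E'" "a \<cdot> b = Idt C E"
    using iso_inverse[OF a(1)] by (metis a)
  obtain s where s: "s \<in> Arr C" "Dom C s = R" "Cod C s = R'" "s \<cdot> r = Idt C R'" "r \<cdot> s = Idt C R"
    using iso_inverse[OF r(1)] by (metis r)
  note [simp] = b(2-4) s(1-3)
  have [simp]: "P \<in> Obj C" "E \<in> Obj C" "E' \<in> Obj C" "R \<in> Obj C" "R' \<in> Obj C"
    using cod_obj[of p2] cod_obj[of p1] cod_obj[of p1'] dom_obj[of p1] dom_obj[of p1'] by simp_all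
  have "b \<cdot> (p1 \<cdot> r) = p1'" using b(5) by (simp add: p1'(4) reassoc[OF b(5)])
  then have P': "is_product C E' P R' p1' p2'"
    by (intro product_iso_invariant[OF P(1) b(1) _ _ iso_idt[of P] _ _ r(1)]) (simp_all add: p2')
  show ?thesis unfolding is_exponential_def
  proof (intro conjI allI impI)
    fix X' S q1 q2 f assume a: "is_product C X' P S q1 q2 \<and> f \<in> hom C S Q"
    then have S: "is_product C X' P S q1 q2" and f: "f \<in> Arr C" "Dom C f = S" "Cod C f = Q" by auto
    note [simp] = productD[OF S] f
    obtain u v where u: "u \<in> Arr C" "Dom C u = X'" "Cod C u = E" "v \<in> Arr C" "Dom C v = S" "Cod C v = R"
      "p1 \<cdot> v = u \<cdot> q1" "p2 \<cdot> v = q2" "e \<cdot> v = f"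
      using exponential_ex[OF X S f] by auto
    note [simp] = u(1-6)
    have "p1' \<cdot> (s \<cdot> v) = b \<cdot> (u \<cdot> q1)"
      using \<open>b \<cdot> (p1 \<cdot> r) = p1'\<close>[symmetric] by (simp add: reassoc[OF s(5)] u(7))
    then have uv: "b \<cdot> u \<in> hom C X' E' \<and> (\<exists>v \<in> hom C S R'. p1' \<cdot> v = (b \<cdot> u) \<cdot> q1 \<and> p2' \<cdot> v = q2 \<and> e' \<cdot> v = f)"
      by (intro conjI bexI[of _ "s \<cdot> v"]) (simp_all add: p2' e' reassoc[OF s(5)] u(8,9))
    show "\<exists>!u. u \<in> hom C X' E' \<and> (\<exists>v \<in> hom C S R'. p1' \<cdot> v = u \<cdot> q1 \<and> p2' \<cdot> v = q2 \<and> e' \<cdot> v = f)"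
    proof (rule ex1I[where a = "b \<cdot> u"], rule uv)
      fix u' assume "u' \<in> hom C X' E' \<and> (\<exists>v \<in> hom C S R'. p1' \<cdot> v = u' \<cdot> q1 \<and> p2' \<cdot> v = q2 \<and> e' \<cdot> v = f)"
      then obtain v' where u': "u' \<in> Arr C" "Dom C u' = X'" "Cod C u' = E'" "v' \<in> Arr C" "Dom C v' = S" "Cod C v' = R'"
        "p1' \<cdot> v' = u' \<cdot> q1" "p2' \<cdot> v' = q2" "e' \<cdot> v' = f" by auto
      note [simp] = u'(1-6)
      have "a \<cdot> u' = u"
        by (rule exponential_eq[OF X S, of _ "r \<cdot> v'" f _ v])
          (use u u' in \<open>simp_all add: reassoc[OF p1'(4)] p2' e'\<close>)
      then have "b \<cdot> u = b \<cdot> (a \<cdot> u')" by simp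
      then show "u' = b \<cdot> u" by (simp add: reassoc[OF b(5)])
    qed
  qed (use P' in \<open>simp_all add: e'\<close>)
qed

section \<open>Pullbacks\<close>

lemma pullbackD:
  assumes "is_pullback C g h k f"
  shows "g \<in> Arr C" "k \<in> Arr C" "h \<in> Arr C" "f \<in> Arr C" "Cod C k = Cod C g" "Cod C h = Dom C g"
    "Dom C f = Dom C h" "Cod C f = Dom C k" "g \<cdot> h = k \<cdot> f"
  using assms by (auto simp: is_pullback_def)

lemma pullback_ex:
  assumes "is_pullback C g h k f" "a \<in> Arr C" "b \<in> Arr C" "Dom C a = Dom C b" "Cod C a = Dom C g"
    "Cod C b = Dom C k" "g \<cdot> a = k \<cdot> b"
  shows "\<exists>u. u \<in> Arr C \<and>
    Dom C u = Dom C b \<and>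
    Cod C u = Dom C h \<and>
    h \<cdot> u = a \<and>
    f \<cdot> u = b"
proof -
  have "\<exists>!u. u \<in> hom C (Dom C b) (Dom C h) \<and> h \<cdot> u = a \<and> f \<cdot> u = b"
    using assms unfolding is_pullback_def by auto
  then show ?thesis by auto
qed

lemma pullback_eq:
  assumes P: "is_pullback C g h k f"
    and uv: "u \<in> Arr C" "v \<in> Arr C" "Dom C u = Dom C v" "Cod C u = Dom C h" "Cod C v = Dom C h"
      "h \<cdot> u = h \<cdot> v" "f \<cdot> u = f \<cdot> v"
  shows "u = v"
proof -
  note p = pullbackD[OF P]
  have "g \<cdot> (h \<cdot> v) = k \<cdot> (f \<cdot> v)" using uv p by (simp add: reassoc[OF p(9)])
  then have "\<exists>!w. w \<in> hom C (Dom C v) (Dom C h) \<and> h \<cdot> w = h \<cdot> v \<and> f \<cdot> w = f \<cdot> v"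
    using P uv p unfolding is_pullback_def by auto
  then show ?thesis using uv by auto
qed

lemma pullbackI:
  assumes "g \<in> Arr C" "k \<in> Arr C" "h \<in> Arr C" "f \<in> Arr C" "Cod C k = Cod C g" "Cod C h = Dom C g"
    "Dom C f = Dom C h" "Cod C f = Dom C k" "g \<cdot> h = k \<cdot> f"
    and "\<And>a b. a \<in> Arr C \<Longrightarrow> b \<in> Arr C \<Longrightarrow> Dom C a = Dom C b \<Longrightarrow> Cod C a = Dom C g \<Longrightarrow>
      Cod C b = Dom C k \<Longrightarrow> g \<cdot> a = k \<cdot> b \<Longrightarrow>
      \<exists>u. u \<in> Arr C \<and> Dom C u = Dom C b \<and> Cod C u = Dom C h \<and> h \<cdot> u = a \<and> f \<cdot> u = b"
    and "\<And>u v. u \<in> Arr C \<Longrightarrow> v \<in> Arr C \<Longrightarrow> Dom C u = Dom C v \<Longrightarrow> Cod C u = Dom C h \<Longrightarrow>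
      Cod C v = Dom C h \<Longrightarrow> h \<cdot> u = h \<cdot> v \<Longrightarrow> f \<cdot> u = f \<cdot> v \<Longrightarrow> u = v"
  shows "is_pullback C g h k f"
  unfolding is_pullback_def
proof (intro conjI allI ballI impI)
  fix X a b assume "a \<in> hom C X (Dom C g)" "b \<in> hom C X (Dom C k)" "g \<cdot> a = k \<cdot> b"
  then obtain u where "u \<in> Arr C \<and> Dom C u = Dom C b \<and> Cod C u = Dom C h \<and> h \<cdot> u = a \<and> f \<cdot> u = b"
    using assms(10)[of a b] by auto
  then show "\<exists>!u. u \<in> hom C X (Dom C h) \<and> h \<cdot> u = a \<and> f \<cdot> u = b"
    using assms(11) \<open>b \<in> hom C X (Dom C k)\<close> by (intro ex1I[of _ u]) auto
qed (use assms in auto)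

lemma pullback_sym: "is_pullback C g h k f \<Longrightarrow> is_pullback C k f g h"
proof -
  assume P: "is_pullback C g h k f"
  note [simp] = pullbackD[OF P]
  show ?thesis
  proof (rule pullbackI)
    fix a b assume "a \<in> Arr C" "b \<in> Arr C" "Dom C a = Dom C b" "Cod C a = Dom C k" "Cod C b = Dom C g"
      "k \<cdot> a = g \<cdot> b"
    then show "\<exists>u. u \<in> Arr C \<and> Dom C u = Dom C b \<and> Cod C u = Dom C f \<and> f \<cdot> u = a \<and> h \<cdot> u = b"
      using pullback_ex[OF P, of b a] by auto
  next
    fix u v assume "u \<in> Arr C" "v \<in> Arr C" "Dom C u = Dom C v" "Cod C u = Dom C f" "Cod C v = Dom C f"
      "f \<cdot> u = f \<cdot> v" "h \<cdot> u = h \<cdot> v"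
    then show "u = v" by - (rule pullback_eq[OF P], simp_all)
  qed simp_all
qed

text \<open>Mediating arrows are built one square at a time. In the convention used here
  \<open>f\<close> is the pullback of \<open>g\<close> along \<open>k\<close>, so the pasting runs
  in the direction of \<open>k\<close>; the other direction is had by applying
  \<open>pullback_sym\<close> to both squares and to the result.\<close>

lemma pullback_paste:
  assumes P: "is_pullback C g h k f" and Q: "is_pullback C f h' k' f'"
  shows "is_pullback C g (h \<cdot> h') (k \<cdot> k') f'"
proof -
  note [simp] = pullbackD(1-8)[OF P] pullbackD(1-8)[OF Q] and e = pullbackD(9)[OF P] pullbackD(9)[OF Q]
  show ?thesis
  proof (rule pullbackI)
    fix a b assume ab: "a \<in> Arr C" "b \<in> Arr C" "Dom C a = Dom C b" "Cod C a = Dom C g"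
      "Cod C b = Dom C (k \<cdot> k')" "g \<cdot> a = (k \<cdot> k') \<cdot> b"
    obtain u where u: "u \<in> Arr C" "Dom C u = Dom C b" "Cod C u = Dom C h" "h \<cdot> u = a" "f \<cdot> u = k' \<cdot> b"
      using pullback_ex[OF P, of a "k' \<cdot> b"] ab by auto
    obtain v where v: "v \<in> Arr C" "Dom C v = Dom C b" "Cod C v = Dom C h'" "h' \<cdot> v = u" "f' \<cdot> v = b"
      using pullback_ex[OF Q, of u b] u ab by auto
    show "\<exists>u. u \<in> Arr C \<and> Dom C u = Dom C b \<and> Cod C u = Dom C (h \<cdot> h') \<and> (h \<cdot> h') \<cdot> u = a \<and> f' \<cdot> u = b"
      using u v by (intro exI[of _ v]) simp
  next
    fix u v assume uv: "u \<in> Arr C" "v \<in> Arr C" "Dom C u = Dom C v" "Cod C u = Dom C (h \<cdot> h')"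
      "Cod C v = Dom C (h \<cdot> h')" "(h \<cdot> h') \<cdot> u = (h \<cdot> h') \<cdot> v" "f' \<cdot> u = f' \<cdot> v"
    have "h' \<cdot> u = h' \<cdot> v" by (rule pullback_eq[OF P]) (use uv in \<open>simp_all add: reassoc[OF e(2)]\<close>)
    then show "u = v" using uv by - (rule pullback_eq[OF Q], auto)
  qed (simp_all add: reassoc[OF e(1)] e(2))
qed

lemma pullback_idt:
  assumes "f \<in> Arr C"
  shows "is_pullback C f (Idt C (Dom C f)) (Idt C (Cod C f)) f"
  by (rule pullbackI) (use assms in auto)

lemma pullback_comp_iso:
  assumes P: "is_pullback C g h k f" and r: "is_iso C r" "Cod C r = Dom C h"
  shows "is_pullback C g (h \<cdot> r) k (f \<cdot> r)"
proof -
  note [simp] = pullbackD(1-8)[OF P] iso_arr[OF r(1)] r(2) and e = pullbackD(9)[OF P]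
  obtain s where s: "s \<in> Arr C" "Dom C s = Dom C h" "Cod C s = Dom C r" "s \<cdot> r = Idt C (Dom C r)"
    "r \<cdot> s = Idt C (Dom C h)"
    using iso_inverse[OF r(1)] by (metis r)
  show ?thesis
  proof (rule pullbackI)
    fix a b assume ab: "a \<in> Arr C" "b \<in> Arr C" "Dom C a = Dom C b" "Cod C a = Dom C g" "Cod C b = Dom C k" "g \<cdot> a = k \<cdot> b"
    obtain u where u: "u \<in> Arr C" "Dom C u = Dom C b" "Cod C u = Dom C h" "h \<cdot> u = a" "f \<cdot> u = b"
      using pullback_ex[OF P ab] by auto
    show "\<exists>u. u \<in> Arr C \<and> Dom C u = Dom C b \<and> Cod C u = Dom C (h \<cdot> r) \<and> (h \<cdot> r) \<cdot> u = a \<and> (f \<cdot> r) \<cdot> u = b"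
      using u s by (intro exI[of _ "s \<cdot> u"]) (simp add: reassoc[OF s(5)])
  next
    fix u v assume uv: "u \<in> Arr C" "v \<in> Arr C" "Dom C u = Dom C v" "Cod C u = Dom C (h \<cdot> r)"
      "Cod C v = Dom C (h \<cdot> r)" "(h \<cdot> r) \<cdot> u = (h \<cdot> r) \<cdot> v" "(f \<cdot> r) \<cdot> u = (f \<cdot> r) \<cdot> v"
    have "r \<cdot> u = r \<cdot> v" by (rule pullback_eq[OF P]) (use uv in simp_all)
    then show "u = v" using uv by - (rule iso_cancel_left[OF r(1)], simp_all)
  qed (simp_all add: reassoc[OF e])
qed

lemma pullback_iso:
  assumes P: "is_pullback C g h k f" and P': "is_pullback C g h' k f'"
  shows "\<exists>r. is_iso C r \<and>
    Dom C r = Dom C h' \<and>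
    Cod C r = Dom C h \<and>
    h' = h \<cdot> r \<and>
    f' = f \<cdot> r"
proof -
  note [simp] = pullbackD(1-8)[OF P] pullbackD(1-8)[OF P'] and e = pullbackD(9)[OF P] pullbackD(9)[OF P']
  obtain u where u: "u \<in> Arr C" "Dom C u = Dom C h'" "Cod C u = Dom C h" "h \<cdot> u = h'" "f \<cdot> u = f'"
    using pullback_ex[OF P, of h' f'] e by auto
  obtain v where v: "v \<in> Arr C" "Dom C v = Dom C h" "Cod C v = Dom C h'" "h' \<cdot> v = h" "f' \<cdot> v = f"
    using pullback_ex[OF P', of h f] e by auto
  note [simp] = u v
  have "u \<cdot> v = Idt C (Dom C h)" by (rule pullback_eq[OF P]) (simp_all add: reassoc[OF u(4)] reassoc[OF u(5)])
  moreover have "v \<cdot> u = Idt C (Dom C h')"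
    by (rule pullback_eq[OF P']) (simp_all add: reassoc[OF v(4)] reassoc[OF v(5)])
  ultimately show ?thesis using isoI[of u v] by (intro exI[of _ u]) simp
qed

end

section \<open>Locally cartesian closed categories\<close>

lemma opp_simps [simp]:
  "Obj (opp C) = Obj C" "Arr (opp C) = Arr C" "Dom (opp C) = Cod C" "Cod (opp C) = Dom C"
  "Idt (opp C) = Idt C" "Cmp (opp C) g f = Cmp C f g"
  by (simp_all add: opp_def)

section \<open>Coproducts, initial objects, and products in slices\<close>

context category
begin

lemma coproductD:
  assumes "is_coproduct C P Q S i1 i2"
  shows "i1 \<in> Arr C" "Cod C i1 = S" "Dom C i1 = P" "i2 \<in> Arr C" "Cod C i2 = S" "Dom C i2 = Q"
  using category.productD[OF category_opp assms[unfolded is_coproduct_def]] by simp_all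

lemma coproduct_ex:
  assumes "is_coproduct C P Q S i1 i2" "f \<in> Arr C" "g \<in> Arr C" "Cod C f = Cod C g" "Dom C f = P" "Dom C g = Q"
  shows "\<exists>u. u \<in> Arr C \<and> Cod C u = Cod C g \<and> Dom C u = S \<and> u \<cdot> i1 = f \<and> u \<cdot> i2 = g"
  using category.product_ex[OF category_opp assms(1)[unfolded is_coproduct_def], of f g] assms(2-) by simp

lemma coproduct_eq:
  assumes "is_coproduct C P Q S i1 i2"
    and "u \<in> Arr C" "v \<in> Arr C" "Cod C u = Cod C v" "Dom C u = S" "Dom C v = S"
      "u \<cdot> i1 = v \<cdot> i1" "u \<cdot> i2 = v \<cdot> i2"
  shows "u = v"
  using category.product_eq[OF category_opp assms(1)[unfolded is_coproduct_def], of u v] assms(2-) by simp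

lemma coproductI:
  assumes "i1 \<in> Arr C" "Cod C i1 = S" "Dom C i1 = P" "i2 \<in> Arr C" "Cod C i2 = S" "Dom C i2 = Q"
    and "\<And>f g. f \<in> Arr C \<Longrightarrow> g \<in> Arr C \<Longrightarrow> Cod C f = Cod C g \<Longrightarrow> Dom C f = P \<Longrightarrow> Dom C g = Q \<Longrightarrow>
      \<exists>u. u \<in> Arr C \<and> Cod C u = Cod C g \<and> Dom C u = S \<and> u \<cdot> i1 = f \<and> u \<cdot> i2 = g"
    and "\<And>u v. u \<in> Arr C \<Longrightarrow> v \<in> Arr C \<Longrightarrow> Cod C u = Cod C v \<Longrightarrow> Dom C u = S \<Longrightarrow> Dom C v = S \<Longrightarrow>
      u \<cdot> i1 = v \<cdot> i1 \<Longrightarrow> u \<cdot> i2 = v \<cdot> i2 \<Longrightarrow> u = v"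
  shows "is_coproduct C P Q S i1 i2"
  unfolding is_coproduct_def
  by (rule category.productI[OF category_opp]) (simp_all add: assms)

lemma initial_map: "is_initial C Z \<Longrightarrow> X \<in> Obj C \<Longrightarrow> \<exists>u. u \<in> Arr C \<and> Cod C u = X \<and> Dom C u = Z"
  using category.terminal_map[OF category_opp, of Z X] by (simp add: is_initial_def)

lemma initial_eq: "is_initial C Z \<Longrightarrow> f \<in> Arr C \<Longrightarrow> g \<in> Arr C \<Longrightarrow> Dom C f = Z \<Longrightarrow> Dom C g = Z \<Longrightarrow>
    Cod C f = Cod C g \<Longrightarrow> f = g"
  using category.terminal_eq[OF category_opp, of Z f g] by (simp add: is_initial_def)

lemma terminalI:
  assumes "T \<in> Obj C" "\<And>X. X \<in> Obj C \<Longrightarrow> \<exists>u. u \<in> Arr C \<and> Dom C u = X \<and> Cod C u = T"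
    "\<And>f g. f \<in> Arr C \<Longrightarrow> g \<in> Arr C \<Longrightarrow> Cod C f = T \<Longrightarrow> Cod C g = T \<Longrightarrow> Dom C f = Dom C g \<Longrightarrow> f = g"
  shows "is_terminal C T"
  unfolding is_terminal_def
proof (intro conjI ballI)
  fix X assume "X \<in> Obj C"
  then obtain u where "u \<in> Arr C \<and> Dom C u = X \<and> Cod C u = T" using assms(2) by blast
  then show "\<exists>!u. u \<in> hom C X T" using assms(3) by (intro ex1I[of _ u]) auto
qed (rule assms)

lemma initialI:
  assumes "T \<in> Obj C" "\<And>X. X \<in> Obj C \<Longrightarrow> \<exists>u. u \<in> Arr C \<and> Cod C u = X \<and> Dom C u = T"
    "\<And>f g. f \<in> Arr C \<Longrightarrow> g \<in> Arr C \<Longrightarrow> Dom C f = T \<Longrightarrow> Dom C g = T \<Longrightarrow> Cod C f = Cod C g \<Longrightarrow> f = g"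
  shows "is_initial C T"
  unfolding is_initial_def
  by (rule category.terminalI[OF category_opp]) (simp_all add: assms)

lemma slice_hom:
  "h \<in> hom (slice C B) x y \<longleftrightarrow> (\<exists>t. h = (x, t, y) \<and> x \<in> Arr C \<and> Cod C x = B \<and> y \<in> Arr C \<and> Cod C y = B \<and>
    t \<in> Arr C \<and> Dom C t = Dom C x \<and> Cod C t = Dom C y \<and> y \<cdot> t = x)"
  by (cases h) (auto simp: slice_def)

lemma slice_simps:
  "x \<in> Obj (slice C B) \<longleftrightarrow> x \<in> Arr C \<and> Cod C x = B"
  "(y, s, z) \<cdot>\<^bsub>slice C B\<^esub> (x, t, y') = (x, s \<cdot> t, z)"
  by (auto simp: slice_def)

text \<open>Local cartesian closedness is stated through slices; this reads pullbacks of the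
  category itself off the products found there.\<close>

lemma slice_product_pullback:
  assumes P: "is_product (slice C B) f g r q1 q2"
  shows "\<exists>h k. q1 = (r, h, f) \<and> q2 = (r, k, g) \<and> is_pullback C f h g k \<and> r = f \<cdot> h"
proof -
  have "q1 \<in> hom (slice C B) r f" "q2 \<in> hom (slice C B) r g"
    using P unfolding is_product_def by blast+
  then obtain h k where q: "q1 = (r, h, f)" "q2 = (r, k, g)"
    and t [simp]: "r \<in> Arr C" "Cod C r = B" "f \<in> Arr C" "Cod C f = B" "g \<in> Arr C" "Cod C g = B"
      "h \<in> Arr C" "Dom C h = Dom C r" "Cod C h = Dom C f"
      "k \<in> Arr C" "Dom C k = Dom C r" "Cod C k = Dom C g"
    and e: "f \<cdot> h = r" "g \<cdot> k = r"
    unfolding slice_hom by - (elim exE conjE, rule that, assumption+)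
  have ex1: "\<exists>!u. u \<in> hom (slice C B) x r \<and> q1 \<cdot>\<^bsub>slice C B\<^esub> u = a \<and> q2 \<cdot>\<^bsub>slice C B\<^esub> u = b"
    if "a \<in> hom (slice C B) x f" "b \<in> hom (slice C B) x g" for x a b
    using P that unfolding is_product_def by blast
  have "is_pullback C f h g k"
  proof (rule pullbackI)
    fix a b assume ab: "a \<in> Arr C" "b \<in> Arr C" "Dom C a = Dom C b" "Cod C a = Dom C f" "Cod C b = Dom C g" "f \<cdot> a = g \<cdot> b"
    have "(f \<cdot> a, a, f) \<in> hom (slice C B) (f \<cdot> a) f" "(f \<cdot> a, b, g) \<in> hom (slice C B) (f \<cdot> a) g"
      unfolding slice_hom using ab by simp_all
    from ex1_implies_ex[OF ex1[OF this]]
    obtain u' where u': "u' \<in> hom (slice C B) (f \<cdot> a) r" "q1 \<cdot>\<^bsub>slice C B\<^esub> u' = (f \<cdot> a, a, f)"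
      "q2 \<cdot>\<^bsub>slice C B\<^esub> u' = (f \<cdot> a, b, g)" by blast
    from u'(1) obtain u where "u' = (f \<cdot> a, u, r)" "u \<in> Arr C" "Dom C u = Dom C (f \<cdot> a)" "Cod C u = Dom C r"
      unfolding slice_hom by blast
    then show "\<exists>u. u \<in> Arr C \<and> Dom C u = Dom C b \<and> Cod C u = Dom C h \<and> h \<cdot> u = a \<and> k \<cdot> u = b"
      using u'(2,3) ab by (intro exI[of _ u]) (simp add: q slice_simps)
  next
    fix u v assume uv: "u \<in> Arr C" "v \<in> Arr C" "Dom C u = Dom C v" "Cod C u = Dom C h" "Cod C v = Dom C h"
      "h \<cdot> u = h \<cdot> v" "k \<cdot> u = k \<cdot> v"
    let ?x = "r \<cdot> v"
    \<comment> \<open>Only with \<open>r \<cdot> u = r \<cdot> v\<close> do \<open>u\<close> and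
      \<open>v\<close> become slice arrows with the same domain, to which uniqueness
      applies.\<close>
    have "f \<cdot> (h \<cdot> u) = f \<cdot> (h \<cdot> v)" using uv by simp
    then have r: "r \<cdot> u = r \<cdot> v" using uv(1-5) by (simp only: reassoc[OF e(1)] t)
    have "(?x, h \<cdot> v, f) \<in> hom (slice C B) ?x f" "(?x, k \<cdot> v, g) \<in> hom (slice C B) ?x g"
      unfolding slice_hom using uv by (simp_all add: reassoc[OF e(1)] reassoc[OF e(2)])
    note E = ex1[OF this]
    have "(?x, u, r) \<in> hom (slice C B) ?x r" "(?x, v, r) \<in> hom (slice C B) ?x r"
      unfolding slice_hom using uv r by simp_all
    moreover have "q1 \<cdot>\<^bsub>slice C B\<^esub> (?x, u, r) = (?x, h \<cdot> v, f)" "q2 \<cdot>\<^bsub>slice C B\<^esub> (?x, u, r) = (?x, k \<cdot> v, g)"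
      "q1 \<cdot>\<^bsub>slice C B\<^esub> (?x, v, r) = (?x, h \<cdot> v, f)" "q2 \<cdot>\<^bsub>slice C B\<^esub> (?x, v, r) = (?x, k \<cdot> v, g)"
      using uv by (simp_all add: q slice_simps)
    ultimately have "(?x, u, r) = (?x, v, r)" using E by blast
    then show "u = v" by simp
  qed (simp_all add: e)
  then show ?thesis using q e by simp
qed

lemma pullback_slice_product:
  assumes P: "is_pullback C f h g k" and B: "Cod C f = B"
  shows "is_product (slice C B) f g (f \<cdot> h) (f \<cdot> h, h, f) (f \<cdot> h, k, g)"
  unfolding is_product_def
proof (intro conjI allI ballI)
  note [simp] = pullbackD(1-8)[OF P] B and e = pullbackD(9)[OF P]
  show "(f \<cdot> h, h, f) \<in> hom (slice C B) (f \<cdot> h) f" "(f \<cdot> h, k, g) \<in> hom (slice C B) (f \<cdot> h) g"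
    unfolding slice_hom by (simp_all add: e)
  fix x a' b' assume ab: "a' \<in> hom (slice C B) x f" "b' \<in> hom (slice C B) x g"
  then obtain a b where ab: "a' = (x, a, f)" "b' = (x, b, g)" and [simp]: "x \<in> Arr C" "Cod C x = B"
    "a \<in> Arr C" "Dom C a = Dom C x" "Cod C a = Dom C f" "b \<in> Arr C" "Dom C b = Dom C x" "Cod C b = Dom C g"
    and xe: "f \<cdot> a = x" "g \<cdot> b = x"
    unfolding slice_hom by blast
  obtain u where u: "u \<in> Arr C" "Dom C u = Dom C x" "Cod C u = Dom C h" "h \<cdot> u = a" "k \<cdot> u = b"
    using pullback_ex[OF P, of a b] xe by auto
  show "\<exists>!u. u \<in> hom (slice C B) x (f \<cdot> h) \<and> (f \<cdot> h, h, f) \<cdot>\<^bsub>slice C B\<^esub> u = a' \<and> (f \<cdot> h, k, g) \<cdot>\<^bsub>slice C B\<^esub> u = b'"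
  proof (rule ex1I[where a = "(x, u, f \<cdot> h)"])
    show "(x, u, f \<cdot> h) \<in> hom (slice C B) x (f \<cdot> h) \<and> (f \<cdot> h, h, f) \<cdot>\<^bsub>slice C B\<^esub> (x, u, f \<cdot> h) = a' \<and>
      (f \<cdot> h, k, g) \<cdot>\<^bsub>slice C B\<^esub> (x, u, f \<cdot> h) = b'"
      unfolding slice_hom using u xe by (simp add: slice_simps ab)
    fix v' assume v': "v' \<in> hom (slice C B) x (f \<cdot> h) \<and> (f \<cdot> h, h, f) \<cdot>\<^bsub>slice C B\<^esub> v' = a' \<and>
      (f \<cdot> h, k, g) \<cdot>\<^bsub>slice C B\<^esub> v' = b'"
    then obtain v where v: "v' = (x, v, f \<cdot> h)" "v \<in> Arr C" "Dom C v = Dom C x" "Cod C v = Dom C (f \<cdot> h)"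
      unfolding slice_hom by blast
    have "h \<cdot> v = a" "k \<cdot> v = b" using v' unfolding v(1) by (simp_all add: slice_simps ab)
    then have "v = u" using v u by - (rule pullback_eq[OF P], simp_all)
    then show "v' = (x, u, f \<cdot> h)" using v by simp
  qed
qed

end

text \<open>\<open>v\<close> is the base change of the arrow \<open>u : x \<rightarrow> r\<close> over the codomain of \<open>f\<close>; the squares
  \<open>(x, c', f, s')\<close> and \<open>(r, c, f, s)\<close> are meant to be pullbacks.\<close>

definition base_change :: "('o, 'a, 'm) cat_scheme \<Rightarrow> 'a \<Rightarrow> 'a \<Rightarrow> 'a \<Rightarrow> 'a \<Rightarrow> 'a \<Rightarrow> 'a \<Rightarrow> 'a \<Rightarrow> 'a \<Rightarrow> bool" where
  "base_change C r c s x c' s' u v \<longleftrightarrow> u \<in> Arr C \<and> Dom C u = Dom C x \<and> Cod C u = Dom C r \<and>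
    v \<in> Arr C \<and> Dom C v = Dom C c' \<and> Cod C v = Dom C c \<and>
    r \<cdot>\<^bsub>C\<^esub> u = x \<and> c \<cdot>\<^bsub>C\<^esub> v = u \<cdot>\<^bsub>C\<^esub> c' \<and> s \<cdot>\<^bsub>C\<^esub> v = s'"

text \<open>The exponential of \<open>q\<close> by \<open>f\<close> in the slice over the codomain
  of \<open>f\<close>, unfolded: \<open>r\<close> is the exponential object, the square
  \<open>(r, c, f, s)\<close> its product with \<open>f\<close>, and \<open>e\<close> the
  evaluation.\<close>

definition slice_exponential :: "('o, 'a, 'm) cat_scheme \<Rightarrow> 'a \<Rightarrow> 'a \<Rightarrow> 'a \<Rightarrow> 'a \<Rightarrow> 'a \<Rightarrow> 'a \<Rightarrow> bool" where
  "slice_exponential C f q r c s e \<longleftrightarrow> is_pullback C r c f s \<and>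
    q \<in> Arr C \<and> Cod C q = Cod C f \<and> e \<in> Arr C \<and> Dom C e = Dom C c \<and> Cod C e = Dom C q \<and> q \<cdot>\<^bsub>C\<^esub> e = r \<cdot>\<^bsub>C\<^esub> c \<and>
    (\<forall>x c' s' t. is_pullback C x c' f s' \<and> t \<in> Arr C \<and> Dom C t = Dom C c' \<and> Cod C t = Dom C q \<and>
      q \<cdot>\<^bsub>C\<^esub> t = x \<cdot>\<^bsub>C\<^esub> c' \<longrightarrow> (\<exists>u v. base_change C r c s x c' s' u v \<and> e \<cdot>\<^bsub>C\<^esub> v = t)) \<and>
    (\<forall>x c' s' u v u' v'. is_pullback C x c' f s' \<and> base_change C r c s x c' s' u v \<and>
      base_change C r c s x c' s' u' v' \<and> e \<cdot>\<^bsub>C\<^esub> v = e \<cdot>\<^bsub>C\<^esub> v' \<longrightarrow> u = u')"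

text \<open>The dependent product of \<open>p\<close> along \<open>f\<close>: \<open>r\<close> is
  the resulting object over the codomain of \<open>f\<close>, \<open>s\<close> its pullback along
  \<open>f\<close>, and \<open>e : s \<rightarrow> p\<close> the counit. The clauses say that arrows
  \<open>x \<rightarrow> r\<close> correspond to arrows from the pullback of \<open>x\<close> to
  \<open>p\<close>; uniqueness compares only \<open>u\<close>, which determines its base change
  \<open>v\<close>.\<close>

definition slice_Pi :: "('o, 'a, 'm) cat_scheme \<Rightarrow> 'a \<Rightarrow> 'a \<Rightarrow> 'a \<Rightarrow> 'a \<Rightarrow> 'a \<Rightarrow> 'a \<Rightarrow> bool" where
  "slice_Pi C f p r c s e \<longleftrightarrow> is_pullback C r c f s \<and>
    p \<in> Arr C \<and> Cod C p = Dom C f \<and> e \<in> Arr C \<and> Dom C e = Dom C c \<and> Cod C e = Dom C p \<and> p \<cdot>\<^bsub>C\<^esub> e = s \<and>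
    (\<forall>x c' s' t. is_pullback C x c' f s' \<and> t \<in> Arr C \<and> Dom C t = Dom C c' \<and> Cod C t = Dom C p \<and>
      p \<cdot>\<^bsub>C\<^esub> t = s' \<longrightarrow> (\<exists>u v. base_change C r c s x c' s' u v \<and> e \<cdot>\<^bsub>C\<^esub> v = t)) \<and>
    (\<forall>x c' s' u v u' v'. is_pullback C x c' f s' \<and> base_change C r c s x c' s' u v \<and>
      base_change C r c s x c' s' u' v' \<and> e \<cdot>\<^bsub>C\<^esub> v = e \<cdot>\<^bsub>C\<^esub> v' \<longrightarrow> u = u')"

section \<open>Dependent products and the universality of coproducts\<close>

locale lcc_category = category C for C :: "('o, 'a, 'm) cat_scheme" (structure) +
  assumes lcc: "locally_cartesian_closed C"
begin

lemma base_changeD: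
  assumes "base_change C r c s x c' s' u v"
  shows "u \<in> Arr C" "Dom C u = Dom C x" "Cod C u = Dom C r" "v \<in> Arr C" "Dom C v = Dom C c'" "Cod C v = Dom C c"
    "r \<cdot> u = x" "c \<cdot> v = u \<cdot> c'" "s \<cdot> v = s'"
  using assms by (simp_all add: base_change_def)

lemma base_change_ex:
  assumes P: "is_pullback C r c f s" and Q: "is_pullback C x c' f s'"
    and u: "u \<in> Arr C" "Cod C u = Dom C r" "r \<cdot> u = x"
  shows "\<exists>v. base_change C r c s x c' s' u v"
proof -
  note [simp] = pullbackD(1-8)[OF P] u(1,2) and e = pullbackD(9)[OF P]
  have [simp]: "Dom C x = Dom C u" using u(3) by auto
  note [simp] = pullbackD(3-8)[OF Q] and e' = pullbackD(9)[OF Q]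
  obtain v where "v \<in> Arr C" "Dom C v = Dom C s'" "Cod C v = Dom C c" "c \<cdot> v = u \<cdot> c'" "s \<cdot> v = s'"
    using pullback_ex[OF P, of "u \<cdot> c'" s'] e' by (auto simp: reassoc[OF u(3)])
  then show ?thesis using u by (auto simp: base_change_def)
qed

lemma pullback_exists:
  assumes "f \<in> Arr C" "g \<in> Arr C" "Cod C f = Cod C g"
  shows "\<exists>h k. is_pullback C f h g k"
proof -
  let ?B = "Cod C f"
  have "cartesian_closed (slice C ?B)" using lcc assms unfolding locally_cartesian_closed_def by simp
  then have "\<exists>r p1 p2. is_product (slice C ?B) f g r p1 p2"
    using assms by (simp add: cartesian_closed_def has_finite_products_def slice_simps)
  then show ?thesis using slice_product_pullback by blast
qed

lemma slice_exponential_exists: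
  assumes f: "f \<in> Arr C" and q: "q \<in> Arr C" "Cod C q = Cod C f"
  shows "\<exists>r c s e. slice_exponential C f q r c s e"
proof -
  let ?B = "Cod C f" and ?S = "slice C (Cod C f)"
  have "cartesian_closed ?S" using lcc f unfolding locally_cartesian_closed_def by simp
  then have "\<exists>r z p1 p2 e. is_exponential ?S f q r z p1 p2 e"
    using f q by (simp add: cartesian_closed_def has_exponentials_def slice_simps)
  then obtain r z p1 p2 e' where E: "is_exponential ?S f q r z p1 p2 e'" by blast
  have "is_product ?S r f z p1 p2" "e' \<in> hom ?S z q" using E unfolding is_exponential_def by blast+
  then obtain c s e where p: "p1 = (z, c, r)" "p2 = (z, s, f)" "e' = (z, e, q)" and P: "is_pullback C r c f s"
    and z: "z = r \<cdot> c" and e: "e \<in> Arr C" "Dom C e = Dom C z" "Cod C e = Dom C q" "q \<cdot> e = z"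
    using slice_product_pullback unfolding slice_hom by blast
  note [simp] = pullbackD(1-8)[OF P] f q e(1,3)
  have [simp]: "Dom C e = Dom C c" using e z by simp
  \<comment> \<open>A pullback square \<open>(x, c', f, s')\<close> is a product of \<open>x\<close>
    and \<open>f\<close> in the slice, so arrows out of its vertex have transposes.\<close>
  have ex1: "\<exists>!u. u \<in> hom ?S x r \<and> (\<exists>v \<in> hom ?S (x \<cdot> c') z. p1 \<cdot>\<^bsub>?S\<^esub> v = u \<cdot>\<^bsub>?S\<^esub> (x \<cdot> c', c', x) \<and>
      p2 \<cdot>\<^bsub>?S\<^esub> v = (x \<cdot> c', s', f) \<and> e' \<cdot>\<^bsub>?S\<^esub> v = (x \<cdot> c', t, q))"
    if Q: "is_pullback C x c' f s'" and t: "t \<in> Arr C" "Dom C t = Dom C c'" "Cod C t = Dom C q" "q \<cdot> t = x \<cdot> c'"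
    for x c' s' t
  proof -
    note [simp] = pullbackD(3-8)[OF Q] pullbackD(5)[OF Q, symmetric]
    have [simp]: "x \<in> Arr C" "Cod C x = Cod C f" using pullbackD[OF Q] by simp_all
    have "is_product ?S x f (x \<cdot> c') (x \<cdot> c', c', x) (x \<cdot> c', s', f)"
      using pullback_slice_product[OF Q] by simp
    moreover have "(x \<cdot> c', t, q) \<in> hom ?S (x \<cdot> c') q"
      unfolding slice_hom using t by simp
    ultimately show ?thesis using E unfolding is_exponential_def by blast
  qed
  have "slice_exponential C f q r c s e" unfolding slice_exponential_def
  proof (intro conjI allI impI)
    fix x c' s' t assume a: "is_pullback C x c' f s' \<and> t \<in> Arr C \<and> Dom C t = Dom C c' \<and> Cod C t = Dom C q \<and>
      q \<cdot> t = x \<cdot> c'"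
    then have Q: "is_pullback C x c' f s'" by blast
    have [simp]: "x \<in> Arr C" "Cod C x = Cod C f" "c' \<in> Arr C" "Cod C c' = Dom C x" using pullbackD[OF Q] by simp_all
    from a ex1[OF Q, of t] obtain u' v' where u': "u' \<in> hom ?S x r" and v': "v' \<in> hom ?S (x \<cdot> c') z" and
      uv: "p1 \<cdot>\<^bsub>?S\<^esub> v' = u' \<cdot>\<^bsub>?S\<^esub> (x \<cdot> c', c', x)" "p2 \<cdot>\<^bsub>?S\<^esub> v' = (x \<cdot> c', s', f)" "e' \<cdot>\<^bsub>?S\<^esub> v' = (x \<cdot> c', t, q)"
      by (metis (no_types, lifting))
    from u' obtain u where u: "u' = (x, u, r)" "u \<in> Arr C" "Dom C u = Dom C x" "Cod C u = Dom C r" "r \<cdot> u = x"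
      unfolding slice_hom by blast
    from v' obtain v where v: "v' = (x \<cdot> c', v, z)" "v \<in> Arr C" "Dom C v = Dom C (x \<cdot> c')" "Cod C v = Dom C z"
      unfolding slice_hom by blast
    show "\<exists>u v. base_change C r c s x c' s' u v \<and> e \<cdot> v = t"
      using u v uv by (intro exI[of _ u] exI[of _ v]) (simp add: base_change_def p slice_simps z)
  next
    fix x c' s' u v u' v' assume a: "is_pullback C x c' f s' \<and> base_change C r c s x c' s' u v \<and>
      base_change C r c s x c' s' u' v' \<and> e \<cdot> v = e \<cdot> v'"
    then have Q: "is_pullback C x c' f s'" and e: "e \<cdot> v = e \<cdot> v'" by auto
    note b = base_changeD[of r c s x c' s' u v] and b' = base_changeD[of r c s x c' s' u' v']
    note [simp] = b(1-6) b'(1-6)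
    have [simp]: "base_change C r c s x c' s' u v" "base_change C r c s x c' s' u' v'" using a by auto
    have [simp]: "x \<in> Arr C" "Cod C x = Cod C f" "c' \<in> Arr C" "Cod C c' = Dom C x" using pullbackD[OF Q] by simp_all
    have qe: "q \<cdot> (e \<cdot> w) = r \<cdot> (c \<cdot> w)" if "w \<in> Arr C" "Cod C w = Dom C c" for w
      using that by (simp add: reassoc[OF \<open>q \<cdot> e = z\<close>] z)
    have c: "r \<cdot> (c \<cdot> v) = x \<cdot> c'" "r \<cdot> (c \<cdot> v') = x \<cdot> c'"
      by (simp_all add: b(8) b'(8) reassoc[OF b(7)] reassoc[OF b'(7)])
    have ve: "e \<cdot> v \<in> Arr C" "Dom C (e \<cdot> v) = Dom C c'" "Cod C (e \<cdot> v) = Dom C q" "q \<cdot> (e \<cdot> v) = x \<cdot> c'"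
      using c by (simp_all add: qe)
    note E = ex1[OF Q ve]
    have "(x, u, r) \<in> hom ?S x r" "(x, u', r) \<in> hom ?S x r" "(x \<cdot> c', v, z) \<in> hom ?S (x \<cdot> c') z"
      "(x \<cdot> c', v', z) \<in> hom ?S (x \<cdot> c') z"
      unfolding slice_hom using c by (simp_all add: b(7) b'(7) z)
    moreover have "p1 \<cdot>\<^bsub>?S\<^esub> (x \<cdot> c', v, z) = (x, u, r) \<cdot>\<^bsub>?S\<^esub> (x \<cdot> c', c', x)"
      "p1 \<cdot>\<^bsub>?S\<^esub> (x \<cdot> c', v', z) = (x, u', r) \<cdot>\<^bsub>?S\<^esub> (x \<cdot> c', c', x)"
      "p2 \<cdot>\<^bsub>?S\<^esub> (x \<cdot> c', v, z) = (x \<cdot> c', s', f)" "p2 \<cdot>\<^bsub>?S\<^esub> (x \<cdot> c', v', z) = (x \<cdot> c', s', f)"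
      "e' \<cdot>\<^bsub>?S\<^esub> (x \<cdot> c', v, z) = (x \<cdot> c', e \<cdot> v, q)" "e' \<cdot>\<^bsub>?S\<^esub> (x \<cdot> c', v', z) = (x \<cdot> c', e \<cdot> v, q)"
      using e by (simp_all add: p slice_simps b(8,9) b'(8,9))
    ultimately have "(x, u, r) = (x, u', r)" using E by blast
    then show "u = u'" by simp
  qed (use P e z in simp_all)
  then show ?thesis by blast
qed

lemma slice_PiD:
  assumes "slice_Pi C f p r c s e"
  shows "is_pullback C r c f s" "p \<in> Arr C" "Cod C p = Dom C f" "e \<in> Arr C" "Dom C e = Dom C c" "Cod C e = Dom C p" "p \<cdot> e = s"
  using assms unfolding slice_Pi_def by blast+

lemma slice_Pi_ex:
  assumes "slice_Pi C f p r c s e" "is_pullback C x c' f s'" "t \<in> Arr C" "Dom C t = Dom C c'" "Cod C t = Dom C p" "p \<cdot> t = s'"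
  shows "\<exists>u v. base_change C r c s x c' s' u v \<and> e \<cdot> v = t"
  using assms unfolding slice_Pi_def by blast

lemma slice_Pi_eq:
  assumes "slice_Pi C f p r c s e" "is_pullback C x c' f s'" "base_change C r c s x c' s' u v" "base_change C r c s x c' s' u' v'" "e \<cdot> v = e \<cdot> v'"
  shows "u = u'"
  using assms unfolding slice_Pi_def by blast

text \<open>The dependent product of \<open>p\<close> along \<open>f\<close> is the part of the exponential of \<open>f \<cdot> p\<close> by \<open>f\<close> over
  which composition with \<open>p\<close> is the identity of \<open>f\<close>.\<close>

lemma slice_Pi_exists:
  assumes f: "f \<in> Arr C" and p: "p \<in> Arr C" "Cod C p = Dom C f"
  shows "\<exists>r c s e. slice_Pi C f p r c s e"
proof -
  let ?A = "Dom C f" and ?B = "Cod C f"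
  note [simp] = f p
  obtain e1 c1 s1 v1 where E1: "slice_exponential C f (f \<cdot> p) e1 c1 s1 v1"
    using slice_exponential_exists[of f "f \<cdot> p"] by auto
  obtain e2 c2 s2 v2 where E2: "slice_exponential C f f e2 c2 s2 v2"
    using slice_exponential_exists[of f f] by auto
  have P1: "is_pullback C e1 c1 f s1" and V1: "v1 \<in> Arr C" "Dom C v1 = Dom C c1" "Cod C v1 = Dom C (f \<cdot> p)" "(f \<cdot> p) \<cdot> v1 = e1 \<cdot> c1"
    using E1 unfolding slice_exponential_def by blast+
  have P2: "is_pullback C e2 c2 f s2" and V2: "v2 \<in> Arr C" "Dom C v2 = Dom C c2" "Cod C v2 = Dom C f"
    using E2 unfolding slice_exponential_def by blast+
  have ex1: "\<exists>u v. base_change C e1 c1 s1 x c' s' u v \<and> v1 \<cdot> v = t"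
    if "is_pullback C x c' f s'" "t \<in> Arr C" "Dom C t = Dom C c'" "Cod C t = Dom C (f \<cdot> p)" "(f \<cdot> p) \<cdot> t = x \<cdot> c'" for x c' s' t
    using E1 that unfolding slice_exponential_def by blast
  have ex2: "\<exists>u v. base_change C e2 c2 s2 x c' s' u v \<and> v2 \<cdot> v = t"
    if "is_pullback C x c' f s'" "t \<in> Arr C" "Dom C t = Dom C c'" "Cod C t = Dom C f" "f \<cdot> t = x \<cdot> c'" for x c' s' t
    using E2 that unfolding slice_exponential_def by blast
  have eq1: "u = u'" if "is_pullback C x c' f s'" "base_change C e1 c1 s1 x c' s' u v"
    "base_change C e1 c1 s1 x c' s' u' v'" "v1 \<cdot> v = v1 \<cdot> v'" for x c' s' u v u' v'
    using E1 that unfolding slice_exponential_def by blast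
  have eq2: "u = u'" if "is_pullback C x c' f s'" "base_change C e2 c2 s2 x c' s' u v"
    "base_change C e2 c2 s2 x c' s' u' v'" "v2 \<cdot> v = v2 \<cdot> v'" for x c' s' u v u' v'
    using E2 that unfolding slice_exponential_def by blast
  note [simp] = pullbackD(1-4,6-8)[OF P1] pullbackD(1-4,6-8)[OF P2] pullbackD(5)[OF P1, symmetric]
    pullbackD(5)[OF P2, symmetric] V1(1,2) V2
  have [simp]: "Cod C v1 = Dom C p" using V1 by simp
  have v1e: "f \<cdot> (p \<cdot> v1) = e1 \<cdot> c1" using V1(4) by simp
  \<comment> \<open>\<open>i\<close> names the identity of \<open>f\<close> as a section of the
    exponential of \<open>f\<close> by itself.\<close>
  obtain i vi where "base_change C e2 c2 s2 (Idt C ?B) f (Idt C ?A) i vi" and i4: "v2 \<cdot> vi = Idt C ?A"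
    using ex2[OF pullback_sym[OF pullback_idt[OF f]], of "Idt C ?A"] by auto
  then have [simp]: "i \<in> Arr C" "Dom C i = ?B" "Cod C i = Dom C e2" "vi \<in> Arr C" "Dom C vi = ?A" "Cod C vi = Dom C c2"
    and i: "e2 \<cdot> i = Idt C ?B" "c2 \<cdot> vi = i \<cdot> f" "s2 \<cdot> vi = Idt C ?A" by (simp_all add: base_change_def)
  \<comment> \<open>\<open>m\<close> is composition with \<open>p\<close>, from the exponential of
    \<open>f \<cdot> p\<close> to that of \<open>f\<close>.\<close>
  obtain m vm where "base_change C e2 c2 s2 e1 c1 s1 m vm" and m4: "v2 \<cdot> vm = p \<cdot> v1"
    using ex2[OF P1, of "p \<cdot> v1"] v1e by auto
  then have [simp]: "m \<in> Arr C" "Dom C m = Dom C e1" "Cod C m = Dom C e2" "vm \<in> Arr C" "Dom C vm = Dom C c1" "Cod C vm = Dom C c2"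
    and m: "e2 \<cdot> m = e1" "c2 \<cdot> vm = m \<cdot> c1" "s2 \<cdot> vm = s1" by (simp_all add: base_change_def)
  \<comment> \<open>Pulling \<open>m\<close> back along \<open>i\<close> cuts out the part on which
    composing with \<open>p\<close> gives the identity.\<close>
  obtain n r where K: "is_pullback C m n i r" using pullback_exists[of m i] by auto
  note [simp] = pullbackD(3-8)[OF K] and k = pullbackD(9)[OF K]
  have r: "e1 \<cdot> n = r"
  proof -
    have "e2 \<cdot> (m \<cdot> n) = e2 \<cdot> (i \<cdot> r)" using k by simp
    then show ?thesis by (simp add: reassoc[OF m(1)] reassoc[OF i(1)])
  qed
  obtain c s where P: "is_pullback C r c f s" using pullback_exists[of r f] by auto
  note [simp] = pullbackD(3,4,6-8)[OF P] and cs = pullbackD(9)[OF P]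
  obtain z where z [simp]: "z \<in> Arr C" "Dom C z = Dom C c" "Cod C z = Dom C c1" and z1: "c1 \<cdot> z = n \<cdot> c" "s1 \<cdot> z = s"
    using pullback_ex[OF P1, of "n \<cdot> c" s] cs by (auto simp: reassoc[OF r])
  \<comment> \<open>After base change to \<open>r\<close>, the composition map and the name of the
    identity agree; evaluating both yields \<open>p \<cdot> (v1 \<cdot> z) = s\<close>, so
    \<open>v1 \<cdot> z\<close> is the counit.\<close>
  have vz: "vm \<cdot> z = vi \<cdot> s"
    by (rule pullback_eq[OF P2]) (simp_all add: reassoc[OF m(2)] reassoc[OF m(3)] reassoc[OF i(2)] reassoc[OF i(3)] z1
      reassoc[OF k] cs)
  have pz: "p \<cdot> (v1 \<cdot> z) = s"
  proof -
    have "p \<cdot> (v1 \<cdot> z) = v2 \<cdot> (vm \<cdot> z)" by (simp add: reassoc[OF m4])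
    also have "\<dots> = s" unfolding vz by (simp add: reassoc[OF i4])
    finally show ?thesis .
  qed
  have "slice_Pi C f p r c s (v1 \<cdot> z)" unfolding slice_Pi_def
  proof (intro conjI allI impI)
    fix x c' s' t assume a: "is_pullback C x c' f s' \<and> t \<in> Arr C \<and> Dom C t = Dom C c' \<and> Cod C t = Dom C p \<and> p \<cdot> t = s'"
    then have Q: "is_pullback C x c' f s'" and t [simp]: "t \<in> Arr C" "Dom C t = Dom C c'" "Cod C t = Dom C p" and pt: "p \<cdot> t = s'"
      by auto
    have [simp]: "x \<in> Arr C" "Cod C x = Cod C f" using pullbackD[OF Q] by simp_all
    note [simp] = pullbackD(3,4,6,7,8)[OF Q] and xc = pullbackD(9)[OF Q]
    obtain u1 w1 where "base_change C e1 c1 s1 x c' s' u1 w1" and t1: "v1 \<cdot> w1 = t"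
      using ex1[OF Q, of t] pt xc by auto
    then have [simp]: "u1 \<in> Arr C" "Dom C u1 = Dom C x" "Cod C u1 = Dom C e1" "w1 \<in> Arr C" "Dom C w1 = Dom C c'" "Cod C w1 = Dom C c1"
      and u1: "e1 \<cdot> u1 = x" "c1 \<cdot> w1 = u1 \<cdot> c'" "s1 \<cdot> w1 = s'" by (simp_all add: base_change_def)
    \<comment> \<open>Both sides are transposes of \<open>s'\<close>, so the transpose
      \<open>u1\<close> of \<open>t\<close> factors through \<open>n\<close>.\<close>
    have "m \<cdot> u1 = i \<cdot> x"
    proof (rule eq2[OF Q])
      show "base_change C e2 c2 s2 x c' s' (m \<cdot> u1) (vm \<cdot> w1)"
        by (simp add: base_change_def reassoc[OF m(1)] reassoc[OF m(2)] reassoc[OF m(3)] u1)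
      show "base_change C e2 c2 s2 x c' s' (i \<cdot> x) (vi \<cdot> s')"
        by (simp add: base_change_def reassoc[OF i(1)] reassoc[OF i(2)] reassoc[OF i(3)] xc)
      show "v2 \<cdot> (vm \<cdot> w1) = v2 \<cdot> (vi \<cdot> s')"
        by (simp add: reassoc[OF m4] reassoc[OF i4] t1 pt)
    qed
    then obtain u where u [simp]: "u \<in> Arr C" "Dom C u = Dom C x" "Cod C u = Dom C n" and u2: "n \<cdot> u = u1" "r \<cdot> u = x"
      using pullback_ex[OF K, of u1 x] by auto
    obtain v where v [simp]: "v \<in> Arr C" "Dom C v = Dom C c'" "Cod C v = Dom C c" and v2: "c \<cdot> v = u \<cdot> c'" "s \<cdot> v = s'"
      using pullback_ex[OF P, of "u \<cdot> c'" s'] xc by (auto simp: reassoc[OF u2(2)])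
    have "z \<cdot> v = w1"
      by (rule pullback_eq[OF P1]) (simp_all add: reassoc[OF z1(1)] reassoc[OF z1(2)] v2 reassoc[OF u2(1)] u1)
    then show "\<exists>u v. base_change C r c s x c' s' u v \<and> (v1 \<cdot> z) \<cdot> v = t"
      by (intro exI[of _ u] exI[of _ v]) (simp add: base_change_def u2 v2 t1)
  next
    fix x c' s' u v u' v' assume a: "is_pullback C x c' f s' \<and> base_change C r c s x c' s' u v \<and>
      base_change C r c s x c' s' u' v' \<and> (v1 \<cdot> z) \<cdot> v = (v1 \<cdot> z) \<cdot> v'"
    then have Q: "is_pullback C x c' f s'" and b: "base_change C r c s x c' s' u v" "base_change C r c s x c' s' u' v'" by auto
    have [simp]: "x \<in> Arr C" "Cod C x = Cod C f" using pullbackD[OF Q] by simp_all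
    note [simp] = pullbackD(3,4,6,7,8)[OF Q] base_changeD(1-6)[OF b(1)] base_changeD(1-6)[OF b(2)]
    note bu = base_changeD(7-9)[OF b(1)] base_changeD(7-9)[OF b(2)]
    have "n \<cdot> u = n \<cdot> u'"
      by (rule eq1[OF Q, of _ "z \<cdot> v" _ "z \<cdot> v'"])
        (use a in \<open>simp_all add: base_change_def reassoc[OF r] reassoc[OF z1(1)] reassoc[OF z1(2)] bu\<close>)
    then show "u = u'" by - (rule pullback_eq[OF K], simp_all add: bu)
  qed (use P pz in simp_all)
  then show ?thesis by blast
qed

lemma product_exists:
  assumes "P \<in> Obj C" "Q \<in> Obj C"
  shows "\<exists>R p1 p2. is_product C P Q R p1 p2"
proof -
  obtain T where T: "is_terminal C T" using lcc unfolding locally_cartesian_closed_def by blast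
  obtain a b where [simp]: "a \<in> Arr C" "Dom C a = P" "Cod C a = T" "b \<in> Arr C" "Dom C b = Q" "Cod C b = T"
    using terminal_map[OF T assms(1)] terminal_map[OF T assms(2)] by auto
  obtain p1 p2 where P: "is_pullback C a p1 b p2" using pullback_exists[of a b] by auto
  note [simp] = pullbackD(3-8)[OF P]
  have "is_product C P Q (Dom C p1) p1 p2"
  proof (rule productI)
    fix f g assume fg: "f \<in> Arr C" "g \<in> Arr C" "Dom C f = Dom C g" "Cod C f = P" "Cod C g = Q"
    have "a \<cdot> f = b \<cdot> g" by (rule terminal_eq[OF T]) (simp_all add: fg)
    then show "\<exists>u. u \<in> Arr C \<and> Dom C u = Dom C g \<and> Cod C u = Dom C p1 \<and> p1 \<cdot> u = f \<and> p2 \<cdot> u = g"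
      using pullback_ex[OF P, of f g] fg by auto
  qed (use pullback_eq[OF P] in simp_all)
  then show ?thesis by blast
qed

text \<open>Arrows from the domain of \<open>f\<close> to an object \<open>Y\<close> are sections of
  the projection \<open>z1\<close> from its product with \<open>Y\<close>, hence sections of the
  dependent product \<open>r\<close> of \<open>z1\<close> along \<open>f\<close>. Those can be
  prescribed on the two summands of \<open>S\<close> separately. This spells out that pullback along
  \<open>f\<close>, being a left adjoint, preserves coproducts.\<close>

lemma coproduct_pullback:
  assumes S: "is_coproduct C P Q S i1 i2" and f: "Cod C f = S"
    and P1: "is_pullback C i1 h1 f j1" and P2: "is_pullback C i2 h2 f j2"
  shows "is_coproduct C (Dom C j1) (Dom C j2) (Dom C f) j1 j2"
proof -
  note [simp] = coproductD[OF S] pullbackD(2-8)[OF P1] pullbackD(2-8)[OF P2] f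
    and e = pullbackD(9)[OF P1] pullbackD(9)[OF P2]
  have [simp]: "S \<in> Obj C" using cod_obj[of i1] by simp
  have I: "is_pullback C (Idt C S) f f (Idt C (Dom C f))" using pullback_sym[OF pullback_idt[of f]] by simp
  show ?thesis
  proof (rule coproductI)
    fix a b assume ab [simp]: "a \<in> Arr C" "b \<in> Arr C" "Cod C a = Cod C b" "Dom C a = Dom C j1" "Dom C b = Dom C j2"
    obtain Z z1 z2 where Z: "is_product C (Dom C f) (Cod C b) Z z1 z2" using product_exists[of "Dom C f" "Cod C b"] by auto
    note [simp] = productD[OF Z]
    obtain r c s d where R: "slice_Pi C f z1 r c s d" using slice_Pi_exists[of f z1] by auto
    note p = slice_PiD(1)[OF R]
    note [simp] = pullbackD(1-4,6-8)[OF p] pullbackD(5)[OF p, symmetric] slice_PiD(4-6)[OF R]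
    obtain t1 where t1 [simp]: "t1 \<in> Arr C" "Dom C t1 = Dom C j1" "Cod C t1 = Z" and t1e: "z1 \<cdot> t1 = j1" "z2 \<cdot> t1 = a"
      using product_ex[OF Z, of j1 a] by auto
    obtain t2 where t2 [simp]: "t2 \<in> Arr C" "Dom C t2 = Dom C j2" "Cod C t2 = Z" and t2e: "z1 \<cdot> t2 = j2" "z2 \<cdot> t2 = b"
      using product_ex[OF Z, of j2 b] by auto
    obtain u1 v1 where u1: "base_change C r c s i1 h1 j1 u1 v1" "d \<cdot> v1 = t1"
      using slice_Pi_ex[OF R P1, of t1] t1e by auto
    obtain u2 v2 where u2: "base_change C r c s i2 h2 j2 u2 v2" "d \<cdot> v2 = t2"
      using slice_Pi_ex[OF R P2, of t2] t2e by auto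
    note [simp] = base_changeD(1-6)[OF u1(1)] base_changeD(1-6)[OF u2(1)]
    note u1e = base_changeD(7-9)[OF u1(1)] and u2e = base_changeD(7-9)[OF u2(1)]
    obtain u where [simp]: "u \<in> Arr C" "Dom C u = S" "Cod C u = Dom C r" and ue: "u \<cdot> i1 = u1" "u \<cdot> i2 = u2"
      using coproduct_ex[OF S, of u1 u2] by auto
    \<comment> \<open>\<open>u\<close> is glued from the transposes of the two given arrows; as a
      section of \<open>r\<close> it transposes back to a section of \<open>z1\<close>.\<close>
    have ru: "r \<cdot> u = Idt C S" by (rule coproduct_eq[OF S]) (simp_all add: ue u1e u2e)
    obtain v where v: "base_change C r c s (Idt C S) f (Idt C (Dom C f)) u v"
      using base_change_ex[OF p I, of u] ru by auto
    note [simp] = base_changeD(4-6)[OF v] and ve = base_changeD(7-9)[OF v]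
    have "v \<cdot> j1 = v1" by (rule pullback_eq[OF p]) (simp_all add: reassoc[OF ve(2)] reassoc[OF ve(3)] u1e e(1)[symmetric] reassoc[OF ue(1)])
    moreover have "v \<cdot> j2 = v2" by (rule pullback_eq[OF p]) (simp_all add: reassoc[OF ve(2)] reassoc[OF ve(3)] u2e e(2)[symmetric] reassoc[OF ue(2)])
    ultimately show "\<exists>u. u \<in> Arr C \<and> Cod C u = Cod C b \<and> Dom C u = Dom C f \<and> u \<cdot> j1 = a \<and> u \<cdot> j2 = b"
      by (intro exI[of _ "z2 \<cdot> (d \<cdot> v)"]) (simp add: u1 u2 t1e t2e)
  next
    fix w w' assume w [simp]: "w \<in> Arr C" "w' \<in> Arr C" "Cod C w = Cod C w'" "Dom C w = Dom C f" "Dom C w' = Dom C f"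
      and we: "w \<cdot> j1 = w' \<cdot> j1" "w \<cdot> j2 = w' \<cdot> j2"
    obtain Z z1 z2 where Z: "is_product C (Dom C f) (Cod C w') Z z1 z2" using product_exists[of "Dom C f" "Cod C w'"] by auto
    note [simp] = productD[OF Z]
    obtain r c s d where R: "slice_Pi C f z1 r c s d" using slice_Pi_exists[of f z1] by auto
    note p = slice_PiD(1)[OF R]
    note [simp] = pullbackD(1-4,6-8)[OF p] pullbackD(5)[OF p, symmetric] slice_PiD(4-6)[OF R]
    obtain t where t [simp]: "t \<in> Arr C" "Dom C t = Dom C f" "Cod C t = Z" and te: "z1 \<cdot> t = Idt C (Dom C f)" "z2 \<cdot> t = w"
      using product_ex[OF Z, of "Idt C (Dom C f)" w] by auto
    obtain t' where t' [simp]: "t' \<in> Arr C" "Dom C t' = Dom C f" "Cod C t' = Z" and te': "z1 \<cdot> t' = Idt C (Dom C f)" "z2 \<cdot> t' = w'"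
      using product_ex[OF Z, of "Idt C (Dom C f)" w'] by auto
    obtain u v where uv: "base_change C r c s (Idt C S) f (Idt C (Dom C f)) u v" and de: "d \<cdot> v = t"
      using slice_Pi_ex[OF R I, of t] te by auto
    obtain u' v' where uv': "base_change C r c s (Idt C S) f (Idt C (Dom C f)) u' v'" and de': "d \<cdot> v' = t'"
      using slice_Pi_ex[OF R I, of t'] te' by auto
    note [simp] = base_changeD(1-6)[OF uv] base_changeD(1-6)[OF uv']
    note ue = base_changeD(7-9)[OF uv] and ue' = base_changeD(7-9)[OF uv']
    have tj1: "t \<cdot> j1 = t' \<cdot> j1" by (rule product_eq[OF Z]) (simp_all add: reassoc[OF te(1)] reassoc[OF te(2)] reassoc[OF te'(1)] reassoc[OF te'(2)] we)
    have tj2: "t \<cdot> j2 = t' \<cdot> j2" by (rule product_eq[OF Z]) (simp_all add: reassoc[OF te(1)] reassoc[OF te(2)] reassoc[OF te'(1)] reassoc[OF te'(2)] we)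
    have "u \<cdot> i1 = u' \<cdot> i1"
      by (rule slice_Pi_eq[OF R P1, of _ "v \<cdot> j1" _ "v' \<cdot> j1"])
        (simp_all add: base_change_def reassoc[OF ue(1)] reassoc[OF ue(2)] reassoc[OF ue(3)]
          reassoc[OF ue'(1)] reassoc[OF ue'(2)] reassoc[OF ue'(3)] e reassoc[OF de] reassoc[OF de'] tj1)
    moreover have "u \<cdot> i2 = u' \<cdot> i2"
      by (rule slice_Pi_eq[OF R P2, of _ "v \<cdot> j2" _ "v' \<cdot> j2"])
        (simp_all add: base_change_def reassoc[OF ue(1)] reassoc[OF ue(2)] reassoc[OF ue(3)]
          reassoc[OF ue'(1)] reassoc[OF ue'(2)] reassoc[OF ue'(3)] e reassoc[OF de] reassoc[OF de'] tj2)
    ultimately have "u = u'" by - (rule coproduct_eq[OF S], simp_all)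
    then have "v = v'" by - (rule pullback_eq[OF p], simp_all add: ue ue')
    then show "w = w'" using de de' te te' by simp
  qed simp_all
qed

text \<open>The argument of \<open>coproduct_pullback\<close> for the empty coproduct: arrows out of
  the domain of \<open>f\<close> correspond to sections over \<open>Z\<close> of a dependent
  product, and over an initial object there is exactly one section.\<close>

lemma initial_strict:
  assumes Z: "is_initial C Z" and u: "f \<in> Arr C" "Cod C f = Z"
  shows "is_initial C (Dom C f)"
proof -
  note [simp] = u
  have [simp]: "Z \<in> Obj C" using cod_obj[of f] by simp
  have I: "is_pullback C (Idt C Z) f f (Idt C (Dom C f))" using pullback_sym[OF pullback_idt[of f]] by simp
  show ?thesis
  proof (rule initialI)
    fix X assume X: "X \<in> Obj C"
    obtain Y z1 z2 where Y: "is_product C (Dom C f) X Y z1 z2" using product_exists[of "Dom C f" X] X by auto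
    note [simp] = productD[OF Y]
    obtain r c s d where R: "slice_Pi C f z1 r c s d" using slice_Pi_exists[of f z1] by auto
    note p = slice_PiD(1)[OF R]
    note [simp] = pullbackD(1-4,6-8)[OF p] pullbackD(5)[OF p, symmetric] slice_PiD(4-6)[OF R]
    obtain u where [simp]: "u \<in> Arr C" "Dom C u = Z" "Cod C u = Dom C r" using initial_map[OF Z, of "Dom C r"] by auto
    have ru: "r \<cdot> u = Idt C Z" by (rule initial_eq[OF Z]) simp_all
    obtain v where v: "base_change C r c s (Idt C Z) f (Idt C (Dom C f)) u v"
      using base_change_ex[OF p I, of u] ru by auto
    note [simp] = base_changeD(4-6)[OF v]
    show "\<exists>u. u \<in> Arr C \<and> Cod C u = X \<and> Dom C u = Dom C f"
      by (intro exI[of _ "z2 \<cdot> (d \<cdot> v)"]) simp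
  next
    fix w w' assume w [simp]: "w \<in> Arr C" "w' \<in> Arr C" "Dom C w = Dom C f" "Dom C w' = Dom C f" "Cod C w = Cod C w'"
    obtain Y z1 z2 where Y: "is_product C (Dom C f) (Cod C w') Y z1 z2" using product_exists[of "Dom C f" "Cod C w'"] by auto
    note [simp] = productD[OF Y]
    obtain r c s d where R: "slice_Pi C f z1 r c s d" using slice_Pi_exists[of f z1] by auto
    note p = slice_PiD(1)[OF R]
    note [simp] = pullbackD(1-4,6-8)[OF p] pullbackD(5)[OF p, symmetric] slice_PiD(4-6)[OF R]
    obtain t where t [simp]: "t \<in> Arr C" "Dom C t = Dom C f" "Cod C t = Y" and te: "z1 \<cdot> t = Idt C (Dom C f)" "z2 \<cdot> t = w"
      using product_ex[OF Y, of "Idt C (Dom C f)" w] by auto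
    obtain t' where t' [simp]: "t' \<in> Arr C" "Dom C t' = Dom C f" "Cod C t' = Y" and te': "z1 \<cdot> t' = Idt C (Dom C f)" "z2 \<cdot> t' = w'"
      using product_ex[OF Y, of "Idt C (Dom C f)" w'] by auto
    obtain u v where uv: "base_change C r c s (Idt C Z) f (Idt C (Dom C f)) u v" and de: "d \<cdot> v = t"
      using slice_Pi_ex[OF R I, of t] te by auto
    obtain u' v' where uv': "base_change C r c s (Idt C Z) f (Idt C (Dom C f)) u' v'" and de': "d \<cdot> v' = t'"
      using slice_Pi_ex[OF R I, of t'] te' by auto
    note [simp] = base_changeD(1-6)[OF uv] base_changeD(1-6)[OF uv']
    note ue = base_changeD(7-9)[OF uv] and ue' = base_changeD(7-9)[OF uv']
    have "u = u'" by (rule initial_eq[OF Z]) simp_all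
    then have "v = v'" by - (rule pullback_eq[OF p], simp_all add: ue ue')
    then show "w = w'" using de de' te te' by simp
  qed simp
qed

end

section \<open>Suitable model categories\<close>

lemma terminal_of_finite_limits:
  fixes D :: "('o, 'a) cat"
  assumes D: "category D" and lim: "has_finite_limits D"
  shows "\<exists>T. is_terminal D T"
proof -
  \<comment> \<open>The empty shape: its limit is a terminal object.\<close>
  define E :: "(nat, nat) cat" where
    "E = \<lparr>Obj = {}, Arr = {}, Dom = id, Cod = id, Idt = id, Cmp = (\<lambda>g f. f)\<rparr>"
  define F :: "(nat, nat, 'o, 'a) ftr" where
    "F = \<lparr>Src = E, Tgt = D, OMap = undefined, AMap = undefined\<rparr>"
  have E: "category E" by standard (auto simp: E_def)
  have "cat_functor F"
    by (rule cat_functor.intro) (simp_all add: F_def D E, simp_all add: E_def)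
  moreover have "Tgt F = D" "finite (Obj (Src F))" "finite (Arr (Src F))" by (simp_all add: F_def E_def)
  ultimately obtain L l where "is_limit F L l" using lim unfolding has_finite_limits_def by blast
  then have "is_terminal D L"
    unfolding is_limit_def is_cone_def is_terminal_def by (simp add: F_def E_def)
  then show ?thesis by blast
qed

lemma product_of_finite_limits:
  fixes D :: "('o, 'a) cat"
  assumes D: "category D" and lim: "has_finite_limits D" and PQ: "P \<in> Obj D" "Q \<in> Obj D"
  shows "\<exists>R p1 p2. is_product D P Q R p1 p2"
proof -
  interpret D: category D by fact
  \<comment> \<open>The discrete shape on two points; its only arrows are the identities, named by
    the points themselves.\<close>
  define E :: "(nat, nat) cat" where
    "E = \<lparr>Obj = {0, 1}, Arr = {0, 1}, Dom = id, Cod = id, Idt = id, Cmp = (\<lambda>g f. f)\<rparr>"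
  define F :: "(nat, nat, 'o, 'a) ftr" where
    "F = \<lparr>Src = E, Tgt = D, OMap = (\<lambda>i. if i = 0 then P else Q),
      AMap = (\<lambda>i. Idt D (if i = 0 then P else Q))\<rparr>"
  have E: "category E" by standard (auto simp: E_def)
  have "cat_functor F"
    by (rule cat_functor.intro) (simp_all add: F_def D E, auto simp: E_def PQ)
  moreover have "Tgt F = D" "finite (Obj (Src F))" "finite (Arr (Src F))" by (simp_all add: F_def E_def)
  ultimately obtain L l where L: "is_limit F L l" using lim unfolding has_finite_limits_def by blast
  have cone: "is_cone F X m \<longleftrightarrow> m 0 \<in> hom D X P \<and> m 1 \<in> hom D X Q" for X m
    by (auto simp: is_cone_def F_def E_def)
  have ex1: "\<exists>!u. u \<in> hom D X L \<and> l 0 \<cdot>\<^bsub>D\<^esub> u = m 0 \<and> l 1 \<cdot>\<^bsub>D\<^esub> u = m 1" if "is_cone F X m" for X m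
    using L that unfolding is_limit_def by (simp add: F_def E_def)
  have "is_product D P Q L (l 0) (l 1)" unfolding is_product_def
  proof (intro conjI allI ballI)
    have "is_cone F L l" using L unfolding is_limit_def by blast
    then show "l 0 \<in> hom D L P" "l 1 \<in> hom D L Q" unfolding cone by blast+
    fix X f g assume "f \<in> hom D X P" "g \<in> hom D X Q"
    then have "is_cone F X (\<lambda>i. if i = 0 then f else g)" unfolding cone by simp
    from ex1[OF this] show "\<exists>!u. u \<in> hom D X L \<and> l 0 \<cdot>\<^bsub>D\<^esub> u = f \<and> l 1 \<cdot>\<^bsub>D\<^esub> u = g" by simp
  qed
  then show ?thesis by blast
qed

context category
begin

lemma mono_eq:
  assumes "is_mono C f" "g \<in> Arr C" "h \<in> Arr C" "Dom C g = Dom C h" "Cod C g = Dom C f" "Cod C h = Dom C f"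
    "f \<cdot> g = f \<cdot> h"
  shows "g = h"
  using assms unfolding is_mono_def by auto

lemma monoI:
  assumes "f \<in> Arr C" "\<And>g h. g \<in> Arr C \<Longrightarrow> h \<in> Arr C \<Longrightarrow> Dom C g = Dom C h \<Longrightarrow> Cod C g = Dom C f \<Longrightarrow>
    Cod C h = Dom C f \<Longrightarrow> f \<cdot> g = f \<cdot> h \<Longrightarrow> g = h"
  shows "is_mono C f"
  using assms unfolding is_mono_def by auto

lemma mono_pullback:
  assumes i: "is_mono C i" and P: "is_pullback C i h g j"
  shows "is_mono C j"
proof (rule monoI)
  note [simp] = pullbackD(1-8)[OF P] and e = pullbackD(9)[OF P]
  show "j \<in> Arr C" by simp
  fix u v assume uv: "u \<in> Arr C" "v \<in> Arr C" "Dom C u = Dom C v" "Cod C u = Dom C j" "Cod C v = Dom C j" "j \<cdot> u = j \<cdot> v"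
  have "h \<cdot> u = h \<cdot> v" by (rule mono_eq[OF i]) (use uv in \<open>simp_all add: reassoc[OF e]\<close>)
  then show "u = v" using uv by - (rule pullback_eq[OF P], simp_all)
qed

text \<open>Over a terminal object the commutativity condition is automatic. In this form
  projections inherit from \<open>A \<rightarrow> 1\<close> whatever is stable under
  pullback.\<close>

lemma product_pullback_terminal:
  assumes P: "is_product C A B R p1 p2" and T: "is_terminal C T"
    and ab: "a \<in> Arr C" "Dom C a = A" "Cod C a = T" "b \<in> Arr C" "Dom C b = B" "Cod C b = T"
  shows "is_pullback C a p1 b p2"
proof (rule pullbackI)
  note [simp] = productD[OF P] ab
  show "a \<cdot> p1 = b \<cdot> p2" by (rule terminal_eq[OF T]) simp_all
  show "\<exists>u. u \<in> Arr C \<and> Dom C u = Dom C g \<and> Cod C u = Dom C p1 \<and> p1 \<cdot> u = f \<and> p2 \<cdot> u = g"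
    if "f \<in> Arr C" "g \<in> Arr C" "Dom C f = Dom C g" "Cod C f = Dom C a" "Cod C g = Dom C b" for f g
    using product_ex[OF P, of f g] that by auto
  show "u = v" if "u \<in> Arr C" "v \<in> Arr C" "Dom C u = Dom C v" "Cod C u = Dom C p1" "Cod C v = Dom C p1"
    "p1 \<cdot> u = p1 \<cdot> v" "p2 \<cdot> u = p2 \<cdot> v" for u v
    using that by - (rule product_eq[OF P], simp_all)
qed (use productD[OF P] ab in simp_all)

end

section \<open>Fibrations and acyclic fibrations through lifting properties\<close>

context model_category
begin

lemma initial_exists: "\<exists>Z. is_initial M Z"
  and coproduct_exists: "P \<in> Obj M \<Longrightarrow> Q \<in> Obj M \<Longrightarrow> \<exists>S i j. is_coproduct M P Q S i j"
proof -
  \<comment> \<open>The opposite category forgets the model structure anyway, so truncating first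
    makes no difference.\<close>
  have o: "opp (cat.truncate M) = opp M" by (simp add: opp_def cat.truncate_def)
  have l: "has_finite_limits (opp M)" using finite_colimits unfolding has_finite_colimits_def o .
  show "\<exists>Z. is_initial M Z"
    using terminal_of_finite_limits[OF category_opp l] unfolding is_initial_def .
  show "P \<in> Obj M \<Longrightarrow> Q \<in> Obj M \<Longrightarrow> \<exists>S i j. is_coproduct M P Q S i j"
    using product_of_finite_limits[OF category_opp l, of P Q] unfolding is_coproduct_def by simp
qed

lemma fib_simp [simp]: "f \<in> Fib M \<Longrightarrow> f \<in> Arr M"
  and we_simp: "f \<in> WE M \<Longrightarrow> f \<in> Arr M"
  and cof_simp: "f \<in> Cof M \<Longrightarrow> f \<in> Arr M"
  using fib_arr we_arr cof_arr by auto

lemma has_lifting_ex: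
  assumes "has_lifting M i p" "a \<in> Arr M" "b \<in> Arr M" "Dom M a = Dom M i" "Cod M a = Dom M p" "Dom M b = Cod M i"
    "Cod M b = Cod M p" "p \<cdot> a = b \<cdot> i"
  shows "\<exists>l. l \<in> Arr M \<and> Dom M l = Cod M i \<and> Cod M l = Dom M p \<and> l \<cdot> i = a \<and> p \<cdot> l = b"
proof -
  have "a \<in> hom M (Dom M i) (Dom M p)" "b \<in> hom M (Cod M i) (Cod M p)" using assms by simp_all
  then obtain l where "l \<in> hom M (Cod M i) (Dom M p)" "l \<cdot> i = a" "p \<cdot> l = b"
    using assms(1,8) unfolding has_lifting_def by blast
  then show ?thesis by auto
qed

lemma has_liftingI:
  assumes "\<And>a b. a \<in> Arr M \<Longrightarrow> b \<in> Arr M \<Longrightarrow> Dom M a = Dom M i \<Longrightarrow> Cod M a = Dom M p \<Longrightarrow> Dom M b = Cod M i \<Longrightarrow>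
    Cod M b = Cod M p \<Longrightarrow> p \<cdot> a = b \<cdot> i \<Longrightarrow>
    \<exists>l. l \<in> Arr M \<and> Dom M l = Cod M i \<and> Cod M l = Dom M p \<and> l \<cdot> i = a \<and> p \<cdot> l = b"
  shows "has_lifting M i p"
  unfolding has_lifting_def
proof (intro ballI impI)
  fix a b assume "a \<in> hom M (Dom M i) (Dom M p)" "b \<in> hom M (Cod M i) (Cod M p)" "p \<cdot> a = b \<cdot> i"
  then have "\<exists>l. l \<in> Arr M \<and> Dom M l = Cod M i \<and> Cod M l = Dom M p \<and> l \<cdot> i = a \<and> p \<cdot> l = b"
    using assms[of a b] by simp
  then show "\<exists>l\<in>hom M (Cod M i) (Dom M p). l \<cdot> i = a \<and> p \<cdot> l = b" by auto
qed

text \<open>The retract argument: a lift of the identity of the domain of \<open>f\<close> along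
  \<open>i\<close>, lying over \<open>p\<close>, is the retraction.\<close>

lemma lifting_retract:
  assumes f: "f \<in> Arr M" "has_lifting M i f" and ip: "i \<in> Arr M" "p \<in> Arr M" "Dom M i = Dom M f" "Dom M p = Cod M i"
    "Cod M p = Cod M f" "p \<cdot> i = f"
  shows "is_retract M f p"
proof -
  obtain l where l: "l \<in> Arr M" "Dom M l = Cod M i" "Cod M l = Dom M f" "l \<cdot> i = Idt M (Dom M f)" "f \<cdot> l = p"
    using has_lifting_ex[OF f(2), of "Idt M (Dom M f)" p] f ip by auto
  show ?thesis unfolding is_retract_def
    by (intro conjI bexI[of _ i] bexI[of _ l] bexI[of _ "Idt M (Cod M f)"]) (use f l ip in simp_all)
qed

text \<open>Factor \<open>f\<close> as an acyclic cofibration followed by a fibration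
  \<open>p\<close>; lifting makes \<open>f\<close> a retract of \<open>p\<close>.\<close>

lemma fibI:
  assumes f: "f \<in> Arr M" and l: "\<And>i. i \<in> Cof M \<Longrightarrow> i \<in> WE M \<Longrightarrow> has_lifting M i f"
  shows "f \<in> Fib M"
proof -
  obtain X i p where "i \<in> hom M (Dom M f) X" "p \<in> hom M X (Cod M f)" "i \<in> Cof M" "i \<in> WE M" "p \<in> Fib M" "p \<cdot> i = f"
    using factor_acyclic_cof[OF homI[OF f]] by blast
  then show ?thesis using lifting_retract[OF f l, of i p] retract_fib[of f p] by auto
qed

text \<open>The retract argument for the other factorization, which delivers both properties at
  once.\<close>

lemma acyclic_fibI:
  assumes f: "f \<in> Arr M" and l: "\<And>i. i \<in> Cof M \<Longrightarrow> has_lifting M i f"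
  shows "f \<in> Fib M" "f \<in> WE M"
proof -
  obtain X i p where ip: "i \<in> hom M (Dom M f) X" "p \<in> hom M X (Cod M f)" "i \<in> Cof M" "p \<in> Fib M" "p \<in> WE M" "p \<cdot> i = f"
    using factor_acyclic_fib[OF homI[OF f]] by blast
  then have "is_retract M f p" using lifting_retract[OF f l, of i p] by auto
  then show "f \<in> Fib M" "f \<in> WE M" using retract_fib[of f p] retract_we[of f p] ip by auto
qed

lemma has_lifting_pullback:
  assumes l: "has_lifting M i p" and P: "is_pullback M p h g q" and i: "i \<in> Arr M"
  shows "has_lifting M i q"
proof (rule has_liftingI)
  note [simp] = pullbackD(1-8)[OF P] i and e = pullbackD(9)[OF P]
  fix a b assume ab [simp]: "a \<in> Arr M" "b \<in> Arr M" "Dom M a = Dom M i" "Cod M a = Dom M q" "Dom M b = Cod M i"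
    "Cod M b = Cod M q" and qa: "q \<cdot> a = b \<cdot> i"
  obtain l where l: "l \<in> Arr M" "Dom M l = Cod M i" "Cod M l = Dom M p" "l \<cdot> i = h \<cdot> a" "p \<cdot> l = g \<cdot> b"
    using has_lifting_ex[OF l, of "h \<cdot> a" "g \<cdot> b"] by (auto simp: reassoc[OF e] qa)
  obtain m where m: "m \<in> Arr M" "Dom M m = Cod M i" "Cod M m = Dom M h" "h \<cdot> m = l" "q \<cdot> m = b"
    using pullback_ex[OF P, of l b] l by auto
  have "m \<cdot> i = a" by (rule pullback_eq[OF P]) (simp_all add: l m reassoc[OF m(4)] reassoc[OF m(5)] qa)
  then show "\<exists>l. l \<in> Arr M \<and> Dom M l = Cod M i \<and> Cod M l = Dom M q \<and> l \<cdot> i = a \<and> q \<cdot> l = b"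
    using m by auto
qed

lemma fib_pullback: "is_pullback M p h g q \<Longrightarrow> p \<in> Fib M \<Longrightarrow> q \<in> Fib M"
  by (rule fibI) (auto simp: pullbackD cof_simp intro: has_lifting_pullback lifting_acyclic_cof)

lemma acyclic_fib_pullback:
  assumes "is_pullback M p h g q" "p \<in> Fib M" "p \<in> WE M"
  shows "q \<in> Fib M" "q \<in> WE M"
  by (rule acyclic_fibI; use assms in \<open>auto simp: pullbackD cof_simp intro: has_lifting_pullback lifting_acyclic_fib\<close>)+

lemma has_lifting_comp:
  assumes l: "has_lifting M i p" "has_lifting M i q" and pq: "p \<in> Arr M" "q \<in> Arr M" "Cod M p = Dom M q" "i \<in> Arr M"
  shows "has_lifting M i (q \<cdot> p)"
proof (rule has_liftingI)
  note [simp] = pq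
  fix a b assume ab [simp]: "a \<in> Arr M" "b \<in> Arr M" "Dom M a = Dom M i" "Cod M a = Dom M (q \<cdot> p)" "Dom M b = Cod M i"
    "Cod M b = Cod M (q \<cdot> p)" and qa: "(q \<cdot> p) \<cdot> a = b \<cdot> i"
  obtain l where l': "l \<in> Arr M" "Dom M l = Cod M i" "Cod M l = Dom M q" "l \<cdot> i = p \<cdot> a" "q \<cdot> l = b"
    using has_lifting_ex[OF l(2), of "p \<cdot> a" b] qa by auto
  obtain m where m: "m \<in> Arr M" "Dom M m = Cod M i" "Cod M m = Dom M p" "m \<cdot> i = a" "p \<cdot> m = l"
    using has_lifting_ex[OF l(1), of a l] l' by auto
  then show "\<exists>l. l \<in> Arr M \<and> Dom M l = Cod M i \<and> Cod M l = Dom M (q \<cdot> p) \<and> l \<cdot> i = a \<and> (q \<cdot> p) \<cdot> l = b"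
    using l' by auto
qed

lemma fib_comp: "p \<in> Fib M \<Longrightarrow> q \<in> Fib M \<Longrightarrow> Cod M p = Dom M q \<Longrightarrow> q \<cdot> p \<in> Fib M"
  by (rule fibI) (auto simp: cof_simp intro: has_lifting_comp lifting_acyclic_cof)

text \<open>Composing the bottom side with the inverse of \<open>f\<close> gives the lift. By the
  lifting criteria isomorphisms are then acyclic fibrations.\<close>

lemma iso_has_lifting:
  assumes f: "is_iso M f" and i: "i \<in> Arr M"
  shows "has_lifting M i f"
proof (rule has_liftingI)
  obtain g where g: "f \<in> Arr M" "g \<in> Arr M" "Dom M g = Cod M f" "Cod M g = Dom M f" "g \<cdot> f = Idt M (Dom M f)" "f \<cdot> g = Idt M (Cod M f)"
    using iso_inverse[OF f] by blast
  fix a b assume ab: "a \<in> Arr M" "b \<in> Arr M" "Dom M a = Dom M i" "Cod M a = Dom M f" "Dom M b = Cod M i"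
    "Cod M b = Cod M f" and fa: "f \<cdot> a = b \<cdot> i"
  have "g \<cdot> (f \<cdot> a) = a" using g ab by (simp add: reassoc[OF g(5)])
  then show "\<exists>l. l \<in> Arr M \<and> Dom M l = Cod M i \<and> Cod M l = Dom M f \<and> l \<cdot> i = a \<and> f \<cdot> l = b"
    using g ab fa i by (intro exI[of _ "g \<cdot> b"]) (simp add: reassoc[OF g(6)])
qed

lemma iso_fib: "is_iso M f \<Longrightarrow> f \<in> Fib M" and iso_we: "is_iso M f \<Longrightarrow> f \<in> WE M"
  by (auto intro!: fibI acyclic_fibI(2) iso_has_lifting simp: iso_arr cof_simp)

lemma we_cancel_left:
  "f \<in> Arr M \<Longrightarrow> g \<in> Arr M \<Longrightarrow> Cod M f = Dom M g \<Longrightarrow> f \<in> WE M \<Longrightarrow> g \<cdot> f \<in> WE M \<Longrightarrow> g \<in> WE M"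
  using two_of_three_left[of f "Dom M f" "Cod M f" g "Cod M g"] by simp

lemma we_cancel_right:
  "f \<in> Arr M \<Longrightarrow> g \<in> Arr M \<Longrightarrow> Cod M f = Dom M g \<Longrightarrow> g \<in> WE M \<Longrightarrow> g \<cdot> f \<in> WE M \<Longrightarrow> f \<in> WE M"
  using two_of_three_right[of f "Dom M f" "Cod M f" g "Cod M g"] by simp

lemma factor_ac:
  assumes "f \<in> Arr M"
  shows "\<exists>i p. i \<in> Cof M \<and> i \<in> WE M \<and> p \<in> Fib M \<and> i \<in> Arr M \<and> Dom M i = Dom M f \<and> Cod M i = Dom M p \<and> Cod M p = Cod M f \<and> p \<cdot> i = f"
proof -
  obtain X i p where "i \<in> hom M (Dom M f) X" "p \<in> hom M X (Cod M f)" "i \<in> Cof M" "i \<in> WE M" "p \<in> Fib M" "p \<cdot> i = f"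
    using factor_acyclic_cof[OF homI[OF assms]] by blast
  then show ?thesis by (intro exI[of _ i] exI[of _ p]) simp
qed

lemma factor_af:
  assumes "f \<in> Arr M"
  shows "\<exists>i p. i \<in> Cof M \<and> p \<in> Fib M \<and> p \<in> WE M \<and> i \<in> Arr M \<and> Dom M i = Dom M f \<and> Cod M i = Dom M p \<and> Cod M p = Cod M f \<and> p \<cdot> i = f"
proof -
  obtain X i p where "i \<in> hom M (Dom M f) X" "p \<in> hom M X (Cod M f)" "i \<in> Cof M" "p \<in> Fib M" "p \<in> WE M" "p \<cdot> i = f"
    using factor_acyclic_fib[OF homI[OF assms]] by blast
  then show ?thesis by (intro exI[of _ i] exI[of _ p]) simp
qed

lemma lift_ac:
  assumes "i \<in> Cof M" "i \<in> WE M" "p \<in> Fib M" "a \<in> Arr M" "b \<in> Arr M" "Dom M a = Dom M i" "Cod M a = Dom M p" "Dom M b = Cod M i"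
    "Cod M b = Cod M p" "p \<cdot> a = b \<cdot> i"
  shows "\<exists>l. l \<in> Arr M \<and> Dom M l = Cod M i \<and> Cod M l = Dom M p \<and> l \<cdot> i = a \<and> p \<cdot> l = b"
  using has_lifting_ex[OF lifting_acyclic_cof] assms by blast

lemma lift_af:
  assumes "i \<in> Cof M" "p \<in> Fib M" "p \<in> WE M" "a \<in> Arr M" "b \<in> Arr M" "Dom M a = Dom M i" "Cod M a = Dom M p" "Dom M b = Cod M i"
    "Cod M b = Cod M p" "p \<cdot> a = b \<cdot> i"
  shows "\<exists>l. l \<in> Arr M \<and> Dom M l = Cod M i \<and> Cod M l = Dom M p \<and> l \<cdot> i = a \<and> p \<cdot> l = b"
  using has_lifting_ex[OF lifting_acyclic_fib] assms by blast

lemma fibrant_obj: "fibrant M A \<Longrightarrow> A \<in> Obj M"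
  by (simp add: fibrant_def)

text \<open>Arrows to two terminal objects differ by an isomorphism, which is a fibration; hence one
  terminal object decides what \<open>fibrant\<close> demands of all.\<close>

lemma fibrantI:
  assumes T: "is_terminal M T" and u: "u \<in> Fib M" "Dom M u = A" "Cod M u = T"
  shows "fibrant M A"
  unfolding fibrant_def
proof (intro conjI allI impI)
  have [simp]: "u \<in> Arr M" using u by simp
  then show "A \<in> Obj M" using u dom_obj[of u] by simp
  fix T' v assume "is_terminal M T' \<and> v \<in> hom M A T'"
  then have T': "is_terminal M T'" and v: "v \<in> Arr M" "Dom M v = A" "Cod M v = T'" by auto
  obtain j where j: "is_iso M j" "j \<in> Arr M" "Dom M j = T" "Cod M j = T'" using terminal_unique_iso[OF T T'] by blast
  have "v = j \<cdot> u" by (rule terminal_eq[OF T']) (use v j u in simp_all)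
  then show "v \<in> Fib M" using fib_comp[OF u(1) iso_fib[OF j(1)]] u j by simp
qed

lemma fibrant_terminal: "is_terminal M T \<Longrightarrow> fibrant M T"
  using fibrantI[of T "Idt M T" T] iso_fib[OF iso_idt[of T]] terminal_obj[of T] by simp

lemma fibrant_fib:
  assumes T: "is_terminal M T" and p: "p \<in> Fib M" "fibrant M (Cod M p)"
  shows "fibrant M (Dom M p)"
proof -
  obtain u where u: "u \<in> Arr M" "Dom M u = Cod M p" "Cod M u = T"
    using terminal_map[OF T, of "Cod M p"] p by auto
  then have "u \<in> Fib M" using p(2) T unfolding fibrant_def by auto
  then have "u \<cdot> p \<in> Fib M" using p u by (simp add: fib_comp)
  then show ?thesis using fibrantI[OF T, of "u \<cdot> p" "Dom M p"] u p by simp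
qed

end

lemma fibrant_cat_simps [simp]:
  "f \<in> Arr (fibrant_cat M) \<longleftrightarrow> f \<in> Arr M \<and> fibrant M (Dom M f) \<and> fibrant M (Cod M f)"
  "A \<in> Obj (fibrant_cat M) \<longleftrightarrow> fibrant M A"
  "Dom (fibrant_cat M) = Dom M" "Cod (fibrant_cat M) = Cod M" "Idt (fibrant_cat M) = Idt M"
  "Cmp (fibrant_cat M) = Cmp M"
  by (auto simp: fibrant_cat_def full_subcat_def fibrant_def)

sublocale suitable_model_category \<subseteq> lcc_category M
  by standard (rule locally_ccc)

section \<open>Consequences of suitability, and the category of fibrant objects\<close>

context suitable_model_category
begin

lemma terminal_exists: "\<exists>T. is_terminal M T"
  using locally_ccc unfolding locally_cartesian_closed_def by blast

lemma fibrant_dom: "p \<in> Fib M \<Longrightarrow> fibrant M (Cod M p) \<Longrightarrow> fibrant M (Dom M p)"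
  using fibrant_fib terminal_exists by blast

text \<open>Monomorphisms are stable under every pullback, and right properness takes care of the
  weak equivalence when \<open>g\<close> is a fibration.\<close>

lemma acyclic_cof_pullback:
  assumes P: "is_pullback M i h g j" and i: "i \<in> Cof M" "i \<in> WE M" and g: "g \<in> Fib M"
  shows "j \<in> Cof M" "j \<in> WE M"
  using mono_pullback[OF _ P] right_proper[OF pullback_sym[OF P] g i(2)] i(1) cof_iff_mono by auto

text \<open>By strictness anything mapping to \<open>Z\<close> is itself initial, so parallel arrows
  into \<open>Z\<close> are equal and \<open>u\<close> is monic. In other words every object is
  cofibrant.\<close>

lemma cof_initial:
  assumes "is_initial M Z" "u \<in> Arr M" "Dom M u = Z"
  shows "u \<in> Cof M"
  unfolding cof_iff_mono
proof (rule monoI)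
  fix g h assume gh: "g \<in> Arr M" "h \<in> Arr M" "Dom M g = Dom M h" "Cod M g = Dom M u" "Cod M h = Dom M u"
  have "is_initial M (Dom M g)" by (rule initial_strict[OF assms(1)]) (use gh assms in simp_all)
  then show "g = h" by (rule initial_eq) (use gh in simp_all)
qed (rule assms)

text \<open>Every object is cofibrant, so the identity of the codomain lifts through
  \<open>p\<close>.\<close>

lemma acyclic_fib_section:
  assumes p: "p \<in> Fib M" "p \<in> WE M"
  shows "\<exists>s. s \<in> Arr M \<and> Dom M s = Cod M p \<and> Cod M s = Dom M p \<and> p \<cdot> s = Idt M (Cod M p)"
proof -
  have [simp]: "p \<in> Arr M" using p by simp
  obtain Z where Z: "is_initial M Z" using initial_exists by blast
  obtain a where a: "a \<in> Arr M" "Dom M a = Z" "Cod M a = Dom M p" using initial_map[OF Z, of "Dom M p"] by auto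
  have "\<exists>l. l \<in> Arr M \<and> Dom M l = Cod M (p \<cdot> a) \<and> Cod M l = Dom M p \<and> l \<cdot> (p \<cdot> a) = a \<and> p \<cdot> l = Idt M (Cod M p)"
    by (rule lift_af[OF _ p]) (use a cof_initial[OF Z, of "p \<cdot> a"] in simp_all)
  then show ?thesis using a by auto
qed

text \<open>The dependent product along a fibration is right adjoint to a functor preserving acyclic
  cofibrations.\<close>

lemma slice_Pi_fib:
  assumes R: "slice_Pi M f p r c s e" and f: "f \<in> Fib M" and p: "p \<in> Fib M"
  shows "r \<in> Fib M"
proof (rule fibI)
  note P = slice_PiD(1)[OF R]
  note [simp] = pullbackD(1-4,6-8)[OF P] pullbackD(5)[OF P, symmetric] slice_PiD(2-6)[OF R]
  show "r \<in> Arr M" by simp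
  fix i assume i: "i \<in> Cof M" "i \<in> WE M"
  then have [simp]: "i \<in> Arr M" by (simp add: cof_simp)
  show "has_lifting M i r"
  proof (rule has_liftingI)
    fix a b assume [simp]: "a \<in> Arr M" "b \<in> Arr M" "Dom M a = Dom M i" "Cod M a = Dom M r" "Dom M b = Cod M i"
      "Cod M b = Cod M r" and ra: "r \<cdot> a = b \<cdot> i"
    \<comment> \<open>\<open>c2\<close> is the pullback of the fibration \<open>f\<close> along
      \<open>b\<close>. Pulling \<open>i\<close> back along \<open>c2\<close> then gives an acyclic
      cofibration \<open>j\<close>.\<close>
    obtain s2 c2 where Q: "is_pullback M f s2 b c2" using pullback_exists[of f b] by auto
    note [simp] = pullbackD(3,4,6-8)[OF Q] and q = pullbackD(9)[OF Q]
    obtain j h where J: "is_pullback M c2 j i h" using pullback_exists[of c2 i] by auto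
    note [simp] = pullbackD(3,4,6-8)[OF J] and je = pullbackD(9)[OF J]
    have j: "j \<in> Cof M" "j \<in> WE M"
      using acyclic_cof_pullback[OF pullback_sym[OF J] i fib_pullback[OF Q f]] by blast+
    have PQ: "is_pullback M (b \<cdot> i) h f (s2 \<cdot> j)" using pullback_sym[OF pullback_paste[OF Q J]] .
    obtain w where w: "base_change M r c s (b \<cdot> i) h (s2 \<cdot> j) a w" using base_change_ex[OF P PQ, of a] ra by auto
    note [simp] = base_changeD(4-6)[OF w] and we = base_changeD(7-9)[OF w]
    \<comment> \<open>The lifting problem of \<open>i\<close> against \<open>r\<close> transposes to
      one of \<open>j\<close> against the fibration \<open>p\<close>; its solution \<open>t\<close>
      is transposed back to \<open>u\<close>.\<close>
    have "\<exists>l. l \<in> Arr M \<and> Dom M l = Cod M j \<and> Cod M l = Dom M p \<and> l \<cdot> j = e \<cdot> w \<and> p \<cdot> l = s2"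
      by (rule lift_ac[OF j p]) (simp_all add: reassoc[OF slice_PiD(7)[OF R]] we)
    then obtain t where [simp]: "t \<in> Arr M" "Dom M t = Dom M c2" "Cod M t = Dom M p" and t: "t \<cdot> j = e \<cdot> w" "p \<cdot> t = s2"
      by auto
    obtain u v where uv: "base_change M r c s b c2 s2 u v" and ev: "e \<cdot> v = t"
      using slice_Pi_ex[OF R pullback_sym[OF Q], of t] t by auto
    note [simp] = base_changeD(1-6)[OF uv] and ue = base_changeD(7-9)[OF uv]
    have "u \<cdot> i = a"
      by (rule slice_Pi_eq[OF R PQ _ w, of _ "v \<cdot> j"])
        (simp_all add: base_change_def reassoc[OF ue(1)] reassoc[OF ue(2)] reassoc[OF ue(3)] reassoc[OF ev] t je)
    then show "\<exists>l. l \<in> Arr M \<and> Dom M l = Cod M i \<and> Cod M l = Dom M r \<and> l \<cdot> i = a \<and> r \<cdot> l = b"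
      using ue by (intro exI[of _ u]) simp
  qed
qed

lemma product_projection_fib:
  assumes P: "is_product M A B R p1 p2" and A: "fibrant M A"
  shows "p2 \<in> Fib M"
proof -
  note [simp] = productD[OF P]
  obtain T where T: "is_terminal M T" using terminal_exists by blast
  have "B \<in> Obj M" "A \<in> Obj M" using cod_obj[of p2] cod_obj[of p1] by simp_all
  then obtain a b where a: "a \<in> Arr M" "Dom M a = A" "Cod M a = T" and b: "b \<in> Arr M" "Dom M b = B" "Cod M b = T"
    using terminal_map[OF T, of A] terminal_map[OF T, of B] by auto
  have "a \<in> Fib M" using A T a unfolding fibrant_def by auto
  then show ?thesis using fib_pullback[OF product_pullback_terminal[OF P T a b]] by simp
qed

lemma category_fibrant_cat: "category (fibrant_cat M)"
  unfolding fibrant_cat_def by (rule category_full_subcat) (rule category_axioms)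

lemma fibrant_cat_product:
  assumes P: "is_product M A B R p1 p2" and "fibrant M A" "fibrant M B"
  shows "is_product (fibrant_cat M) A B R p1 p2"
proof -
  note [simp] = productD[OF P] assms(2,3)
  have [simp]: "fibrant M R" using fibrant_dom[OF product_projection_fib[OF P]] by simp
  show ?thesis
  proof (rule category.productI[OF category_fibrant_cat])
    fix f g assume fg: "f \<in> Arr (fibrant_cat M)" "g \<in> Arr (fibrant_cat M)" "Dom (fibrant_cat M) f = Dom (fibrant_cat M) g"
      "Cod (fibrant_cat M) f = A" "Cod (fibrant_cat M) g = B"
    then obtain u where "u \<in> Arr M" "Dom M u = Dom M g" "Cod M u = R" "p1 \<cdot> u = f" "p2 \<cdot> u = g"
      using product_ex[OF P, of f g] unfolding fibrant_cat_simps by blast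
    then show "\<exists>u. u \<in> Arr (fibrant_cat M) \<and> Dom (fibrant_cat M) u = Dom (fibrant_cat M) g \<and> Cod (fibrant_cat M) u = R \<and>
      p1 \<cdot>\<^bsub>fibrant_cat M\<^esub> u = f \<and> p2 \<cdot>\<^bsub>fibrant_cat M\<^esub> u = g"
      using fg by (intro exI[of _ u]) simp
  qed (simp_all, rule product_eq[OF P], simp_all)
qed

lemma fibrant_cat_has_finite_products: "has_finite_products (fibrant_cat M)"
  unfolding has_finite_products_def
proof (intro conjI ballI)
  obtain T where T: "is_terminal M T" using terminal_exists by blast
  have "is_terminal (fibrant_cat M) T"
  proof (rule category.terminalI[OF category_fibrant_cat])
    show "\<exists>u. u \<in> Arr (fibrant_cat M) \<and> Dom (fibrant_cat M) u = X \<and> Cod (fibrant_cat M) u = T"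
      if "X \<in> Obj (fibrant_cat M)" for X
      using that terminal_map[OF T, of X] fibrant_terminal[OF T] by (auto simp: fibrant_obj)
    show "f = g" if "f \<in> Arr (fibrant_cat M)" "g \<in> Arr (fibrant_cat M)" "Cod (fibrant_cat M) f = T" "Cod (fibrant_cat M) g = T"
      "Dom (fibrant_cat M) f = Dom (fibrant_cat M) g" for f g
      using that by - (rule terminal_eq[OF T], simp_all)
  qed (simp add: fibrant_terminal[OF T])
  then show "\<exists>T. is_terminal (fibrant_cat M) T" by blast
  fix P Q assume "P \<in> Obj (fibrant_cat M)" "Q \<in> Obj (fibrant_cat M)"
  then show "\<exists>R p1 p2. is_product (fibrant_cat M) P Q R p1 p2"
    using product_exists[of P Q] fibrant_cat_product[of P Q] unfolding fibrant_cat_simps by (blast dest: fibrant_obj)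
qed

lemma iso_fibrant_cat: "is_iso (fibrant_cat M) f \<Longrightarrow> is_iso M f"
  by (auto simp: is_iso_def inverse_arrows_def)

text \<open>Up to isomorphism a product of fibrant objects is computed in the whole category, where
  the projection is a pullback of \<open>A \<rightarrow> 1\<close>. This is why quantification along
  projections only ever concerns fibrations.\<close>

lemma fibrant_cat_projection_fib:
  assumes "product_projection (fibrant_cat M) g"
  shows "g \<in> Fib M"
proof -
  obtain A B R p1 where P: "is_product (fibrant_cat M) A B R p1 g" using assms unfolding product_projection_def by blast
  have AB: "fibrant M A" "fibrant M B" using category.productD[OF category_fibrant_cat P] by auto
  then obtain R' q1 q2 where Q: "is_product M A B R' q1 q2" using product_exists[of A B] by (auto simp: fibrant_obj)
  obtain r where "is_iso (fibrant_cat M) r" "g = q2 \<cdot> r" "Cod M r = R'"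
    using category.product_iso[OF category_fibrant_cat fibrant_cat_product[OF Q AB] P] by auto
  then show ?thesis
    using fib_comp[OF iso_fib[OF iso_fibrant_cat] product_projection_fib[OF Q AB(1)]] productD[OF Q] by simp
qed

text \<open>The pullback formed in the whole category has a fibrant vertex, because \<open>g\<close>
  is a fibration and the domain of \<open>k\<close> is fibrant. It is therefore also a pullback
  among fibrant objects, and the given square is isomorphic to it.\<close>

lemma fibrant_cat_pullback:
  assumes P: "is_pullback (fibrant_cat M) g h k f" and g: "g \<in> Fib M"
  shows "is_pullback M g h k f" "f \<in> Fib M"
proof -
  note p = category.pullbackD[OF category_fibrant_cat P]
  have [simp]: "g \<in> Arr M" "k \<in> Arr M" "Cod M k = Cod M g" "fibrant M (Dom M g)" "fibrant M (Dom M k)" "fibrant M (Cod M g)"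
    using p by simp_all
  obtain h' f' where Q: "is_pullback M g h' k f'" using pullback_exists[of g k] by auto
  note [simp] = pullbackD(3,4,6-8)[OF Q] and q = pullbackD(9)[OF Q]
  have [simp]: "fibrant M (Dom M h')" using fibrant_dom[OF fib_pullback[OF Q g]] by simp
  have "is_pullback (fibrant_cat M) g h' k f'"
  proof (rule category.pullbackI[OF category_fibrant_cat])
    fix a b assume ab: "a \<in> Arr (fibrant_cat M)" "b \<in> Arr (fibrant_cat M)" "Dom (fibrant_cat M) a = Dom (fibrant_cat M) b"
      "Cod (fibrant_cat M) a = Dom (fibrant_cat M) g" "Cod (fibrant_cat M) b = Dom (fibrant_cat M) k"
      "g \<cdot>\<^bsub>fibrant_cat M\<^esub> a = k \<cdot>\<^bsub>fibrant_cat M\<^esub> b"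
    then obtain u where "u \<in> Arr M" "Dom M u = Dom M b" "Cod M u = Dom M h'" "h' \<cdot> u = a" "f' \<cdot> u = b"
      using pullback_ex[OF Q, of a b] unfolding fibrant_cat_simps by blast
    then show "\<exists>u. u \<in> Arr (fibrant_cat M) \<and> Dom (fibrant_cat M) u = Dom (fibrant_cat M) b \<and>
      Cod (fibrant_cat M) u = Dom (fibrant_cat M) h' \<and> h' \<cdot>\<^bsub>fibrant_cat M\<^esub> u = a \<and> f' \<cdot>\<^bsub>fibrant_cat M\<^esub> u = b"
      using ab by (intro exI[of _ u]) simp
  qed (simp_all add: q, rule pullback_eq[OF Q], simp_all)
  then obtain r where r: "is_iso (fibrant_cat M) r" "Cod M r = Dom M h'" "h = h' \<cdot> r" "f = f' \<cdot> r"
    using category.pullback_iso[OF category_fibrant_cat _ P] by force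
  have "is_pullback M g (h' \<cdot> r) k (f' \<cdot> r)"
    using pullback_comp_iso[OF Q iso_fibrant_cat] r by simp
  then show "is_pullback M g h k f" "f \<in> Fib M" using r fib_pullback[OF _ g] by simp_all
qed

end

section \<open>Cylinders and homotopies\<close>

text \<open>A cylinder whose projection is a cartesian natural transformation. Besides \<open>X \<times> I\<close> this also
  covers the trivial cylinder \<open>cyl X = X\<close>, for which homotopy is equality.\<close>

locale cylinder = suitable_model_category M for M :: "('o, 'a) model_cat" (structure) +
  fixes cyl :: "'o \<Rightarrow> 'o" and pr i0 i1 :: "'o \<Rightarrow> 'a"
  assumes cyl_simps [simp]: "X \<in> Obj M \<Longrightarrow> pr X \<in> Arr M" "X \<in> Obj M \<Longrightarrow> Dom M (pr X) = cyl X" "X \<in> Obj M \<Longrightarrow> Cod M (pr X) = X"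
      "X \<in> Obj M \<Longrightarrow> i0 X \<in> Arr M" "X \<in> Obj M \<Longrightarrow> Dom M (i0 X) = X" "X \<in> Obj M \<Longrightarrow> Cod M (i0 X) = cyl X"
      "X \<in> Obj M \<Longrightarrow> i1 X \<in> Arr M" "X \<in> Obj M \<Longrightarrow> Dom M (i1 X) = X" "X \<in> Obj M \<Longrightarrow> Cod M (i1 X) = cyl X"
      "X \<in> Obj M \<Longrightarrow> pr X \<cdot> i0 X = Idt M X" "X \<in> Obj M \<Longrightarrow> pr X \<cdot> i1 X = Idt M X"
    and cyl_map: "s \<in> Arr M \<Longrightarrow> \<exists>s'. is_pullback M (pr (Cod M s)) s' s (pr (Dom M s)) \<and>
      s' \<cdot> i0 (Dom M s) = i0 (Cod M s) \<cdot> s \<and> s' \<cdot> i1 (Dom M s) = i1 (Cod M s) \<cdot> s"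
begin

section \<open>Homotopies, and their passage through pullbacks, coproducts and dependent
  products\<close>

lemma cyl_pr_reassoc [simp]:
  assumes "X \<in> Obj M" "u \<in> Arr M" "Cod M u = X"
  shows "pr X \<cdot> (i0 X \<cdot> u) = u" "pr X \<cdot> (i1 X \<cdot> u) = u"
  using assms by (simp_all add: reassoc[OF cyl_simps(10)] reassoc[OF cyl_simps(11)])

lemma cyl_map_ex:
  assumes "s \<in> Arr M" "Dom M s = X" "Cod M s = Y"
  shows "\<exists>s'. is_pullback M (pr Y) s' s (pr X) \<and> s' \<in> Arr M \<and> Dom M s' = cyl X \<and> Cod M s' = cyl Y \<and>
    s' \<cdot> i0 X = i0 Y \<cdot> s \<and> s' \<cdot> i1 X = i1 Y \<cdot> s \<and> pr Y \<cdot> s' = s \<cdot> pr X"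
proof -
  obtain s' where s: "is_pullback M (pr Y) s' s (pr X)" "s' \<cdot> i0 X = i0 Y \<cdot> s" "s' \<cdot> i1 X = i1 Y \<cdot> s"
    using cyl_map[OF assms(1)] assms(2,3) by blast
  have [simp]: "X \<in> Obj M" "Y \<in> Obj M" using assms by auto
  show ?thesis using s pullbackD[OF s(1)] by (intro exI[of _ s']) simp
qed

text \<open>The last equation keeps \<open>H\<close> in the fibres of \<open>y\<close>. No arrow
  from the domain of \<open>t\<close> to the base is fixed, so that the notion applies to the top
  sides of squares over an arbitrary arrow of the base.\<close>

definition is_htpy :: "'a \<Rightarrow> 'a \<Rightarrow> 'a \<Rightarrow> 'a \<Rightarrow> bool" where
  "is_htpy y t t' H \<longleftrightarrow> y \<in> Arr M \<and> t \<in> Arr M \<and> t' \<in> Arr M \<and> Dom M t' = Dom M t \<and> Cod M t = Dom M y \<and>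
    Cod M t' = Dom M y \<and> y \<cdot> t = y \<cdot> t' \<and> H \<in> Arr M \<and> Dom M H = cyl (Dom M t) \<and> Cod M H = Dom M y \<and>
    H \<cdot> i0 (Dom M t) = t \<and> H \<cdot> i1 (Dom M t) = t' \<and> y \<cdot> H = y \<cdot> (t \<cdot> pr (Dom M t))"

definition htpy :: "'a \<Rightarrow> 'a \<Rightarrow> 'a \<Rightarrow> bool" where
  "htpy y t t' \<longleftrightarrow> (\<exists>H. is_htpy y t t' H)"

lemma is_htpyD:
  assumes "is_htpy y t t' H"
  shows "y \<in> Arr M" "t \<in> Arr M" "t' \<in> Arr M" "Dom M t' = Dom M t" "Cod M t = Dom M y"
    "Cod M t' = Dom M y" "y \<cdot> t = y \<cdot> t'" "H \<in> Arr M" "Dom M H = cyl (Dom M t)" "Cod M H = Dom M y"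
    "H \<cdot> i0 (Dom M t) = t" "H \<cdot> i1 (Dom M t) = t'" "y \<cdot> H = y \<cdot> (t \<cdot> pr (Dom M t))"
  using assms by (simp_all add: is_htpy_def)

lemma htpyI: "is_htpy y t t' H \<Longrightarrow> htpy y t t'"
  by (auto simp: htpy_def)

lemma htpy_refl: "t \<in> Arr M \<Longrightarrow> y \<in> Arr M \<Longrightarrow> Cod M t = Dom M y \<Longrightarrow> htpy y t t"
  by (rule htpyI[of _ _ _ "t \<cdot> pr (Dom M t)"]) (simp add: is_htpy_def)

lemma htpy_post:
  assumes h: "htpy y t t'" and s: "s \<in> Arr M" "Dom M s = Dom M y" "z \<in> Arr M" "Cod M s = Dom M z"
    and b: "b \<in> Arr M" "Dom M b = Cod M y" "z \<cdot> s = b \<cdot> y"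
  shows "htpy z (s \<cdot> t) (s \<cdot> t')"
proof -
  obtain H where H: "is_htpy y t t' H" using h by (auto simp: htpy_def)
  note [simp] = is_htpyD(1-6,8-10)[OF H] s b(1,2) and e = is_htpyD[OF H]
  have "is_htpy z (s \<cdot> t) (s \<cdot> t') (s \<cdot> H)"
    by (simp add: is_htpy_def reassoc[OF b(3)] e(7,11-13))
  then show ?thesis by (rule htpyI)
qed

text \<open>Naturality of the cylinder: \<open>H\<close> is precomposed with the map of cylinders
  induced by \<open>w\<close>.\<close>

lemma htpy_pre:
  assumes h: "htpy y t t'" and w: "w \<in> Arr M" "Cod M w = Dom M t"
  shows "htpy y (t \<cdot> w) (t' \<cdot> w)"
proof -
  obtain H where H: "is_htpy y t t' H" using h by (auto simp: htpy_def)
  note [simp] = is_htpyD(1-6,8-10)[OF H] w and e = is_htpyD[OF H]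
  obtain w' where w' [simp]: "w' \<in> Arr M" "Dom M w' = cyl (Dom M w)" "Cod M w' = cyl (Dom M t)"
    "w' \<cdot> i0 (Dom M w) = i0 (Dom M t) \<cdot> w" "w' \<cdot> i1 (Dom M w) = i1 (Dom M t) \<cdot> w" "pr (Dom M t) \<cdot> w' = w \<cdot> pr (Dom M w)"
    using cyl_map_ex[OF w(1) refl w(2)] by blast
  have "is_htpy y (t \<cdot> w) (t' \<cdot> w) (H \<cdot> w')"
    by (simp add: is_htpy_def reassoc[OF e(7)] reassoc[OF e(11)] reassoc[OF e(12)] reassoc[OF e(13)])
  then show ?thesis by (rule htpyI)
qed

text \<open>\<open>H\<close> and the constant homotopy
  \<open>z \<cdot> (w \<cdot> pr (Dom M w))\<close> are compatible and define a homotopy into the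
  pullback. This gives the uniqueness half of cartesianness in the quotient.\<close>

lemma htpy_pullback:
  assumes P: "is_pullback M q c b z" and w: "w \<in> Arr M" "w' \<in> Arr M" "Cod M w = Dom M z" "Cod M w' = Dom M z" "z \<cdot> w = z \<cdot> w'"
    and h: "htpy q (c \<cdot> w) (c \<cdot> w')"
  shows "htpy z w w'"
proof -
  note [simp] = pullbackD(1-8)[OF P] w(1-4) and e = pullbackD(9)[OF P]
  obtain H where H: "is_htpy q (c \<cdot> w) (c \<cdot> w') H" using h by (auto simp: htpy_def)
  have w3 [simp]: "Dom M w' = Dom M w" "Cod M w = Dom M c" "Cod M w' = Dom M c" using is_htpyD(4)[OF H] by simp_all
  note [simp] = is_htpyD(8-10)[OF H, simplified] and he = is_htpyD[OF H, simplified]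
  obtain K where K [simp]: "K \<in> Arr M" "Dom M K = cyl (Dom M w)" "Cod M K = Dom M c" and Ke: "c \<cdot> K = H" "z \<cdot> K = z \<cdot> (w \<cdot> pr (Dom M w))"
    using pullback_ex[OF P, of H "z \<cdot> (w \<cdot> pr (Dom M w))"] he by (auto simp: reassoc[OF e])
  have "K \<cdot> i0 (Dom M w) = w" by (rule pullback_eq[OF P]) (simp_all add: reassoc[OF Ke(1)] reassoc[OF Ke(2)] he)
  moreover have "K \<cdot> i1 (Dom M w) = w'" by (rule pullback_eq[OF P]) (simp_all add: reassoc[OF Ke(1)] reassoc[OF Ke(2)] he w(5))
  ultimately have "is_htpy z w w' K" using w(5) by (simp add: is_htpy_def Ke)
  then show ?thesis by (rule htpyI)
qed

text \<open>Homotopies of the two components agree in the base, where both are constant, so together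
  they define one into the fibre product.\<close>

lemma htpy_fibre_product:
  assumes P: "is_pullback M (f \<cdot> x) c p s" and x: "x \<in> Arr M" "f \<in> Arr M" "Cod M x = Dom M f"
    and w: "w \<in> Arr M" "w' \<in> Arr M" "Cod M w = Dom M c" "Cod M w' = Dom M c"
    and h: "htpy x (c \<cdot> w) (c \<cdot> w')" "htpy p (s \<cdot> w) (s \<cdot> w')"
  shows "htpy (x \<cdot> c) w w'"
proof -
  note [simp] = x w and P' = pullbackD[OF P, simplified]
  note [simp] = P'(2-8) and e = P'(9)
  obtain H where H: "is_htpy x (c \<cdot> w) (c \<cdot> w') H" using h by (auto simp: htpy_def)
  obtain K where K: "is_htpy p (s \<cdot> w) (s \<cdot> w') K" using h by (auto simp: htpy_def)
  have w3 [simp]: "Dom M w' = Dom M w" using is_htpyD(4)[OF H] by simp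
  note [simp] = is_htpyD(8-10)[OF H, simplified] is_htpyD(8-10)[OF K, simplified]
    and he = is_htpyD[OF H, simplified] and ke = is_htpyD[OF K, simplified]
  obtain L where L [simp]: "L \<in> Arr M" "Dom M L = cyl (Dom M w)" "Cod M L = Dom M c" and Le: "c \<cdot> L = H" "s \<cdot> L = K"
    using pullback_ex[OF P, of H K] he(13) ke(13) reassoc[OF e] by auto
  have "L \<cdot> i0 (Dom M w) = w" by (rule pullback_eq[OF P]) (simp_all add: reassoc[OF Le(1)] reassoc[OF Le(2)] he ke)
  moreover have "L \<cdot> i1 (Dom M w) = w'" by (rule pullback_eq[OF P]) (simp_all add: reassoc[OF Le(1)] reassoc[OF Le(2)] he ke)
  ultimately have "is_htpy (x \<cdot> c) w w' L" using he(7,13) by (simp add: is_htpy_def Le)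
  then show ?thesis by (rule htpyI)
qed

text \<open>The projections \<open>pr\<close> being cartesian, the cylinders of the summands are
  pullbacks of the cylinder of \<open>S\<close>. Coproducts are universal, so the latter is the
  coproduct of the former and the two homotopies can be copaired.\<close>

lemma htpy_coproduct:
  assumes S: "is_coproduct M P Q S i j" and w: "w \<in> Arr M" "w' \<in> Arr M" "Dom M w = S" "Dom M w' = S"
    and h: "htpy y (w \<cdot> i) (w' \<cdot> i)" "htpy y (w \<cdot> j) (w' \<cdot> j)"
  shows "htpy y w w'"
proof -
  note [simp] = coproductD[OF S] w
  have o [simp]: "S \<in> Obj M" "P \<in> Obj M" "Q \<in> Obj M" using dom_obj[of i] dom_obj[of j] cod_obj[of i] by simp_all
  obtain H where H: "is_htpy y (w \<cdot> i) (w' \<cdot> i) H" using h by (auto simp: htpy_def)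
  obtain K where K: "is_htpy y (w \<cdot> j) (w' \<cdot> j) K" using h by (auto simp: htpy_def)
  have w3 [simp]: "Cod M w = Dom M y" "Cod M w' = Dom M y" using is_htpyD(5,6)[OF H] by simp_all
  note [simp] = is_htpyD(1,8-10)[OF H, simplified] is_htpyD(8-10)[OF K, simplified]
    and he = is_htpyD[OF H, simplified] and ke = is_htpyD[OF K, simplified]
  obtain i' where I: "is_pullback M (pr S) i' i (pr P)" and [simp]: "i' \<in> Arr M" "Dom M i' = cyl P" "Cod M i' = cyl S"
    and i': "i' \<cdot> i0 P = i0 S \<cdot> i" "i' \<cdot> i1 P = i1 S \<cdot> i" "pr S \<cdot> i' = i \<cdot> pr P"
    using cyl_map_ex[of i P S] by auto
  obtain j' where J: "is_pullback M (pr S) j' j (pr Q)" and [simp]: "j' \<in> Arr M" "Dom M j' = cyl Q" "Cod M j' = cyl S"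
    and j': "j' \<cdot> i0 Q = i0 S \<cdot> j" "j' \<cdot> i1 Q = i1 S \<cdot> j" "pr S \<cdot> j' = j \<cdot> pr Q"
    using cyl_map_ex[of j Q S] by auto
  have C: "is_coproduct M (cyl P) (cyl Q) (cyl S) i' j'"
    using coproduct_pullback[OF S _ pullback_sym[OF I] pullback_sym[OF J]] by simp
  obtain L where L [simp]: "L \<in> Arr M" "Dom M L = cyl S" "Cod M L = Dom M y" and Le: "L \<cdot> i' = H" "L \<cdot> j' = K"
    using coproduct_ex[OF C, of H K] by auto
  have "y \<cdot> w = y \<cdot> w'" by (rule coproduct_eq[OF S]) (simp_all add: he ke)
  moreover have "L \<cdot> i0 S = w"
    by (rule coproduct_eq[OF S]) (simp_all add: i'(1,2)[symmetric] j'(1,2)[symmetric] reassoc[OF Le(1)] reassoc[OF Le(2)] he ke)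
  moreover have "L \<cdot> i1 S = w'"
    by (rule coproduct_eq[OF S]) (simp_all add: i'(1,2)[symmetric] j'(1,2)[symmetric] reassoc[OF Le(1)] reassoc[OF Le(2)] he ke)
  moreover have "y \<cdot> L = y \<cdot> (w \<cdot> pr S)"
    by (rule coproduct_eq[OF C]) (simp_all add: i' j' Le he ke)
  ultimately have "is_htpy y w w' L" by (simp add: is_htpy_def)
  then show ?thesis by (rule htpyI)
qed

text \<open>A homotopy between the arrows into \<open>p\<close> is transposed along \<open>f\<close>
  to one between their transposes; evaluation at the two ends is compatible with
  transposition.\<close>

lemma htpy_slice_Pi:
  assumes R: "slice_Pi M f p r c s e" and Q: "is_pullback M x c' f s'"
    and b: "base_change M r c s x c' s' u v" "base_change M r c s x c' s' u' v'" and h: "htpy p (e \<cdot> v) (e \<cdot> v')"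
  shows "htpy r u u'"
proof -
  note P = slice_PiD(1)[OF R]
  note [simp] = pullbackD(1-4,6-8)[OF P] pullbackD(5)[OF P, symmetric] slice_PiD(2-6)[OF R]
    pullbackD(1,3,4,6-8)[OF Q] pullbackD(5)[OF Q, symmetric] base_changeD(1-6)[OF b(1)] base_changeD(1-6)[OF b(2)]
    and b1 = base_changeD(7-9)[OF b(1)] and b2 = base_changeD(7-9)[OF b(2)] and pe = slice_PiD(7)[OF R]
  let ?X = "Dom M x" and ?S = "Dom M c'"
  obtain H where H: "is_htpy p (e \<cdot> v) (e \<cdot> v') H" using h by (auto simp: htpy_def)
  note [simp] = is_htpyD(8-10)[OF H, simplified] and he = is_htpyD[OF H, simplified]
  obtain d where D: "is_pullback M (pr ?X) d c' (pr ?S)" and [simp]: "d \<in> Arr M" "Dom M d = cyl ?S" "Cod M d = cyl ?X"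
    and d: "d \<cdot> i0 ?S = i0 ?X \<cdot> c'" "d \<cdot> i1 ?S = i1 ?X \<cdot> c'" "pr ?X \<cdot> d = c' \<cdot> pr ?S"
    using cyl_map_ex[of c' ?S ?X] by auto
  \<comment> \<open>The cylinder of the pullback of \<open>x\<close> along \<open>f\<close> is the
    pullback of the cylinder of \<open>x\<close>; this is what allows \<open>H\<close> to be
    transposed.\<close>
  have PQ: "is_pullback M (x \<cdot> pr ?X) d f (s' \<cdot> pr ?S)"
    by (rule pullback_sym, rule pullback_paste[OF pullback_sym[OF Q] pullback_sym[OF D]])
  have "p \<cdot> H = s' \<cdot> pr ?S" by (simp add: he(13) reassoc[OF pe] reassoc[OF b1(3)])
  then obtain k l where kl: "base_change M r c s (x \<cdot> pr ?X) d (s' \<cdot> pr ?S) k l" and le: "e \<cdot> l = H"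
    using slice_Pi_ex[OF R PQ, of H] by auto
  note [simp] = base_changeD(1-6)[OF kl, simplified] and kl1 = base_changeD(7-9)[OF kl]
  have "k \<cdot> i0 ?X = u"
    by (rule slice_Pi_eq[OF R Q _ b(1), of _ "l \<cdot> i0 ?S"])
      (simp_all add: base_change_def reassoc[OF kl1(1)] reassoc[OF kl1(2)] reassoc[OF kl1(3)] reassoc[OF le] d he)
  moreover have "k \<cdot> i1 ?X = u'"
    by (rule slice_Pi_eq[OF R Q _ b(2), of _ "l \<cdot> i1 ?S"])
      (simp_all add: base_change_def reassoc[OF kl1(1)] reassoc[OF kl1(2)] reassoc[OF kl1(3)] reassoc[OF le] d he)
  ultimately have "is_htpy r u u' k" by (simp add: is_htpy_def kl1 b1 b2 reassoc[OF b1(1)])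
  then show ?thesis by (rule htpyI)
qed

end

lemma (in suitable_model_category) trivial_cylinder: "cylinder M (\<lambda>X. X) (Idt M) (Idt M) (Idt M)"
proof unfold_locales
  fix s assume "s \<in> Arr M"
  then show "\<exists>s'. is_pullback M (Idt M (Cod M s)) s' s (Idt M (Dom M s)) \<and>
      s' \<cdot> Idt M (Dom M s) = Idt M (Cod M s) \<cdot> s \<and> s' \<cdot> Idt M (Dom M s) = Idt M (Cod M s) \<cdot> s"
    using pullback_sym[OF pullback_idt[of s]] by (intro exI[of _ s]) simp
qed simp_all

text \<open>\<open>cyl_lift\<close> says that the copair of \<open>i0 X\<close> and
  \<open>i1 X\<close> is a cofibration, expressed through its lifting property so that no coproduct
  \<open>X + X\<close> has to be chosen.\<close>

locale interval_cylinder = cylinder M cyl pr i0 i1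
  for M :: "('o, 'a) model_cat" (structure) and cyl :: "'o \<Rightarrow> 'o" and pr i0 i1 :: "'o \<Rightarrow> 'a" +
  assumes pr_acyclic: "X \<in> Obj M \<Longrightarrow> pr X \<in> Fib M" "X \<in> Obj M \<Longrightarrow> pr X \<in> WE M"
    and cyl_lift: "X \<in> Obj M \<Longrightarrow> p \<in> Fib M \<Longrightarrow> p \<in> WE M \<Longrightarrow> a0 \<in> Arr M \<Longrightarrow> a1 \<in> Arr M \<Longrightarrow> b \<in> Arr M \<Longrightarrow>
      Dom M a0 = X \<Longrightarrow> Dom M a1 = X \<Longrightarrow> Cod M a0 = Dom M p \<Longrightarrow> Cod M a1 = Dom M p \<Longrightarrow>
      Dom M b = cyl X \<Longrightarrow> Cod M b = Cod M p \<Longrightarrow> p \<cdot> a0 = b \<cdot> i0 X \<Longrightarrow> p \<cdot> a1 = b \<cdot> i1 X \<Longrightarrow>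
      \<exists>k. k \<in> Arr M \<and> Dom M k = cyl X \<and> Cod M k = Dom M p \<and> k \<cdot> i0 X = a0 \<and> k \<cdot> i1 X = a1 \<and> p \<cdot> k = b"

lemma (in suitable_model_category) interval_cylinder_exists: "\<exists>cyl pr i0 i1. interval_cylinder M cyl pr i0 i1"
proof -
  obtain T where T: "is_terminal M T" using terminal_exists by blast
  have [simp]: "T \<in> Obj M" using terminal_obj[OF T] .
  obtain T2 j0 j1 where T2: "is_coproduct M T T T2 j0 j1" using coproduct_exists[of T T] by auto
  note [simp] = coproductD[OF T2]
  have [simp]: "T2 \<in> Obj M" using cod_obj[of j0] by simp
  obtain u where u: "u \<in> Arr M" "Dom M u = T2" "Cod M u = T" using terminal_map[OF T, of T2] by auto
  \<comment> \<open>The interval is the middle object of a factorization of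
    \<open>1 + 1 \<rightarrow> 1\<close> into a cofibration and an acyclic fibration.\<close>
  obtain i p where i: "i \<in> Cof M" and p: "p \<in> Fib M" "p \<in> WE M" and ip: "i \<in> Arr M" "Dom M i = T2" "Cod M i = Dom M p" "Cod M p = T"
    using factor_af[OF u(1)] u by metis
  note [simp] = ip
  have [simp]: "p \<in> Arr M" using p by simp
  let ?I = "Dom M p"
  \<comment> \<open>A product of the interval with each object, with its projections, is chosen
    simultaneously; nothing is claimed off \<open>Obj M\<close>.\<close>
  have "\<forall>X. \<exists>R. X \<in> Obj M \<longrightarrow> (case R of (R, q, r) \<Rightarrow> is_product M ?I X R q r)"
  proof
    fix X show "\<exists>R. X \<in> Obj M \<longrightarrow> (case R of (R, q, r) \<Rightarrow> is_product M ?I X R q r)"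
      using product_exists[of ?I X] by (cases "X \<in> Obj M") auto
  qed
  then obtain F where F: "\<And>X. X \<in> Obj M \<Longrightarrow> (case F X of (R, q, r) \<Rightarrow> is_product M ?I X R q r)" by metis
  define cyl where "cyl X = fst (F X)" for X
  define q where "q X = fst (snd (F X))" for X
  define pr where "pr X = snd (snd (F X))" for X
  have P: "is_product M ?I X (cyl X) (q X) (pr X)" if "X \<in> Obj M" for X
    using F[OF that] by (simp add: cyl_def q_def pr_def split_beta)
  have [simp]: "q X \<in> Arr M" "Dom M (q X) = cyl X" "Cod M (q X) = ?I" "pr X \<in> Arr M" "Dom M (pr X) = cyl X" "Cod M (pr X) = X"
    if "X \<in> Obj M" for X using productD[OF P[OF that]] by simp_all
  have "\<forall>X. \<exists>t. X \<in> Obj M \<longrightarrow> t \<in> Arr M \<and> Dom M t = X \<and> Cod M t = T" using terminal_map[OF T] by auto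
  then obtain t where t [simp]: "\<And>X. X \<in> Obj M \<Longrightarrow> t X \<in> Arr M" "\<And>X. X \<in> Obj M \<Longrightarrow> Dom M (t X) = X" "\<And>X. X \<in> Obj M \<Longrightarrow> Cod M (t X) = T"
    by metis
  have ts: "t (Cod M s) \<cdot> s = t (Dom M s)" if "s \<in> Arr M" for s
    by (rule terminal_eq[OF T]) (use that in simp_all)
  \<comment> \<open>The end inclusions are the identity of \<open>X\<close> paired with a constant
    map to one of the two end points of the interval.\<close>
  have end_ex: "\<exists>e. \<forall>X. X \<in> Obj M \<longrightarrow> e X \<in> Arr M \<and> Dom M (e X) = X \<and> Cod M (e X) = cyl X \<and> q X \<cdot> e X = i \<cdot> (j \<cdot> t X) \<and>
    pr X \<cdot> e X = Idt M X" if [simp]: "j \<in> Arr M" "Dom M j = T" "Cod M j = T2" for j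
  proof -
    have "\<exists>e. X \<in> Obj M \<longrightarrow> e \<in> Arr M \<and> Dom M e = X \<and> Cod M e = cyl X \<and> q X \<cdot> e = i \<cdot> (j \<cdot> t X) \<and> pr X \<cdot> e = Idt M X" for X
      using product_ex[OF P, of X "i \<cdot> (j \<cdot> t X)" "Idt M X"] by (cases "X \<in> Obj M") auto
    then show ?thesis by metis
  qed
  obtain i0 where i0 [simp]: "\<And>X. X \<in> Obj M \<Longrightarrow> i0 X \<in> Arr M" "\<And>X. X \<in> Obj M \<Longrightarrow> Dom M (i0 X) = X"
    "\<And>X. X \<in> Obj M \<Longrightarrow> Cod M (i0 X) = cyl X" "\<And>X. X \<in> Obj M \<Longrightarrow> q X \<cdot> i0 X = i \<cdot> (j0 \<cdot> t X)" "\<And>X. X \<in> Obj M \<Longrightarrow> pr X \<cdot> i0 X = Idt M X"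
    using end_ex[of j0] by auto
  obtain i1 where i1 [simp]: "\<And>X. X \<in> Obj M \<Longrightarrow> i1 X \<in> Arr M" "\<And>X. X \<in> Obj M \<Longrightarrow> Dom M (i1 X) = X"
    "\<And>X. X \<in> Obj M \<Longrightarrow> Cod M (i1 X) = cyl X" "\<And>X. X \<in> Obj M \<Longrightarrow> q X \<cdot> i1 X = i \<cdot> (j1 \<cdot> t X)" "\<And>X. X \<in> Obj M \<Longrightarrow> pr X \<cdot> i1 X = Idt M X"
    using end_ex[of j1] by auto
  have "interval_cylinder M cyl pr i0 i1"
  proof unfold_locales
    fix s assume s [simp]: "s \<in> Arr M"
    let ?X = "Dom M s" and ?Y = "Cod M s"
    have PX: "is_product M ?I ?X (cyl ?X) (q ?X) (pr ?X)" and PY: "is_product M ?I ?Y (cyl ?Y) (q ?Y) (pr ?Y)" using P by simp_all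
    obtain s' where s' [simp]: "s' \<in> Arr M" "Dom M s' = cyl ?X" "Cod M s' = cyl ?Y" and e: "q ?Y \<cdot> s' = q ?X" "pr ?Y \<cdot> s' = s \<cdot> pr ?X"
      using product_ex[OF PY, of "q ?X" "s \<cdot> pr ?X"] by auto
    \<comment> \<open>\<open>s'\<close> is the product of the interval with \<open>s\<close>, and a
      square between projections from products with a fixed object is a pullback.\<close>
    have "is_pullback M (pr ?Y) s' s (pr ?X)"
    proof (rule pullbackI)
      fix a b assume ab [simp]: "a \<in> Arr M" "b \<in> Arr M" "Dom M a = Dom M b" "Cod M a = Dom M (pr ?Y)" "Cod M b = Dom M s" and abe: "pr ?Y \<cdot> a = s \<cdot> b"
      obtain u where u [simp]: "u \<in> Arr M" "Dom M u = Dom M b" "Cod M u = cyl ?X" and ue: "q ?X \<cdot> u = q ?Y \<cdot> a" "pr ?X \<cdot> u = b"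
        using product_ex[OF PX, of "q ?Y \<cdot> a" b] by auto
      have "s' \<cdot> u = a" by (rule product_eq[OF PY]) (simp_all add: reassoc[OF e(1)] reassoc[OF e(2)] ue abe)
      then show "\<exists>u. u \<in> Arr M \<and> Dom M u = Dom M b \<and> Cod M u = Dom M s' \<and> s' \<cdot> u = a \<and> pr ?X \<cdot> u = b"
        using ue by (intro exI[of _ u]) simp
    next
      fix u v assume uv [simp]: "u \<in> Arr M" "v \<in> Arr M" "Dom M u = Dom M v" "Cod M u = Dom M s'" "Cod M v = Dom M s'"
        and uve: "s' \<cdot> u = s' \<cdot> v" "pr ?X \<cdot> u = pr ?X \<cdot> v"
      have "q ?Y \<cdot> (s' \<cdot> u) = q ?Y \<cdot> (s' \<cdot> v)" using uve by simp
      then have "q ?X \<cdot> u = q ?X \<cdot> v" by (simp add: reassoc[OF e(1)])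
      then show "u = v" using uve by - (rule product_eq[OF PX], simp_all)
    qed (simp_all add: e)
    moreover have "s' \<cdot> i0 ?X = i0 ?Y \<cdot> s"
      by (rule product_eq[OF PY]) (simp_all add: reassoc[OF e(1)] reassoc[OF e(2)] reassoc[OF i0(4)] reassoc[OF i0(5)] ts)
    moreover have "s' \<cdot> i1 ?X = i1 ?Y \<cdot> s"
      by (rule product_eq[OF PY]) (simp_all add: reassoc[OF e(1)] reassoc[OF e(2)] reassoc[OF i1(4)] reassoc[OF i1(5)] ts)
    ultimately show "\<exists>s'. is_pullback M (pr ?Y) s' s (pr ?X) \<and> s' \<cdot> i0 ?X = i0 ?Y \<cdot> s \<and> s' \<cdot> i1 ?X = i1 ?Y \<cdot> s" by blast
  next
    fix X assume X [simp]: "X \<in> Obj M"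
    show "pr X \<in> Fib M" "pr X \<in> WE M"
      using acyclic_fib_pullback[OF product_pullback_terminal[OF P[OF X] T, of p "t X"] p] by simp_all
    fix g a0 a1 b assume g: "g \<in> Fib M" "g \<in> WE M" and a [simp]: "a0 \<in> Arr M" "a1 \<in> Arr M" "b \<in> Arr M"
      "Dom M a0 = X" "Dom M a1 = X" "Cod M a0 = Dom M g" "Cod M a1 = Dom M g" "Dom M b = cyl X" "Cod M b = Cod M g"
      and ae: "g \<cdot> a0 = b \<cdot> i0 X" "g \<cdot> a1 = b \<cdot> i1 X"
    have [simp]: "g \<in> Arr M" using g by simp
    \<comment> \<open>\<open>E\<close> stands for \<open>(1 + 1) \<times> X\<close>, and
      \<open>m\<close> below for the product of \<open>i\<close> with \<open>X\<close>. As a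
      pullback of \<open>i\<close>, \<open>m\<close> is a cofibration.\<close>
    obtain E a' b' where E: "is_product M T2 X E a' b'" using product_exists[of T2 X] by auto
    note [simp] = productD[OF E]
    obtain m where m [simp]: "m \<in> Arr M" "Dom M m = E" "Cod M m = cyl X" and me: "q X \<cdot> m = i \<cdot> a'" "pr X \<cdot> m = b'"
      using product_ex[OF P[OF X], of "i \<cdot> a'" b'] by auto
    have mi: "is_pullback M i a' (q X) m"
    proof (rule pullbackI)
      fix g h assume gh [simp]: "g \<in> Arr M" "h \<in> Arr M" "Dom M g = Dom M h" "Cod M g = Dom M i" "Cod M h = Dom M (q X)" and ghe: "i \<cdot> g = q X \<cdot> h"
      obtain u where u [simp]: "u \<in> Arr M" "Dom M u = Dom M h" "Cod M u = E" and ue: "a' \<cdot> u = g" "b' \<cdot> u = pr X \<cdot> h"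
        using product_ex[OF E, of g "pr X \<cdot> h"] by auto
      have "m \<cdot> u = h" by (rule product_eq[OF P[OF X]]) (simp_all add: reassoc[OF me(1)] reassoc[OF me(2)] ue ghe)
      then show "\<exists>u. u \<in> Arr M \<and> Dom M u = Dom M h \<and> Cod M u = Dom M a' \<and> a' \<cdot> u = g \<and> m \<cdot> u = h"
        using ue by (intro exI[of _ u]) simp
    next
      fix u v assume uv [simp]: "u \<in> Arr M" "v \<in> Arr M" "Dom M u = Dom M v" "Cod M u = Dom M a'" "Cod M v = Dom M a'"
        and uve: "a' \<cdot> u = a' \<cdot> v" "m \<cdot> u = m \<cdot> v"
      have "pr X \<cdot> (m \<cdot> u) = pr X \<cdot> (m \<cdot> v)" using uve by simp
      then have "b' \<cdot> u = b' \<cdot> v" by (simp add: reassoc[OF me(2)])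
      then show "u = v" using uve by - (rule product_eq[OF E], simp_all)
    qed (simp_all add: me)
    have mc: "m \<in> Cof M" using mono_pullback[OF _ mi] i cof_iff_mono by blast
    \<comment> \<open>The two copies of \<open>X\<close> in \<open>E\<close> are the pullbacks of
      the two points of \<open>1 + 1\<close>, so that universality of coproducts identifies
      \<open>E\<close> with \<open>X + X\<close>.\<close>
    have end_pb: "\<exists>k. is_pullback M j (t X) a' k \<and> k \<in> Arr M \<and> Dom M k = X \<and> Cod M k = E \<and> a' \<cdot> k = j \<cdot> t X \<and> b' \<cdot> k = Idt M X"
      if [simp]: "j \<in> Arr M" "Dom M j = T" "Cod M j = T2" for j
    proof -
      obtain k where k [simp]: "k \<in> Arr M" "Dom M k = X" "Cod M k = E" and ke: "a' \<cdot> k = j \<cdot> t X" "b' \<cdot> k = Idt M X"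
        using product_ex[OF E, of "j \<cdot> t X" "Idt M X"] by auto
      have "is_pullback M j (t X) a' k"
      proof (rule pullbackI)
        fix g h assume gh [simp]: "g \<in> Arr M" "h \<in> Arr M" "Dom M g = Dom M h" "Cod M g = Dom M j" "Cod M h = Dom M a'" and ghe: "j \<cdot> g = a' \<cdot> h"
        have tg: "t X \<cdot> (b' \<cdot> h) = g" by (rule terminal_eq[OF T]) simp_all
        have "k \<cdot> (b' \<cdot> h) = h" by (rule product_eq[OF E]) (simp_all add: reassoc[OF ke(1)] reassoc[OF ke(2)] tg ghe)
        then show "\<exists>u. u \<in> Arr M \<and> Dom M u = Dom M h \<and> Cod M u = Dom M (t X) \<and> t X \<cdot> u = g \<and> k \<cdot> u = h"
          using tg by (intro exI[of _ "b' \<cdot> h"]) simp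
      next
        fix u v assume uv [simp]: "u \<in> Arr M" "v \<in> Arr M" "Dom M u = Dom M v" "Cod M u = Dom M (t X)" "Cod M v = Dom M (t X)"
          and uve: "t X \<cdot> u = t X \<cdot> v" "k \<cdot> u = k \<cdot> v"
        have "b' \<cdot> (k \<cdot> u) = b' \<cdot> (k \<cdot> v)" using uve by simp
        then show "u = v" by (simp add: reassoc[OF ke(2)])
      qed (simp_all add: ke)
      then show ?thesis using ke by (intro exI[of _ k]) simp
    qed
    obtain k0 where K0: "is_pullback M j0 (t X) a' k0" and [simp]: "k0 \<in> Arr M" "Dom M k0 = X" "Cod M k0 = E"
      and k0: "a' \<cdot> k0 = j0 \<cdot> t X" "b' \<cdot> k0 = Idt M X" using end_pb[of j0] by auto
    obtain k1 where K1: "is_pullback M j1 (t X) a' k1" and [simp]: "k1 \<in> Arr M" "Dom M k1 = X" "Cod M k1 = E"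
      and k1: "a' \<cdot> k1 = j1 \<cdot> t X" "b' \<cdot> k1 = Idt M X" using end_pb[of j1] by auto
    have C: "is_coproduct M X X E k0 k1" using coproduct_pullback[OF T2 _ K0 K1] by simp
    obtain w where w [simp]: "w \<in> Arr M" "Dom M w = E" "Cod M w = Dom M g" and we: "w \<cdot> k0 = a0" "w \<cdot> k1 = a1"
      using coproduct_ex[OF C, of a0 a1] by auto
    have mk: "m \<cdot> k0 = i0 X" "m \<cdot> k1 = i1 X"
      by (rule product_eq[OF P[OF X]], simp_all add: reassoc[OF me(1)] reassoc[OF me(2)] k0 k1)+
    \<comment> \<open>The prescribed values at both ends form one square from the cofibration
      \<open>m\<close> to the acyclic fibration \<open>g\<close>.\<close>
    have "g \<cdot> w = b \<cdot> m" by (rule coproduct_eq[OF C]) (simp_all add: we ae mk)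
    then obtain k where k [simp]: "k \<in> Arr M" "Dom M k = cyl X" "Cod M k = Dom M g" and ke: "k \<cdot> m = w" "g \<cdot> k = b"
      using lift_af[OF mc g, of w b] by auto
    have "k \<cdot> (m \<cdot> k0) = a0" "k \<cdot> (m \<cdot> k1) = a1" by (simp_all add: reassoc[OF ke(1)] we)
    then show "\<exists>k. k \<in> Arr M \<and> Dom M k = cyl X \<and> Cod M k = Dom M g \<and> k \<cdot> i0 X = a0 \<and> k \<cdot> i1 X = a1 \<and> g \<cdot> k = b"
      using ke by (intro exI[of _ k]) (simp add: mk)
  qed simp_all
  then show ?thesis by blast
qed

section \<open>The localization at the vertical weak equivalences\<close>

context interval_cylinder
begin

text \<open>\<open>pr X\<close> is a retraction of \<open>i0 X\<close>, which makes it monic, and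
  two-out-of-three makes it a weak equivalence.\<close>

lemma i0_acyclic_cof:
  assumes [simp]: "X \<in> Obj M"
  shows "i0 X \<in> Cof M" "i0 X \<in> WE M"
proof -
  have "is_mono M (i0 X)"
  proof (rule monoI)
    fix g h assume gh [simp]: "g \<in> Arr M" "h \<in> Arr M" "Dom M g = Dom M h" "Cod M g = Dom M (i0 X)" "Cod M h = Dom M (i0 X)"
      and e: "i0 X \<cdot> g = i0 X \<cdot> h"
    have "pr X \<cdot> (i0 X \<cdot> g) = pr X \<cdot> (i0 X \<cdot> h)" using e by simp
    then show "g = h" by simp
  qed simp
  then show "i0 X \<in> Cof M" by (simp add: cof_iff_mono)
  have "pr X \<cdot> i0 X \<in> WE M" by (simp add: iso_we iso_idt)
  then show "i0 X \<in> WE M" using we_cancel_right[of "i0 X" "pr X"] pr_acyclic(2)[of X] by simp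
qed

text \<open>A path object of \<open>y\<close> over its base: \<open>c\<close> is the inclusion of
  constant paths, \<open>p\<close> and \<open>q\<close> are the ends. The last clause says that the
  pair of ends is a fibration onto the fibre product of \<open>y\<close> with itself, through
  lifting and without naming that product.\<close>

definition is_path_object :: "'a \<Rightarrow> 'a \<Rightarrow> 'a \<Rightarrow> 'a \<Rightarrow> bool" where
  "is_path_object y c p q \<longleftrightarrow> c \<in> Arr M \<and> p \<in> Arr M \<and> q \<in> Arr M \<and> Dom M c = Dom M y \<and> Cod M c = Dom M p \<and>
    Dom M q = Dom M p \<and> Cod M p = Dom M y \<and> Cod M q = Dom M y \<and> p \<cdot> c = Idt M (Dom M y) \<and> q \<cdot> c = Idt M (Dom M y) \<and>
    p \<in> Fib M \<and> p \<in> WE M \<and> y \<cdot> p = y \<cdot> q \<and>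
    (\<forall>i a b d. i \<in> Cof M \<and> i \<in> WE M \<and> a \<in> Arr M \<and> b \<in> Arr M \<and> d \<in> Arr M \<and> Dom M a = Dom M i \<and>
      Cod M a = Dom M p \<and> Dom M b = Cod M i \<and> Dom M d = Cod M i \<and> Cod M b = Dom M y \<and> Cod M d = Dom M y \<and>
      y \<cdot> b = y \<cdot> d \<and> p \<cdot> a = b \<cdot> i \<and> q \<cdot> a = d \<cdot> i \<longrightarrow>
      (\<exists>l. l \<in> Arr M \<and> Dom M l = Cod M i \<and> Cod M l = Dom M p \<and> l \<cdot> i = a \<and> p \<cdot> l = b \<and> q \<cdot> l = d))"

lemma path_object_exists:
  assumes y: "y \<in> Fib M"
  shows "\<exists>c p q. is_path_object y c p q"
proof -
  have [simp]: "y \<in> Arr M" using y by simp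
  obtain a b where P: "is_pullback M y a y b" using pullback_exists[of y y] by auto
  note [simp] = pullbackD(3,4,6-8)[OF P] and e = pullbackD(9)[OF P]
  obtain d where d [simp]: "d \<in> Arr M" "Dom M d = Dom M y" "Cod M d = Dom M a" and de: "a \<cdot> d = Idt M (Dom M y)" "b \<cdot> d = Idt M (Dom M y)"
    using pullback_ex[OF P, of "Idt M (Dom M y)" "Idt M (Dom M y)"] by auto
  obtain c g where c: "c \<in> Cof M" "c \<in> WE M" and g: "g \<in> Fib M" and cg: "c \<in> Arr M" "Dom M c = Dom M y" "Cod M c = Dom M g"
    "Cod M g = Dom M a" and gc: "g \<cdot> c = d"
    using factor_ac[OF d(1)] d by metis
  note [simp] = cg
  have [simp]: "g \<in> Arr M" using g by simp
  have ac: "(a \<cdot> g) \<cdot> c = Idt M (Dom M y)" "(b \<cdot> g) \<cdot> c = Idt M (Dom M y)" by (simp_all add: gc de)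
  have af: "a \<cdot> g \<in> Fib M" using fib_comp[OF g fib_pullback[OF pullback_sym[OF P] y]] by simp
  \<comment> \<open>The end projection has the acyclic \<open>c\<close> as a section, so
    two-out-of-three applies.\<close>
  have aw: "a \<cdot> g \<in> WE M"
    by (rule we_cancel_left[of c]) (use ac(1) c in \<open>simp_all add: iso_we iso_idt\<close>)
  have "is_path_object y c (a \<cdot> g) (b \<cdot> g)" unfolding is_path_object_def
  proof (intro conjI allI impI)
    fix i k u v assume "i \<in> Cof M \<and> i \<in> WE M \<and> k \<in> Arr M \<and> u \<in> Arr M \<and> v \<in> Arr M \<and> Dom M k = Dom M i \<and>
      Cod M k = Dom M (a \<cdot> g) \<and> Dom M u = Cod M i \<and> Dom M v = Cod M i \<and> Cod M u = Dom M y \<and> Cod M v = Dom M y \<and>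
      y \<cdot> u = y \<cdot> v \<and> a \<cdot> g \<cdot> k = u \<cdot> i \<and> b \<cdot> g \<cdot> k = v \<cdot> i"
    then have i: "i \<in> Cof M" "i \<in> WE M" and k [simp]: "k \<in> Arr M" "u \<in> Arr M" "v \<in> Arr M" "Dom M k = Dom M i"
      "Cod M k = Dom M g" "Dom M u = Cod M i" "Dom M v = Cod M i" "Cod M u = Dom M y" "Cod M v = Dom M y"
      and ke: "y \<cdot> u = y \<cdot> v" "a \<cdot> (g \<cdot> k) = u \<cdot> i" "b \<cdot> (g \<cdot> k) = v \<cdot> i" by auto
    have [simp]: "i \<in> Arr M" using i by (simp add: cof_simp)
    obtain w where w [simp]: "w \<in> Arr M" "Dom M w = Cod M i" "Cod M w = Dom M a" and we: "a \<cdot> w = u" "b \<cdot> w = v"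
      using pullback_ex[OF P, of u v] ke by auto
    have "g \<cdot> k = w \<cdot> i" by (rule pullback_eq[OF P]) (simp_all add: ke reassoc[OF we(1)] reassoc[OF we(2)])
    then obtain l where "l \<in> Arr M" "Dom M l = Cod M i" "Cod M l = Dom M g" "l \<cdot> i = k" "g \<cdot> l = w"
      using lift_ac[OF i g, of k w] by auto
    then show "\<exists>l. l \<in> Arr M \<and> Dom M l = Cod M i \<and> Cod M l = Dom M (a \<cdot> g) \<and> l \<cdot> i = k \<and> (a \<cdot> g) \<cdot> l = u \<and> (b \<cdot> g) \<cdot> l = v"
      by (intro exI[of _ l]) (simp add: we)
  qed (use ac af aw in \<open>simp_all add: reassoc[OF e]\<close>)
  then show ?thesis by blast
qed

lemma path_objectD:
  assumes "is_path_object y c p q"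
  shows "c \<in> Arr M" "p \<in> Arr M" "q \<in> Arr M" "Dom M c = Dom M y" "Cod M c = Dom M p"
    "Dom M q = Dom M p" "Cod M p = Dom M y" "Cod M q = Dom M y" "p \<cdot> c = Idt M (Dom M y)" "q \<cdot> c = Idt M (Dom M y)"
    "p \<in> Fib M" "p \<in> WE M" "y \<cdot> p = y \<cdot> q"
  using assms unfolding is_path_object_def by blast+

lemma path_object_lift:
  assumes "is_path_object y c p q" "i \<in> Cof M" "i \<in> WE M" "a \<in> Arr M" "b \<in> Arr M" "d \<in> Arr M" "Dom M a = Dom M i"
      "Cod M a = Dom M p" "Dom M b = Cod M i" "Dom M d = Cod M i" "Cod M b = Dom M y" "Cod M d = Dom M y"
      "y \<cdot> b = y \<cdot> d" "p \<cdot> a = b \<cdot> i" "q \<cdot> a = d \<cdot> i"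
  shows "\<exists>l. l \<in> Arr M \<and> Dom M l = Cod M i \<and> Cod M l = Dom M p \<and> l \<cdot> i = a \<and> p \<cdot> l = b \<and> q \<cdot> l = d"
  using assms unfolding is_path_object_def by blast

text \<open>Lift the cylinder homotopy along the acyclic cofibration \<open>i0\<close> into the path
  object, starting from \<open>k\<close> and keeping the second end at \<open>t''\<close>; the other
  end of the lift is the required path. A constant \<open>k\<close> converts cylinder homotopies
  into path homotopies, a general one composes them.\<close>

lemma right_htpy_step:
  assumes P: "is_path_object y c p q" and h: "htpy y t' t" and k: "k \<in> Arr M" "Cod M k = Dom M p" "p \<cdot> k = t'" "q \<cdot> k = t''"
  shows "\<exists>l. l \<in> Arr M \<and> Dom M l = Dom M t \<and> Cod M l = Dom M p \<and> p \<cdot> l = t \<and> q \<cdot> l = t''"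
proof -
  obtain H where H: "is_htpy y t' t H" using h by (auto simp: htpy_def)
  note [simp] = path_objectD(1-8)[OF P] k(1,2) is_htpyD(1-6,8-10)[OF H]
  have d: "Dom M t' = Dom M k" using k(3) by auto
  have t'' [simp]: "t'' \<in> Arr M" "Dom M t'' = Dom M k" "Cod M t'' = Dom M y" using k(4) by auto
  note [simp] = d
  note he = is_htpyD[OF H, simplified]
  have "y \<cdot> (p \<cdot> k) = y \<cdot> (q \<cdot> k)" by (simp add: reassoc[OF path_objectD(13)[OF P]])
  then have yt: "y \<cdot> t' = y \<cdot> t''" by (simp add: k)
  obtain l where [simp]: "l \<in> Arr M" "Dom M l = cyl (Dom M k)" "Cod M l = Dom M p" and l: "p \<cdot> l = H" "q \<cdot> l = t'' \<cdot> pr (Dom M k)"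
    using path_object_lift[OF P i0_acyclic_cof[of "Dom M k"], of k H "t'' \<cdot> pr (Dom M k)"]
    by (auto simp: he k reassoc[OF yt])
  have "p \<cdot> (l \<cdot> i1 (Dom M k)) = t" "q \<cdot> (l \<cdot> i1 (Dom M k)) = t''"
    by (simp_all add: reassoc[OF l(1)] reassoc[OF l(2)] he)
  then show ?thesis by (intro exI[of _ "l \<cdot> i1 (Dom M k)"]) simp
qed

text \<open>Since \<open>p\<close> is an acyclic fibration, the constant path at \<open>t\<close>
  can be joined to \<open>k\<close> through paths with first end \<open>t\<close>. Following the
  second end yields a homotopy on the cylinder.\<close>

lemma right_htpy_left:
  assumes P: "is_path_object y c p q" and y: "y \<in> Arr M" and k: "k \<in> Arr M" "Cod M k = Dom M p" "p \<cdot> k = t" "q \<cdot> k = t'"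
  shows "htpy y t t'"
proof -
  note [simp] = path_objectD(1-8)[OF P] k(1,2) y and e = path_objectD(9-13)[OF P]
  let ?X = "Dom M k"
  have t [simp]: "t \<in> Arr M" "Dom M t = ?X" "Cod M t = Dom M y" "t' \<in> Arr M" "Dom M t' = ?X" "Cod M t' = Dom M y" using k(3,4) by auto
  \<comment> \<open>\<open>l\<close> runs from the constant path \<open>c \<cdot> t\<close> to
    \<open>k\<close>, over the constant homotopy of \<open>t\<close>.\<close>
  obtain l where [simp]: "l \<in> Arr M" "Dom M l = cyl ?X" "Cod M l = Dom M p" and l: "l \<cdot> i0 ?X = c \<cdot> t" "l \<cdot> i1 ?X = k" "p \<cdot> l = t \<cdot> pr ?X"
    using cyl_lift[of ?X p "c \<cdot> t" k "t \<cdot> pr ?X"] e by (auto simp: reassoc[OF e(1)] k)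
  have "y \<cdot> (p \<cdot> k) = y \<cdot> (q \<cdot> k)" by (simp add: reassoc[OF e(5)])
  then have yt: "y \<cdot> t = y \<cdot> t'" by (simp add: k)
  have "y \<cdot> (q \<cdot> l) = y \<cdot> (p \<cdot> l)" by (simp only: reassoc[OF e(5)] y path_objectD(1-8)[OF P] \<open>l \<in> Arr M\<close> \<open>Cod M l = Dom M p\<close>, simp)
  then have "is_htpy y t t' (q \<cdot> l)"
    by (simp add: is_htpy_def yt l k reassoc[OF e(2)])
  then show ?thesis by (rule htpyI)
qed

text \<open>\<open>right_htpy_step\<close> starting from the constant path at \<open>t\<close>. The
  resulting path runs from \<open>t'\<close> to \<open>t\<close>, which is exactly the reversal that
  symmetry needs.\<close>

lemma htpy_right:
  assumes P: "is_path_object y c p q" and h: "htpy y t t'"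
  shows "\<exists>k. k \<in> Arr M \<and> Dom M k = Dom M t \<and> Cod M k = Dom M p \<and> p \<cdot> k = t' \<and> q \<cdot> k = t"
proof -
  obtain H where H: "is_htpy y t t' H" using h by (auto simp: htpy_def)
  note [simp] = path_objectD(1-8)[OF P] is_htpyD(1-6)[OF H] and e = path_objectD(9-10)[OF P]
  show ?thesis using right_htpy_step[OF P h, of "c \<cdot> t" t] by (simp add: reassoc[OF e(1)] reassoc[OF e(2)])
qed

lemma htpyD:
  assumes "htpy y t t'"
  shows "y \<in> Arr M" "t \<in> Arr M" "t' \<in> Arr M" "Dom M t' = Dom M t" "Cod M t = Dom M y" "Cod M t' = Dom M y" "y \<cdot> t = y \<cdot> t'"
proof -
  obtain H where H: "is_htpy y t t' H" using assms by (auto simp: htpy_def)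
  show "y \<in> Arr M" "t \<in> Arr M" "t' \<in> Arr M" "Dom M t' = Dom M t" "Cod M t = Dom M y" "Cod M t' = Dom M y" "y \<cdot> t = y \<cdot> t'"
    by (rule is_htpyD[OF H])+
qed

lemma htpy_sym:
  assumes y: "y \<in> Fib M" and h: "htpy y t t'"
  shows "htpy y t' t"
proof -
  obtain c p q where P: "is_path_object y c p q" using path_object_exists[OF y] by blast
  show ?thesis using htpy_right[OF P h] right_htpy_left[OF P htpyD(1)[OF h]] by blast
qed

text \<open>One homotopy is turned into a path, to which the other is composed by
  \<open>right_htpy_step\<close>; symmetry puts both in the directions required.\<close>

lemma htpy_trans:
  assumes y: "y \<in> Fib M" and h: "htpy y t t'" and h': "htpy y t' t''"
  shows "htpy y t t''"
proof -
  obtain c p q where P: "is_path_object y c p q" using path_object_exists[OF y] by blast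
  obtain k where "k \<in> Arr M" "Cod M k = Dom M p" "p \<cdot> k = t'" "q \<cdot> k = t''"
    using htpy_right[OF P htpy_sym[OF y h']] by blast
  then show ?thesis using right_htpy_step[OF P htpy_sym[OF y h]] right_htpy_left[OF P htpyD(1)[OF h]] by blast
qed

text \<open>A right homotopy from \<open>s \<cdot> r\<close> to \<open>s' \<cdot> r\<close> is extended along \<open>r\<close> by lifting against the path object.\<close>

lemma htpy_extend:
  assumes y: "y \<in> Fib M" and r: "r \<in> Cof M" "r \<in> WE M" and s: "s \<in> Arr M" "s' \<in> Arr M" "Dom M s = Cod M r" "Dom M s' = Cod M r"
    "y \<cdot> s = y \<cdot> s'" and h: "htpy y (s \<cdot> r) (s' \<cdot> r)" and c: "Cod M s = Dom M y" "Cod M s' = Dom M y"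
  shows "htpy y s s'"
proof -
  obtain c p q where P: "is_path_object y c p q" using path_object_exists[OF y] by blast
  note [simp] = path_objectD(1-8)[OF P] s(1-4) c cof_simp[OF r(1)]
  obtain k where k: "k \<in> Arr M" "Dom M k = Dom M r" "Cod M k = Dom M p" "p \<cdot> k = s \<cdot> r" "q \<cdot> k = s' \<cdot> r"
    using htpy_right[OF P htpy_sym[OF y h]] by auto
  obtain l where "l \<in> Arr M" "Cod M l = Dom M p" "p \<cdot> l = s" "q \<cdot> l = s'"
    using path_object_lift[OF P r, of k s s'] k s by auto
  then show ?thesis using right_htpy_left[OF P] y by auto
qed

text \<open>Whitehead's theorem over the base. Factor \<open>w\<close> as an acyclic cofibration
  \<open>i\<close> followed by a fibration \<open>p\<close>, which is acyclic too. Then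
  \<open>i\<close> has a retraction \<open>r\<close> because \<open>x\<close> is a fibration,
  \<open>p\<close> has a section \<open>s\<close> because all objects are cofibrant, and
  \<open>r \<cdot> s\<close> is the inverse.\<close>

lemma homotopy_inverse:
  assumes x: "x \<in> Fib M" and y: "y \<in> Fib M" and w: "w \<in> WE M" "Dom M w = Dom M x" "Cod M w = Dom M y" "y \<cdot> w = x"
  shows "\<exists>v. v \<in> Arr M \<and> Dom M v = Dom M y \<and> Cod M v = Dom M x \<and> x \<cdot> v = y \<and>
    htpy x (v \<cdot> w) (Idt M (Dom M x)) \<and> htpy y (w \<cdot> v) (Idt M (Dom M y))"
proof -
  have [simp]: "x \<in> Arr M" "y \<in> Arr M" "w \<in> Arr M" using x y w by (simp_all add: we_simp)
  note [simp] = w(2,3)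
  have [simp]: "Cod M x = Cod M y" using w(4) by auto
  obtain i p where i: "i \<in> Cof M" "i \<in> WE M" and p: "p \<in> Fib M" and ip: "i \<in> Arr M" "Dom M i = Dom M x" "Cod M i = Dom M p"
    "Cod M p = Dom M y" and pi: "p \<cdot> i = w"
    using factor_ac[of w] w by auto
  note [simp] = ip
  have [simp]: "p \<in> Arr M" using p by simp
  have pw: "p \<in> WE M" using we_cancel_left[of i p] i w pi by simp
  have yp: "y \<cdot> p \<in> Fib M" using fib_comp[OF p y] by simp
  obtain s where [simp]: "s \<in> Arr M" "Dom M s = Dom M y" "Cod M s = Dom M p" and ps: "p \<cdot> s = Idt M (Dom M y)"
    using acyclic_fib_section[OF p pw] by auto
  obtain r where [simp]: "r \<in> Arr M" "Dom M r = Dom M p" "Cod M r = Dom M x" and ri: "r \<cdot> i = Idt M (Dom M x)" and xr: "x \<cdot> r = y \<cdot> p"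
    using lift_ac[OF i x, of "Idt M (Dom M x)" "y \<cdot> p"] by (auto simp: pi w)
  have e1: "y \<cdot> (p \<cdot> (i \<cdot> r)) = y \<cdot> p" by (simp add: reassoc[OF pi] reassoc[OF w(4)] xr)
  \<comment> \<open>Both arrows restrict to \<open>i\<close> along the acyclic cofibration
    \<open>i\<close>, and homotopies extend along it.\<close>
  have h1: "htpy (y \<cdot> p) (i \<cdot> r) (Idt M (Dom M p))"
    by (rule htpy_extend[OF yp i]) (simp_all add: e1 ri htpy_refl)
  have "htpy (y \<cdot> p) (i \<cdot> (r \<cdot> s)) s" using htpy_pre[OF h1, of s] by simp
  then have "htpy y (p \<cdot> (i \<cdot> (r \<cdot> s))) (p \<cdot> s)"
    by (rule htpy_post[where b = "Idt M (Cod M y)"]) simp_all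
  then have A: "htpy y (w \<cdot> (r \<cdot> s)) (Idt M (Dom M y))" by (simp add: reassoc[OF pi] ps)
  let ?Z = "Dom M p"
  \<comment> \<open>\<open>s \<cdot> p\<close> and the identity have the same composite with
    \<open>p\<close>; lifting the constant homotopy of \<open>p\<close> through the acyclic
    fibration \<open>p\<close> joins them.\<close>
  obtain k where [simp]: "k \<in> Arr M" "Dom M k = cyl ?Z" "Cod M k = ?Z" and k: "k \<cdot> i0 ?Z = s \<cdot> p" "k \<cdot> i1 ?Z = Idt M ?Z" "p \<cdot> k = p \<cdot> pr ?Z"
  proof -
    have "\<exists>k. k \<in> Arr M \<and> Dom M k = cyl ?Z \<and> Cod M k = ?Z \<and> k \<cdot> i0 ?Z = s \<cdot> p \<and> k \<cdot> i1 ?Z = Idt M ?Z \<and> p \<cdot> k = p \<cdot> pr ?Z"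
      by (rule cyl_lift) (use p pw in \<open>simp_all add: reassoc[OF ps]\<close>)
    then show thesis using that by blast
  qed
  have "is_htpy (y \<cdot> p) (s \<cdot> p) (Idt M ?Z) k" by (simp add: is_htpy_def k reassoc[OF ps])
  then have "htpy (y \<cdot> p) (s \<cdot> p) (Idt M ?Z)" by (rule htpyI)
  from htpy_pre[OF this, of i] have "htpy (y \<cdot> p) (s \<cdot> w) i" by (simp add: pi)
  then have "htpy x (r \<cdot> (s \<cdot> w)) (r \<cdot> i)"
    by (rule htpy_post[where b = "Idt M (Cod M y)"]) (simp_all add: xr)
  then have B: "htpy x ((r \<cdot> s) \<cdot> w) (Idt M (Dom M x))" by (simp add: ri)
  show ?thesis using A B by (intro exI[of _ "r \<cdot> s"]) (simp add: reassoc[OF xr] ps)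
qed

end

section \<open>Squares between fibrations over fibrant objects\<close>

context suitable_model_category
begin

definition fib_square :: "'a \<Rightarrow> 'a \<Rightarrow> 'a \<Rightarrow> 'a \<Rightarrow> bool" where
  "fib_square x t b y \<longleftrightarrow> x \<in> Fib M \<and> y \<in> Fib M \<and> fibrant M (Cod M x) \<and> fibrant M (Cod M y) \<and>
    t \<in> Arr M \<and> Dom M t = Dom M x \<and> Cod M t = Dom M y \<and> b \<in> Arr M \<and> Dom M b = Cod M x \<and> Cod M b = Cod M y \<and>
    y \<cdot> t = b \<cdot> x"

lemma fib_squareD:
  assumes "fib_square x t b y"
  shows "x \<in> Fib M" "y \<in> Fib M" "fibrant M (Cod M x)" "fibrant M (Cod M y)" "t \<in> Arr M" "Dom M t = Dom M x"
    "Cod M t = Dom M y" "b \<in> Arr M" "Dom M b = Cod M x" "Cod M b = Cod M y" "y \<cdot> t = b \<cdot> x"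
  using assms by (simp_all add: fib_square_def)

abbreviation FA where "FA \<equiv> fibrant_arrow_cat M"

lemma FA_simps [simp]:
  "(x, t, b, y) \<in> Arr FA \<longleftrightarrow> fib_square x t b y"
  "x \<in> Obj FA \<longleftrightarrow> x \<in> Fib M \<and> fibrant M (Cod M x)"
  "Dom FA (x, t, b, y) = x" "Cod FA (x, t, b, y) = y" "Idt FA x = (x, Idt M (Dom M x), Idt M (Cod M x), x)"
  "(y', t', b', z) \<cdot>\<^bsub>FA\<^esub> (x, t, b, y) = (x, t' \<cdot> t, b' \<cdot> b, z)"
  by (auto simp: fibrant_arrow_cat_def full_subcat_def arrow_cat_def fib_square_def)

lemma FA_cases:
  assumes "f \<in> Arr FA"
  obtains x t b y where "f = (x, t, b, y)" "fib_square x t b y"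
  using assms by (cases f) auto

lemma category_FA: "category FA"
  unfolding fibrant_arrow_cat_def by (rule category_full_subcat, rule category_arrow_cat, rule category_axioms)

lemma fib_square_cmp: "fib_square x t b y \<Longrightarrow> fib_square y t' b' z \<Longrightarrow> fib_square x (t' \<cdot> t) (b' \<cdot> b) z"
  using category.cmp_simps(1)[OF category_FA, of "(x, t, b, y)" "(y, t', b', z)"] by simp

lemma vertical_WE_iff: "(x, t, b, y) \<in> vertical_WE M \<longleftrightarrow> fib_square x t b y \<and> b = Idt M (Cod M x) \<and> t \<in> WE M"
  by (simp add: vertical_WE_def)

lemma gamma_simps [simp]:
  "Src (gamma_fb M) = FA" "Tgt (gamma_fb M) = localization FA (vertical_WE M)" "OMap (gamma_fb M) x = x"
  by (simp_all add: gamma_fb_def loc_ftr_def)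

end

sublocale suitable_model_category \<subseteq> FA: category "fibrant_arrow_cat M"
  by (rule category_FA)

sublocale suitable_model_category \<subseteq> gamma: cat_functor "gamma_fb M"
  by (rule cat_functor_gamma_fb) (rule category_axioms)

section \<open>Homotopy as the kernel of the localization functor\<close>

context interval_cylinder
begin

definition feq :: "'a \<times> 'a \<times> 'a \<times> 'a \<Rightarrow> 'a \<times> 'a \<times> 'a \<times> 'a \<Rightarrow> bool" where
  "feq f g \<longleftrightarrow> (\<exists>x t t' b y. f = (x, t, b, y) \<and> g = (x, t', b, y) \<and> fib_square x t b y \<and> fib_square x t' b y \<and> htpy y t t')"

lemma feq_iff: "feq (x, t, b, y) (x', t', b', y') \<longleftrightarrow> x' = x \<and> b' = b \<and> y' = y \<and> fib_square x t b y \<and> fib_square x t' b y \<and> htpy y t t'"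
  by (auto simp: feq_def)

lemma feq_refl: "f \<in> Arr FA \<Longrightarrow> feq f f"
  by (elim FA_cases) (auto simp: feq_iff fib_squareD intro: htpy_refl)

lemma feq_sym: "feq f g \<Longrightarrow> feq g f"
  unfolding feq_def by (blast intro: htpy_sym fib_squareD(2))

lemma feq_trans: "feq f g \<Longrightarrow> feq g h \<Longrightarrow> feq f h"
  unfolding feq_def by (elim exE conjE) (simp, blast intro: htpy_trans fib_squareD(2))

lemma feq_cmp:
  assumes "feq f f'" "feq g g'" "Cod FA f = Dom FA g"
  shows "feq (g \<cdot>\<^bsub>FA\<^esub> f) (g' \<cdot>\<^bsub>FA\<^esub> f')"
proof -
  obtain x t t' b y where f: "f = (x, t, b, y)" "f' = (x, t', b, y)" "fib_square x t b y" "fib_square x t' b y" "htpy y t t'"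
    using assms(1) unfolding feq_def by blast
  obtain s s' c z where g: "g = (y, s, c, z)" "g' = (y, s', c, z)" "fib_square y s c z" "fib_square y s' c z" "htpy z s s'"
    using assms(2,3) unfolding feq_def f by auto
  note [simp] = fib_squareD(1-10)[OF f(3)] fib_squareD(1-10)[OF f(4)] fib_squareD(1-10)[OF g(3)] fib_squareD(1-10)[OF g(4)]
  have "htpy z (s \<cdot> t) (s \<cdot> t')" using fib_squareD(11)[OF g(3)] by (intro htpy_post[OF f(5), of _ _ c]) simp_all
  moreover have "htpy z (s \<cdot> t') (s' \<cdot> t')" by (rule htpy_pre[OF g(5)]) simp_all
  ultimately have "htpy z (s \<cdot> t) (s' \<cdot> t')" by (rule htpy_trans[rotated]) simp
  then show ?thesis using fib_square_cmp[OF f(3) g(3)] fib_square_cmp[OF f(4) g(4)] by (simp add: f g feq_iff)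
qed

text \<open>The two end inclusions into the cylinder of \<open>x\<close> are sections of the
  vertical weak equivalence \<open>pr\<close>, which the localization inverts, so they become equal.
  Composing with the homotopy \<open>H\<close> identifies \<open>f\<close> and
  \<open>g\<close>.\<close>

lemma feq_gamma:
  assumes "feq f g"
  shows "AMap (gamma_fb M) f = AMap (gamma_fb M) g"
proof -
  obtain x t t' b y where f: "f = (x, t, b, y)" "g = (x, t', b, y)" and S: "fib_square x t b y" and S': "fib_square x t' b y" and h: "htpy y t t'"
    using assms unfolding feq_def by blast
  obtain H where H: "is_htpy y t t' H" using h by (auto simp: htpy_def)
  let ?X = "Dom M x" and ?I = "Idt M (Cod M x)"
  note [simp] = fib_squareD(1-10)[OF S] fib_squareD(1-10)[OF S'] is_htpyD(8-10)[OF H, simplified]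
  note he = is_htpyD(11-13)[OF H, simplified]
  \<comment> \<open>The cylinder is itself a fibration over the same base, hence an object of the
    category being localized.\<close>
  have xp: "x \<cdot> pr ?X \<in> Fib M" by (rule fib_comp) (simp_all add: pr_acyclic)
  let ?y = "x \<cdot> pr ?X"
  let ?i = "(x, i0 ?X, ?I, ?y)" and ?j = "(x, i1 ?X, ?I, ?y)" and ?p = "(?y, pr ?X, ?I, x)" and ?H = "(?y, H, b, y)"
  have a [simp]: "?i \<in> Arr FA" "?j \<in> Arr FA" "?p \<in> Arr FA" "?H \<in> Arr FA"
    using xp fib_squareD(11)[OF S] by (simp_all add: fib_square_def he reassoc[OF fib_squareD(11)[OF S]])
  have "?p \<in> Arr FA \<inter> vertical_WE M" using a by (simp add: vertical_WE_iff pr_acyclic)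
  from loc_ftr_inverts[OF category_FA this]
  have p: "is_iso (Tgt (gamma_fb M)) (AMap (gamma_fb M) ?p)" unfolding gamma_simps unfolding gamma_fb_def .
  interpret L: category "Tgt (gamma_fb M)" by (rule gamma.tgt_category)
  have G: "AMap (gamma_fb M) k \<in> hom (Tgt (gamma_fb M)) (Dom FA k) (Cod FA k)" if "k \<in> Arr FA" for k
    using gamma.amap_hom[of k "Dom FA k" "Cod FA k"] that by simp
  have C: "AMap (gamma_fb M) (k \<cdot>\<^bsub>FA\<^esub> l) = AMap (gamma_fb M) k \<cdot>\<^bsub>Tgt (gamma_fb M)\<^esub> AMap (gamma_fb M) l"
    if "k \<in> Arr FA" "l \<in> Arr FA" "Cod FA l = Dom FA k" for k l
    using gamma.amap_cmp[of l "Dom FA l" "Cod FA l" k "Cod FA k"] that by simp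
  have c: "Cod FA ?i = Dom FA ?p" "Cod FA ?j = Dom FA ?p" "Cod FA ?i = Dom FA ?H" "Cod FA ?j = Dom FA ?H" by simp_all
  have "?p \<cdot>\<^bsub>FA\<^esub> ?i = ?p \<cdot>\<^bsub>FA\<^esub> ?j" by simp
  then have e: "AMap (gamma_fb M) ?p \<cdot>\<^bsub>Tgt (gamma_fb M)\<^esub> AMap (gamma_fb M) ?i = AMap (gamma_fb M) ?p \<cdot>\<^bsub>Tgt (gamma_fb M)\<^esub> AMap (gamma_fb M) ?j"
    by (simp only: C[OF a(3) a(1) c(1), symmetric] C[OF a(3) a(2) c(2), symmetric])
  have ij: "AMap (gamma_fb M) ?i = AMap (gamma_fb M) ?j"
    by (rule L.iso_cancel_left[OF p _ _ _ _ e]) (use G[OF a(1)] G[OF a(2)] G[OF a(3)] in \<open>simp_all del: gamma_simps\<close>)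
  have "f = ?H \<cdot>\<^bsub>FA\<^esub> ?i" "g = ?H \<cdot>\<^bsub>FA\<^esub> ?j" by (simp_all add: f he)
  then show ?thesis by (simp only: C[OF a(4) a(1) c(3)] C[OF a(4) a(2) c(4)] ij)
qed

definition is_hinv :: "'a \<times> 'a \<times> 'a \<times> 'a \<Rightarrow> 'a \<times> 'a \<times> 'a \<times> 'a \<Rightarrow> bool" where
  "is_hinv w v \<longleftrightarrow> v \<in> Arr FA \<and> Dom FA v = Cod FA w \<and> Cod FA v = Dom FA w \<and>
    feq (v \<cdot>\<^bsub>FA\<^esub> w) (Idt FA (Dom FA w)) \<and> feq (w \<cdot>\<^bsub>FA\<^esub> v) (Idt FA (Cod FA w))"

text \<open>A fixed choice of homotopy inverse, which serves as the value of a formal inverse in a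
  zigzag.\<close>

definition hinv :: "'a \<times> 'a \<times> 'a \<times> 'a \<Rightarrow> 'a \<times> 'a \<times> 'a \<times> 'a" where
  "hinv w = (SOME v. is_hinv w v)"

lemma is_hinv_hinv:
  assumes "w \<in> vertical_WE M"
  shows "is_hinv w (hinv w)"
proof -
  obtain x t b y where w: "w = (x, t, b, y)" by (cases w)
  have S: "fib_square x t b y" and b: "b = Idt M (Cod M x)" and t: "t \<in> WE M" using assms unfolding w vertical_WE_iff by auto
  note [simp] = fib_squareD(1-8)[OF S]
  have [simp]: "Cod M y = Cod M x" using fib_squareD(10)[OF S] b by simp
  have yt: "y \<cdot> t = x" using fib_squareD(11)[OF S] b by simp
  obtain v where v [simp]: "v \<in> Arr M" "Dom M v = Dom M y" "Cod M v = Dom M x" and ve: "x \<cdot> v = y"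
    "htpy x (v \<cdot> t) (Idt M (Dom M x))" "htpy y (t \<cdot> v) (Idt M (Dom M y))"
    using homotopy_inverse[of x y t] t yt by auto
  have "is_hinv w (y, v, b, x)"
    unfolding is_hinv_def w using ve(2,3) by (simp add: feq_iff b, simp add: fib_square_def ve yt reassoc[OF yt] reassoc[OF ve(1)])
  then show ?thesis unfolding hinv_def by (rule someI)
qed

text \<open>Evaluates a zigzag to a single square, a formal inverse being read as a homotopy
  inverse. It is well defined only up to \<open>feq\<close>, which is enough to recover
  \<open>feq\<close> from equality in the localization without constructing the quotient
  category.\<close>

primrec zz_value :: "('a \<times> 'a \<times> 'a \<times> 'a) step list \<Rightarrow> 'a \<Rightarrow> 'a \<times> 'a \<times> 'a \<times> 'a" where
  "zz_value [] x = Idt FA x"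
| "zz_value (s # p) x = (case s of Fwd f \<Rightarrow> zz_value p (Cod FA f) \<cdot>\<^bsub>FA\<^esub> f | Bwd w \<Rightarrow> zz_value p (Dom FA w) \<cdot>\<^bsub>FA\<^esub> hinv w)"

abbreviation W where "W \<equiv> vertical_WE M"

lemma hinv_simps:
  assumes "w \<in> W"
  shows "hinv w \<in> Arr FA" "Dom FA (hinv w) = Cod FA w" "Cod FA (hinv w) = Dom FA w"
    "feq (hinv w \<cdot>\<^bsub>FA\<^esub> w) (Idt FA (Dom FA w))" "feq (w \<cdot>\<^bsub>FA\<^esub> hinv w) (Idt FA (Cod FA w))"
  using is_hinv_hinv[OF assms] unfolding is_hinv_def by blast+

lemma zz_value_hom:
  "zigzag FA W x p y \<Longrightarrow> zz_value p x \<in> Arr FA \<and> Dom FA (zz_value p x) = x \<and> Cod FA (zz_value p x) = y"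
proof (induction p arbitrary: x)
  case Nil
  then have "x \<in> Obj FA" "y = x" by auto
  then show ?case using FA.idt_simps[of x] by (simp del: FA_simps)
next
  case (Cons s p)
  then show ?case by (cases s) (auto simp del: FA_simps simp: hinv_simps)
qed

lemma zz_value_append:
  "zigzag FA W x p y \<Longrightarrow> zigzag FA W y q z \<Longrightarrow> zz_value (p @ q) x = zz_value q y \<cdot>\<^bsub>FA\<^esub> zz_value p x"
proof (induction p arbitrary: x)
  case Nil
  then show ?case using zz_value_hom[of x q z] by (simp del: FA_simps)
next
  case (Cons s p)
  then show ?case using zz_value_hom[of y q z]
    by (cases s) (auto simp del: FA_simps simp: hinv_simps zz_value_hom)
qed

text \<open>Each generating relation of \<open>zz_eq\<close> holds up to homotopy, and homotopy is a
  congruence; the two cancellation relations are the defining property of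
  \<open>hinv\<close>.\<close>

lemma zz_value_cong: "zz_eq FA W x p q y \<Longrightarrow> feq (zz_value p x) (zz_value q x)"
proof (induction rule: zz_eq.induct)
  case (zz_refl x p y)
  then show ?case using zz_value_hom[of x p y] feq_refl by (simp del: FA_simps)
next
  case (zz_sym x p q y)
  then show ?case by (rule_tac feq_sym)
next
  case (zz_trans x p q y r)
  then show ?case using feq_trans by blast
next
  case (zz_append x p q y p' q' z)
  then show ?case using zz_eq_zigzag[OF category_FA] zz_value_append[of x p y p' z] zz_value_append[of x q y q' z]
      feq_cmp[of "zz_value p x" "zz_value q x" "zz_value p' y" "zz_value q' y"] zz_value_hom[of x p y] zz_value_hom[of y p' z]
    by (simp del: FA_simps)
next
  case (zz_idt x)
  then show ?case using FA.idt_simps[of x] feq_refl[of "Idt FA x"] by (simp del: FA_simps)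
next
  case (zz_cmp f x y g z)
  then show ?case using feq_refl[of "g \<cdot>\<^bsub>FA\<^esub> f"] by (simp del: FA_simps)
next
  case (zz_inv1 w)
  then show ?case using hinv_simps[of w] by (simp del: FA_simps)
next
  case (zz_inv2 w)
  then show ?case using hinv_simps[of w] by (simp del: FA_simps)
qed

lemma gamma_class: "AMap (gamma_fb M) f = zz_class FA W (Dom FA f) [Fwd f] (Cod FA f)"
  by (simp add: gamma_fb_def loc_ftr_def)

text \<open>A square is the value of the zigzag consisting of it alone, so if two such zigzags are
  equivalent, evaluation makes the squares homotopic.\<close>

lemma gamma_eq_iff:
  assumes "f \<in> Arr FA" "g \<in> Arr FA"
  shows "AMap (gamma_fb M) f = AMap (gamma_fb M) g \<longleftrightarrow> feq f g"
proof
  assume e: "AMap (gamma_fb M) f = AMap (gamma_fb M) g"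
  have z: "zigzag FA W (Dom FA f) [Fwd f] (Cod FA f)" using assms FA.cod_obj by (simp del: FA_simps)
  have d: "Dom FA f = Dom FA g" "Cod FA f = Cod FA g" using e by (auto simp: gamma_class zz_class_def)
  have "zz_eq FA W (Dom FA f) [Fwd f] [Fwd g] (Cod FA f)"
    using zz_class_eq_iff[OF z, of "[Fwd g]"] e d by (simp add: gamma_class)
  from zz_value_cong[OF this] show "feq f g" using assms d by (simp del: FA_simps)
qed (rule feq_gamma)

text \<open>No genuine zigzags are needed: the class of a formal inverse is already the image of a
  homotopy inverse.\<close>

lemma gamma_full_zz: "zigzag FA W x p y \<Longrightarrow> \<exists>f \<in> hom FA x y. zz_class FA W x p y = AMap (gamma_fb M) f"
proof (induction p arbitrary: x)
  case Nil
  then have x: "x \<in> Obj FA" "y = x" by auto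
  then show ?case using gamma.amap_idt[of x] FA.idt_simps[of x]
    by (intro bexI[of _ "Idt FA x"]) (simp_all del: FA_simps add: loc_simps)
next
  case (Cons s p)
  obtain x' where s: "zigzag FA W x [s] x'" "zigzag FA W x' p y"
    using zigzag_append[OF category_FA, of W x "[s]" p y] Cons.prems by auto
  obtain f where f: "f \<in> hom FA x' y" "zz_class FA W x' p y = AMap (gamma_fb M) f" using Cons.IH[OF s(2)] by blast
  have "\<exists>g \<in> hom FA x x'. zz_class FA W x [s] x' = AMap (gamma_fb M) g"
  proof (cases s)
    case (Fwd g)
    then show ?thesis using s(1) by (intro bexI[of _ g]) (auto simp: gamma_class)
  next
    case (Bwd w)
    then have w: "w \<in> Arr FA \<inter> W" "x = Cod FA w" "x' = Dom FA w" using s(1) by auto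
    note v = hinv_simps[of w]
    let ?L = "Tgt (gamma_fb M)"
    have h: "w \<in> hom (Src (gamma_fb M)) x' x" "hinv w \<in> hom (Src (gamma_fb M)) x x'" using w v by (simp_all del: FA_simps)
    interpret L: category ?L by (rule gamma.tgt_category)
    have o: "x \<in> Obj (Src (gamma_fb M))" "x' \<in> Obj (Src (gamma_fb M))" using w by (simp_all del: FA_simps)
    have "inverse_arrows ?L (AMap (gamma_fb M) w) (zz_class FA W (Cod FA w) [Bwd w] (Dom FA w))"
      using loc_ftr_inverse[OF category_FA w(1)] unfolding gamma_simps unfolding gamma_fb_def .
    \<comment> \<open>Homotopic squares have equal images, so the homotopy inverse becomes a strict
      one and coincides with the formal inverse.\<close>
    moreover have "inverse_arrows ?L (AMap (gamma_fb M) w) (AMap (gamma_fb M) (hinv w))"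
      unfolding L.inverse_arrows_iff[OF gamma.amap_hom[OF h(1)]]
      using gamma.amap_hom[OF h(2)] gamma.amap_cmp[OF h(1) h(2)] gamma.amap_cmp[OF h(2) h(1)]
        feq_gamma[OF v(4)] feq_gamma[OF v(5)] gamma.amap_idt[OF o(1)] gamma.amap_idt[OF o(2)] w
      by (simp del: FA_simps)
    ultimately have "zz_class FA W (Cod FA w) [Bwd w] (Dom FA w) = AMap (gamma_fb M) (hinv w)" by (rule L.inverse_unique)
    then show ?thesis using Bwd w h(2) by (intro bexI[of _ "hinv w"]) simp_all
  qed
  then obtain g where g: "g \<in> hom FA x x'" "zz_class FA W x [s] x' = AMap (gamma_fb M) g" by blast
  have "zz_class FA W x (s # p) y = AMap (gamma_fb M) (f \<cdot>\<^bsub>FA\<^esub> g)"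
    using loc_cmp[OF s] f g gamma.amap_cmp[of g x x' f y] by simp
  then show ?case using f g by (intro bexI[of _ "f \<cdot>\<^bsub>FA\<^esub> g"]) simp_all
qed

lemma gamma_full: "h \<in> hom (localization FA W) x y \<Longrightarrow> \<exists>f \<in> hom FA x y. h = AMap (gamma_fb M) f"
  unfolding loc_hom using gamma_full_zz by blast

end

section \<open>Diagrams in the fibres of a fibration\<close>

lemma (in category) is_iso_opp: "is_iso (opp C) f \<longleftrightarrow> is_iso C f"
  by (auto simp: is_iso_def inverse_arrows_def)

lemma fiber_simps [simp]:
  "f \<in> Arr (fiber \<pi> A) \<longleftrightarrow> f \<in> Arr (Src \<pi>) \<and> AMap \<pi> f = Idt (Tgt \<pi>) A"
  "X \<in> Obj (fiber \<pi> A) \<longleftrightarrow> X \<in> Obj (Src \<pi>) \<and> OMap \<pi> X = A"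
  "Dom (fiber \<pi> A) = Dom (Src \<pi>)" "Cod (fiber \<pi> A) = Cod (Src \<pi>)" "Idt (fiber \<pi> A) = Idt (Src \<pi>)"
  "Cmp (fiber \<pi> A) = Cmp (Src \<pi>)"
  by (auto simp: fiber_def)

lemma opp_ftr_simps [simp]:
  "Src (opp_ftr F) = opp (Src F)" "Tgt (opp_ftr F) = opp (Tgt F)" "OMap (opp_ftr F) = OMap F" "AMap (opp_ftr F) = AMap F"
  by (simp_all add: opp_ftr_def)

section \<open>Cartesian and cocartesian arrows up to vertical isomorphism\<close>

context cat_functor
begin

interpretation S: category "Src F" by (rule src_category)
interpretation T: category "Tgt F" by (rule tgt_category)

abbreviation E where "E \<equiv> Src F"
abbreviation B where "B \<equiv> Tgt F"
abbreviation cmp_src (infixl "\<odot>" 70) where "g \<odot> f \<equiv> g \<cdot>\<^bsub>Src F\<^esub> f"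
abbreviation cmp_tgt (infixl "\<otimes>" 70) where "g \<otimes> f \<equiv> g \<cdot>\<^bsub>Tgt F\<^esub> f"

lemma ftr_simps [simp]:
  "f \<in> Arr E \<Longrightarrow> AMap F f \<in> Arr B"
  "f \<in> Arr E \<Longrightarrow> Dom B (AMap F f) = OMap F (Dom E f)"
  "f \<in> Arr E \<Longrightarrow> Cod B (AMap F f) = OMap F (Cod E f)"
  "X \<in> Obj E \<Longrightarrow> OMap F X \<in> Obj B"
  "X \<in> Obj E \<Longrightarrow> AMap F (Idt E X) = Idt B (OMap F X)"
  "f \<in> Arr E \<Longrightarrow> g \<in> Arr E \<Longrightarrow> Cod E f = Dom E g \<Longrightarrow>
    AMap F (g \<odot> f) = AMap F g \<otimes> AMap F f"
  using amap_hom[of f "Dom E f" "Cod E f"] amap_cmp[of f "Dom E f" "Cod E f" g "Cod E g"]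
  by (simp_all add: omap_obj amap_idt)

lemma vertical_objs:
  assumes "f \<in> Arr E" "AMap F f = Idt B A" "A \<in> Obj B"
  shows "OMap F (Dom E f) = A" "OMap F (Cod E f) = A"
  using assms ftr_simps(2,3)[of f] T.idt_simps[of A] by auto

lemma category_fiber:
  assumes A: "A \<in> Obj B"
  shows "category (fiber F A)"
  by (rule category.intro) (use A in \<open>auto simp: vertical_objs\<close>)

lemma cat_functor_opp: "cat_functor (opp_ftr F)"
  by (rule cat_functor.intro) (auto simp: S.category_opp T.category_opp)

lemma cartesian_arr: "is_cartesian F q \<Longrightarrow> q \<in> Arr E"
  unfolding is_cartesian_def by blast

lemma cartesian_ex:
  assumes q: "is_cartesian F q" and r: "r \<in> Arr E" "Cod E r = Cod E q"
    and f: "f \<in> Arr B" "Cod B f = OMap F (Dom E q)" "AMap F r = AMap F q \<otimes> f"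
  shows "\<exists>s. s \<in> Arr E \<and> Dom E s = Dom E r \<and> Cod E s = Dom E q \<and> AMap F s = f \<and> q \<odot> s = r"
proof -
  have "\<exists>!s. s \<in> hom E (Dom E r) (Dom E q) \<and> AMap F s = f \<and> q \<odot> s = r"
    using q r f cartesian_arr[OF q] unfolding is_cartesian_def by simp
  then show ?thesis unfolding in_hom by blast
qed

lemma cartesian_eq:
  assumes q: "is_cartesian F q" and s: "s \<in> Arr E" "s' \<in> Arr E" "Dom E s = Dom E s'"
    "Cod E s = Dom E q" "Cod E s' = Dom E q" "AMap F s = AMap F s'" "q \<odot> s = q \<odot> s'"
  shows "s = s'"
proof -
  note [simp] = cartesian_arr[OF q]
  let ?r = "q \<odot> s'"
  have u: "AMap F s' \<in> Arr B \<and> Cod B (AMap F s') = Dom B (AMap F q) \<and> ?r \<in> Arr E \<and>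
    Cod E ?r = Cod E q \<and> AMap F ?r = AMap F q \<otimes> AMap F s'"
    using s by simp
  have "\<exists>!w. w \<in> hom E (Dom E ?r) (Dom E q) \<and> AMap F w = AMap F s' \<and> q \<odot> w = ?r"
    by (rule q[unfolded is_cartesian_def, THEN conjunct2, rule_format, OF u])
  moreover have "s \<in> hom E (Dom E ?r) (Dom E q) \<and> AMap F s = AMap F s' \<and> q \<odot> s = ?r"
    "s' \<in> hom E (Dom E ?r) (Dom E q) \<and> AMap F s' = AMap F s' \<and> q \<odot> s' = ?r"
    using s by simp_all
  ultimately show ?thesis by blast
qed

lemma cartesianI:
  assumes q: "q \<in> Arr E"
    and ex: "\<And>f r. r \<in> Arr E \<Longrightarrow> Cod E r = Cod E q \<Longrightarrow> f \<in> Arr B \<Longrightarrow> Cod B f = OMap F (Dom E q) \<Longrightarrow>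
      Dom B f = OMap F (Dom E r) \<Longrightarrow> AMap F r = AMap F q \<otimes> f \<Longrightarrow>
      \<exists>s. s \<in> Arr E \<and> Dom E s = Dom E r \<and> Cod E s = Dom E q \<and> AMap F s = f \<and> q \<odot> s = r"
    and eq: "\<And>s s'. s \<in> Arr E \<Longrightarrow> s' \<in> Arr E \<Longrightarrow> Dom E s = Dom E s' \<Longrightarrow>
      Cod E s = Dom E q \<Longrightarrow> Cod E s' = Dom E q \<Longrightarrow> AMap F s = AMap F s' \<Longrightarrow>
      q \<odot> s = q \<odot> s' \<Longrightarrow> s = s'"
  shows "is_cartesian F q"
  unfolding is_cartesian_def
proof (intro conjI allI impI)
  fix f r assume a: "f \<in> Arr B \<and> Cod B f = Dom B (AMap F q) \<and> r \<in> Arr E \<and> Cod E r = Cod E q \<and>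
    AMap F r = AMap F q \<otimes> f"
  then have "Dom B (AMap F q \<otimes> f) = OMap F (Dom E r)" using ftr_simps(2)[of r] by metis
  then have "Dom B f = OMap F (Dom E r)" using a q by simp
  then obtain s where "s \<in> Arr E \<and> Dom E s = Dom E r \<and> Cod E s = Dom E q \<and> AMap F s = f \<and> q \<odot> s = r"
    using ex[of r f] a q by auto
  then show "\<exists>!s. s \<in> hom E (Dom E r) (Dom E q) \<and> AMap F s = f \<and> q \<odot> s = r"
    using eq by (intro ex1I[of _ s]) auto
qed (rule q)

lemma viso_inverse:
  assumes "is_iso (fiber F A) f" "A \<in> Obj B"
  shows "\<exists>g. is_iso (fiber F A) g \<and> f \<in> Arr E \<and> g \<in> Arr E \<and> Dom E g = Cod E f \<and> Cod E g = Dom E f \<and>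
    g \<odot> f = Idt E (Dom E f) \<and> f \<odot> g = Idt E (Cod E f) \<and>
    AMap F f = Idt B A \<and> AMap F g = Idt B A \<and> OMap F (Dom E f) = A \<and> OMap F (Cod E f) = A"
  using category.iso_inverse[OF category_fiber[OF assms(2)] assms(1)] assms(2) by (auto simp: vertical_objs)

lemma visoI:
  assumes "f \<in> Arr E" "g \<in> Arr E" "Dom E g = Cod E f" "Cod E g = Dom E f"
    "g \<odot> f = Idt E (Dom E f)" "f \<odot> g = Idt E (Cod E f)"
    "AMap F f = Idt B A" "AMap F g = Idt B A" "A \<in> Obj B"
  shows "is_iso (fiber F A) f"
  by (rule category.isoI[OF category_fiber, of _ _ g]) (use assms in simp_all)

lemma cartesian_comp_viso:
  assumes q: "is_cartesian F q" and f: "is_iso (fiber F A) f" "A \<in> Obj B" "Cod E f = Dom E q"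
  shows "is_cartesian F (q \<odot> f)" "AMap F (q \<odot> f) = AMap F q"
proof -
  note [simp] = cartesian_arr[OF q] f(2,3)
  obtain g where g [simp]: "f \<in> Arr E" "g \<in> Arr E" "Dom E g = Dom E q" "Cod E g = Dom E f"
    "AMap F f = Idt B A" "AMap F g = Idt B A" "OMap F (Dom E f) = A" "OMap F (Dom E q) = A"
    and gf: "g \<odot> f = Idt E (Dom E f)" and fg: "f \<odot> g = Idt E (Dom E q)"
    using viso_inverse[OF f(1,2)] f(3) by metis
  show "AMap F (q \<odot> f) = AMap F q" by simp
  show "is_cartesian F (q \<odot> f)"
  proof (rule cartesianI)
    fix k r assume a [simp]: "r \<in> Arr E" "Cod E r = Cod E (q \<odot> f)" "k \<in> Arr B"
      "Cod B k = OMap F (Dom E (q \<odot> f))" "AMap F r = AMap F (q \<odot> f) \<otimes> k"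
    obtain s where s: "s \<in> Arr E" "Dom E s = Dom E r" "Cod E s = Dom E q" "AMap F s = k" "q \<odot> s = r"
      using cartesian_ex[OF q, of r k] by auto
    show "\<exists>s. s \<in> Arr E \<and> Dom E s = Dom E r \<and> Cod E s = Dom E (q \<odot> f) \<and> AMap F s = k \<and> (q \<odot> f) \<odot> s = r"
      by (rule exI[of _ "g \<odot> s"]) (simp add: s S.reassoc[OF fg])
  next
    fix s s' assume a [simp]: "s \<in> Arr E" "s' \<in> Arr E" "Dom E s = Dom E s'"
      "Cod E s = Dom E (q \<odot> f)" "Cod E s' = Dom E (q \<odot> f)"
      and e: "AMap F s = AMap F s'" "(q \<odot> f) \<odot> s = (q \<odot> f) \<odot> s'"
    have "f \<odot> s = f \<odot> s'" by (rule cartesian_eq[OF q]) (use e in simp_all)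
    then have "g \<odot> (f \<odot> s) = g \<odot> (f \<odot> s')" by simp
    then show "s = s'" by (simp add: S.reassoc[OF gf])
  qed simp
qed

lemma viso_comp_cartesian:
  assumes q: "is_cartesian F q" and f: "is_iso (fiber F A) f" "A \<in> Obj B" "Dom E f = Cod E q"
  shows "is_cartesian F (f \<odot> q)" "AMap F (f \<odot> q) = AMap F q"
proof -
  note [simp] = cartesian_arr[OF q] f(2,3)
  obtain g where g [simp]: "f \<in> Arr E" "g \<in> Arr E" "Dom E g = Cod E f" "Cod E g = Cod E q"
    "AMap F f = Idt B A" "AMap F g = Idt B A" "OMap F (Cod E f) = A" "OMap F (Cod E q) = A"
    and gf: "g \<odot> f = Idt E (Cod E q)" and fg: "f \<odot> g = Idt E (Cod E f)"
    using viso_inverse[OF f(1,2)] f(3) by metis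
  show "AMap F (f \<odot> q) = AMap F q" by simp
  show "is_cartesian F (f \<odot> q)"
  proof (rule cartesianI)
    fix k r assume a [simp]: "r \<in> Arr E" "Cod E r = Cod E (f \<odot> q)" "k \<in> Arr B"
      "Cod B k = OMap F (Dom E (f \<odot> q))" "AMap F r = AMap F (f \<odot> q) \<otimes> k"
    obtain s where s: "s \<in> Arr E" "Dom E s = Dom E r" "Cod E s = Dom E q" "AMap F s = k" "q \<odot> s = g \<odot> r"
      using cartesian_ex[OF q, of "g \<odot> r" k] by auto
    show "\<exists>s. s \<in> Arr E \<and> Dom E s = Dom E r \<and> Cod E s = Dom E (f \<odot> q) \<and> AMap F s = k \<and> (f \<odot> q) \<odot> s = r"
      by (rule exI[of _ s]) (simp add: s S.reassoc[OF fg])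
  next
    fix s s' assume a [simp]: "s \<in> Arr E" "s' \<in> Arr E" "Dom E s = Dom E s'"
      "Cod E s = Dom E (f \<odot> q)" "Cod E s' = Dom E (f \<odot> q)"
      and e: "AMap F s = AMap F s'" "(f \<odot> q) \<odot> s = (f \<odot> q) \<odot> s'"
    have "g \<odot> ((f \<odot> q) \<odot> s) = g \<odot> ((f \<odot> q) \<odot> s')" using e by simp
    then have "q \<odot> s = q \<odot> s'" by (simp add: S.reassoc[OF gf])
    then show "s = s'" by - (rule cartesian_eq[OF q], use e in simp_all)
  qed simp
qed

lemma cartesian_viso:
  assumes q: "is_cartesian F q" and q': "is_cartesian F q'" and e: "Cod E q = Cod E q'" "AMap F q = AMap F q'"
  shows "\<exists>f. is_iso (fiber F (OMap F (Dom E q))) f \<and> Dom E f = Dom E q' \<and> Cod E f = Dom E q \<and> q' = q \<odot> f"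
proof -
  note [simp] = cartesian_arr[OF q] cartesian_arr[OF q'] e(1)
  let ?I = "Idt B (OMap F (Dom E q))"
  have d [simp]: "OMap F (Dom E q') = OMap F (Dom E q)" using e(2) ftr_simps(2)[of q] ftr_simps(2)[of q'] by simp
  obtain f where f [simp]: "f \<in> Arr E" "Dom E f = Dom E q'" "Cod E f = Dom E q" "AMap F f = ?I" and qf: "q \<odot> f = q'"
    using cartesian_ex[OF q, of q' ?I] e by auto
  obtain g where g [simp]: "g \<in> Arr E" "Dom E g = Dom E q" "Cod E g = Dom E q'" "AMap F g = ?I" and qg: "q' \<odot> g = q"
    using cartesian_ex[OF q', of q ?I] e by auto
  have "f \<odot> g = Idt E (Dom E q)" by (rule cartesian_eq[OF q]) (simp_all add: S.reassoc[OF qf] qg)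
  moreover have "g \<odot> f = Idt E (Dom E q')" by (rule cartesian_eq[OF q']) (simp_all add: S.reassoc[OF qg] qf)
  ultimately show ?thesis using visoI[of f g] qf by (intro exI[of _ f]) simp
qed

lemma cartesian_comp:
  assumes q: "is_cartesian F q" and c: "is_cartesian F c" and e: "Cod E c = Dom E q"
  shows "is_cartesian F (q \<odot> c)"
proof (rule cartesianI)
  note [simp] = cartesian_arr[OF q] cartesian_arr[OF c] e
  show "q \<odot> c \<in> Arr E" by simp
  fix k r assume a [simp]: "r \<in> Arr E" "Cod E r = Cod E (q \<odot> c)" "k \<in> Arr B"
    "Cod B k = OMap F (Dom E (q \<odot> c))" "AMap F r = AMap F (q \<odot> c) \<otimes> k"
  obtain s where s [simp]: "s \<in> Arr E" "Dom E s = Dom E r" "Cod E s = Dom E q" "AMap F s = AMap F c \<otimes> k" "q \<odot> s = r"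
    using cartesian_ex[OF q, of r "AMap F c \<otimes> k"] by auto
  obtain t where t: "t \<in> Arr E" "Dom E t = Dom E r" "Cod E t = Dom E c" "AMap F t = k" "c \<odot> t = s"
    using cartesian_ex[OF c, of s k] by auto
  show "\<exists>s. s \<in> Arr E \<and> Dom E s = Dom E r \<and> Cod E s = Dom E (q \<odot> c) \<and> AMap F s = k \<and> (q \<odot> c) \<odot> s = r"
    by (rule exI[of _ t]) (simp add: t)
next
  note [simp] = cartesian_arr[OF q] cartesian_arr[OF c] e
  fix s s' assume a [simp]: "s \<in> Arr E" "s' \<in> Arr E" "Dom E s = Dom E s'"
    "Cod E s = Dom E (q \<odot> c)" "Cod E s' = Dom E (q \<odot> c)"
    and e: "AMap F s = AMap F s'" "(q \<odot> c) \<odot> s = (q \<odot> c) \<odot> s'"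
  have "c \<odot> s = c \<odot> s'" by (rule cartesian_eq[OF q]) (use e in simp_all)
  then show "s = s'" using e by - (rule cartesian_eq[OF c], simp_all)
qed

lemma cartesian_cancel:
  assumes q: "is_cartesian F q" and c: "c \<in> Arr E" "Cod E c = Dom E q" and qc: "is_cartesian F (q \<odot> c)"
  shows "is_cartesian F c"
proof (rule cartesianI)
  note [simp] = cartesian_arr[OF q] c
  fix k r assume a [simp]: "r \<in> Arr E" "Cod E r = Cod E c" "k \<in> Arr B"
    "Cod B k = OMap F (Dom E c)" "AMap F r = AMap F c \<otimes> k"
  obtain s where s [simp]: "s \<in> Arr E" "Dom E s = Dom E r" "Cod E s = Dom E c" "AMap F s = k" and e: "q \<odot> (c \<odot> s) = q \<odot> r"
    using cartesian_ex[OF qc, of "q \<odot> r" k] by auto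
  have "c \<odot> s = r" by (rule cartesian_eq[OF q]) (simp_all add: e)
  then show "\<exists>s. s \<in> Arr E \<and> Dom E s = Dom E r \<and> Cod E s = Dom E c \<and> AMap F s = k \<and> c \<odot> s = r"
    by (intro exI[of _ s]) simp
next
  note [simp] = cartesian_arr[OF q] c
  fix s s' assume a [simp]: "s \<in> Arr E" "s' \<in> Arr E" "Dom E s = Dom E s'"
    "Cod E s = Dom E c" "Cod E s' = Dom E c"
    and e: "AMap F s = AMap F s'" "c \<odot> s = c \<odot> s'"
  show "s = s'" by (rule cartesian_eq[OF qc]) (use e in simp_all)
qed (rule c)

lemma cartesian_idt: "X \<in> Obj E \<Longrightarrow> is_cartesian F (Idt E X)"
proof (rule cartesianI)
  assume [simp]: "X \<in> Obj E"
  show "Idt E X \<in> Arr E" by simp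
  show "\<exists>s. s \<in> Arr E \<and> Dom E s = Dom E r \<and> Cod E s = Dom E (Idt E X) \<and> AMap F s = f \<and> Idt E X \<odot> s = r"
    if "r \<in> Arr E" "Cod E r = Cod E (Idt E X)" "f \<in> Arr B" "Cod B f = OMap F (Dom E (Idt E X))"
      "AMap F r = AMap F (Idt E X) \<otimes> f" for f r
    using that by (intro exI[of _ r]) simp
qed simp

lemma cocartesian_viso:
  assumes q: "is_cocartesian F q" and q': "is_cocartesian F q'" and e: "Dom E q = Dom E q'" "AMap F q = AMap F q'"
  shows "\<exists>f. is_iso (fiber F (OMap F (Cod E q))) f \<and> Cod E f = Cod E q' \<and> Dom E f = Cod E q \<and> q' = f \<odot> q"
proof -
  \<comment> \<open>The opposite functor has the same vertical isomorphisms, so the statement about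
    cartesian arrows dualises.\<close>
  have i: "is_iso (fiber (opp_ftr F) A) f \<longleftrightarrow> is_iso (fiber F A) f" for A f
    by (auto simp: is_iso_def inverse_arrows_def)
  show ?thesis
    using cat_functor.cartesian_viso[OF cat_functor_opp q[unfolded is_cocartesian_def] q'[unfolded is_cocartesian_def]] e by (simp add: i)
qed

lemma viso_comp_cocartesian:
  assumes q: "is_cocartesian F q" and f: "is_iso (fiber F A) f" "A \<in> Obj B" "Dom E f = Cod E q"
  shows "is_cocartesian F (f \<odot> q)"
proof -
  have i: "is_iso (fiber (opp_ftr F) A) f" using f(1) by (auto simp: is_iso_def inverse_arrows_def)
  show ?thesis
    using cat_functor.cartesian_comp_viso[OF cat_functor_opp q[unfolded is_cocartesian_def] i] f by (simp add: is_cocartesian_def)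
qed

lemma cocartesian_comp_viso:
  assumes q: "is_cocartesian F q" and f: "is_iso (fiber F A) f" "A \<in> Obj B" "Cod E f = Dom E q"
  shows "is_cocartesian F (q \<odot> f)"
proof -
  have i: "is_iso (fiber (opp_ftr F) A) f" using f(1) by (auto simp: is_iso_def inverse_arrows_def)
  show ?thesis
    using cat_functor.viso_comp_cartesian[OF cat_functor_opp q[unfolded is_cocartesian_def] i] f by (simp add: is_cocartesian_def)
qed

lemma cocartesian_arr: "is_cocartesian F q \<Longrightarrow> q \<in> Arr E"
  using cat_functor.cartesian_arr[OF cat_functor_opp, of q] by (simp add: is_cocartesian_def)

lemma cocartesianI:
  assumes q: "q \<in> Arr E"
    and ex: "\<And>f r. r \<in> Arr E \<Longrightarrow> Dom E r = Dom E q \<Longrightarrow> f \<in> Arr B \<Longrightarrow> Dom B f = OMap F (Cod E q) \<Longrightarrow>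
      Cod B f = OMap F (Cod E r) \<Longrightarrow> AMap F r = f \<otimes> AMap F q \<Longrightarrow>
      \<exists>s. s \<in> Arr E \<and> Cod E s = Cod E r \<and> Dom E s = Cod E q \<and> AMap F s = f \<and> s \<odot> q = r"
    and eq: "\<And>s s'. s \<in> Arr E \<Longrightarrow> s' \<in> Arr E \<Longrightarrow> Cod E s = Cod E s' \<Longrightarrow>
      Dom E s = Cod E q \<Longrightarrow> Dom E s' = Cod E q \<Longrightarrow> AMap F s = AMap F s' \<Longrightarrow>
      s \<odot> q = s' \<odot> q \<Longrightarrow> s = s'"
  shows "is_cocartesian F q"
  unfolding is_cocartesian_def
  by (rule cat_functor.cartesianI[OF cat_functor_opp]) (use assms in simp_all)

end

section \<open>Stability of diagrams in a fibration\<close>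

context cat_functor
begin

interpretation S: category "Src F" by (rule src_category)
interpretation T: category "Tgt F" by (rule tgt_category)

lemma cart_liftD:
  assumes "cart_lift F f Q c"
  shows "is_cartesian F c" "c \<in> Arr E" "Cod E c = Q" "AMap F c = f" "OMap F (Dom E c) = Dom B f"
proof -
  show c: "is_cartesian F c" "Cod E c = Q" "AMap F c = f" using assms by (auto simp: cart_lift_def)
  show "c \<in> Arr E" using cartesian_arr[OF c(1)] .
  then show "OMap F (Dom E c) = Dom B f" using c(3) ftr_simps(2)[of c] by simp
qed

lemma cart_liftI: "is_cartesian F c \<Longrightarrow> Cod E c = Q \<Longrightarrow> AMap F c = f \<Longrightarrow> cart_lift F f Q c"
  by (simp add: cart_lift_def)

lemma cart_lift_idt: "X \<in> Obj E \<Longrightarrow> cart_lift F (Idt B (OMap F X)) X (Idt E X)"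
  by (rule cart_liftI) (simp_all add: cartesian_idt)

text \<open>Exchanging the codomain for an isomorphic object leaves the domain of the lift
  unchanged, so statements about pulled back diagrams transfer literally.\<close>

lemma cart_lift_viso:
  assumes c: "cart_lift F f Q c" and r: "is_iso (fiber F A) r" "A \<in> Obj B" "Dom E r = Q"
  shows "cart_lift F f (Cod E r) (r \<odot> c)" "Dom E (r \<odot> c) = Dom E c"
proof -
  note [simp] = cart_liftD[OF c] r(3)
  have [simp]: "r \<in> Arr E" using viso_inverse[OF r(1,2)] by blast
  have rc: "Dom E r = Cod E c" by simp
  show "cart_lift F f (Cod E r) (r \<odot> c)"
    using viso_comp_cartesian[OF cart_liftD(1)[OF c] r(1,2) rc] by (intro cart_liftI) simp_all
  show "Dom E (r \<odot> c) = Dom E c" by simp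
qed

lemma cart_lift_iso:
  assumes c: "cart_lift F f Q c" and d: "cart_lift F f Q d"
  shows "\<exists>r. is_iso (fiber F (Dom B f)) r \<and> r \<in> Arr E \<and> AMap F r = Idt B (Dom B f) \<and> Dom E r = Dom E d \<and> Cod E r = Dom E c \<and> d = c \<odot> r"
proof -
  note C = cart_liftD[OF c] and D = cart_liftD[OF d]
  obtain r where "is_iso (fiber F (Dom B f)) r" "Dom E r = Dom E d" "Cod E r = Dom E c" "d = c \<odot> r"
    using cartesian_viso[OF C(1) D(1)] C D by auto
  moreover have "r \<in> Arr E" "AMap F r = Idt B (Dom B f)"
    using \<open>is_iso (fiber F (Dom B f)) r\<close> by (auto simp: is_iso_def inverse_arrows_def)
  ultimately show ?thesis by blast
qed

lemma inducedD:
  assumes "induced F b c u d u'"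
  shows "u' \<in> Arr E" "Dom E u' = Dom E c" "Cod E u' = Dom E d" "AMap F u' = b" "d \<odot> u' = u \<odot> c"
  using assms by (simp_all add: induced_def)

text \<open>Terminal with respect to arrows over every arrow of the base, not only vertical ones.
  Composition with a cartesian lift then carries the property to the pulled back object.\<close>

definition strong_terminal :: "'o \<Rightarrow> bool" where
  "strong_terminal T \<longleftrightarrow> T \<in> Obj E \<and>
    (\<forall>X \<in> Obj E. \<forall>f \<in> hom B (OMap F X) (OMap F T). \<exists>u \<in> hom E X T. AMap F u = f) \<and>
    (\<forall>u \<in> Arr E. \<forall>v \<in> Arr E. Cod E u = T \<and> Cod E v = T \<and> Dom E u = Dom E v \<and> AMap F u = AMap F v \<longrightarrow> u = v)"

lemma strong_terminal_stable:
  assumes T: "strong_terminal T" and f: "f \<in> Arr B"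
  shows "stable_terminal F f T"
  unfolding stable_terminal_def
proof (intro allI impI)
  fix c assume c: "cart_lift F f T c"
  note C = cart_liftD[OF c] and [simp] = cart_liftD(2-5)[OF c] f
  have Tf: "OMap F T = Cod B f" using ftr_simps(3)[OF C(2)] by simp
  show "is_terminal (fiber F (Dom B f)) (Dom E c)"
  proof (rule category.terminalI[OF category_fiber])
    show "Dom B f \<in> Obj B" by simp
    show "Dom E c \<in> Obj (fiber F (Dom B f))" by simp
  next
    fix X assume X: "X \<in> Obj (fiber F (Dom B f))"
    have "X \<in> Obj E" "f \<in> hom B (OMap F X) (OMap F T)" using X Tf by simp_all
    then obtain u where "u \<in> hom E X T" "AMap F u = f" using T unfolding strong_terminal_def by blast
    then have u: "u \<in> Arr E" "Dom E u = X" "Cod E u = T" "AMap F u = f" by simp_all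
    then show "\<exists>v. v \<in> Arr (fiber F (Dom B f)) \<and> Dom (fiber F (Dom B f)) v = X \<and> Cod (fiber F (Dom B f)) v = Dom E c"
      using cartesian_ex[OF C(1), of u "Idt B (Dom B f)"] X by auto
  next
    fix u v assume uv: "u \<in> Arr (fiber F (Dom B f))" "v \<in> Arr (fiber F (Dom B f))" "Cod (fiber F (Dom B f)) u = Dom E c"
      "Cod (fiber F (Dom B f)) v = Dom E c" "Dom (fiber F (Dom B f)) u = Dom (fiber F (Dom B f)) v"
    have "c \<odot> u \<in> Arr E" "c \<odot> v \<in> Arr E" "Cod E (c \<odot> u) = T" "Cod E (c \<odot> v) = T" "Dom E (c \<odot> u) = Dom E (c \<odot> v)"
      "AMap F (c \<odot> u) = AMap F (c \<odot> v)" using uv by simp_all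
    then have "c \<odot> u = c \<odot> v" using T unfolding strong_terminal_def by blast
    then show "u = v" using uv by - (rule cartesian_eq[OF C(1)], simp_all)
  qed
qed

lemma strong_terminal_fiber:
  assumes T: "strong_terminal T"
  shows "is_terminal (fiber F (OMap F T)) T"
proof -
  have [simp]: "T \<in> Obj E" using T by (simp add: strong_terminal_def)
  show ?thesis
    using strong_terminal_stable[OF T, of "Idt B (OMap F T)"] cart_lift_idt[of T] unfolding stable_terminal_def by force
qed

text \<open>Any terminal object of the fibre is isomorphic to the strong one, so its cartesian lifts
  are, after composition with that isomorphism, lifts of the strong one.\<close>

lemma terminal_stableI:
  assumes T: "strong_terminal T" and f: "f \<in> Arr B" "OMap F T = Cod B f" and T': "is_terminal (fiber F (Cod B f)) T'"
  shows "stable_terminal F f T'"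
  unfolding stable_terminal_def
proof (intro allI impI)
  fix c assume c: "cart_lift F f T' c"
  have B: "Cod B f \<in> Obj B" using f by simp
  obtain r where r: "is_iso (fiber F (Cod B f)) r" "Dom E r = T'" "Cod E r = T"
    using category.terminal_unique_iso[OF category_fiber[OF B] T' strong_terminal_fiber[OF T, unfolded f(2)]] by auto
  show "is_terminal (fiber F (Dom B f)) (Dom E c)"
    using strong_terminal_stable[OF T f(1)] cart_lift_viso[OF c r(1) B r(2)] r(3) unfolding stable_terminal_def by metis
qed

text \<open>The product of \<open>X\<close> with the pullback of \<open>P\<close> along
  \<open>f\<close>, described without choosing a cartesian lift of \<open>P\<close>, and tested
  against arrows over any arrow of the base. With \<open>f\<close> an identity it is a product in a
  fibre.\<close>

definition fibred_product :: "'b \<Rightarrow> 'o \<Rightarrow> 'o \<Rightarrow> 'o \<Rightarrow> 'a \<Rightarrow> 'a \<Rightarrow> bool" where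
  "fibred_product f X P R p q \<longleftrightarrow> p \<in> Arr E \<and> Dom E p = R \<and> Cod E p = X \<and> AMap F p = Idt B (OMap F X) \<and>
    q \<in> Arr E \<and> Dom E q = R \<and> Cod E q = P \<and> AMap F q = f \<and>
    (\<forall>a \<in> Arr E. \<forall>b \<in> Arr E. Dom E a = Dom E b \<and> Cod E a = X \<and> Cod E b = P \<and> AMap F b = f \<otimes> AMap F a \<longrightarrow>
      (\<exists>w \<in> hom E (Dom E b) R. p \<odot> w = a \<and> q \<odot> w = b)) \<and>
    (\<forall>w \<in> Arr E. \<forall>w' \<in> Arr E. Dom E w = Dom E w' \<and> Cod E w = R \<and> Cod E w' = R \<and> p \<odot> w = p \<odot> w' \<and> q \<odot> w = q \<odot> w' \<longrightarrow> w = w')"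

lemma fibred_productD:
  assumes "fibred_product f X P R p q"
  shows "p \<in> Arr E" "Dom E p = R" "Cod E p = X" "AMap F p = Idt B (OMap F X)" "q \<in> Arr E" "Dom E q = R" "Cod E q = P" "AMap F q = f"
    "OMap F R = OMap F X"
proof -
  show p: "p \<in> Arr E" "Dom E p = R" "Cod E p = X" "AMap F p = Idt B (OMap F X)" "q \<in> Arr E" "Dom E q = R" "Cod E q = P" "AMap F q = f"
    using assms unfolding fibred_product_def by blast+
  show "OMap F R = OMap F X" using vertical_objs(1)[of p "OMap F X"] p S.cod_obj[of p] ftr_simps(4)[of X] by simp
qed

lemma fibred_product_ex:
  assumes "fibred_product f X P R p q" "a \<in> Arr E" "b \<in> Arr E" "Dom E a = Dom E b" "Cod E a = X" "Cod E b = P" "AMap F b = f \<otimes> AMap F a"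
  shows "\<exists>w. w \<in> Arr E \<and> Dom E w = Dom E b \<and> Cod E w = R \<and> p \<odot> w = a \<and> q \<odot> w = b \<and> AMap F w = AMap F a"
proof -
  note D = fibred_productD[OF assms(1)]
  obtain w where w: "w \<in> hom E (Dom E b) R" "p \<odot> w = a" "q \<odot> w = b" using assms unfolding fibred_product_def by blast
  have "AMap F w = AMap F (p \<odot> w)" using D w(1) by simp
  also have "\<dots> = AMap F a" by (simp only: w(2))
  finally have "AMap F w = AMap F a" .
  then show ?thesis using w unfolding in_hom by blast
qed

lemma fibred_product_eq:
  assumes "fibred_product f X P R p q" "w \<in> Arr E" "w' \<in> Arr E" "Dom E w = Dom E w'" "Cod E w = R" "Cod E w' = R"
    "p \<odot> w = p \<odot> w'" "q \<odot> w = q \<odot> w'"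
  shows "w = w'"
  using assms unfolding fibred_product_def by blast

lemma fibred_productI:
  assumes "p \<in> Arr E" "Dom E p = R" "Cod E p = X" "AMap F p = Idt B (OMap F X)" "q \<in> Arr E" "Dom E q = R" "Cod E q = P" "AMap F q = f"
    and "\<And>a b. a \<in> Arr E \<Longrightarrow> b \<in> Arr E \<Longrightarrow> Dom E a = Dom E b \<Longrightarrow> Cod E a = X \<Longrightarrow> Cod E b = P \<Longrightarrow> AMap F b = f \<otimes> AMap F a \<Longrightarrow>
      \<exists>w. w \<in> Arr E \<and> Dom E w = Dom E b \<and> Cod E w = R \<and> p \<odot> w = a \<and> q \<odot> w = b"
    and "\<And>w w'. w \<in> Arr E \<Longrightarrow> w' \<in> Arr E \<Longrightarrow> Dom E w = Dom E w' \<Longrightarrow> Cod E w = R \<Longrightarrow> Cod E w' = R \<Longrightarrow>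
      p \<odot> w = p \<odot> w' \<Longrightarrow> q \<odot> w = q \<odot> w' \<Longrightarrow> w = w'"
  shows "fibred_product f X P R p q"
  unfolding fibred_product_def
proof (intro conjI ballI impI)
  fix a b assume "a \<in> Arr E" "b \<in> Arr E" "Dom E a = Dom E b \<and> Cod E a = X \<and> Cod E b = P \<and> AMap F b = f \<otimes> AMap F a"
  then have "\<exists>w. w \<in> Arr E \<and> Dom E w = Dom E b \<and> Cod E w = R \<and> p \<odot> w = a \<and> q \<odot> w = b" using assms(9) by blast
  then show "\<exists>w \<in> hom E (Dom E b) R. p \<odot> w = a \<and> q \<odot> w = b" by auto
next
  fix w w' assume "w \<in> Arr E" "w' \<in> Arr E" "Dom E w = Dom E w' \<and> Cod E w = R \<and> Cod E w' = R \<and> p \<odot> w = p \<odot> w' \<and> q \<odot> w = q \<odot> w'"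
  then show "w = w'" using assms(10) by blast
qed (use assms in simp_all)

text \<open>Composition with the cartesian \<open>c\<close> identifies vertical arrows into its
  domain with arrows over \<open>f\<close> into \<open>P\<close>, which turns the fibred product
  into an ordinary one.\<close>

lemma fibred_product_fiber:
  assumes R: "fibred_product f X P R p q" and f: "f \<in> Arr B" "OMap F X = Dom B f" and c: "cart_lift F f P c"
    and q': "q' \<in> Arr E" "Dom E q' = R" "Cod E q' = Dom E c" "AMap F q' = Idt B (Dom B f)" "c \<odot> q' = q"
  shows "is_product (fiber F (Dom B f)) X (Dom E c) R p q'"
proof (rule category.productI[OF category_fiber])
  note [simp] = fibred_productD[OF R] f cart_liftD(2-5)[OF c] q'(1-4)
  note C = cart_liftD(1)[OF c]
  show "Dom B f \<in> Obj B" by simp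
  fix a b assume ab: "a \<in> Arr (fiber F (Dom B f))" "b \<in> Arr (fiber F (Dom B f))" "Dom (fiber F (Dom B f)) a = Dom (fiber F (Dom B f)) b"
      "Cod (fiber F (Dom B f)) a = X" "Cod (fiber F (Dom B f)) b = Dom E c"
  obtain w where w: "w \<in> Arr E" "Dom E w = Dom E b" "Cod E w = R" "p \<odot> w = a" "q \<odot> w = c \<odot> b" "AMap F w = AMap F a"
    using fibred_product_ex[OF R, of a "c \<odot> b"] ab by auto
  have "q' \<odot> w = b" by (rule cartesian_eq[OF C]) (use ab w in \<open>simp_all add: S.reassoc[OF q'(5)]\<close>)
  then show "\<exists>u. u \<in> Arr (fiber F (Dom B f)) \<and> Dom (fiber F (Dom B f)) u = Dom (fiber F (Dom B f)) b \<and> Cod (fiber F (Dom B f)) u = R \<and>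
    p \<cdot>\<^bsub>fiber F (Dom B f)\<^esub> u = a \<and> q' \<cdot>\<^bsub>fiber F (Dom B f)\<^esub> u = b"
    using w ab by (intro exI[of _ w]) simp
next
  note [simp] = fibred_productD[OF R] f cart_liftD(2-5)[OF c] q'(1-4)
  fix u v assume uv: "u \<in> Arr (fiber F (Dom B f))" "v \<in> Arr (fiber F (Dom B f))" "Dom (fiber F (Dom B f)) u = Dom (fiber F (Dom B f)) v"
      "Cod (fiber F (Dom B f)) u = R" "Cod (fiber F (Dom B f)) v = R" "p \<cdot>\<^bsub>fiber F (Dom B f)\<^esub> u = p \<cdot>\<^bsub>fiber F (Dom B f)\<^esub> v"
      "q' \<cdot>\<^bsub>fiber F (Dom B f)\<^esub> u = q' \<cdot>\<^bsub>fiber F (Dom B f)\<^esub> v"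
  then have "c \<odot> (q' \<odot> u) = c \<odot> (q' \<odot> v)" by simp
  then have "q \<odot> u = q \<odot> v" using uv(1-5) by (simp add: S.reassoc[OF q'(5)])
  then show "u = v" using uv by - (rule fibred_product_eq[OF R], simp_all)
qed (use fibred_productD[OF R] f q' in simp_all)

lemma fibred_product_stable:
  assumes R: "fibred_product (Idt B (Cod B f)) P Q R p q" and f: "f \<in> Arr B" "OMap F P = Cod B f"
  shows "stable_product F f P Q R p q"
  unfolding stable_product_def Let_def
proof (intro allI impI)
  fix cP cQ cR p' q'
  assume a: "cart_lift F f P cP \<and> cart_lift F f Q cQ \<and> cart_lift F f R cR \<and>
      induced F (Idt B (Dom B f)) cR p cP p' \<and> induced F (Idt B (Dom B f)) cR q cQ q'"
  then have c: "cart_lift F f P cP" "cart_lift F f Q cQ" "cart_lift F f R cR" and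
    i: "induced F (Idt B (Dom B f)) cR p cP p'" "induced F (Idt B (Dom B f)) cR q cQ q'" by blast+
  note C = cart_liftD(1)[OF c(1)] cart_liftD(1)[OF c(2)] cart_liftD(1)[OF c(3)]
  note [simp] = fibred_productD[OF R] f cart_liftD(2-5)[OF c(1)] cart_liftD(2-5)[OF c(2)] cart_liftD(2-5)[OF c(3)] inducedD(1-4)[OF i(1)] inducedD(1-4)[OF i(2)]
  have "fibred_product (Idt B (Dom B f)) (Dom E cP) (Dom E cQ) (Dom E cR) p' q'"
  proof (rule fibred_productI)
    fix a b assume ab [simp]: "a \<in> Arr E" "b \<in> Arr E" "Dom E a = Dom E b" "Cod E a = Dom E cP" "Cod E b = Dom E cQ"
      and e: "AMap F b = Idt B (Dom B f) \<otimes> AMap F a"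
    have e' [simp]: "AMap F b = AMap F a" using e by simp
    obtain w where w [simp]: "w \<in> Arr E" "Dom E w = Dom E b" "Cod E w = R" "AMap F w = f \<otimes> AMap F a" and we: "p \<odot> w = cP \<odot> a" "q \<odot> w = cQ \<odot> b"
      using fibred_product_ex[OF R, of "cP \<odot> a" "cQ \<odot> b"] by auto
    obtain v where v [simp]: "v \<in> Arr E" "Dom E v = Dom E b" "Cod E v = Dom E cR" "AMap F v = AMap F a" and ve: "cR \<odot> v = w"
      using cartesian_ex[OF C(3), of w "AMap F a"] by auto
    have "p' \<odot> v = a" by (rule cartesian_eq[OF C(1)]) (simp_all add: S.reassoc[OF inducedD(5)[OF i(1)]] ve we)
    moreover have "q' \<odot> v = b" by (rule cartesian_eq[OF C(2)]) (simp_all add: S.reassoc[OF inducedD(5)[OF i(2)]] ve we)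
    ultimately show "\<exists>w. w \<in> Arr E \<and> Dom E w = Dom E b \<and> Cod E w = Dom E cR \<and> p' \<odot> w = a \<and> q' \<odot> w = b"
      by (intro exI[of _ v]) simp
  next
    fix u v assume uv [simp]: "u \<in> Arr E" "v \<in> Arr E" "Dom E u = Dom E v" "Cod E u = Dom E cR" "Cod E v = Dom E cR"
      and e: "p' \<odot> u = p' \<odot> v" "q' \<odot> u = q' \<odot> v"
    \<comment> \<open>As \<open>p'\<close> is vertical, \<open>u\<close> and \<open>v\<close> lie
      over the same arrow, which uniqueness for the cartesian \<open>cR\<close> requires.\<close>
    have "AMap F (p' \<odot> u) = AMap F (p' \<odot> v)" using e by simp
    then have m: "AMap F u = AMap F v" by simp
    have "cP \<odot> (p' \<odot> u) = cP \<odot> (p' \<odot> v)" "cQ \<odot> (q' \<odot> u) = cQ \<odot> (q' \<odot> v)" using e by simp_all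
    then have "p \<odot> (cR \<odot> u) = p \<odot> (cR \<odot> v)" "q \<odot> (cR \<odot> u) = q \<odot> (cR \<odot> v)"
      by (simp_all add: S.reassoc[OF inducedD(5)[OF i(1)]] S.reassoc[OF inducedD(5)[OF i(2)]])
    then have "cR \<odot> u = cR \<odot> v" by - (rule fibred_product_eq[OF R], simp_all)
    then show "u = v" using m by - (rule cartesian_eq[OF C(3)], simp_all)
  qed simp_all
  from fibred_product_fiber[OF this, of "Idt E (Dom E cQ)" q'] cart_lift_idt[of "Dom E cQ"]
  show "is_product (fiber F (Dom B f)) (Dom E cP) (Dom E cQ) (Dom E cR) p' q'" by simp
qed

lemma fibred_product_fiber_idt:
  assumes R: "fibred_product (Idt B (OMap F P)) P Q R p q"
  shows "is_product (fiber F (OMap F P)) P Q R p q"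
proof -
  note [simp] = fibred_productD[OF R]
  have [simp]: "P \<in> Obj E" "Q \<in> Obj E" "OMap F P \<in> Obj B" using S.cod_obj[of p] S.cod_obj[of q] ftr_simps(4)[of P] by simp_all
  have "OMap F Q = OMap F P" using vertical_objs(2)[of q "OMap F P"] by simp
  then show ?thesis using fibred_product_fiber[OF R _ _ _ _ _ _ _ S.idl[of q]] cart_lift_idt[of Q] by simp
qed

lemma product_stableI:
  assumes R: "fibred_product (Idt B (Cod B f)) P Q R p q" and f: "f \<in> Arr B" "OMap F P = Cod B f"
    and P: "is_product (fiber F (Cod B f)) P Q R' p' q'"
  shows "stable_product F f P Q R' p' q'"
  unfolding stable_product_def Let_def
proof (intro allI impI)
  fix cP cQ cR u v
  assume a: "cart_lift F f P cP \<and> cart_lift F f Q cQ \<and> cart_lift F f R' cR \<and>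
      induced F (Idt B (Dom B f)) cR p' cP u \<and> induced F (Idt B (Dom B f)) cR q' cQ v"
  have B: "Cod B f \<in> Obj B" using f by simp
  note pR = fibred_productD[OF R]
  have R': "is_product (fiber F (Cod B f)) P Q R p q" using fibred_product_fiber_idt[of P Q R p q] R f by simp
  obtain r where r: "is_iso (fiber F (Cod B f)) r" "Dom E r = R'" "Cod E r = R" "p' = p \<odot> r" "q' = q \<odot> r"
    using category.product_iso[OF category_fiber[OF B] R' P] by auto
  have [simp]: "r \<in> Arr E" using viso_inverse[OF r(1) B] by blast
  have c: "cart_lift F f R' cR" using a by blast
  note C = cart_liftD[OF c]
  have "induced F (Idt B (Dom B f)) (r \<odot> cR) p cP u" "induced F (Idt B (Dom B f)) (r \<odot> cR) q cQ v"
    using a r C pR by (simp_all add: induced_def)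
  then show "is_product (fiber F (Dom B f)) (Dom E cP) (Dom E cQ) (Dom E cR) u v"
    using fibred_product_stable[OF R f] a cart_lift_viso[OF c r(1) B r(2)] r(3) unfolding stable_product_def Let_def by metis
qed

text \<open>Here \<open>X\<close> is the exponential object. Transposes are taken over every arrow
  \<open>f\<close> into the base of \<open>X\<close>, and for each \<open>Y\<close> and
  \<open>f\<close> a single fibred product is provided, in keeping with
  \<open>exponentialI\<close>.\<close>

definition strong_exponential :: "'o \<Rightarrow> 'o \<Rightarrow> 'o \<Rightarrow> 'o \<Rightarrow> 'a \<Rightarrow> 'a \<Rightarrow> 'a \<Rightarrow> bool" where
  "strong_exponential P Q X R p q e \<longleftrightarrow> fibred_product (Idt B (OMap F X)) X P R p q \<and>
    e \<in> Arr E \<and> Dom E e = R \<and> Cod E e = Q \<and> AMap F e = Idt B (OMap F X) \<and>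
    (\<forall>Y f. Y \<in> Obj E \<and> f \<in> hom B (OMap F Y) (OMap F X) \<longrightarrow> (\<exists>Z s t. fibred_product f Y P Z s t \<and>
      (\<forall>k. k \<in> hom E Z Q \<and> AMap F k = f \<longrightarrow> (\<exists>!u. u \<in> hom E Y X \<and> AMap F u = f \<and>
        (\<exists>v \<in> hom E Z R. p \<odot> v = u \<odot> s \<and> q \<odot> v = t \<and> e \<odot> v = k)))))"

text \<open>Vertical arrows into the domain of a cartesian lift correspond to arrows over
  \<open>f\<close> into its codomain, so the exponential property of the pulled back diagram is the
  strong property at \<open>f\<close>.\<close>

lemma strong_exponential_stable:
  assumes X: "strong_exponential P Q X R p q e" and f: "f \<in> Arr B" "OMap F X = Cod B f"
  shows "stable_exponential F f P Q X R p q e"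
  unfolding stable_exponential_def Let_def
proof (intro allI impI)
  let ?A = "Dom B f"
  let ?I = "Idt B ?A"
  fix cP cQ cX cR p' q' e'
  assume a: "cart_lift F f P cP \<and> cart_lift F f Q cQ \<and> cart_lift F f X cX \<and> cart_lift F f R cR \<and>
      induced F ?I cR p cX p' \<and> induced F ?I cR q cP q' \<and> induced F ?I cR e cQ e'"
  then have c: "cart_lift F f P cP" "cart_lift F f Q cQ" "cart_lift F f X cX" "cart_lift F f R cR" and
    i: "induced F ?I cR p cX p'" "induced F ?I cR q cP q'" "induced F ?I cR e cQ e'" by blast+
  note C = cart_liftD(1)[OF c(1)] cart_liftD(1)[OF c(2)] cart_liftD(1)[OF c(3)] cart_liftD(1)[OF c(4)]
  have R: "fibred_product (Idt B (Cod B f)) X P R p q" and e: "e \<in> Arr E" "Dom E e = R" "Cod E e = Q" "AMap F e = Idt B (Cod B f)"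
    using X unfolding strong_exponential_def f by blast+
  note [simp] = fibred_productD[OF R] f e cart_liftD(2-5)[OF c(1)] cart_liftD(2-5)[OF c(2)] cart_liftD(2-5)[OF c(3)] cart_liftD(2-5)[OF c(4)]
    inducedD(1-4)[OF i(1)] inducedD(1-4)[OF i(2)] inducedD(1-4)[OF i(3)]
  note I = S.reassoc[OF inducedD(5)[OF i(1)]] S.reassoc[OF inducedD(5)[OF i(2)]] S.reassoc[OF inducedD(5)[OF i(3)]]
  have A: "?A \<in> Obj B" by simp
  show "is_exponential (fiber F ?A) (Dom E cP) (Dom E cQ) (Dom E cX) (Dom E cR) p' q' e'"
  proof (rule category.exponentialI[OF category_fiber[OF A]])
    show "is_product (fiber F ?A) (Dom E cX) (Dom E cP) (Dom E cR) p' q'"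
      using fibred_product_stable[OF R f] c i unfolding stable_product_def Let_def by blast
    fix Y assume Y: "Y \<in> Obj (fiber F ?A)"
    then have Y' [simp]: "Y \<in> Obj E" "OMap F Y = ?A" by simp_all
    have fh: "f \<in> hom B (OMap F Y) (OMap F X)" by simp
    note strong = X[unfolded strong_exponential_def, THEN conjunct2, THEN conjunct2, THEN conjunct2, THEN conjunct2, THEN conjunct2]
    obtain Z s t where Z: "fibred_product f Y P Z s t" and
      k0: "\<forall>k. k \<in> hom E Z Q \<and> AMap F k = f \<longrightarrow> (\<exists>!u. u \<in> hom E Y X \<and> AMap F u = f \<and>
        (\<exists>v \<in> hom E Z R. p \<odot> v = u \<odot> s \<and> q \<odot> v = t \<and> e \<odot> v = k))"
      using strong[THEN spec, THEN spec, THEN mp, OF conjI[OF Y'(1) fh]] by (elim exE conjE)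
    note k = k0[THEN spec, THEN mp]
    note [simp] = fibred_productD[OF Z]
    have oZ: "OMap F Z = ?A" using vertical_objs(1)[of s ?A] by simp
    obtain t' where t' [simp]: "t' \<in> Arr E" "Dom E t' = Z" "Cod E t' = Dom E cP" "AMap F t' = ?I" and t'e: "cP \<odot> t' = t"
      using cartesian_ex[OF C(1), of t ?I] by auto
    have Zp: "is_product (fiber F ?A) Y (Dom E cP) Z s t'" by (rule fibred_product_fiber[OF Z _ _ c(1)]) (simp_all add: t'e)
    have "\<exists>!u. u \<in> hom (fiber F ?A) Y (Dom E cX) \<and> (\<exists>v \<in> hom (fiber F ?A) Z (Dom E cR). p' \<odot> v = u \<odot> s \<and> q' \<odot> v = t' \<and> e' \<odot> v = k')"
      if k': "k' \<in> hom (fiber F ?A) Z (Dom E cQ)" for k'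
    proof -
      have k'' [simp]: "k' \<in> Arr E" "Dom E k' = Z" "Cod E k' = Dom E cQ" "AMap F k' = ?I" using k' by simp_all
      have "cQ \<odot> k' \<in> hom E Z Q \<and> AMap F (cQ \<odot> k') = f" by simp
      note K = k[OF this]
      \<comment> \<open>Composition with the lifts \<open>cX\<close>, \<open>cP\<close>,
        \<open>cQ\<close> and \<open>cR\<close> translates the two transposition conditions into
        each other.\<close>
      have iff: "(\<exists>v \<in> hom (fiber F ?A) Z (Dom E cR). p' \<odot> v = u \<odot> s \<and> q' \<odot> v = t' \<and> e' \<odot> v = k') \<longleftrightarrow>
        (\<exists>v \<in> hom E Z R. p \<odot> v = (cX \<odot> u) \<odot> s \<and> q \<odot> v = t \<and> e \<odot> v = cQ \<odot> k')" (is "?L \<longleftrightarrow> ?R")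
        if u: "u \<in> hom (fiber F ?A) Y (Dom E cX)" for u
      proof
        assume ?L
        then obtain v where [simp]: "v \<in> Arr E" "Dom E v = Z" "Cod E v = Dom E cR" "AMap F v = ?I" and v: "p' \<odot> v = u \<odot> s" "q' \<odot> v = t'" "e' \<odot> v = k'" by auto
        have "p \<odot> (cR \<odot> v) = cX \<odot> (p' \<odot> v)" "q \<odot> (cR \<odot> v) = cP \<odot> (q' \<odot> v)" "e \<odot> (cR \<odot> v) = cQ \<odot> (e' \<odot> v)"
          by (simp_all add: I)
        then show ?R using u by (intro bexI[of _ "cR \<odot> v"]) (simp_all add: v t'e)
      next
        assume ?R
        then obtain v where [simp]: "v \<in> Arr E" "Dom E v = Z" "Cod E v = R" and v: "p \<odot> v = cX \<odot> (u \<odot> s)" "q \<odot> v = t" "e \<odot> v = cQ \<odot> k'" using u by auto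
        have "AMap F (e \<odot> v) = AMap F (cQ \<odot> k')" using v by simp
        then have [simp]: "AMap F v = f" by simp
        obtain w where [simp]: "w \<in> Arr E" "Dom E w = Z" "Cod E w = Dom E cR" "AMap F w = ?I" and w: "cR \<odot> w = v"
          using cartesian_ex[OF C(4), of v ?I] by auto
        have "p' \<odot> w = u \<odot> s" by (rule cartesian_eq[OF C(3)]) (use u in \<open>simp_all add: I w v\<close>)
        moreover have "q' \<odot> w = t'" by (rule cartesian_eq[OF C(1)]) (use u in \<open>simp_all add: I w v t'e\<close>)
        moreover have "e' \<odot> w = k'" by (rule cartesian_eq[OF C(2)]) (use u in \<open>simp_all add: I w v\<close>)
        ultimately show ?L by (intro bexI[of _ w]) simp_all
      qed
      obtain u0 where u0: "u0 \<in> hom E Y X" "AMap F u0 = f" "\<exists>v \<in> hom E Z R. p \<odot> v = u0 \<odot> s \<and> q \<odot> v = t \<and> e \<odot> v = cQ \<odot> k'"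
        using K by blast
      obtain u where u: "u \<in> Arr E" "Dom E u = Y" "Cod E u = Dom E cX" "AMap F u = ?I" "cX \<odot> u = u0"
        using cartesian_ex[OF C(3), of u0 ?I] u0 by auto
      have uh: "u \<in> hom (fiber F ?A) Y (Dom E cX)" using u by simp
      show ?thesis
      proof (rule ex1I[where a = u])
        show "u \<in> hom (fiber F ?A) Y (Dom E cX) \<and> (\<exists>v \<in> hom (fiber F ?A) Z (Dom E cR). p' \<odot> v = u \<odot> s \<and> q' \<odot> v = t' \<and> e' \<odot> v = k')"
          using iff[OF uh] u0(3) uh u(5) by blast
        fix u' assume u': "u' \<in> hom (fiber F ?A) Y (Dom E cX) \<and> (\<exists>v \<in> hom (fiber F ?A) Z (Dom E cR). p' \<odot> v = u' \<odot> s \<and> q' \<odot> v = t' \<and> e' \<odot> v = k')"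
        then have "\<exists>v \<in> hom E Z R. p \<odot> v = (cX \<odot> u') \<odot> s \<and> q \<odot> v = t \<and> e \<odot> v = cQ \<odot> k'" using iff[of u'] by blast
        moreover have "cX \<odot> u' \<in> hom E Y X" "AMap F (cX \<odot> u') = f" using u' by simp_all
        ultimately have "cX \<odot> u' = u0" using K u0 by blast
        then show "u' = u" using u u' by - (rule cartesian_eq[OF C(3)], simp_all)
      qed
    qed
    then show "\<exists>S q1 q2. is_product (fiber F ?A) Y (Dom E cP) S q1 q2 \<and> (\<forall>f'\<in>hom (fiber F ?A) S (Dom E cQ).
      \<exists>!u. u \<in> hom (fiber F ?A) Y (Dom E cX) \<and> (\<exists>v\<in>hom (fiber F ?A) S (Dom E cR). p' \<cdot>\<^bsub>fiber F ?A\<^esub> v = u \<cdot>\<^bsub>fiber F ?A\<^esub> q1 \<and>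
        q' \<cdot>\<^bsub>fiber F ?A\<^esub> v = q2 \<and> e' \<cdot>\<^bsub>fiber F ?A\<^esub> v = f'))"
      using Zp unfolding fiber_simps by blast
  qed simp_all
qed

lemma strong_exponential_fiber:
  assumes X: "strong_exponential P Q X R p q e"
  shows "is_exponential (fiber F (OMap F X)) P Q X R p q e"
proof -
  have R: "fibred_product (Idt B (OMap F X)) X P R p q" and e: "e \<in> Arr E" "Dom E e = R" "Cod E e = Q" "AMap F e = Idt B (OMap F X)"
    using X unfolding strong_exponential_def by blast+
  note [simp] = fibred_productD[OF R] e
  have [simp]: "X \<in> Obj E" "P \<in> Obj E" "Q \<in> Obj E" "R \<in> Obj E" "OMap F X \<in> Obj B"
    using S.cod_obj[of p] S.cod_obj[of q] S.cod_obj[of e] S.dom_obj[of p] ftr_simps(4)[of X] by simp_all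
  have o: "OMap F P = OMap F X" "OMap F R = OMap F X" "OMap F Q = OMap F X"
    using vertical_objs[of q "OMap F X"] vertical_objs[of e "OMap F X"] by simp_all
  let ?I = "Idt B (OMap F X)"
  have "cart_lift F ?I P (Idt E P)" "cart_lift F ?I Q (Idt E Q)" "cart_lift F ?I X (Idt E X)" "cart_lift F ?I R (Idt E R)"
    using cart_lift_idt[of P] cart_lift_idt[of Q] cart_lift_idt[of X] cart_lift_idt[of R] by (simp_all add: o)
  moreover have "induced F ?I (Idt E R) p (Idt E X) p" "induced F ?I (Idt E R) q (Idt E P) q" "induced F ?I (Idt E R) e (Idt E Q) e"
    by (simp_all add: induced_def)
  moreover have "stable_exponential F ?I P Q X R p q e" using strong_exponential_stable[OF X, of ?I] by simp
  note this[unfolded stable_exponential_def Let_def, rule_format, of "Idt E P" "Idt E Q" "Idt E X" "Idt E R" p q e]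
  ultimately show ?thesis by simp
qed

text \<open>The given diagram is isomorphic to the strong one; the isomorphisms on \<open>X'\<close>
  and \<open>R'\<close> are absorbed into the lifts \<open>cX\<close> and \<open>cR\<close>, and the
  same induced arrows serve for both.\<close>

lemma exponential_stableI:
  assumes X: "strong_exponential P Q X R p q e" and f: "f \<in> Arr B" "OMap F X = Cod B f"
    and X': "is_exponential (fiber F (Cod B f)) P Q X' R' p' q' e'"
  shows "stable_exponential F f P Q X' R' p' q' e'"
  unfolding stable_exponential_def Let_def
proof (intro allI impI)
  let ?I = "Idt B (Dom B f)"
  fix cP cQ cX cR u v w
  assume a: "cart_lift F f P cP \<and> cart_lift F f Q cQ \<and> cart_lift F f X' cX \<and> cart_lift F f R' cR \<and>
      induced F ?I cR p' cX u \<and> induced F ?I cR q' cP v \<and> induced F ?I cR e' cQ w"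
  have B: "Cod B f \<in> Obj B" using f by simp
  have R: "fibred_product (Idt B (Cod B f)) X P R p q" and e: "e \<in> Arr E" "Dom E e = R" "Cod E e = Q" "AMap F e = Idt B (Cod B f)"
    using X unfolding strong_exponential_def f by blast+
  note pR = fibred_productD[OF R] e
  note P' = category.productD[OF category_fiber[OF B] category.exponentialD(1)[OF category_fiber[OF B] X']]
  obtain k r where k: "is_iso (fiber F (Cod B f)) k" "Dom E k = X'" "Cod E k = X" and
    r: "is_iso (fiber F (Cod B f)) r" "Dom E r = R'" "Cod E r = R" and kr: "p \<odot> r = k \<odot> p'" "q \<odot> r = q'" "e \<odot> r = e'"
    using category.exponential_iso[OF category_fiber[OF B] strong_exponential_fiber[OF X, unfolded f] X'] unfolding fiber_simps by blast
  have [simp]: "r \<in> Arr E" "k \<in> Arr E" using viso_inverse[OF r(1) B] viso_inverse[OF k(1) B] by blast+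
  have c: "cart_lift F f R' cR" "cart_lift F f X' cX" using a by blast+
  note C = cart_liftD[OF c(1)] cart_liftD[OF c(2)]
  have i: "induced F ?I cR p' cX u" "induced F ?I cR q' cP v" "induced F ?I cR e' cQ w" using a by blast+
  have [simp]: "p' \<in> Arr E" "Dom E p' = R'" "Cod E p' = X'" using P' by simp_all
  have "induced F ?I (r \<odot> cR) p (k \<odot> cX) u" "induced F ?I (r \<odot> cR) q cP v" "induced F ?I (r \<odot> cR) e cQ w"
    using inducedD[OF i(1)] inducedD[OF i(2)] inducedD[OF i(3)] r k C pR by (simp_all add: induced_def S.reassoc[OF kr(1)] S.reassoc[OF kr(2)] S.reassoc[OF kr(3)])
  then show "is_exponential (fiber F (Dom B f)) (Dom E cP) (Dom E cQ) (Dom E cX) (Dom E cR) u v w"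
    using strong_exponential_stable[OF X f] a cart_lift_viso[OF c(1) r(1) B r(2)] cart_lift_viso[OF c(2) k(1) B k(2)] r(3) k(3)
    unfolding stable_exponential_def Let_def by metis
qed

end

section \<open>Stability of initial objects, coproducts, cocartesian arrows and dependent
  products\<close>

context cat_functor
begin

interpretation S: category "Src F" by (rule src_category)
interpretation T: category "Tgt F" by (rule tgt_category)

text \<open>Colimits are tested by arrows out of an object, about which cartesian lifts give no
  information. Stability is therefore assumed for one initial object and one lift, and carried over
  by vertical isomorphisms.\<close>

lemma initial_stableI:
  assumes f: "f \<in> Arr B" and Z: "is_initial (fiber F (Cod B f)) Z" and Z0: "is_initial (fiber F (Cod B f)) Z0"
    and c0: "cart_lift F f Z0 c0" "is_initial (fiber F (Dom B f)) (Dom E c0)"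
  shows "stable_initial F f Z"
  unfolding stable_initial_def
proof (intro allI impI)
  fix c assume c: "cart_lift F f Z c"
  have o: "Cod B f \<in> Obj B" "Dom B f \<in> Obj B" using f by simp_all
  interpret C: category "fiber F (Cod B f)" by (rule category_fiber[OF o(1)])
  interpret A: category "fiber F (Dom B f)" by (rule category_fiber[OF o(2)])
  obtain r where r: "is_iso (fiber F (Cod B f)) r" "Dom E r = Z" "Cod E r = Z0"
    using category.terminal_unique_iso[OF C.category_opp Z0[unfolded is_initial_def] Z[unfolded is_initial_def]]
    by (auto simp: C.is_iso_opp)
  note d = cart_lift_viso[OF c r(1) o(1) r(2), unfolded r(3)]
  obtain s where s: "is_iso (fiber F (Dom B f)) s" "Dom E s = Dom E c" "Cod E s = Dom E c0" "s \<in> Arr (fiber F (Dom B f))"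
    using cart_lift_iso[OF c0(1) d(1)] d(2) by auto
  show "is_initial (fiber F (Dom B f)) (Dom E c)"
    unfolding is_initial_def
    by (rule category.terminal_iso[OF A.category_opp c0(2)[unfolded is_initial_def], of s]) (use s in \<open>simp_all add: A.is_iso_opp\<close>)
qed

text \<open>As for initial objects, one stable representative with one choice of lifts suffices;
  here the comparison isomorphisms must also be checked against the injections.\<close>

lemma coproduct_stableI:
  assumes f: "f \<in> Arr B" and S: "is_coproduct (fiber F (Cod B f)) P Q S i1 i2" and S0: "is_coproduct (fiber F (Cod B f)) P Q S0 j1 j2"
    and c0: "cart_lift F f P cP0" "cart_lift F f Q cQ0" "cart_lift F f S0 cS0"
      "induced F (Idt B (Dom B f)) cP0 j1 cS0 j1'" "induced F (Idt B (Dom B f)) cQ0 j2 cS0 j2'"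
      "is_coproduct (fiber F (Dom B f)) (Dom E cP0) (Dom E cQ0) (Dom E cS0) j1' j2'"
  shows "stable_coproduct F f P Q S i1 i2"
  unfolding stable_coproduct_def Let_def
proof (intro allI impI)
  let ?I = "Idt B (Dom B f)"
  fix cP cQ cS i1' i2'
  assume a: "cart_lift F f P cP \<and> cart_lift F f Q cQ \<and> cart_lift F f S cS \<and> induced F ?I cP i1 cS i1' \<and> induced F ?I cQ i2 cS i2'"
  then have c: "cart_lift F f P cP" "cart_lift F f Q cQ" "cart_lift F f S cS" and i: "induced F ?I cP i1 cS i1'" "induced F ?I cQ i2 cS i2'" by blast+
  have o: "Cod B f \<in> Obj B" "Dom B f \<in> Obj B" using f by simp_all
  interpret C: category "fiber F (Cod B f)" by (rule category_fiber[OF o(1)])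
  interpret A: category "fiber F (Dom B f)" by (rule category_fiber[OF o(2)])
  obtain r where r: "is_iso (fiber F (Cod B f)) r" "Dom E r = S" "Cod E r = S0" and ij: "j1 = r \<odot> i1" "j2 = r \<odot> i2"
    using category.product_iso[OF C.category_opp S[unfolded is_coproduct_def] S0[unfolded is_coproduct_def]]
    by (auto simp: C.is_iso_opp)
  note d = cart_lift_viso[OF c(3) r(1) o(1) r(2), unfolded r(3)]
  have [simp]: "r \<in> Arr E" using viso_inverse[OF r(1) o(1)] by blast
  note si = C.coproductD[OF S] C.coproductD[OF S0]
  note [simp] = cart_liftD(2-5)[OF c(1)] cart_liftD(2-5)[OF c(2)] cart_liftD(2-5)[OF c(3)] cart_liftD(2-5)[OF c0(1)]
    cart_liftD(2-5)[OF c0(2)] cart_liftD(2-5)[OF c0(3)] r(2,3) inducedD(1-4)[OF i(1)] inducedD(1-4)[OF i(2)]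
    inducedD(1-4)[OF c0(4)] inducedD(1-4)[OF c0(5)]
  have [simp]: "i1 \<in> Arr E" "Dom E i1 = P" "Cod E i1 = S" "i2 \<in> Arr E" "Dom E i2 = Q" "Cod E i2 = S"
    "j1 \<in> Arr E" "Dom E j1 = P" "Cod E j1 = S0" "j2 \<in> Arr E" "Dom E j2 = Q" "Cod E j2 = S0" using si by simp_all
  obtain a where a: "is_iso (fiber F (Dom B f)) a" "a \<in> Arr E" "AMap F a = ?I" "Dom E a = Dom E cP" "Cod E a = Dom E cP0" "cP = cP0 \<odot> a"
    using cart_lift_iso[OF c0(1) c(1)] by auto
  obtain b where b: "is_iso (fiber F (Dom B f)) b" "b \<in> Arr E" "AMap F b = ?I" "Dom E b = Dom E cQ" "Cod E b = Dom E cQ0" "cQ = cQ0 \<odot> b"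
    using cart_lift_iso[OF c0(2) c(2)] by auto
  obtain s where s: "is_iso (fiber F (Dom B f)) s" "s \<in> Arr E" "AMap F s = ?I" "Dom E s = Dom E cS" "Cod E s = Dom E cS0" "r \<odot> cS = cS0 \<odot> s"
    using cart_lift_iso[OF c0(3) d(1)] d(2) by auto
  note [simp] = a(2-5) b(2-5) s(2-5)
  obtain s' where s': "is_iso (fiber F (Dom B f)) s'" and [simp]: "s' \<in> Arr E" "Dom E s' = Dom E cS0" "Cod E s' = Dom E cS" "AMap F s' = ?I"
    and ss': "s' \<odot> s = Idt E (Dom E cS)"
    using viso_inverse[OF s(1) o(2)] by auto
  \<comment> \<open>The comparisons commute with the induced injections because they do so after
    composition with the cartesian \<open>cS0\<close>.\<close>
  have "s \<odot> i1' = j1' \<odot> a"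
  proof (rule cartesian_eq[OF cart_liftD(1)[OF c0(3)]])
    have "cS0 \<odot> (s \<odot> i1') = r \<odot> (cS \<odot> i1')" using S.reassoc[OF s(6)[symmetric], of i1'] by simp
    also have "\<dots> = j1 \<odot> cP" by (simp add: inducedD(5)[OF i(1)] ij)
    also have "\<dots> = cS0 \<odot> (j1' \<odot> a)" using S.reassoc[OF inducedD(5)[OF c0(4)], of a] by (simp add: a(6)[symmetric])
    finally show "cS0 \<odot> (s \<odot> i1') = cS0 \<odot> (j1' \<odot> a)" .
  qed simp_all
  then have 1: "i1' = s' \<odot> (j1' \<odot> a)" using S.reassoc[OF ss', of i1'] by simp
  have "s \<odot> i2' = j2' \<odot> b"
  proof (rule cartesian_eq[OF cart_liftD(1)[OF c0(3)]])
    have "cS0 \<odot> (s \<odot> i2') = r \<odot> (cS \<odot> i2')" using S.reassoc[OF s(6)[symmetric], of i2'] by simp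
    also have "\<dots> = j2 \<odot> cQ" by (simp add: inducedD(5)[OF i(2)] ij)
    also have "\<dots> = cS0 \<odot> (j2' \<odot> b)" using S.reassoc[OF inducedD(5)[OF c0(5)], of b] by (simp add: b(6)[symmetric])
    finally show "cS0 \<odot> (s \<odot> i2') = cS0 \<odot> (j2' \<odot> b)" .
  qed simp_all
  then have 2: "i2' = s' \<odot> (j2' \<odot> b)" using S.reassoc[OF ss', of i2'] by simp
  show "is_coproduct (fiber F (Dom B f)) (Dom E cP) (Dom E cQ) (Dom E cS) i1' i2'"
    unfolding is_coproduct_def
    by (rule category.product_iso_invariant[OF A.category_opp c0(6)[unfolded is_coproduct_def], of a _ b _ s'])
      (use a(1) b(1) s' in \<open>simp_all add: A.is_iso_opp 1 2\<close>)
qed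

text \<open>Another choice of lifts changes the induced arrow by vertical isomorphisms at both ends,
  which preserve cocartesianness.\<close>

lemma cocartesian_one_lift:
  assumes q: "q \<in> Arr E" and c0: "cart_lift F h (Dom E q) c0" "cart_lift F k (Cod E q) d0" "induced F f c0 q d0 q0" "is_cocartesian F q0"
    and c: "cart_lift F h (Dom E q) c" "cart_lift F k (Cod E q) d" "induced F f c q d q'"
  shows "is_cocartesian F q'"
proof -
  note [simp] = q cart_liftD(2-5)[OF c0(1)] cart_liftD(2-5)[OF c0(2)] cart_liftD(2-5)[OF c(1)] cart_liftD(2-5)[OF c(2)]
    inducedD(1-4)[OF c0(3)] inducedD(1-4)[OF c(3)]
  have f: "Dom B f = Dom B h" "Cod B f = Dom B k" "f \<in> Arr B"
    using ftr_simps(1-3)[of q0] by simp_all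
  obtain a where a: "is_iso (fiber F (Dom B h)) a" "a \<in> Arr E" "AMap F a = Idt B (Dom B h)" "Dom E a = Dom E c" "Cod E a = Dom E c0" "c = c0 \<odot> a"
    using cart_lift_iso[OF c0(1) c(1)] by auto
  obtain b where b: "is_iso (fiber F (Dom B k)) b" "b \<in> Arr E" "AMap F b = Idt B (Dom B k)" "Dom E b = Dom E d" "Cod E b = Dom E d0" "d = d0 \<odot> b"
    using cart_lift_iso[OF c0(2) c(2)] by auto
  have o: "Dom B h \<in> Obj B" "Dom B k \<in> Obj B" using f by (metis T.dom_obj T.cod_obj)+
  note [simp] = a(2-5) b(2-5) f
  obtain b' where b': "is_iso (fiber F (Dom B k)) b'" and [simp]: "b' \<in> Arr E" "Dom E b' = Dom E d0" "Cod E b' = Dom E d"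
    and bb: "b' \<odot> b = Idt E (Dom E d)"
    using viso_inverse[OF b(1) o(2)] by auto
  have "b \<odot> q' = q0 \<odot> a"
  proof (rule cartesian_eq[OF cart_liftD(1)[OF c0(2)]])
    have "d0 \<odot> (b \<odot> q') = d \<odot> q'" using S.reassoc[OF b(6)[symmetric], of q'] by simp
    also have "\<dots> = q \<odot> c" by (rule inducedD(5)[OF c(3)])
    also have "\<dots> = d0 \<odot> (q0 \<odot> a)" using S.reassoc[OF inducedD(5)[OF c0(3)], of a] by (simp add: a(6)[symmetric])
    finally show "d0 \<odot> (b \<odot> q') = d0 \<odot> (q0 \<odot> a)" .
  qed simp_all
  then have "q' = b' \<odot> (q0 \<odot> a)" using S.reassoc[OF bb, of q'] by simp
  moreover have "is_cocartesian F (q0 \<odot> a)" by (rule cocartesian_comp_viso[OF c0(4) a(1) o(1)]) simp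
  then have "is_cocartesian F (b' \<odot> (q0 \<odot> a))" by (rule viso_comp_cocartesian[OF _ b'(1) o(2)]) simp
  ultimately show ?thesis by simp
qed

lemma cocartesian_stableI:
  assumes q: "is_cocartesian F q" and q0: "is_cocartesian F q0" and e: "Dom E q = Dom E q0" "AMap F q = AMap F q0" and st: "stable_cocartesian F q0"
  shows "stable_cocartesian F q"
  unfolding stable_cocartesian_def
proof (intro allI impI)
  fix h k f c d q'
  assume a: "is_pullback B (AMap F q) h k f \<and> cart_lift F h (Dom E q) c \<and> cart_lift F k (Cod E q) d \<and> induced F f c q d q'"
  note [simp] = cocartesian_arr[OF q] cocartesian_arr[OF q0] e
  let ?A = "OMap F (Cod E q)"
  obtain r where r: "is_iso (fiber F ?A) r" "Cod E r = Cod E q0" "Dom E r = Cod E q" "q0 = r \<odot> q"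
    using cocartesian_viso[OF q q0] e by auto
  have A: "?A \<in> Obj B" by simp
  have [simp]: "r \<in> Arr E" using viso_inverse[OF r(1) A] by blast
  have d: "cart_lift F k (Cod E q) d" and c: "cart_lift F h (Dom E q) c" and i: "induced F f c q d q'" using a by blast+
  note D = cart_lift_viso[OF d r(1) A r(3), unfolded r(2)]
  note [simp] = cart_liftD(2-5)[OF d] cart_liftD(2-5)[OF c] inducedD(1-4)[OF i] r(2,3)
  have "r \<odot> (q \<odot> c) = q0 \<odot> c" using S.reassoc[OF r(4)[symmetric], of c] by simp
  then have "induced F f c q0 (r \<odot> d) q'" by (simp add: induced_def inducedD(5)[OF i])
  moreover have "is_pullback B (AMap F q0) h k f" "cart_lift F h (Dom E q0) c" using a c by simp_all
  ultimately show "is_cocartesian F q'" using st D(1) unfolding stable_cocartesian_def by blast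
qed

text \<open>The universal property after base change along every pullback of \<open>g\<close>:
  arrows over \<open>k\<close> from \<open>X\<close> to the product object correspond to arrows over
  \<open>h\<close> from the pullback of \<open>X\<close> along \<open>f\<close> to \<open>P\<close>.
  The trivial pullback square gives the plain \<open>\<Prod>\<close>-diagram; the general ones give
  its stability.\<close>

definition strong_Pi :: "'b \<Rightarrow> 'o \<Rightarrow> 'a \<Rightarrow> 'a \<Rightarrow> bool" where
  "strong_Pi g P c e \<longleftrightarrow> is_cartesian F c \<and> AMap F c = g \<and> e \<in> Arr E \<and> Dom E e = Dom E c \<and> Cod E e = P \<and> AMap F e = Idt B (Dom B g) \<and>
    (\<forall>h k f X. is_pullback B g h k f \<and> X \<in> Obj E \<and> OMap F X = Dom B k \<longrightarrow> (\<exists>c'. cart_lift F f X c' \<and>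
      (\<forall>t. t \<in> hom E (Dom E c') P \<and> AMap F t = h \<longrightarrow>
        (\<exists>!s. s \<in> hom E X (Cod E c) \<and> AMap F s = k \<and> (\<exists>u. induced F h c' s c u \<and> e \<odot> u = t)))))"

lemma strong_PiD:
  assumes "strong_Pi g P c e"
  shows "is_cartesian F c" "c \<in> Arr E" "AMap F c = g" "e \<in> Arr E" "Dom E e = Dom E c" "Cod E e = P" "AMap F e = Idt B (Dom B g)"
    "g \<in> Arr B" "OMap F (Dom E c) = Dom B g" "OMap F (Cod E c) = Cod B g"
proof -
  show c: "is_cartesian F c" "AMap F c = g" "e \<in> Arr E" "Dom E e = Dom E c" "Cod E e = P" "AMap F e = Idt B (Dom B g)"
    using assms unfolding strong_Pi_def by blast+
  show "c \<in> Arr E" using cartesian_arr[OF c(1)] .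
  then show "g \<in> Arr B" "OMap F (Dom E c) = Dom B g" "OMap F (Cod E c) = Cod B g" using c(2) ftr_simps(1-3)[of c] by simp_all
qed

text \<open>\<open>strong_Pi\<close> speaks of one lift of each \<open>f\<close>; every other
  differs from it by a vertical isomorphism, along which the condition is transported.\<close>

lemma strong_Pi_univ:
  assumes P: "strong_Pi g P c e" and pb: "is_pullback B g h k f" and c': "is_cartesian F c'" "AMap F c' = f"
    and t: "t \<in> Arr E" "Dom E t = Dom E c'" "Cod E t = P" "AMap F t = h"
  shows "\<exists>!s. s \<in> hom E (Cod E c') (Cod E c) \<and> AMap F s = k \<and> (\<exists>u. induced F h c' s c u \<and> e \<odot> u = t)"
proof -
  note [simp] = strong_PiD(2-10)[OF P] cartesian_arr[OF c'(1)] c'(2) t T.pullbackD(1-8)[OF pb]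
  have X: "Cod E c' \<in> Obj E" "OMap F (Cod E c') = Dom B k" using ftr_simps(3)[of c'] by simp_all
  note univ = P[unfolded strong_Pi_def, THEN conjunct2, THEN conjunct2, THEN conjunct2, THEN conjunct2, THEN conjunct2, THEN conjunct2,
      THEN spec, THEN spec, THEN spec, THEN spec, THEN mp, OF conjI[OF pb conjI[OF X]]]
  obtain c0 where c0: "cart_lift F f (Cod E c') c0" and
    u0: "\<forall>t. t \<in> hom E (Dom E c0) P \<and> AMap F t = h \<longrightarrow>
        (\<exists>!s. s \<in> hom E (Cod E c') (Cod E c) \<and> AMap F s = k \<and> (\<exists>u. induced F h c0 s c u \<and> e \<odot> u = t))"
    using univ by (elim exE conjE)
  note [simp] = cart_liftD(2-5)[OF c0]
  have c'l: "cart_lift F f (Cod E c') c'" using c' by (intro cart_liftI) simp_all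
  obtain r where r: "is_iso (fiber F (Dom B f)) r" and [simp]: "r \<in> Arr E" "AMap F r = Idt B (Dom B f)" "Dom E r = Dom E c'" "Cod E r = Dom E c0"
    and rc: "c' = c0 \<odot> r"
    using cart_lift_iso[OF c0 c'l] by auto
  have A: "Dom B f \<in> Obj B" by simp
  obtain r' where [simp]: "r' \<in> Arr E" "AMap F r' = Idt B (Dom B f)" "Dom E r' = Dom E c0" "Cod E r' = Dom E c'"
    and rr: "r' \<odot> r = Idt E (Dom E c')" "r \<odot> r' = Idt E (Dom E c0)"
    using viso_inverse[OF r A] by auto
  have rc': "c' \<odot> r' = c0" using S.reassoc[OF rc[symmetric], of r'] by (simp add: rr)
  have "t \<odot> r' \<in> hom E (Dom E c0) P \<and> AMap F (t \<odot> r') = h" by simp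
  note U = u0[THEN spec, THEN mp, OF this]
  have "(\<exists>u. induced F h c' s c u \<and> e \<odot> u = t) \<longleftrightarrow> (\<exists>u. induced F h c0 s c u \<and> e \<odot> u = t \<odot> r')" (is "?L \<longleftrightarrow> ?R")
    if s: "s \<in> hom E (Cod E c') (Cod E c)" for s
  proof
    assume ?L
    then obtain u where u: "induced F h c' s c u" and eu: "e \<odot> u = t" by blast
    note [simp] = inducedD(1-4)[OF u]
    have "induced F h c0 s c (u \<odot> r')" using s by (simp add: induced_def S.reassoc[OF inducedD(5)[OF u]] rc')
    moreover have "e \<odot> (u \<odot> r') = t \<odot> r'" by (simp add: S.reassoc[OF eu])
    ultimately show ?R by blast
  next
    assume ?R
    then obtain u where u: "induced F h c0 s c u" and eu: "e \<odot> u = t \<odot> r'" by blast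
    note [simp] = inducedD(1-4)[OF u]
    have "induced F h c' s c (u \<odot> r)" using s by (simp add: induced_def S.reassoc[OF inducedD(5)[OF u]] rc[symmetric])
    moreover have "e \<odot> (u \<odot> r) = t" by (simp add: S.reassoc[OF eu] rr)
    ultimately show ?L by blast
  qed
  then have "s \<in> hom E (Cod E c') (Cod E c) \<and> AMap F s = k \<and> (\<exists>u. induced F h c' s c u \<and> e \<odot> u = t) \<longleftrightarrow>
    s \<in> hom E (Cod E c') (Cod E c) \<and> AMap F s = k \<and> (\<exists>u. induced F h c0 s c u \<and> e \<odot> u = t \<odot> r')" for s by blast
  then show ?thesis using U by (simp only:)
qed

lemma strong_Pi_diagram:
  assumes P: "strong_Pi g P c e"
  shows "is_Pi_diagram F g P c e"
proof -
  note D = strong_PiD[OF P]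
  have pb: "is_pullback B g (Idt B (Dom B g)) (Idt B (Cod B g)) g" by (rule T.pullback_idt) (rule D(8))
  have "\<exists>!s. s \<in> hom E (Cod E c') (Cod E c) \<and> AMap F s = Idt B (Cod B g) \<and> (\<exists>u. induced F (Idt B (Dom B g)) c' s c u \<and> e \<odot> u = t)"
    if "is_cartesian F c' \<and> AMap F c' = g \<and> t \<in> hom E (Dom E c') P \<and> AMap F t = Idt B (Dom B g)" for c' t
    using that by (intro strong_Pi_univ[OF P pb]) simp_all
  then show ?thesis unfolding is_Pi_diagram_def Let_def using D by simp
qed

text \<open>Composing with the cartesian lifts over \<open>h\<close> and \<open>k\<close> reduces
  vertical transposition over the pulled back \<open>f\<close> to transposition over the pullback
  square, which is part of \<open>strong_Pi\<close>.\<close>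

lemma strong_Pi_stable:
  assumes P: "strong_Pi g P c e"
  shows "stable_Pi_diagram F g P c e"
  unfolding stable_Pi_diagram_def
proof (intro allI impI)
  fix h k f cP cS cR c' e'
  assume a: "is_pullback B g h k f \<and> cart_lift F h P cP \<and> cart_lift F h (Dom E c) cS \<and> cart_lift F k (Cod E c) cR \<and>
    induced F f cS c cR c' \<and> induced F (Idt B (Dom B f)) cS e cP e'"
  then have pb: "is_pullback B g h k f" and cP: "cart_lift F h P cP" and cS: "cart_lift F h (Dom E c) cS" and cR: "cart_lift F k (Cod E c) cR"
    and ic: "induced F f cS c cR c'" and ie: "induced F (Idt B (Dom B f)) cS e cP e'" by blast+
  let ?I = "Idt B (Dom B f)" and ?J = "Idt B (Cod B f)"
  note [simp] = strong_PiD(2-10)[OF P] T.pullbackD(1-4,6-8)[OF pb] cart_liftD(2-5)[OF cP] cart_liftD(2-5)[OF cS] cart_liftD(2-5)[OF cR]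
    inducedD(1-4)[OF ic] inducedD(1-4)[OF ie]
  have [simp]: "Cod B k = Cod B g" using T.pullbackD(5)[OF pb] .
  have c'c: "is_cartesian F c'"
  proof (rule cartesian_cancel[OF cart_liftD(1)[OF cR]])
    show "is_cartesian F (cR \<odot> c')" unfolding inducedD(5)[OF ic]
      by (rule cartesian_comp[OF strong_PiD(1)[OF P] cart_liftD(1)[OF cS]]) simp
  qed simp_all
  have "\<exists>!s. s \<in> hom E (Cod E c'') (Cod E c') \<and> AMap F s = ?J \<and> (\<exists>u. induced F ?I c'' s c' u \<and> e' \<odot> u = t)"
    if "is_cartesian F c'' \<and> AMap F c'' = f \<and> t \<in> hom E (Dom E c'') (Dom E cP) \<and> AMap F t = ?I" for c'' t
  proof -
    have c'': "is_cartesian F c''" "AMap F c'' = f" and t [simp]: "t \<in> Arr E" "Dom E t = Dom E c''" "Cod E t = Dom E cP" "AMap F t = ?I" using that by simp_all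
    note [simp] = cartesian_arr[OF c''(1)] c''(2)
    have o [simp]: "OMap F (Cod E c'') = Dom B k" "OMap F (Dom E c'') = Dom B h"
      using ftr_simps(3)[of c''] ftr_simps(2)[of c''] by simp_all
    have "\<exists>!s. s \<in> hom E (Cod E c'') (Cod E c) \<and> AMap F s = k \<and> (\<exists>u. induced F h c'' s c u \<and> e \<odot> u = cP \<odot> t)"
      by (rule strong_Pi_univ[OF P pb c'']) simp_all
    note U = this
    \<comment> \<open>The passage from \<open>s\<close> to \<open>cR \<odot> s\<close>, and from
      \<open>u\<close> to \<open>cS \<odot> u\<close>, can be reversed because \<open>cR\<close> and
      \<open>cS\<close> are cartesian.\<close>
    have iff: "(\<exists>u. induced F ?I c'' s c' u \<and> e' \<odot> u = t) \<longleftrightarrow> (\<exists>u. induced F h c'' (cR \<odot> s) c u \<and> e \<odot> u = cP \<odot> t)" (is "?L \<longleftrightarrow> ?R")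
      if s: "s \<in> hom E (Cod E c'') (Cod E c')" "AMap F s = ?J" for s
    proof
      note [simp] = s[simplified]
      assume ?L
      then obtain u where u: "induced F ?I c'' s c' u" and eu: "e' \<odot> u = t" by blast
      note [simp] = inducedD(1-4)[OF u]
      have "c \<odot> (cS \<odot> u) = cR \<odot> (c' \<odot> u)" by (simp add: S.reassoc[OF inducedD(5)[OF ic]])
      then have "induced F h c'' (cR \<odot> s) c (cS \<odot> u)" by (simp add: induced_def inducedD(5)[OF u])
      moreover have "e \<odot> (cS \<odot> u) = cP \<odot> (e' \<odot> u)" by (simp add: S.reassoc[OF inducedD(5)[OF ie]])
      ultimately show ?R using eu by auto
    next
      note [simp] = s[simplified]
      assume ?R
      then obtain u where u: "induced F h c'' (cR \<odot> s) c u" and eu: "e \<odot> u = cP \<odot> t" by blast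
      note [simp] = inducedD(1-4)[OF u]
      have cu: "c \<odot> u = cR \<odot> (s \<odot> c'')" using inducedD(5)[OF u] by simp
      obtain v where v [simp]: "v \<in> Arr E" "Dom E v = Dom E c''" "Cod E v = Dom E cS" "AMap F v = ?I" and ve: "cS \<odot> v = u"
        using cartesian_ex[OF cart_liftD(1)[OF cS], of u ?I] by auto
      have "c' \<odot> v = s \<odot> c''"
        by (rule cartesian_eq[OF cart_liftD(1)[OF cR]]) (simp_all add: S.reassoc[OF inducedD(5)[OF ic]] ve cu)
      then have "induced F ?I c'' s c' v" by (simp add: induced_def)
      moreover have "e' \<odot> v = t"
        by (rule cartesian_eq[OF cart_liftD(1)[OF cP]]) (simp_all add: S.reassoc[OF inducedD(5)[OF ie]] ve eu)
      ultimately show ?L by blast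
    qed
    obtain s0 where s0: "s0 \<in> hom E (Cod E c'') (Cod E c)" "AMap F s0 = k" "\<exists>u. induced F h c'' s0 c u \<and> e \<odot> u = cP \<odot> t"
      using U by blast
    obtain s where s: "s \<in> Arr E" "Dom E s = Cod E c''" "Cod E s = Dom E cR" "AMap F s = ?J" "cR \<odot> s = s0"
      using cartesian_ex[OF cart_liftD(1)[OF cR], of s0 ?J] s0 by auto
    have sh: "s \<in> hom E (Cod E c'') (Cod E c')" using s by simp
    show ?thesis
    proof (rule ex1I[where a = s])
      show "s \<in> hom E (Cod E c'') (Cod E c') \<and> AMap F s = ?J \<and> (\<exists>u. induced F ?I c'' s c' u \<and> e' \<odot> u = t)"
        using iff[OF sh s(4)] s0(3) sh s(4,5) by blast
      fix s' assume s': "s' \<in> hom E (Cod E c'') (Cod E c') \<and> AMap F s' = ?J \<and> (\<exists>u. induced F ?I c'' s' c' u \<and> e' \<odot> u = t)"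
      then have "\<exists>u. induced F h c'' (cR \<odot> s') c u \<and> e \<odot> u = cP \<odot> t" using iff[of s'] by blast
      moreover have "cR \<odot> s' \<in> hom E (Cod E c'') (Cod E c)" "AMap F (cR \<odot> s') = k" using s' by simp_all
      ultimately have "cR \<odot> s' = s0" using U s0 by blast
      then show "s' = s" using s s' by - (rule cartesian_eq[OF cart_liftD(1)[OF cR]], simp_all)
    qed
  qed
  then show "is_Pi_diagram F f (Dom E cP) c' e'" unfolding is_Pi_diagram_def Let_def using c'c by simp
qed

lemma Pi_diagramD:
  assumes "is_Pi_diagram F g P c e"
  shows "g \<in> Arr B" "is_cartesian F c" "c \<in> Arr E" "AMap F c = g" "e \<in> Arr E" "Dom E e = Dom E c" "Cod E e = P" "AMap F e = Idt B (Dom B g)"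
    "OMap F (Dom E c) = Dom B g" "OMap F (Cod E c) = Cod B g"
proof -
  have "g \<in> Arr B" "is_cartesian F c" "AMap F c = g" "e \<in> hom E (Dom E c) P" "AMap F e = Idt B (Dom B g)"
    using assms unfolding is_Pi_diagram_def Let_def by blast+
  then show "g \<in> Arr B" "is_cartesian F c" "c \<in> Arr E" "AMap F c = g" "e \<in> Arr E" "Dom E e = Dom E c" "Cod E e = P" "AMap F e = Idt B (Dom B g)"
    "OMap F (Dom E c) = Dom B g" "OMap F (Cod E c) = Cod B g"
    using cartesian_arr[of c] ftr_simps(2,3)[of c] by simp_all
qed

lemma Pi_diagram_ex1:
  assumes "is_Pi_diagram F g P c e" "is_cartesian F c'" "AMap F c' = g" "t \<in> Arr E" "Dom E t = Dom E c'" "Cod E t = P" "AMap F t = Idt B (Dom B g)"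
  shows "\<exists>!s. s \<in> hom E (Cod E c') (Cod E c) \<and> AMap F s = Idt B (Cod B g) \<and> (\<exists>u. induced F (Idt B (Dom B g)) c' s c u \<and> e \<odot> u = t)"
proof -
  have "is_cartesian F c' \<and> AMap F c' = g \<and> t \<in> hom E (Dom E c') P \<and> AMap F t = Idt B (Dom B g)" using assms by simp
  then show ?thesis using assms(1) unfolding is_Pi_diagram_def Let_def by blast
qed

text \<open>Each diagram is tested against the other. This yields \<open>r\<close> between the
  product objects, and the arrow \<open>s\<close> it induces between their pullbacks.\<close>

lemma Pi_diagram_iso:
  assumes P: "is_Pi_diagram F g P c e" and P': "is_Pi_diagram F g P c' e'"
  shows "\<exists>r s. is_iso (fiber F (Cod B g)) r \<and> Dom E r = Cod E c' \<and> Cod E r = Cod E c \<and> is_iso (fiber F (Dom B g)) s \<and> Dom E s = Dom E c' \<and>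
    Cod E s = Dom E c \<and> c \<odot> s = r \<odot> c' \<and> e \<odot> s = e'"
proof -
  note D = Pi_diagramD[OF P] and D' = Pi_diagramD[OF P']
  note [simp] = D(1,3-10) D'(3-10)
  let ?I = "Idt B (Dom B g)" and ?J = "Idt B (Cod B g)"
  obtain r where r: "r \<in> hom E (Cod E c') (Cod E c) \<and> AMap F r = ?J \<and> (\<exists>u. induced F ?I c' r c u \<and> e \<odot> u = e')"
    using Pi_diagram_ex1[OF P D'(2,4,5,6,7,8)] by blast
  then obtain s where s: "induced F ?I c' r c s" "e \<odot> s = e'" by blast
  obtain r' where r': "r' \<in> hom E (Cod E c) (Cod E c') \<and> AMap F r' = ?J \<and> (\<exists>u. induced F ?I c r' c' u \<and> e' \<odot> u = e)"
    using Pi_diagram_ex1[OF P' D(2,4,5,6,7,8)] by blast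
  then obtain s' where s': "induced F ?I c r' c' s'" "e' \<odot> s' = e" by blast
  have [simp]: "r \<in> Arr E" "Dom E r = Cod E c'" "Cod E r = Cod E c" "AMap F r = ?J"
    "r' \<in> Arr E" "Dom E r' = Cod E c" "Cod E r' = Cod E c'" "AMap F r' = ?J" using r r' by auto
  note [simp] = inducedD(1-4)[OF s(1)] inducedD(1-4)[OF s'(1)] and si = inducedD(5)[OF s(1)] inducedD(5)[OF s'(1)]
  have uniq: "w = w'" if "is_Pi_diagram F g P d a" "w \<in> hom E (Cod E d) (Cod E d) \<and> AMap F w = ?J" "w' \<in> hom E (Cod E d) (Cod E d) \<and> AMap F w' = ?J"
    "induced F ?I d w d z" "a \<odot> z = a" "induced F ?I d w' d z'" "a \<odot> z' = a" for w w' d a z z'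
    using Pi_diagram_ex1[OF that(1) Pi_diagramD(2,4,5,6,7,8)[OF that(1)]] that(2-) by blast
  have rr: "r \<odot> r' = Idt E (Cod E c)"
    by (rule uniq[OF P, of _ _ "s \<odot> s'" "Idt E (Dom E c)"]) (simp_all add: induced_def S.reassoc[OF si(1)] si(2) S.reassoc[OF s(2)] s'(2))
  have rr': "r' \<odot> r = Idt E (Cod E c')"
    by (rule uniq[OF P', of _ _ "s' \<odot> s" "Idt E (Dom E c')"]) (simp_all add: induced_def S.reassoc[OF si(2)] si(1) S.reassoc[OF s'(2)] s(2))
  have "s \<odot> s' = Idt E (Dom E c)"
    by (rule cartesian_eq[OF D(2)]) (simp_all add: S.reassoc[OF si(1)] si(2) S.reassoc[OF rr])
  moreover have "s' \<odot> s = Idt E (Dom E c')"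
    by (rule cartesian_eq[OF D'(2)]) (simp_all add: S.reassoc[OF si(2)] si(1) S.reassoc[OF rr'])
  ultimately have "is_iso (fiber F (Cod B g)) r" "is_iso (fiber F (Dom B g)) s"
    using visoI[of r r' "Cod B g"] visoI[of s s' "Dom B g"] rr rr' by simp_all
  then show ?thesis using si(1) s(2) by (intro exI[of _ r] exI[of _ s]) simp
qed

lemma Pi_diagram_stableI:
  assumes P: "strong_Pi g P c e" and P': "is_Pi_diagram F g P c' e'"
  shows "stable_Pi_diagram F g P c' e'"
  unfolding stable_Pi_diagram_def
proof (intro allI impI)
  fix h k f cP cS cR d a
  let ?I = "Idt B (Dom B f)"
  assume as: "is_pullback B g h k f \<and> cart_lift F h P cP \<and> cart_lift F h (Dom E c') cS \<and> cart_lift F k (Cod E c') cR \<and>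
    induced F f cS c' cR d \<and> induced F ?I cS e' cP a"
  then have pb: "is_pullback B g h k f" and cP: "cart_lift F h P cP" and cS: "cart_lift F h (Dom E c') cS" and cR: "cart_lift F k (Cod E c') cR"
    and ic: "induced F f cS c' cR d" and ie: "induced F ?I cS e' cP a" by blast+
  note D' = Pi_diagramD[OF P'] and D = Pi_diagramD[OF strong_Pi_diagram[OF P]]
  obtain r s where r: "is_iso (fiber F (Cod B g)) r" "Dom E r = Cod E c'" "Cod E r = Cod E c" and s: "is_iso (fiber F (Dom B g)) s" "Dom E s = Dom E c'"
    "Cod E s = Dom E c" and rs: "c \<odot> s = r \<odot> c'" "e \<odot> s = e'"
    using Pi_diagram_iso[OF strong_Pi_diagram[OF P] P'] by blast
  have o: "Cod B g \<in> Obj B" "Dom B g \<in> Obj B" using D(1) by simp_all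
  have [simp]: "r \<in> Arr E" "s \<in> Arr E" using viso_inverse[OF r(1) o(1)] viso_inverse[OF s(1) o(2)] by blast+
  note [simp] = D(1,3-10) D'(3-10) cart_liftD(2-5)[OF cP] cart_liftD(2-5)[OF cS] cart_liftD(2-5)[OF cR] inducedD(1-4)[OF ic] inducedD(1-4)[OF ie] r(2,3) s(2,3)
  note lR = cart_lift_viso[OF cR r(1) o(1) r(2), unfolded r(3)] and lS = cart_lift_viso[OF cS s(1) o(2) s(2), unfolded s(3)]
  have "induced F f (s \<odot> cS) c (r \<odot> cR) d" by (simp add: induced_def inducedD(5)[OF ic] S.reassoc[OF rs(1)])
  moreover have "induced F ?I (s \<odot> cS) e cP a" by (simp add: induced_def inducedD(5)[OF ie] S.reassoc[OF rs(2)])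
  ultimately show "is_Pi_diagram F f (Dom E cP) d a"
    using strong_Pi_stable[OF P] pb cP lR(1) lS(1) unfolding stable_Pi_diagram_def by blast
qed

lemma Pi_diagram_comp_viso:
  assumes P: "is_Pi_diagram F g P c e" and r: "is_iso (fiber F (Cod B g)) r" "Dom E r = Cod E c'" "Cod E r = Cod E c"
    and s: "is_iso (fiber F (Dom B g)) s" "Dom E s = Dom E c'" "Cod E s = Dom E c" and rs: "c \<odot> s = r \<odot> c'" "e \<odot> s = e'" and c': "c' \<in> Arr E"
  shows "is_Pi_diagram F g P c' e'"
proof -
  note D = Pi_diagramD[OF P]
  have o: "Cod B g \<in> Obj B" "Dom B g \<in> Obj B" using D(1) by simp_all
  obtain r' where r': "is_iso (fiber F (Cod B g)) r'" and [simp]: "r \<in> Arr E" "r' \<in> Arr E" "Dom E r' = Cod E c" "Cod E r' = Cod E c'"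
    "AMap F r = Idt B (Cod B g)" "AMap F r' = Idt B (Cod B g)" and rr: "r' \<odot> r = Idt E (Cod E c')" "r \<odot> r' = Idt E (Cod E c)" and or [simp]: "OMap F (Cod E c') = Cod B g"
    using viso_inverse[OF r(1) o(1)] r by auto
  obtain s' where s': "is_iso (fiber F (Dom B g)) s'" and [simp]: "s \<in> Arr E" "s' \<in> Arr E" "Dom E s' = Dom E c" "Cod E s' = Dom E c'"
    "AMap F s = Idt B (Dom B g)" "AMap F s' = Idt B (Dom B g)" and ss: "s' \<odot> s = Idt E (Dom E c')" "s \<odot> s' = Idt E (Dom E c)" and os [simp]: "OMap F (Dom E c') = Dom B g"
    using viso_inverse[OF s(1) o(2)] s by auto
  note [simp] = D(1,3-10) r(2,3) s(2,3) c'
  have e' [simp]: "e' \<in> Arr E" "Dom E e' = Dom E c'" "Cod E e' = P" "AMap F e' = Idt B (Dom B g)" by (simp_all add: rs(2)[symmetric])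
  have c'e: "c' = r' \<odot> (c \<odot> s)" by (simp add: rs(1) S.reassoc[OF rr(1)])
  have "is_cartesian F (c \<odot> s)" "AMap F (c \<odot> s) = g" using cartesian_comp_viso[OF D(2) s(1) o(2)] by simp_all
  then have cc: "is_cartesian F c'" "AMap F c' = g" unfolding c'e using viso_comp_cartesian[OF _ r'(1) o(1)] by simp_all
  have "\<exists>!k. k \<in> hom E (Cod E d) (Cod E c') \<and> AMap F k = Idt B (Cod B g) \<and> (\<exists>u. induced F (Idt B (Dom B g)) d k c' u \<and> e' \<odot> u = t)"
    if "is_cartesian F d \<and> AMap F d = g \<and> t \<in> hom E (Dom E d) P \<and> AMap F t = Idt B (Dom B g)" for d t
  proof -
    have d: "is_cartesian F d" "AMap F d = g" and t [simp]: "t \<in> Arr E" "Dom E t = Dom E d" "Cod E t = P" "AMap F t = Idt B (Dom B g)" using that by simp_all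
    note [simp] = cartesian_arr[OF d(1)] d(2)
    have od [simp]: "OMap F (Dom E d) = Dom B g" "OMap F (Cod E d) = Cod B g" using ftr_simps(2,3)[of d] by simp_all
    note U = Pi_diagram_ex1[OF P d t]
    obtain k u where k [simp]: "k \<in> Arr E" "Dom E k = Cod E d" "Cod E k = Cod E c" "AMap F k = Idt B (Cod B g)" and u: "induced F (Idt B (Dom B g)) d k c u"
      and eu: "e \<odot> u = t" using U unfolding in_hom by blast
    note [simp] = inducedD(1-4)[OF u]
    show ?thesis
    proof (rule ex1I[where a = "r' \<odot> k"])
      have "(r' \<odot> (c \<odot> s)) \<odot> s' = r' \<odot> c" by (simp add: ss(2))
      then have c's: "c' \<odot> s' = r' \<odot> c" by (simp only: c'e[symmetric])
      have "c' \<odot> (s' \<odot> u) = r' \<odot> (k \<odot> d)" by (simp add: S.reassoc[OF c's] inducedD(5)[OF u])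
      then have "induced F (Idt B (Dom B g)) d (r' \<odot> k) c' (s' \<odot> u)" by (simp add: induced_def)
      moreover have "e' \<odot> (s' \<odot> u) = t" by (simp add: rs(2)[symmetric] S.reassoc[OF ss(2)] eu)
      ultimately show "r' \<odot> k \<in> hom E (Cod E d) (Cod E c') \<and> AMap F (r' \<odot> k) = Idt B (Cod B g) \<and> (\<exists>u. induced F (Idt B (Dom B g)) d (r' \<odot> k) c' u \<and> e' \<odot> u = t)"
        by auto
      fix l assume l: "l \<in> hom E (Cod E d) (Cod E c') \<and> AMap F l = Idt B (Cod B g) \<and> (\<exists>u. induced F (Idt B (Dom B g)) d l c' u \<and> e' \<odot> u = t)"
      then obtain v where v: "induced F (Idt B (Dom B g)) d l c' v" and ev: "e' \<odot> v = t" by blast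
      have [simp]: "l \<in> Arr E" "Dom E l = Cod E d" "Cod E l = Cod E c'" "AMap F l = Idt B (Cod B g)" using l by simp_all
      note [simp] = inducedD(1-4)[OF v]
      have "induced F (Idt B (Dom B g)) d (r \<odot> l) c (s \<odot> v)" by (simp add: induced_def S.reassoc[OF rs(1)] inducedD(5)[OF v])
      moreover have "e \<odot> (s \<odot> v) = t" by (simp add: S.reassoc[OF rs(2)] ev)
      moreover have "r \<odot> l \<in> hom E (Cod E d) (Cod E c) \<and> AMap F (r \<odot> l) = Idt B (Cod B g)" "k \<in> hom E (Cod E d) (Cod E c) \<and> AMap F k = Idt B (Cod B g)" by simp_all
      ultimately have "r \<odot> l = k" using U u eu by blast
      then have "r' \<odot> k = r' \<odot> (r \<odot> l)" by simp
      then show "l = r' \<odot> k" by (simp add: S.reassoc[OF rr(1)])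
    qed
  qed
  then show ?thesis unfolding is_Pi_diagram_def Let_def using cc by simp
qed

text \<open>The defining conditions concern all diagrams, but each class of diagrams is closed under
  isomorphism. One good representative of each construction therefore settles both existence and
  stability.\<close>

theorem h_fibrationI:
  assumes fib: "fibration F" and base: "has_finite_products B"
    and terminal: "\<And>A. A \<in> Obj B \<Longrightarrow> \<exists>T. strong_terminal T \<and> OMap F T = A"
    and initial: "\<And>A. A \<in> Obj B \<Longrightarrow> \<exists>Z. is_initial (fiber F A) Z \<and> (\<forall>f \<in> Arr B. Cod B f = A \<longrightarrow>
      (\<exists>c. cart_lift F f Z c \<and> is_initial (fiber F (Dom B f)) (Dom E c)))"
    and product: "\<And>P Q. P \<in> Obj E \<Longrightarrow> Q \<in> Obj E \<Longrightarrow> OMap F P = OMap F Q \<Longrightarrow> \<exists>R p q. fibred_product (Idt B (OMap F Q)) P Q R p q"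
    and coproduct: "\<And>P Q. P \<in> Obj E \<Longrightarrow> Q \<in> Obj E \<Longrightarrow> OMap F P = OMap F Q \<Longrightarrow> \<exists>S i j. is_coproduct (fiber F (OMap F Q)) P Q S i j \<and>
      (\<forall>f \<in> Arr B. Cod B f = OMap F Q \<longrightarrow> (\<exists>cP cQ cS i' j'. cart_lift F f P cP \<and> cart_lift F f Q cQ \<and> cart_lift F f S cS \<and>
        induced F (Idt B (Dom B f)) cP i cS i' \<and> induced F (Idt B (Dom B f)) cQ j cS j' \<and>
        is_coproduct (fiber F (Dom B f)) (Dom E cP) (Dom E cQ) (Dom E cS) i' j'))"
    and exponential: "\<And>P Q. P \<in> Obj E \<Longrightarrow> Q \<in> Obj E \<Longrightarrow> OMap F P = OMap F Q \<Longrightarrow>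
      \<exists>X R p q e. strong_exponential P Q X R p q e \<and> OMap F X = OMap F Q"
    and cocartesian: "\<And>g P. product_projection B g \<Longrightarrow> P \<in> Obj E \<Longrightarrow> OMap F P = Dom B g \<Longrightarrow>
      \<exists>q. is_cocartesian F q \<and> Dom E q = P \<and> AMap F q = g \<and> stable_cocartesian F q"
    and Pi: "\<And>g P. product_projection B g \<Longrightarrow> P \<in> Obj E \<Longrightarrow> OMap F P = Dom B g \<Longrightarrow> \<exists>c e. strong_Pi g P c e"
  shows "h_fibration F"
proof (rule h_fibration.intro[OF fib], rule h_fibration_axioms.intro)
  fix A assume A: "A \<in> Obj B"
  interpret C: category "fiber F A" by (rule category_fiber[OF A])
  show "has_finite_products (fiber F A)" unfolding has_finite_products_def
  proof (intro conjI ballI)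
    show "\<exists>T. is_terminal (fiber F A) T" using terminal[OF A] strong_terminal_fiber by blast
    fix P Q assume "P \<in> Obj (fiber F A)" "Q \<in> Obj (fiber F A)"
    then show "\<exists>R p q. is_product (fiber F A) P Q R p q" using product[of P Q] fibred_product_fiber_idt[of P Q] by force
  qed
  show "has_finite_coproducts (fiber F A)" unfolding has_finite_coproducts_def
  proof (intro conjI ballI)
    show "\<exists>Z. is_initial (fiber F A) Z" using initial[OF A] by blast
    fix P Q assume "P \<in> Obj (fiber F A)" "Q \<in> Obj (fiber F A)"
    then have o: "P \<in> Obj E" "Q \<in> Obj E" "OMap F P = OMap F Q" "OMap F Q = A" by simp_all
    from coproduct[OF o(1-3)] show "\<exists>S i j. is_coproduct (fiber F A) P Q S i j" unfolding o(4) by blast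
  qed
  show "has_exponentials (fiber F A)" unfolding has_exponentials_def
  proof (intro ballI)
    fix P Q assume "P \<in> Obj (fiber F A)" "Q \<in> Obj (fiber F A)"
    then show "\<exists>X R p q e. is_exponential (fiber F A) P Q X R p q e"
      using exponential[of P Q] strong_exponential_fiber[of P Q] by force
  qed
next
  fix f T assume "f \<in> Arr B" "is_terminal (fiber F (Cod B f)) T"
  then show "stable_terminal F f T" using terminal[of "Cod B f"] terminal_stableI[of _ f T] by auto
next
  fix f Z assume "f \<in> Arr B" "is_initial (fiber F (Cod B f)) Z"
  then show "stable_initial F f Z" using initial[of "Cod B f"] initial_stableI[of f Z] by force
next
  fix f P Q R p q assume f: "f \<in> Arr B" and R: "is_product (fiber F (Cod B f)) P Q R p q"
  have A: "Cod B f \<in> Obj B" using f by simp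
  interpret C: category "fiber F (Cod B f)" by (rule category_fiber[OF A])
  have "P \<in> Obj (fiber F (Cod B f))" "Q \<in> Obj (fiber F (Cod B f))"
    using C.cod_obj[OF C.productD(1)[OF R]] C.cod_obj[OF C.productD(4)[OF R]] C.productD(3,6)[OF R] by metis+
  then show "stable_product F f P Q R p q" using product[of P Q] product_stableI[OF _ f _ R] by auto
next
  fix f P Q S i j assume f: "f \<in> Arr B" and S: "is_coproduct (fiber F (Cod B f)) P Q S i j"
  have A: "Cod B f \<in> Obj B" using f by simp
  interpret C: category "fiber F (Cod B f)" by (rule category_fiber[OF A])
  have "P \<in> Obj (fiber F (Cod B f))" "Q \<in> Obj (fiber F (Cod B f))"
    using C.dom_obj[OF C.coproductD(1)[OF S]] C.dom_obj[OF C.coproductD(4)[OF S]] C.coproductD(3,6)[OF S] by metis+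
  then show "stable_coproduct F f P Q S i j" using coproduct[of P Q] coproduct_stableI[OF f S] f unfolding fiber_simps by metis
next
  fix f P Q X R p q e assume f: "f \<in> Arr B" and X: "is_exponential (fiber F (Cod B f)) P Q X R p q e"
  have A: "Cod B f \<in> Obj B" using f by simp
  interpret C: category "fiber F (Cod B f)" by (rule category_fiber[OF A])
  have "P \<in> Obj (fiber F (Cod B f))" "Q \<in> Obj (fiber F (Cod B f))"
    using C.cod_obj[OF C.productD(4)[OF C.exponentialD(1)[OF X]]] C.cod_obj[OF C.exponentialD(2)[OF X]] C.productD(6)[OF C.exponentialD(1)[OF X]]
      C.exponentialD(4)[OF X] by metis+
  then show "stable_exponential F f P Q X R p q e" using exponential[of P Q] exponential_stableI[OF _ f _ X] unfolding fiber_simps by metis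
next
  fix q assume q: "is_cocartesian F q" and g: "product_projection B (AMap F q)"
  then obtain q0 where "is_cocartesian F q0" "Dom E q0 = Dom E q" "AMap F q0 = AMap F q" "stable_cocartesian F q0"
    using cocartesian[of "AMap F q" "Dom E q"] cocartesian_arr[of q] by auto
  then show "stable_cocartesian F q" using cocartesian_stableI[OF q, of q0] by simp
next
  fix g P c e assume P: "is_Pi_diagram F g P c e" and g: "product_projection B g"
  note D = Pi_diagramD[OF P]
  have "P \<in> Obj E" "OMap F P = Dom B g" using D(5-9) S.cod_obj[of e] vertical_objs(2)[of e "Dom B g"] T.dom_obj[OF D(1)] by simp_all
  then show "stable_Pi_diagram F g P c e" using Pi[OF g] Pi_diagram_stableI[OF _ P] by blast
qed (use base cocartesian Pi strong_Pi_diagram in blast)+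

end

section \<open>Quotients of the fibration of fibrations by homotopy\<close>

context suitable_model_category
begin

lemma pullback_fib_square:
  assumes P: "is_pullback M y t b x" and y: "y \<in> Fib M" "fibrant M (Cod M y)" "fibrant M (Dom M b)"
  shows "fib_square x t b y"
  using pullbackD[OF P] fib_pullback[OF P y(1)] y by (simp add: fib_square_def)

lemma fib_exists_pullback:
  assumes "y \<in> Fib M" "fibrant M (Cod M y)" "f \<in> Arr M" "Cod M f = Cod M y" "fibrant M (Dom M f)"
  shows "\<exists>t x. is_pullback M y t f x \<and> fib_square x t f y"
proof -
  obtain t x where "is_pullback M y t f x" using pullback_exists[of y f] assms by auto
  then show ?thesis using pullback_fib_square assms by blast
qed

end

text \<open>Arrows of the total category are presented by squares through \<open>G\<close>, and two
  squares over the same arrow of the base present the same arrow exactly when their top sides are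
  homotopic. Diagrams can then be named by squares alone, which both instances share.\<close>

locale htpy_quotient = cylinder M cyl pr i0 i1 + tot: cat_functor \<pi>
  for M :: "('o, 'a) model_cat" (structure) and cyl :: "'o \<Rightarrow> 'o" and pr i0 i1 :: "'o \<Rightarrow> 'a"
    and \<pi> :: "('a, 'c, 'o, 'a) ftr" +
  fixes G :: "'a \<times> 'a \<times> 'a \<times> 'a \<Rightarrow> 'c"
  assumes tgt [simp]: "Tgt \<pi> = fibrant_cat M"
    and obj [simp]: "x \<in> Obj (Src \<pi>) \<longleftrightarrow> x \<in> Fib M \<and> fibrant M (Cod M x)"
    and omap [simp]: "OMap \<pi> x = Cod M x"
    and G_hom: "fib_square x t b y \<Longrightarrow> G (x, t, b, y) \<in> hom (Src \<pi>) x y"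
    and G_amap [simp]: "fib_square x t b y \<Longrightarrow> AMap \<pi> (G (x, t, b, y)) = b"
    and G_full: "h \<in> Arr (Src \<pi>) \<Longrightarrow> \<exists>x t b y. fib_square x t b y \<and> h = G (x, t, b, y)"
    and G_eq: "fib_square x t b y \<Longrightarrow> fib_square x t' b y \<Longrightarrow> G (x, t, b, y) = G (x, t', b, y) \<longleftrightarrow> htpy y t t'"
    and G_cmp [simp]: "fib_square x t b y \<Longrightarrow> fib_square y t' b' z \<Longrightarrow>
      G (y, t', b', z) \<cdot>\<^bsub>Src \<pi>\<^esub> G (x, t, b, y) = G (x, t' \<cdot> t, b' \<cdot> b, z)"
    and G_idt: "x \<in> Fib M \<Longrightarrow> fibrant M (Cod M x) \<Longrightarrow> Idt (Src \<pi>) x = G (x, Idt M (Dom M x), Idt M (Cod M x), x)"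
begin

abbreviation \<E> where "\<E> \<equiv> Src \<pi>"

abbreviation \<B> where "\<B> \<equiv> Tgt \<pi>"

abbreviation sq where "sq \<equiv> fib_square"

lemma G_simps [simp]:
  "sq x t b y \<Longrightarrow> G (x, t, b, y) \<in> Arr \<E>" "sq x t b y \<Longrightarrow> Dom \<E> (G (x, t, b, y)) = x"
  "sq x t b y \<Longrightarrow> Cod \<E> (G (x, t, b, y)) = y"
  using G_hom[of x t b y] by simp_all

lemma G_ex:
  assumes "h \<in> Arr \<E>" "Dom \<E> h = x" "Cod \<E> h = y" "AMap \<pi> h = b"
  shows "\<exists>t. sq x t b y \<and> h = G (x, t, b, y)"
proof -
  obtain x' t b' y' where h: "sq x' t b' y'" "h = G (x', t, b', y')" using G_full[OF assms(1)] by blast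
  then have "x' = x" "y' = y" "b' = b" using assms by auto
  then show ?thesis using h by blast
qed

lemma G_eqD:
  assumes "G (x, t, b, y) = G (x', t', b', y')" "sq x t b y" "sq x' t' b' y'"
  shows "x' = x" "b' = b" "y' = y" "htpy y t t'"
proof -
  show e: "x' = x" "b' = b" "y' = y"
    using G_simps(2)[OF assms(2)] G_simps(2)[OF assms(3)] G_simps(3)[OF assms(2)] G_simps(3)[OF assms(3)]
      G_amap[OF assms(2)] G_amap[OF assms(3)] assms(1) by simp_all
  show "htpy y t t'" using assms G_eq[of x t b y t'] unfolding e by simp
qed

section \<open>Standard diagrams in a quotient by homotopy\<close>

lemma category_Src: "category \<E>"
  by (rule tot.src_category)

text \<open>The pullback provides factorizations, and \<open>htpy_pullback\<close> makes them unique
  up to homotopy.\<close>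

lemma G_cartesian:
  assumes P: "is_pullback M y t b x" and y: "y \<in> Fib M" "fibrant M (Cod M y)" "fibrant M (Dom M b)"
  shows "is_cartesian \<pi> (G (x, t, b, y))" "sq x t b y"
proof -
  show S: "sq x t b y" by (rule pullback_fib_square[OF assms])
  note [simp] = fib_squareD(1-10)[OF S] and e = fib_squareD(11)[OF S]
  show "is_cartesian \<pi> (G (x, t, b, y))"
  proof (rule tot.cartesianI)
    fix f r assume a: "r \<in> Arr \<E>" "Cod \<E> r = Cod \<E> (G (x, t, b, y))" "f \<in> Arr \<B>"
      "Cod \<B> f = OMap \<pi> (Dom \<E> (G (x, t, b, y)))" "Dom \<B> f = OMap \<pi> (Dom \<E> r)"
      "AMap \<pi> r = AMap \<pi> (G (x, t, b, y)) \<cdot>\<^bsub>\<B>\<^esub> f"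
    obtain s where s: "sq (Dom \<E> r) s (b \<cdot> f) y" and r: "r = G (Dom \<E> r, s, b \<cdot> f, y)"
      using G_ex[of r "Dom \<E> r" y "b \<cdot> f"] a S by auto
    define z where "z = Dom \<E> r"
    have s: "sq z s (b \<cdot> f) y" and r: "r = G (z, s, b \<cdot> f, y)" using s r unfolding z_def by simp_all
    have f [simp]: "f \<in> Arr M" "Cod M f = Cod M x" "Dom M f = Cod M z" using a S by (simp_all add: z_def)
    note [simp] = fib_squareD(1,3,5-7)[OF s] and se = fib_squareD(11)[OF s]
    obtain u where u: "u \<in> Arr M" "Dom M u = Dom M z" "Cod M u = Dom M t" "t \<cdot> u = s" "x \<cdot> u = f \<cdot> z"
      using pullback_ex[OF P, of s "f \<cdot> z"] se by auto
    have us: "sq z u f x" using u by (simp add: fib_square_def)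
    show "\<exists>s. s \<in> Arr \<E> \<and> Dom \<E> s = Dom \<E> r \<and> Cod \<E> s = Dom \<E> (G (x, t, b, y)) \<and> AMap \<pi> s = f \<and> G (x, t, b, y) \<cdot>\<^bsub>\<E>\<^esub> s = r"
      using us S s by (intro exI[of _ "G (z, u, f, x)"]) (simp add: r u(4))
  next
    fix s s' assume a: "s \<in> Arr \<E>" "s' \<in> Arr \<E>" "Dom \<E> s = Dom \<E> s'" "Cod \<E> s = Dom \<E> (G (x, t, b, y))"
      "Cod \<E> s' = Dom \<E> (G (x, t, b, y))" "AMap \<pi> s = AMap \<pi> s'" "G (x, t, b, y) \<cdot>\<^bsub>\<E>\<^esub> s = G (x, t, b, y) \<cdot>\<^bsub>\<E>\<^esub> s'"
    obtain z f where z: "Dom \<E> s' = z" "AMap \<pi> s' = f" by blast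
    obtain u where u: "sq z u f x" and s: "s = G (z, u, f, x)" using G_ex[of s z x f] a z S by auto
    obtain u' where u': "sq z u' f x" and s': "s' = G (z, u', f, x)" using G_ex[of s' z x f] a z S by auto
    have "G (z, t \<cdot> u, b \<cdot> f, y) = G (z, t \<cdot> u', b \<cdot> f, y)" using a(7) unfolding s s' G_cmp[OF u S] G_cmp[OF u' S] .
    from G_eqD(4)[OF this fib_square_cmp[OF u S] fib_square_cmp[OF u' S]]
    have "htpy x u u'" using fib_squareD[OF u] fib_squareD[OF u'] by - (rule htpy_pullback[OF P], simp_all)
    then show "s = s'" using G_eq[OF u u'] s s' by simp
  qed (simp add: S)
qed

lemma G_cart_lift:
  assumes P: "is_pullback M y t b x" and y: "y \<in> Fib M" "fibrant M (Cod M y)" "fibrant M (Dom M b)"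
  shows "cart_lift \<pi> b y (G (x, t, b, y))"
  using G_cartesian[OF assms] by (simp add: cart_lift_def)

lemma fibration_quotient: "fibration \<pi>"
proof (rule fibration.intro, rule tot.cat_functor_axioms, rule fibration_axioms.intro)
  fix f Q assume a: "f \<in> Arr \<B>" "Q \<in> Obj \<E>" "OMap \<pi> Q = Cod \<B> f"
  then have Q: "Q \<in> Fib M" "fibrant M (Cod M Q)" "f \<in> Arr M" "Cod M f = Cod M Q" "fibrant M (Dom M f)" by simp_all
  then obtain t x where "is_pullback M Q t f x" using fib_exists_pullback by blast
  then show "\<exists>c. cart_lift \<pi> f Q c" using G_cart_lift[OF _ Q(1,2,5)] by blast
qed

text \<open>The identity of \<open>A\<close> is a fibration, and the top side of a square into it is
  forced by the bottom side.\<close>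

lemma std_terminal:
  assumes A: "fibrant M A"
  shows "tot.strong_terminal (Idt M A)"
  unfolding tot.strong_terminal_def
proof (intro conjI ballI impI)
  have [simp]: "A \<in> Obj M" using A by (rule fibrant_obj)
  show "Idt M A \<in> Obj \<E>" using A by (simp add: iso_fib iso_idt)
  have fI [simp]: "Idt M A \<in> Fib M" by (simp add: iso_fib iso_idt)
  show "\<exists>u \<in> hom \<E> X (Idt M A). AMap \<pi> u = f" if X: "X \<in> Obj \<E>" and f: "f \<in> hom \<B> (OMap \<pi> X) (OMap \<pi> (Idt M A))" for X f
  proof -
    have "sq X (f \<cdot> X) f (Idt M A)" using X f A by (simp add: fib_square_def)
    then show ?thesis by (intro bexI[of _ "G (X, f \<cdot> X, f, Idt M A)"]) simp_all
  qed
  show "u = v" if a: "u \<in> Arr \<E>" "v \<in> Arr \<E>" and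
    uv: "Cod \<E> u = Idt M A \<and> Cod \<E> v = Idt M A \<and> Dom \<E> u = Dom \<E> v \<and> AMap \<pi> u = AMap \<pi> v" for u v
  proof -
    obtain z f where z: "Dom \<E> v = z" "AMap \<pi> v = f" by blast
    obtain s where s: "sq z s f (Idt M A)" "u = G (z, s, f, Idt M A)" using G_ex[of u z "Idt M A" f] a uv z by auto
    obtain t where t: "sq z t f (Idt M A)" "v = G (z, t, f, Idt M A)" using G_ex[of v z "Idt M A" f] a uv z by auto
    have "s = f \<cdot> z" "t = f \<cdot> z" using fib_squareD[OF s(1)] fib_squareD[OF t(1)] by simp_all
    then show ?thesis using s t by simp
  qed
qed

text \<open>The arrow from the initial object to \<open>A\<close> is a fibration by suitability, and
  top sides of squares out of it are unique.\<close>

lemma std_initial: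
  assumes Z: "is_initial M Z" and z: "z \<in> Arr M" "Dom M z = Z" "fibrant M (Cod M z)"
  shows "is_initial (fiber \<pi> (Cod M z)) z"
proof (rule category.initialI[OF tot.category_fiber])
  have zf [simp]: "z \<in> Fib M" using initial_fib[OF Z, of z "Cod M z"] z by simp
  note [simp] = z
  show "Cod M z \<in> Obj \<B>" "z \<in> Obj (fiber \<pi> (Cod M z))" by simp_all
  fix X assume X: "X \<in> Obj (fiber \<pi> (Cod M z))"
  then have [simp]: "X \<in> Fib M" "Cod M X = Cod M z" by simp_all
  obtain u where u: "u \<in> Arr M" "Dom M u = Z" "Cod M u = Dom M X" using initial_map[OF Z, of "Dom M X"] by auto
  have "X \<cdot> u = z" by (rule initial_eq[OF Z]) (use u in simp_all)
  then have "sq z u (Idt M (Cod M z)) X" using u by (simp add: fib_square_def)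
  then show "\<exists>u. u \<in> Arr (fiber \<pi> (Cod M z)) \<and> Cod (fiber \<pi> (Cod M z)) u = X \<and> Dom (fiber \<pi> (Cod M z)) u = z"
    by (intro exI[of _ "G (z, u, Idt M (Cod M z), X)"]) simp
next
  fix f g assume a: "f \<in> Arr (fiber \<pi> (Cod M z))" "g \<in> Arr (fiber \<pi> (Cod M z))" "Dom (fiber \<pi> (Cod M z)) f = z"
    "Dom (fiber \<pi> (Cod M z)) g = z" "Cod (fiber \<pi> (Cod M z)) f = Cod (fiber \<pi> (Cod M z)) g"
  obtain X where X: "Cod \<E> g = X" by blast
  obtain s where s: "sq z s (Idt M (Cod M z)) X" "f = G (z, s, Idt M (Cod M z), X)" using G_ex[of f z X "Idt M (Cod M z)"] a X by auto
  obtain t where t: "sq z t (Idt M (Cod M z)) X" "g = G (z, t, Idt M (Cod M z), X)" using G_ex[of g z X "Idt M (Cod M z)"] a X by auto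
  have "s = t" by (rule initial_eq[OF Z]) (use fib_squareD[OF s(1)] fib_squareD[OF t(1)] z in simp_all)
  then show "f = g" using s t by simp
qed

text \<open>A pullback of \<open>z\<close> has a domain mapping to the initial object, which is
  initial by strictness.\<close>

lemma std_initial_stable:
  assumes Z: "is_initial M Z" and z: "z \<in> Arr M" "Dom M z = Z" "fibrant M (Cod M z)" and f: "f \<in> Arr \<B>" "Cod \<B> f = Cod M z"
  shows "\<exists>c. cart_lift \<pi> f z c \<and> is_initial (fiber \<pi> (Dom \<B> f)) (Dom \<E> c)"
proof -
  have zf: "z \<in> Fib M" using initial_fib[OF Z, of z "Cod M z"] z by simp
  have f' [simp]: "f \<in> Arr M" "Cod M f = Cod M z" "fibrant M (Dom M f)" using f by simp_all
  obtain t x where P: "is_pullback M z t f x" and S: "sq x t f z" using fib_exists_pullback[OF zf z(3), of f] by (simp, blast)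
  note p = pullbackD[OF P]
  have "is_initial M (Dom M x)" using initial_strict[OF Z, of t] p z(2) by simp
  then have "is_initial (fiber \<pi> (Cod M x)) x" by (rule std_initial) (use p in simp_all)
  then show ?thesis using G_cart_lift[OF P zf z(3)] S p by (intro exI[of _ "G (x, t, f, z)"]) simp
qed

text \<open>The fibre product of \<open>f \<cdot> x\<close> and \<open>p\<close>, regarded over the
  base of \<open>x\<close>. A pair of homotopies of the components gives one into the fibre product,
  hence uniqueness.\<close>

lemma std_fibred_product:
  assumes P: "is_pullback M (f \<cdot> x) c p s" and x: "x \<in> Fib M" "p \<in> Fib M" "f \<in> Arr M" "Cod M x = Dom M f" "Cod M f = Cod M p"
    and fibrant: "fibrant M (Dom M f)" "fibrant M (Cod M p)"
  shows "tot.fibred_product f x p (x \<cdot> c) (G (x \<cdot> c, c, Idt M (Cod M x), x)) (G (x \<cdot> c, s, f, p))"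
    "sq (x \<cdot> c) c (Idt M (Cod M x)) x" "sq (x \<cdot> c) s f p"
proof -
  have x' [simp]: "x \<in> Arr M" using x by simp
  note [simp] = x fibrant
  note p' = pullbackD[OF P, simplified]
  note [simp] = p'(3,4,6-8)
  have [simp]: "c \<in> Fib M" using fib_pullback[OF pullback_sym[OF P]] by simp
  have xc: "x \<cdot> c \<in> Fib M" by (rule fib_comp) simp_all
  show S: "sq (x \<cdot> c) c (Idt M (Cod M x)) x" "sq (x \<cdot> c) s f p"
    using xc p'(9) by (simp_all add: fib_square_def)
  show "tot.fibred_product f x p (x \<cdot> c) (G (x \<cdot> c, c, Idt M (Cod M x), x)) (G (x \<cdot> c, s, f, p))"
  proof (rule tot.fibred_productI)
    fix a b assume ab: "a \<in> Arr \<E>" "b \<in> Arr \<E>" "Dom \<E> a = Dom \<E> b" "Cod \<E> a = x" "Cod \<E> b = p"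
      "AMap \<pi> b = f \<cdot>\<^bsub>\<B>\<^esub> AMap \<pi> a"
    obtain y g where y: "Dom \<E> b = y" "AMap \<pi> a = g" by blast
    obtain \<alpha> where A: "sq y \<alpha> g x" and a: "a = G (y, \<alpha>, g, x)" using G_ex[of a y x g] ab y by auto
    obtain \<beta> where B: "sq y \<beta> (f \<cdot> g) p" and b: "b = G (y, \<beta>, f \<cdot> g, p)" using G_ex[of b y p "f \<cdot> g"] ab y by auto
    note [simp] = fib_squareD(1,3,5-10)[OF A] fib_squareD(5-7)[OF B] and e = fib_squareD(11)[OF A] fib_squareD(11)[OF B]
    obtain w where w: "w \<in> Arr M" "Dom M w = Dom M y" "Cod M w = Dom M c" "c \<cdot> w = \<alpha>" "s \<cdot> w = \<beta>"
      using pullback_ex[OF P, of \<alpha> \<beta>] e by auto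
    have W: "sq y w g (x \<cdot> c)" using w e xc by (simp add: fib_square_def)
    show "\<exists>w. w \<in> Arr \<E> \<and> Dom \<E> w = Dom \<E> b \<and> Cod \<E> w = x \<cdot> c \<and> G (x \<cdot> c, c, Idt M (Cod M x), x) \<cdot>\<^bsub>\<E>\<^esub> w = a \<and>
      G (x \<cdot> c, s, f, p) \<cdot>\<^bsub>\<E>\<^esub> w = b"
      using W S y by (intro exI[of _ "G (y, w, g, x \<cdot> c)"]) (simp add: a b w(4,5))
  next
    fix w w' assume a: "w \<in> Arr \<E>" "w' \<in> Arr \<E>" "Dom \<E> w = Dom \<E> w'" "Cod \<E> w = x \<cdot> c" "Cod \<E> w' = x \<cdot> c"
      "G (x \<cdot> c, c, Idt M (Cod M x), x) \<cdot>\<^bsub>\<E>\<^esub> w = G (x \<cdot> c, c, Idt M (Cod M x), x) \<cdot>\<^bsub>\<E>\<^esub> w'"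
      "G (x \<cdot> c, s, f, p) \<cdot>\<^bsub>\<E>\<^esub> w = G (x \<cdot> c, s, f, p) \<cdot>\<^bsub>\<E>\<^esub> w'"
    obtain y g g' where y: "Dom \<E> w' = y" "AMap \<pi> w = g" "AMap \<pi> w' = g'" by blast
    obtain u where U: "sq y u g (x \<cdot> c)" and w: "w = G (y, u, g, x \<cdot> c)" using G_ex[of w y "x \<cdot> c" g] a y by auto
    obtain u' where U': "sq y u' g' (x \<cdot> c)" and w': "w' = G (y, u', g', x \<cdot> c)" using G_ex[of w' y "x \<cdot> c" g'] a y by auto
    have e1: "G (y, c \<cdot> u, Idt M (Cod M x) \<cdot> g, x) = G (y, c \<cdot> u', Idt M (Cod M x) \<cdot> g', x)" using a(6) unfolding w w' G_cmp[OF U S(1)] G_cmp[OF U' S(1)] .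
    have e2: "G (y, s \<cdot> u, f \<cdot> g, p) = G (y, s \<cdot> u', f \<cdot> g', p)" using a(7) unfolding w w' G_cmp[OF U S(2)] G_cmp[OF U' S(2)] .
    note d1 = G_eqD[OF e1 fib_square_cmp[OF U S(1)] fib_square_cmp[OF U' S(1)]]
      and d2 = G_eqD[OF e2 fib_square_cmp[OF U S(2)] fib_square_cmp[OF U' S(2)]]
    have g: "g' = g" using d1(2) fib_squareD[OF U] fib_squareD[OF U'] by simp
    have "htpy (x \<cdot> c) u u'" using fib_squareD[OF U] fib_squareD[OF U'] d1(4) d2(4) by - (rule htpy_fibre_product[OF P], simp_all)
    then show "w = w'" using G_eq[OF U, of u'] U' w w' g by simp
  qed (use S in simp_all)
qed

text \<open>The copair of two fibrations is a fibration by suitability, and homotopies on the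
  summands combine by \<open>htpy_coproduct\<close>.\<close>

lemma std_coproduct:
  assumes S: "is_coproduct M P Q S i j" and s: "s \<in> Arr M" "Dom M s = S" "s \<cdot> i \<in> Fib M" "s \<cdot> j \<in> Fib M" and A: "fibrant M (Cod M s)"
  shows "is_coproduct (fiber \<pi> (Cod M s)) (s \<cdot> i) (s \<cdot> j) s (G (s \<cdot> i, i, Idt M (Cod M s), s)) (G (s \<cdot> j, j, Idt M (Cod M s), s))"
    "sq (s \<cdot> i) i (Idt M (Cod M s)) s" "sq (s \<cdot> j) j (Idt M (Cod M s)) s"
proof -
  let ?I = "Idt M (Cod M s)"
  note [simp] = coproductD[OF S] s A
  have sf [simp]: "s \<in> Fib M" using copair_fib[OF S, of s "Cod M s"] by simp
  show I: "sq (s \<cdot> i) i ?I s" "sq (s \<cdot> j) j ?I s" by (simp_all add: fib_square_def)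
  have o: "Cod M s \<in> Obj \<B>" by simp
  show "is_coproduct (fiber \<pi> (Cod M s)) (s \<cdot> i) (s \<cdot> j) s (G (s \<cdot> i, i, ?I, s)) (G (s \<cdot> j, j, ?I, s))"
  proof (rule category.coproductI[OF tot.category_fiber[OF o]])
    fix f g assume a: "f \<in> Arr (fiber \<pi> (Cod M s))" "g \<in> Arr (fiber \<pi> (Cod M s))" "Cod (fiber \<pi> (Cod M s)) f = Cod (fiber \<pi> (Cod M s)) g"
      "Dom (fiber \<pi> (Cod M s)) f = s \<cdot> i" "Dom (fiber \<pi> (Cod M s)) g = s \<cdot> j"
    obtain y where y: "Cod \<E> g = y" by blast
    obtain u where U: "sq (s \<cdot> i) u ?I y" and f: "f = G (s \<cdot> i, u, ?I, y)" using G_ex[of f "s \<cdot> i" y ?I] a y by auto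
    obtain v where V: "sq (s \<cdot> j) v ?I y" and g: "g = G (s \<cdot> j, v, ?I, y)" using G_ex[of g "s \<cdot> j" y ?I] a y by auto
    note [simp] = fib_squareD(2,4-7)[OF U] fib_squareD(5-7)[OF V] and e = fib_squareD(10,11)[OF U] fib_squareD(11)[OF V]
    obtain w where w: "w \<in> Arr M" "Dom M w = S" "Cod M w = Dom M y" "w \<cdot> i = u" "w \<cdot> j = v" using coproduct_ex[OF S, of u v] by auto
    have [simp]: "Cod M y = Cod M s" using e(1) by simp
    have "y \<cdot> w = s" by (rule coproduct_eq[OF S]) (use w e in simp_all)
    then have W: "sq s w ?I y" using w by (simp add: fib_square_def)
    show "\<exists>u. u \<in> Arr (fiber \<pi> (Cod M s)) \<and> Cod (fiber \<pi> (Cod M s)) u = Cod (fiber \<pi> (Cod M s)) g \<and> Dom (fiber \<pi> (Cod M s)) u = s \<and>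
      u \<cdot>\<^bsub>fiber \<pi> (Cod M s)\<^esub> G (s \<cdot> i, i, ?I, s) = f \<and> u \<cdot>\<^bsub>fiber \<pi> (Cod M s)\<^esub> G (s \<cdot> j, j, ?I, s) = g"
      using W I y w by (intro exI[of _ "G (s, w, ?I, y)"]) (simp add: f g)
  next
    fix u v assume a: "u \<in> Arr (fiber \<pi> (Cod M s))" "v \<in> Arr (fiber \<pi> (Cod M s))" "Cod (fiber \<pi> (Cod M s)) u = Cod (fiber \<pi> (Cod M s)) v"
      "Dom (fiber \<pi> (Cod M s)) u = s" "Dom (fiber \<pi> (Cod M s)) v = s"
      "u \<cdot>\<^bsub>fiber \<pi> (Cod M s)\<^esub> G (s \<cdot> i, i, ?I, s) = v \<cdot>\<^bsub>fiber \<pi> (Cod M s)\<^esub> G (s \<cdot> i, i, ?I, s)"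
      "u \<cdot>\<^bsub>fiber \<pi> (Cod M s)\<^esub> G (s \<cdot> j, j, ?I, s) = v \<cdot>\<^bsub>fiber \<pi> (Cod M s)\<^esub> G (s \<cdot> j, j, ?I, s)"
    obtain y where y: "Cod \<E> v = y" by blast
    obtain t where T: "sq s t ?I y" and u: "u = G (s, t, ?I, y)" using G_ex[of u s y ?I] a y by auto
    obtain t' where T': "sq s t' ?I y" and v: "v = G (s, t', ?I, y)" using G_ex[of v s y ?I] a y by auto
    have e: "G (s \<cdot> i, t \<cdot> i, ?I \<cdot> ?I, y) = G (s \<cdot> i, t' \<cdot> i, ?I \<cdot> ?I, y)" "G (s \<cdot> j, t \<cdot> j, ?I \<cdot> ?I, y) = G (s \<cdot> j, t' \<cdot> j, ?I \<cdot> ?I, y)"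
      using a(6,7) unfolding u v fiber_simps G_cmp[OF I(1) T] G_cmp[OF I(1) T'] G_cmp[OF I(2) T] G_cmp[OF I(2) T'] by blast+
    have "htpy y (t \<cdot> i) (t' \<cdot> i)" "htpy y (t \<cdot> j) (t' \<cdot> j)"
      using G_eqD(4)[OF e(1) fib_square_cmp[OF I(1) T] fib_square_cmp[OF I(1) T']] G_eqD(4)[OF e(2) fib_square_cmp[OF I(2) T] fib_square_cmp[OF I(2) T']] .
    then have "htpy y t t'" using fib_squareD[OF T] fib_squareD[OF T'] by - (rule htpy_coproduct[OF S], simp_all)
    then show "u = v" using G_eq[OF T T'] u v by simp
  qed (use I in simp_all)
qed

text \<open>Pull back first \<open>s\<close> along \<open>f\<close>, then the injections along the
  resulting arrow \<open>h\<close>. Universality makes the latter the injections of a coproduct, and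
  pasting shows that the summands are the pullbacks along \<open>f\<close>.\<close>

lemma std_coproduct_stable:
  assumes S: "is_coproduct M P Q S i j" and s: "s \<in> Arr M" "Dom M s = S" "s \<cdot> i \<in> Fib M" "s \<cdot> j \<in> Fib M" and A: "fibrant M (Cod M s)"
    and f: "f \<in> Arr \<B>" "Cod \<B> f = Cod M s"
  shows "\<exists>cP cQ cS i' j'. cart_lift \<pi> f (s \<cdot> i) cP \<and> cart_lift \<pi> f (s \<cdot> j) cQ \<and> cart_lift \<pi> f s cS \<and>
        induced \<pi> (Idt \<B> (Dom \<B> f)) cP (G (s \<cdot> i, i, Idt M (Cod M s), s)) cS i' \<and>
        induced \<pi> (Idt \<B> (Dom \<B> f)) cQ (G (s \<cdot> j, j, Idt M (Cod M s), s)) cS j' \<and>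
        is_coproduct (fiber \<pi> (Dom \<B> f)) (Dom \<E> cP) (Dom \<E> cQ) (Dom \<E> cS) i' j'"
proof -
  note std = std_coproduct[OF S s A]
  note [simp] = coproductD[OF S] s A
  have f' [simp]: "f \<in> Arr M" "Cod M f = Cod M s" "fibrant M (Dom M f)" using f by simp_all
  have sf [simp]: "s \<in> Fib M" using copair_fib[OF S, of s "Cod M s"] by simp
  obtain h s' where Ps: "is_pullback M s h f s'" and S': "sq s' h f s" using fib_exists_pullback[OF sf A, of f] by (simp, blast)
  note [simp] = pullbackD(3,4,6-8)[OF Ps] and ps = pullbackD(9)[OF Ps]
  obtain h1 i' where Pi: "is_pullback M i h1 h i'" using pullback_exists[of i h] by auto
  obtain h2 j' where Pj: "is_pullback M j h2 h j'" using pullback_exists[of j h] by auto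
  note [simp] = pullbackD(3,4,6-8)[OF Pi] pullbackD(3,4,6-8)[OF Pj] and pe = pullbackD(9)[OF Pi] pullbackD(9)[OF Pj]
  have Psi: "is_pullback M (s \<cdot> i) h1 f (s' \<cdot> i')"
    by (rule pullback_sym, rule pullback_paste[OF pullback_sym[OF Ps] pullback_sym[OF Pi]])
  have Psj: "is_pullback M (s \<cdot> j) h2 f (s' \<cdot> j')"
    by (rule pullback_sym, rule pullback_paste[OF pullback_sym[OF Ps] pullback_sym[OF Pj]])
  have C: "is_coproduct M (Dom M i') (Dom M j') (Dom M s') i' j'" using coproduct_pullback[OF S _ Pi Pj] by simp
  have si: "s' \<cdot> i' \<in> Fib M" "s' \<cdot> j' \<in> Fib M" using fib_pullback[OF Psi] fib_pullback[OF Psj] by simp_all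
  have sd: "s' \<in> Arr M" "Dom M s' = Dom M s'" "fibrant M (Cod M s')" by simp_all
  note std' = std_coproduct[OF C sd(1,2) si sd(3)]
  have l: "cart_lift \<pi> f (s \<cdot> i) (G (s' \<cdot> i', h1, f, s \<cdot> i))" "cart_lift \<pi> f (s \<cdot> j) (G (s' \<cdot> j', h2, f, s \<cdot> j))" "cart_lift \<pi> f s (G (s', h, f, s))"
    using G_cart_lift[OF Psi] G_cart_lift[OF Psj] G_cart_lift[OF Ps] by simp_all
  have q: "sq (s' \<cdot> i') h1 f (s \<cdot> i)" "sq (s' \<cdot> j') h2 f (s \<cdot> j)" using pullback_fib_square[OF Psi] pullback_fib_square[OF Psj] by simp_all
  show ?thesis
    by (rule exI[of _ "G (s' \<cdot> i', h1, f, s \<cdot> i)"], rule exI[of _ "G (s' \<cdot> j', h2, f, s \<cdot> j)"], rule exI[of _ "G (s', h, f, s)"],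
      rule exI[of _ "G (s' \<cdot> i', i', Idt M (Cod M s'), s')"], rule exI[of _ "G (s' \<cdot> j', j', Idt M (Cod M s'), s')"])
      (use l std std' q S' in \<open>simp add: induced_def pe\<close>)
qed

text \<open>Along a fibration \<open>g\<close> the cocartesian lift is composition:
  \<open>g \<cdot> p\<close> is again a fibration, so an identity serves as the top side.\<close>

lemma std_cocartesian:
  assumes p: "p \<in> Fib M" "g \<in> Fib M" "Dom M g = Cod M p" and fibrant: "fibrant M (Cod M g)"
  shows "is_cocartesian \<pi> (G (p, Idt M (Dom M p), g, g \<cdot> p))" "sq p (Idt M (Dom M p)) g (g \<cdot> p)"
proof -
  have [simp]: "p \<in> Arr M" "g \<in> Arr M" using p by simp_all
  note [simp] = p fibrant
  have gp [simp]: "g \<cdot> p \<in> Fib M" by (rule fib_comp) simp_all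
  have [simp]: "fibrant M (Cod M p)" using fibrant_dom[of g] by simp
  show S: "sq p (Idt M (Dom M p)) g (g \<cdot> p)" by (simp add: fib_square_def)
  show "is_cocartesian \<pi> (G (p, Idt M (Dom M p), g, g \<cdot> p))"
  proof (rule tot.cocartesianI)
    fix f r assume a: "r \<in> Arr \<E>" "Dom \<E> r = Dom \<E> (G (p, Idt M (Dom M p), g, g \<cdot> p))" "f \<in> Arr \<B>"
      "Dom \<B> f = OMap \<pi> (Cod \<E> (G (p, Idt M (Dom M p), g, g \<cdot> p)))" "Cod \<B> f = OMap \<pi> (Cod \<E> r)"
      "AMap \<pi> r = f \<cdot>\<^bsub>\<B>\<^esub> AMap \<pi> (G (p, Idt M (Dom M p), g, g \<cdot> p))"
    obtain y where y: "Cod \<E> r = y" by blast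
    obtain t where T: "sq p t (f \<cdot> g) y" and r: "r = G (p, t, f \<cdot> g, y)" using G_ex[of r p y "f \<cdot> g"] a y S by auto
    have f [simp]: "f \<in> Arr M" "Dom M f = Cod M g" "Cod M f = Cod M y" using a S y by simp_all
    note t = fib_squareD[OF T]
    have T': "sq (g \<cdot> p) t f y" using t by (simp add: fib_square_def)
    show "\<exists>s. s \<in> Arr \<E> \<and> Cod \<E> s = Cod \<E> r \<and> Dom \<E> s = Cod \<E> (G (p, Idt M (Dom M p), g, g \<cdot> p)) \<and> AMap \<pi> s = f \<and>
      s \<cdot>\<^bsub>\<E>\<^esub> G (p, Idt M (Dom M p), g, g \<cdot> p) = r"
      using T' S y t by (intro exI[of _ "G (g \<cdot> p, t, f, y)"]) (simp add: r T)
  next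
    fix s s' assume a: "s \<in> Arr \<E>" "s' \<in> Arr \<E>" "Cod \<E> s = Cod \<E> s'"
      "Dom \<E> s = Cod \<E> (G (p, Idt M (Dom M p), g, g \<cdot> p))" "Dom \<E> s' = Cod \<E> (G (p, Idt M (Dom M p), g, g \<cdot> p))"
      "AMap \<pi> s = AMap \<pi> s'" "s \<cdot>\<^bsub>\<E>\<^esub> G (p, Idt M (Dom M p), g, g \<cdot> p) = s' \<cdot>\<^bsub>\<E>\<^esub> G (p, Idt M (Dom M p), g, g \<cdot> p)"
    obtain y f where y: "Cod \<E> s' = y" "AMap \<pi> s' = f" by blast
    obtain t where T: "sq (g \<cdot> p) t f y" and s: "s = G (g \<cdot> p, t, f, y)" using G_ex[of s "g \<cdot> p" y f] a y S by auto
    obtain t' where T': "sq (g \<cdot> p) t' f y" and s': "s' = G (g \<cdot> p, t', f, y)" using G_ex[of s' "g \<cdot> p" y f] a y S by auto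
    have e: "G (p, t \<cdot> Idt M (Dom M p), f \<cdot> g, y) = G (p, t' \<cdot> Idt M (Dom M p), f \<cdot> g, y)" using a(7) unfolding s s' G_cmp[OF S T] G_cmp[OF S T'] .
    have "htpy y t t'" using G_eqD(4)[OF e fib_square_cmp[OF S T] fib_square_cmp[OF S T']] fib_squareD[OF T] fib_squareD[OF T'] by simp
    then show "s = s'" using G_eq[OF T T'] s s' by simp
  qed (simp add: S)
qed

text \<open>By pasting, one arrow \<open>t\<close> is the top side of the pullbacks of both
  \<open>p\<close> and \<open>g \<cdot> p\<close>, so the arrow induced between them again has an
  identity as its top side.\<close>

lemma std_cocartesian_stable:
  assumes p: "p \<in> Fib M" "g \<in> Fib M" "Dom M g = Cod M p" and fibrant: "fibrant M (Cod M g)"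
  shows "stable_cocartesian \<pi> (G (p, Idt M (Dom M p), g, g \<cdot> p))"
  unfolding stable_cocartesian_def
proof (intro allI impI)
  note std = std_cocartesian[OF assms]
  have [simp]: "p \<in> Arr M" "g \<in> Arr M" using p by simp_all
  note [simp] = p fibrant
  have gp [simp]: "g \<cdot> p \<in> Fib M" by (rule fib_comp) simp_all
  fix h k f c d q'
  assume a: "is_pullback \<B> (AMap \<pi> (G (p, Idt M (Dom M p), g, g \<cdot> p))) h k f \<and> cart_lift \<pi> h (Dom \<E> (G (p, Idt M (Dom M p), g, g \<cdot> p))) c \<and>
    cart_lift \<pi> k (Cod \<E> (G (p, Idt M (Dom M p), g, g \<cdot> p))) d \<and> induced \<pi> f c (G (p, Idt M (Dom M p), g, g \<cdot> p)) d q'"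
  have PB: "is_pullback (fibrant_cat M) g h k f" using a std by simp
  note pb = fibrant_cat_pullback[OF PB p(2)] and fb = category.pullbackD[OF category_fibrant_cat PB, simplified]
  note [simp] = pullbackD(2-4,6-8)[OF pb(1)] pullbackD(5)[OF pb(1)]
  have [simp]: "fibrant M (Dom M h)" "fibrant M (Dom M k)" "fibrant M (Cod M p)" using fb by auto
  obtain t p' where P': "is_pullback M p t h p'" and T: "sq p' t h p" using fib_exists_pullback[OF p(1), of h] by (simp, blast)
  note [simp] = pullbackD(3,4,6-8)[OF P']
  have Q: "is_pullback M (g \<cdot> p) t k (f \<cdot> p')"
    by (rule pullback_sym, rule pullback_paste[OF pullback_sym[OF pb(1)] pullback_sym[OF P']])
  have T2: "sq (f \<cdot> p') t k (g \<cdot> p)" using pullback_fib_square[OF Q] by simp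
  have p'f: "p' \<in> Fib M" using fib_squareD(1)[OF T] .
  note std' = std_cocartesian[of p' f, OF p'f pb(2)]
  have s': "is_cocartesian \<pi> (G (p', Idt M (Dom M p'), f, f \<cdot> p'))" "sq p' (Idt M (Dom M p')) f (f \<cdot> p')" using std' by simp_all
  show "is_cocartesian \<pi> q'"
  proof (rule tot.cocartesian_one_lift[where c = c and d = d, OF _ _ _ _ s'(1)])
    show "cart_lift \<pi> h (Dom \<E> (G (p, Idt M (Dom M p), g, g \<cdot> p))) (G (p', t, h, p))" using G_cart_lift[OF P'] std(2) by simp
    show "cart_lift \<pi> k (Cod \<E> (G (p, Idt M (Dom M p), g, g \<cdot> p))) (G (f \<cdot> p', t, k, g \<cdot> p))" using G_cart_lift[OF Q] std(2) by simp
    show "induced \<pi> f (G (p', t, h, p)) (G (p, Idt M (Dom M p), g, g \<cdot> p)) (G (f \<cdot> p', t, k, g \<cdot> p)) (G (p', Idt M (Dom M p'), f, f \<cdot> p'))"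
      using T T2 std(2) s'(2) pullbackD(9)[OF pb(1)] by (simp add: induced_def)
  qed (use a std(2) in simp_all)
qed

text \<open>The dependent product along the fibration \<open>g\<close> is a fibration by
  \<open>slice_Pi_fib\<close>. Transposition respects homotopy, which gives uniqueness in the
  quotient.\<close>

lemma std_Pi:
  assumes R: "slice_Pi M g p r c s e" and g: "g \<in> Fib M" "p \<in> Fib M" "fibrant M (Cod M g)"
  shows "tot.strong_Pi g p (G (s, c, g, r)) (G (s, e, Idt M (Dom M g), p))" "sq s c g r" "sq s e (Idt M (Dom M g)) p"
proof -
  have [simp]: "p \<in> Arr M" "g \<in> Arr M" using g by simp_all
  note [simp] = g
  note P = slice_PiD(1)[OF R]
  note [simp] = pullbackD(1-4,6-8)[OF P] pullbackD(5)[OF P, symmetric] slice_PiD(2-6)[OF R]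
  have [simp]: "r \<in> Fib M" by (rule slice_Pi_fib[OF R g(1,2)])
  have [simp]: "fibrant M (Dom M g)" using fibrant_dom[of g] by simp
  note cc = G_cartesian[OF P, simplified]
  show S1: "sq s c g r" by (rule cc)
  have [simp]: "s \<in> Fib M" using fib_squareD(1)[OF S1] .
  show S2: "sq s e (Idt M (Dom M g)) p" by (simp add: fib_square_def slice_PiD(7)[OF R])
  let ?e = "G (s, e, Idt M (Dom M g), p)"
  show "tot.strong_Pi g p (G (s, c, g, r)) (G (s, e, Idt M (Dom M g), p))"
    unfolding tot.strong_Pi_def
  proof (intro conjI allI impI)
    fix h k f x assume a: "is_pullback \<B> g h k f \<and> x \<in> Obj \<E> \<and> OMap \<pi> x = Dom \<B> k"
    then have PB: "is_pullback (fibrant_cat M) g h k f" and x [simp]: "x \<in> Fib M" "Cod M x = Dom M k" by simp_all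
    note pb = fibrant_cat_pullback[OF PB g(1)] and fb = category.pullbackD[OF category_fibrant_cat PB, simplified]
    note [simp] = pullbackD(2-4,6-8)[OF pb(1)] pullbackD(5)[OF pb(1)]
    have [simp]: "fibrant M (Dom M h)" "fibrant M (Dom M k)" using fb by auto
    obtain c1 s' where Q: "is_pullback M x c1 f s'" and C1: "sq s' c1 f x" using fib_exists_pullback[OF x(1), of f] by (simp, blast)
    note [simp] = pullbackD(3,4,6-8)[OF Q] fib_squareD(1)[OF C1] and qe = pullbackD(9)[OF Q]
    \<comment> \<open>By pasting, the pullback of \<open>x\<close> along \<open>f\<close> is also
      the pullback of \<open>k \<cdot> x\<close> along \<open>g\<close>, so the universal property
      of \<open>slice_Pi\<close> applies to it as it stands.\<close>
    have PQ: "is_pullback M (k \<cdot> x) c1 g (h \<cdot> s')" by (rule pullback_sym, rule pullback_paste[OF pb(1) pullback_sym[OF Q]])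
    show "\<exists>c'. cart_lift \<pi> f x c' \<and> (\<forall>t. t \<in> hom \<E> (Dom \<E> c') p \<and> AMap \<pi> t = h \<longrightarrow>
      (\<exists>!S. S \<in> hom \<E> x (Cod \<E> (G (s, c, g, r))) \<and> AMap \<pi> S = k \<and> (\<exists>u. induced \<pi> h c' S (G (s, c, g, r)) u \<and> ?e \<cdot>\<^bsub>\<E>\<^esub> u = t)))"
    proof (rule exI[of _ "G (s', c1, f, x)"], intro conjI allI impI)
      show "cart_lift \<pi> f x (G (s', c1, f, x))" using G_cart_lift[OF Q] by simp
      fix t assume t: "t \<in> hom \<E> (Dom \<E> (G (s', c1, f, x))) p \<and> AMap \<pi> t = h"
      then obtain \<tau> where T: "sq s' \<tau> h p" and te: "t = G (s', \<tau>, h, p)" using G_ex[of t s' p h] C1 by auto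
      note [simp] = fib_squareD(5-7)[OF T]
      obtain u v where uv: "base_change M r c s (k \<cdot> x) c1 (h \<cdot> s') u v" and ev: "e \<cdot> v = \<tau>"
        using slice_Pi_ex[OF R PQ, of \<tau>] fib_squareD(11)[OF T] by auto
      note [simp] = base_changeD(1-6)[OF uv, simplified] and bu = base_changeD(7-9)[OF uv]
      have U: "sq x u k r" using bu by (simp add: fib_square_def)
      have V: "sq s' v h s" using bu by (simp add: fib_square_def)
      show "\<exists>!S. S \<in> hom \<E> x (Cod \<E> (G (s, c, g, r))) \<and> AMap \<pi> S = k \<and>
        (\<exists>u. induced \<pi> h (G (s', c1, f, x)) S (G (s, c, g, r)) u \<and> ?e \<cdot>\<^bsub>\<E>\<^esub> u = t)"
      proof (rule ex1I[where a = "G (x, u, k, r)"])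
        have "induced \<pi> h (G (s', c1, f, x)) (G (x, u, k, r)) (G (s, c, g, r)) (G (s', v, h, s))"
          using U V S1 C1 bu pullbackD(9)[OF pb(1)] by (simp add: induced_def)
        moreover have "?e \<cdot>\<^bsub>\<E>\<^esub> G (s', v, h, s) = t" using V S2 T by (simp add: te ev)
        ultimately show "G (x, u, k, r) \<in> hom \<E> x (Cod \<E> (G (s, c, g, r))) \<and> AMap \<pi> (G (x, u, k, r)) = k \<and>
          (\<exists>ua. induced \<pi> h (G (s', c1, f, x)) (G (x, u, k, r)) (G (s, c, g, r)) ua \<and> ?e \<cdot>\<^bsub>\<E>\<^esub> ua = t)"
          using U S1 by auto
      next
        fix S assume S: "S \<in> hom \<E> x (Cod \<E> (G (s, c, g, r))) \<and> AMap \<pi> S = k \<and>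
          (\<exists>u. induced \<pi> h (G (s', c1, f, x)) S (G (s, c, g, r)) u \<and> ?e \<cdot>\<^bsub>\<E>\<^esub> u = t)"
        then obtain u' where U': "sq x u' k r" and Se: "S = G (x, u', k, r)" using G_ex[of S x r k] S1 by auto
        from S obtain W where W: "induced \<pi> h (G (s', c1, f, x)) S (G (s, c, g, r)) W" and We: "?e \<cdot>\<^bsub>\<E>\<^esub> W = t" by blast
        note iw = tot.inducedD[OF W]
        note [simp] = fib_squareD(5-7)[OF U']
        obtain v' where uv': "base_change M r c s (k \<cdot> x) c1 (h \<cdot> s') u' v'"
          using base_change_ex[OF P PQ, of u'] fib_squareD(11)[OF U'] by auto
        note [simp] = base_changeD(4-6)[OF uv', simplified] and bu' = base_changeD(7-9)[OF uv']
        have V': "sq s' v' h s" using bu' by (simp add: fib_square_def)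
        \<comment> \<open>The arrow \<open>W\<close> is known only as a homotopy class;
          cartesianness identifies it with the class of the strict base change \<open>v'\<close> of
          the representative \<open>u'\<close>.\<close>
        have "G (s, c, g, r) \<cdot>\<^bsub>\<E>\<^esub> W = G (s, c, g, r) \<cdot>\<^bsub>\<E>\<^esub> G (s', v', h, s)"
          using iw(5) V' S1 U' C1 bu' pullbackD(9)[OF pb(1)] by (simp add: Se)
        then have "W = G (s', v', h, s)" using iw V' S1 C1 by - (rule tot.cartesian_eq[OF cc(1)], simp_all)
        then have "G (s', e \<cdot> v', Idt M (Dom M g) \<cdot> h, p) = G (s', e \<cdot> v, Idt M (Dom M g) \<cdot> h, p)" using We V' V S2 by (simp add: te ev)
        from G_eqD(4)[OF this fib_square_cmp[OF V' S2] fib_square_cmp[OF V S2]]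
        have "htpy r u' u" by (rule htpy_slice_Pi[OF R PQ uv' uv])
        then show "S = G (x, u, k, r)" using G_eq[OF U' U] Se by simp
      qed
    qed
  qed (use cc S1 S2 in simp_all)
qed

text \<open>Over the base, the exponential of \<open>q\<close> by \<open>p\<close> is the dependent
  product along \<open>p\<close> of \<open>z1\<close>, the pullback of \<open>q\<close> along
  \<open>p\<close>. It is a fibration since \<open>p\<close> and \<open>z1\<close> are, and
  evaluation is the counit followed by \<open>z2\<close>.\<close>

lemma std_exponential:
  assumes pq: "p \<in> Fib M" "q \<in> Fib M" "Cod M q = Cod M p" and A: "fibrant M (Cod M p)"
    and Z: "is_pullback M p z1 q z2" and R: "slice_Pi M p z1 r c s e"
  shows "tot.strong_exponential p q r (r \<cdot> c) (G (r \<cdot> c, c, Idt M (Cod M p), r)) (G (r \<cdot> c, s, Idt M (Cod M p), p)) (G (r \<cdot> c, z2 \<cdot> e, Idt M (Cod M p), q))"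
    "r \<in> Fib M" "Cod M r = Cod M p" "sq (r \<cdot> c) c (Idt M (Cod M p)) r" "sq (r \<cdot> c) s (Idt M (Cod M p)) p" "sq (r \<cdot> c) (z2 \<cdot> e) (Idt M (Cod M p)) q"
proof -
  have [simp]: "p \<in> Arr M" "q \<in> Arr M" using pq by simp_all
  note [simp] = pq A pullbackD(3,4,6-8)[OF Z] and ze = pullbackD(9)[OF Z]
  note P = slice_PiD(1)[OF R]
  note [simp] = pullbackD(1-4,6-8)[OF P] slice_PiD(2-6)[OF R] and p1e = slice_PiD(7)[OF R]
  show rA [simp]: "Cod M r = Cod M p" using pullbackD(5)[OF P] by simp
  have z1 [simp]: "z1 \<in> Fib M" by (rule fib_pullback[OF pullback_sym[OF Z] pq(2)])
  show rf [simp]: "r \<in> Fib M" by (rule slice_Pi_fib[OF R pq(1) z1])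
  let ?I = "Idt M (Cod M p)"
  have P': "is_pullback M (?I \<cdot> r) c p s" using P by simp
  note std = std_fibred_product[OF P']
  have FP: "tot.fibred_product ?I r p (r \<cdot> c) (G (r \<cdot> c, c, ?I, r)) (G (r \<cdot> c, s, ?I, p))" and S1: "sq (r \<cdot> c) c ?I r" and S2: "sq (r \<cdot> c) s ?I p"
    using std by simp_all
  show "sq (r \<cdot> c) c ?I r" "sq (r \<cdot> c) s ?I p" by fact+
  have [simp]: "r \<cdot> c \<in> Fib M" using fib_squareD(1)[OF S1] .
  have qe: "q \<cdot> (z2 \<cdot> e) = r \<cdot> c" using reassoc[OF ze[symmetric], of e] pullbackD(9)[OF P] by (simp add: p1e)
  show S3: "sq (r \<cdot> c) (z2 \<cdot> e) ?I q" by (simp add: fib_square_def qe)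
  show "tot.strong_exponential p q r (r \<cdot> c) (G (r \<cdot> c, c, ?I, r)) (G (r \<cdot> c, s, ?I, p)) (G (r \<cdot> c, z2 \<cdot> e, ?I, q))"
    unfolding tot.strong_exponential_def
  proof (intro conjI allI impI)
    fix y f assume a: "y \<in> Obj \<E> \<and> f \<in> hom \<B> (OMap \<pi> y) (OMap \<pi> r)"
    then have [simp]: "y \<in> Fib M" "fibrant M (Cod M y)" "f \<in> Arr M" "Dom M f = Cod M y" "Cod M f = Cod M p" by simp_all
    obtain c' s' where PQ: "is_pullback M (f \<cdot> y) c' p s'" using pullback_exists[of "f \<cdot> y" p] by auto
    note [simp] = pullbackD(3,4,6-8)[OF PQ, simplified] and pqe = pullbackD(9)[OF PQ, simplified]
    note std' = std_fibred_product[OF PQ]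
    have FP': "tot.fibred_product f y p (y \<cdot> c') (G (y \<cdot> c', c', Idt M (Cod M y), y)) (G (y \<cdot> c', s', f, p))"
      and T1: "sq (y \<cdot> c') c' (Idt M (Cod M y)) y" and T2: "sq (y \<cdot> c') s' f p" using std' by simp_all
    have [simp]: "y \<cdot> c' \<in> Fib M" using fib_squareD(1)[OF T1] .
    have "\<exists>!u. u \<in> hom \<E> y r \<and> AMap \<pi> u = f \<and> (\<exists>v \<in> hom \<E> (y \<cdot> c') (r \<cdot> c). G (r \<cdot> c, c, ?I, r) \<cdot>\<^bsub>\<E>\<^esub> v = u \<cdot>\<^bsub>\<E>\<^esub> G (y \<cdot> c', c', Idt M (Cod M y), y) \<and>
        G (r \<cdot> c, s, ?I, p) \<cdot>\<^bsub>\<E>\<^esub> v = G (y \<cdot> c', s', f, p) \<and> G (r \<cdot> c, z2 \<cdot> e, ?I, q) \<cdot>\<^bsub>\<E>\<^esub> v = k)"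
      if k: "k \<in> hom \<E> (y \<cdot> c') q \<and> AMap \<pi> k = f" for k
    proof -
      obtain \<kappa> where K: "sq (y \<cdot> c') \<kappa> f q" and ke: "k = G (y \<cdot> c', \<kappa>, f, q)" using G_ex[of k "y \<cdot> c'" q f] k by auto
      note [simp] = fib_squareD(5-7)[OF K, simplified]
      \<comment> \<open>An arrow \<open>\<kappa>\<close> into \<open>q\<close> becomes an arrow
        \<open>\<tau>\<close> into the pullback \<open>z1\<close>, the form in which it can be
        transposed.\<close>
      have "p \<cdot> s' = q \<cdot> \<kappa>" using fib_squareD(11)[OF K] pqe by simp
      then obtain \<tau> where [simp]: "\<tau> \<in> Arr M" "Dom M \<tau> = Dom M c'" "Cod M \<tau> = Dom M z1" and te: "z1 \<cdot> \<tau> = s'" "z2 \<cdot> \<tau> = \<kappa>"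
        using pullback_ex[OF Z, of s' \<kappa>] by auto
      obtain u v where uv: "base_change M r c s (f \<cdot> y) c' s' u v" and ev: "e \<cdot> v = \<tau>"
        using slice_Pi_ex[OF R PQ, of \<tau>] te by auto
      note [simp] = base_changeD(1-6)[OF uv, simplified] and bu = base_changeD(7-9)[OF uv]
      have U: "sq y u f r" using bu by (simp add: fib_square_def)
      have V: "sq (y \<cdot> c') v f (r \<cdot> c)" using bu by (simp add: fib_square_def reassoc[OF bu(1)])
      show ?thesis
      proof (rule ex1I[where a = "G (y, u, f, r)"])
        show "G (y, u, f, r) \<in> hom \<E> y r \<and> AMap \<pi> (G (y, u, f, r)) = f \<and> (\<exists>v \<in> hom \<E> (y \<cdot> c') (r \<cdot> c).
          G (r \<cdot> c, c, ?I, r) \<cdot>\<^bsub>\<E>\<^esub> v = G (y, u, f, r) \<cdot>\<^bsub>\<E>\<^esub> G (y \<cdot> c', c', Idt M (Cod M y), y) \<and>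
          G (r \<cdot> c, s, ?I, p) \<cdot>\<^bsub>\<E>\<^esub> v = G (y \<cdot> c', s', f, p) \<and> G (r \<cdot> c, z2 \<cdot> e, ?I, q) \<cdot>\<^bsub>\<E>\<^esub> v = k)"
          using U V S1 S2 S3 T1 by (intro conjI bexI[of _ "G (y \<cdot> c', v, f, r \<cdot> c)"]) (simp_all add: bu ke ev te)
      next
        fix S assume S: "S \<in> hom \<E> y r \<and> AMap \<pi> S = f \<and> (\<exists>v \<in> hom \<E> (y \<cdot> c') (r \<cdot> c). G (r \<cdot> c, c, ?I, r) \<cdot>\<^bsub>\<E>\<^esub> v = S \<cdot>\<^bsub>\<E>\<^esub> G (y \<cdot> c', c', Idt M (Cod M y), y) \<and>
          G (r \<cdot> c, s, ?I, p) \<cdot>\<^bsub>\<E>\<^esub> v = G (y \<cdot> c', s', f, p) \<and> G (r \<cdot> c, z2 \<cdot> e, ?I, q) \<cdot>\<^bsub>\<E>\<^esub> v = k)"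
        then obtain u' where U': "sq y u' f r" and Se: "S = G (y, u', f, r)" using G_ex[of S y r f] by auto
        from S obtain W where Wh: "W \<in> hom \<E> (y \<cdot> c') (r \<cdot> c)" and W: "G (r \<cdot> c, c, ?I, r) \<cdot>\<^bsub>\<E>\<^esub> W = S \<cdot>\<^bsub>\<E>\<^esub> G (y \<cdot> c', c', Idt M (Cod M y), y)"
          "G (r \<cdot> c, s, ?I, p) \<cdot>\<^bsub>\<E>\<^esub> W = G (y \<cdot> c', s', f, p)" "G (r \<cdot> c, z2 \<cdot> e, ?I, q) \<cdot>\<^bsub>\<E>\<^esub> W = k" by blast
        note [simp] = fib_squareD(5-7)[OF U']
        obtain v' where uv': "base_change M r c s (f \<cdot> y) c' s' u' v'"
          using base_change_ex[OF P PQ, of u'] fib_squareD(11)[OF U'] by auto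
        note [simp] = base_changeD(4-6)[OF uv', simplified] and bu' = base_changeD(7-9)[OF uv']
        have V': "sq (y \<cdot> c') v' f (r \<cdot> c)" using bu' by (simp add: fib_square_def reassoc[OF bu'(1)])
        have "W = G (y \<cdot> c', v', f, r \<cdot> c)"
          using Wh V' S1 S2 T1 T2 U' by - (rule tot.fibred_product_eq[OF FP], simp_all add: W Se bu')
        then have "G (y \<cdot> c', (z2 \<cdot> e) \<cdot> v', ?I \<cdot> f, q) = G (y \<cdot> c', (z2 \<cdot> e) \<cdot> v, ?I \<cdot> f, q)" using W(3) V' V S3 by (simp add: ke ev te)
        from G_eqD(4)[OF this fib_square_cmp[OF V' S3] fib_square_cmp[OF V S3]]
        have h: "htpy q (z2 \<cdot> (e \<cdot> v')) (z2 \<cdot> (e \<cdot> v))" by simp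
        \<comment> \<open>The components in \<open>q\<close> are homotopic and those in
          \<open>p\<close> are equal, so the homotopy lifts to the pullback \<open>z1\<close> and
          can then be transposed.\<close>
        have "htpy z1 (e \<cdot> v') (e \<cdot> v)"
          by (rule htpy_pullback[OF pullback_sym[OF Z] _ _ _ _ _ h]) (simp_all add: reassoc[OF p1e] bu bu')
        then have "htpy r u' u" by (rule htpy_slice_Pi[OF R PQ uv' uv])
        then show "S = G (y, u, f, r)" using G_eq[OF U' U] Se by simp
      qed
    qed
    then show "\<exists>Z a b. tot.fibred_product f y p Z a b \<and> (\<forall>k. k \<in> hom \<E> Z q \<and> AMap \<pi> k = f \<longrightarrow> (\<exists>!u. u \<in> hom \<E> y r \<and> AMap \<pi> u = f \<and>
        (\<exists>v \<in> hom \<E> Z (r \<cdot> c). G (r \<cdot> c, c, ?I, r) \<cdot>\<^bsub>\<E>\<^esub> v = u \<cdot>\<^bsub>\<E>\<^esub> a \<and> G (r \<cdot> c, s, ?I, p) \<cdot>\<^bsub>\<E>\<^esub> v = b \<and> G (r \<cdot> c, z2 \<cdot> e, ?I, q) \<cdot>\<^bsub>\<E>\<^esub> v = k)))"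
      using FP' by blast
  qed (use FP S3 in simp_all)
qed

theorem h_fibration_quotient: "h_fibration \<pi>"
proof (rule tot.h_fibrationI[OF fibration_quotient])
  show "has_finite_products \<B>" by (simp add: fibrant_cat_has_finite_products)
  fix A assume A: "A \<in> Obj \<B>"
  then show "\<exists>T. tot.strong_terminal T \<and> OMap \<pi> T = A" using std_terminal[of A] by (intro exI[of _ "Idt M A"]) (simp add: fibrant_obj)
  obtain Z where Z: "is_initial M Z" using initial_exists by blast
  obtain z where z: "z \<in> Arr M" "Dom M z = Z" "Cod M z = A" using initial_map[OF Z, of A] A by (auto simp: fibrant_obj)
  show "\<exists>Z. is_initial (fiber \<pi> A) Z \<and> (\<forall>f \<in> Arr \<B>. Cod \<B> f = A \<longrightarrow> (\<exists>c. cart_lift \<pi> f Z c \<and> is_initial (fiber \<pi> (Dom \<B> f)) (Dom \<E> c)))"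
    using std_initial[OF Z z(1,2)] std_initial_stable[OF Z z(1,2)] z(3) A by (intro exI[of _ z]) auto
next
  fix p q assume "p \<in> Obj \<E>" "q \<in> Obj \<E>" "OMap \<pi> p = OMap \<pi> q"
  then have [simp]: "p \<in> Fib M" "q \<in> Fib M" "Cod M p = Cod M q" "fibrant M (Cod M q)" by simp_all
  obtain z1 z2 where Z: "is_pullback M p z1 q z2" using pullback_exists[of p q] by auto
  have Z': "is_pullback M (Idt M (Cod M q) \<cdot> p) z1 q z2" using Z by simp
  have "tot.fibred_product (Idt M (Cod M q)) p q (p \<cdot> z1) (G (p \<cdot> z1, z1, Idt M (Cod M p), p)) (G (p \<cdot> z1, z2, Idt M (Cod M q), q))"
    by (rule std_fibred_product[OF Z']) simp_all
  then show "\<exists>R s t. tot.fibred_product (Idt \<B> (OMap \<pi> q)) p q R s t" by auto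
  obtain r c s e where R: "slice_Pi M p z1 r c s e" using slice_Pi_exists[of p z1] pullbackD[OF Z] by auto
  show "\<exists>X R s t e. tot.strong_exponential p q X R s t e \<and> OMap \<pi> X = OMap \<pi> q"
    by (intro exI conjI, rule std_exponential(1)[OF _ _ _ _ Z R]) (simp_all add: std_exponential(3)[OF _ _ _ _ Z R])
  obtain S i j where S: "is_coproduct M (Dom M p) (Dom M q) S i j" using coproduct_exists[of "Dom M p" "Dom M q"] by auto
  obtain s where s: "s \<in> Arr M" "Dom M s = S" "Cod M s = Cod M q" "s \<cdot> i = p" "s \<cdot> j = q" using coproduct_ex[OF S, of p q] by auto
  have fs: "s \<cdot> i \<in> Fib M" "s \<cdot> j \<in> Fib M" "fibrant M (Cod M s)" by (simp_all add: s)
  note c = std_coproduct(1)[OF S s(1,2) fs, unfolded s(3-5)] and st = std_coproduct_stable[OF S s(1,2) fs, unfolded s(3-5)]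
  show "\<exists>S i j. is_coproduct (fiber \<pi> (OMap \<pi> q)) p q S i j \<and> (\<forall>f \<in> Arr \<B>. Cod \<B> f = OMap \<pi> q \<longrightarrow>
    (\<exists>cP cQ cS i' j'. cart_lift \<pi> f p cP \<and> cart_lift \<pi> f q cQ \<and> cart_lift \<pi> f S cS \<and> induced \<pi> (Idt \<B> (Dom \<B> f)) cP i cS i' \<and>
      induced \<pi> (Idt \<B> (Dom \<B> f)) cQ j cS j' \<and> is_coproduct (fiber \<pi> (Dom \<B> f)) (Dom \<E> cP) (Dom \<E> cQ) (Dom \<E> cS) i' j'))"
    unfolding omap
    by (rule exI[of _ s], rule exI[of _ "G (p, i, Idt M (Cod M q), s)"], rule exI[of _ "G (q, j, Idt M (Cod M q), s)"],
      intro conjI ballI impI, rule c, rule st)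
next
  fix g p assume a: "product_projection \<B> g" "p \<in> Obj \<E>" "OMap \<pi> p = Dom \<B> g"
  have g [simp]: "g \<in> Fib M" using a fibrant_cat_projection_fib by simp
  have [simp]: "p \<in> Fib M" "Cod M p = Dom M g" using a by simp_all
  have "g \<in> Arr (fibrant_cat M)" using a(1) category.productD(4)[OF category_fibrant_cat] unfolding product_projection_def by auto
  then have gc [simp]: "fibrant M (Cod M g)" by simp
  show "\<exists>q. is_cocartesian \<pi> q \<and> Dom \<E> q = p \<and> AMap \<pi> q = g \<and> stable_cocartesian \<pi> q"
    using std_cocartesian[of p g] std_cocartesian_stable[of p g] a by (intro exI[of _ "G (p, Idt M (Dom M p), g, g \<cdot> p)"]) simp
  obtain r c s e where R: "slice_Pi M g p r c s e" using slice_Pi_exists[of g p] a by auto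
  show "\<exists>c e. tot.strong_Pi g p c e" using std_Pi(1)[OF R g] by auto
qed

end

section \<open>The two fibrations and the localization morphism\<close>

lemma (in suitable_model_category) trivial_htpy:
  "cylinder.htpy M (\<lambda>X. X) (Idt M) (Idt M) (Idt M) y t t' \<longleftrightarrow> y \<in> Arr M \<and> t \<in> Arr M \<and> Cod M t = Dom M y \<and> t' = t"
proof -
  interpret C: cylinder M "\<lambda>X. X" "Idt M" "Idt M" "Idt M" by (rule trivial_cylinder)
  have "t' = t" if "C.is_htpy y t t' H" for H
  proof -
    have "H \<cdot> Idt M (Dom M t) = t" "H \<cdot> Idt M (Dom M t) = t'" using C.is_htpyD(11,12)[OF that] .
    then show ?thesis by simp
  qed
  then show ?thesis using C.htpy_refl[of t y] C.is_htpyD(1,2,5) unfolding C.htpy_def by blast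
qed

lemma F_fb_simps: "Src (F_fb M) = fibrant_arrow_cat M" "Tgt (F_fb M) = fibrant_cat M" "OMap (F_fb M) x = Cod M x"
  "AMap (F_fb M) (x, t, b, y) = b"
  by (simp_all add: F_fb_def)

lemma HoF_fb_simps: "Src (HoF_fb M) = localization (fibrant_arrow_cat M) (vertical_WE M)" "Tgt (HoF_fb M) = fibrant_cat M"
  "OMap (HoF_fb M) x = Cod M x"
  by (simp_all add: HoF_fb_def loc_lift_def F_fb_def)

lemma (in suitable_model_category) F_fb_quotient: "htpy_quotient M (\<lambda>X. X) (Idt M) (Idt M) (Idt M) (F_fb M) (\<lambda>f. f)"
  by (rule htpy_quotient.intro[OF trivial_cylinder cat_functor_F_fb[OF category_axioms] htpy_quotient_axioms.intro])
    (auto simp: F_fb_simps trivial_htpy fib_squareD fib_square_cmp elim: FA_cases)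

text \<open>The substance lies in \<open>gamma_full\<close> and \<open>gamma_eq_iff\<close>: the
  localization functor is full, and identifies exactly the homotopic squares.\<close>

lemma (in interval_cylinder) HoF_fb_quotient: "htpy_quotient M cyl pr i0 i1 (HoF_fb M) (AMap (gamma_fb M))"
proof (rule htpy_quotient.intro[OF cylinder_axioms cat_functor_HoF_fb[OF category_axioms] htpy_quotient_axioms.intro])
  show "Tgt (HoF_fb M) = fibrant_cat M" "OMap (HoF_fb M) x = Cod M x" for x by (simp_all add: HoF_fb_simps)
  show "x \<in> Obj (Src (HoF_fb M)) \<longleftrightarrow> x \<in> Fib M \<and> fibrant M (Cod M x)" for x by (simp add: HoF_fb_simps loc_simps)
  show "AMap (gamma_fb M) (x, t, b, y) \<in> hom (Src (HoF_fb M)) x y" if "fib_square x t b y" for x t b y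
    using gamma.amap_hom[of "(x, t, b, y)" x y] that by (simp add: HoF_fb_simps)
  show "AMap (HoF_fb M) (AMap (gamma_fb M) (x, t, b, y)) = b" if "fib_square x t b y" for x t b y
    using cat_functor.loc_lift_factors(2)[OF cat_functor_F_fb[OF category_axioms], of "vertical_WE M" "(x, t, b, y)"] F_fb_vertical_WE[OF category_axioms] that
    by (simp add: HoF_fb_def gamma_fb_def F_fb_simps)
  show "\<exists>x t b y. fib_square x t b y \<and> h = AMap (gamma_fb M) (x, t, b, y)" if "h \<in> Arr (Src (HoF_fb M))" for h
  proof -
    let ?L = "localization FA W"
    have "h \<in> hom ?L (Dom ?L h) (Cod ?L h)" using that by (simp add: HoF_fb_simps)
    from gamma_full[OF this] obtain f where f: "f \<in> hom FA (Dom ?L h) (Cod ?L h)" "h = AMap (gamma_fb M) f" by blast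
    have "f \<in> Arr FA" using f(1) unfolding hom_def by blast
    then show ?thesis using f(2) by (elim FA_cases) blast
  qed
  show "AMap (gamma_fb M) (x, t, b, y) = AMap (gamma_fb M) (x, t', b, y) \<longleftrightarrow> htpy y t t'"
    if "fib_square x t b y" "fib_square x t' b y" for x t t' b y
    using gamma_eq_iff[of "(x, t, b, y)" "(x, t', b, y)"] that by (simp add: feq_iff)
  show "AMap (gamma_fb M) (y, t', b', z) \<cdot>\<^bsub>Src (HoF_fb M)\<^esub> AMap (gamma_fb M) (x, t, b, y) = AMap (gamma_fb M) (x, t' \<cdot> t, b' \<cdot> b, z)"
    if "fib_square x t b y" "fib_square y t' b' z" for x t b y t' b' z
    using gamma.amap_cmp[of "(x, t, b, y)" x y "(y, t', b', z)" z] that by (simp add: HoF_fb_simps)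
  show "Idt (Src (HoF_fb M)) x = AMap (gamma_fb M) (x, Idt M (Dom M x), Idt M (Cod M x), x)" if "x \<in> Fib M" "fibrant M (Cod M x)" for x
    using gamma.amap_idt[of x] that by (simp add: HoF_fb_simps)
qed

section \<open>Cocartesian lifts in the localization\<close>

context interval_cylinder
begin

abbreviation \<F> where "\<F> \<equiv> Src (F_fb M)"

abbreviation \<H> where "\<H> \<equiv> Src (HoF_fb M)"

abbreviation \<B> where "\<B> \<equiv> Tgt (HoF_fb M)"

abbreviation \<Gamma> where "\<Gamma> \<equiv> AMap (gamma_fb M)"

interpretation T: htpy_quotient M "\<lambda>X. X" "Idt M" "Idt M" "Idt M" "F_fb M" "\<lambda>f. f" by (rule F_fb_quotient)
interpretation H: htpy_quotient M cyl pr i0 i1 "HoF_fb M" "\<Gamma>" by (rule HoF_fb_quotient)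

text \<open>The cocartesian lift is a fibrant replacement \<open>y\<close> of the composite \<open>f \<cdot> x\<close>.\<close>

lemma HoF_cocartesian:
  assumes x: "x \<in> Fib M" "fibrant M (Cod M x)" and f: "f \<in> Arr M" "Dom M f = Cod M x" "fibrant M (Cod M f)"
  shows "\<exists>q. is_cocartesian (HoF_fb M) q \<and> Dom \<H> q = x \<and> AMap (HoF_fb M) q = f"
proof -
  have [simp]: "x \<in> Arr M" using x by simp
  note [simp] = x f
  obtain r y where r: "r \<in> Cof M" "r \<in> WE M" and y: "y \<in> Fib M" and ry: "r \<in> Arr M" "Dom M r = Dom M x" "Cod M r = Dom M y" "Cod M y = Cod M f"
    "y \<cdot> r = f \<cdot> x"
    using factor_ac[of "f \<cdot> x"] by auto
  note [simp] = ry(1-4) y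
  have [simp]: "y \<in> Arr M" using y by simp
  have S: "fib_square x r f y" by (simp add: fib_square_def ry(5))
  let ?q = "\<Gamma> (x, r, f, y)"
  have "is_cocartesian (HoF_fb M) ?q"
  proof (rule H.tot.cocartesianI)
    fix g s assume a: "s \<in> Arr \<H>" "Dom \<H> s = Dom \<H> ?q" "g \<in> Arr \<B>"
      "Dom \<B> g = OMap (HoF_fb M) (Cod \<H> ?q)" "Cod \<B> g = OMap (HoF_fb M) (Cod \<H> s)"
      "AMap (HoF_fb M) s = g \<cdot>\<^bsub>\<B>\<^esub> AMap (HoF_fb M) ?q"
    obtain z where z: "Cod \<H> s = z" by blast
    obtain t where T: "fib_square x t (g \<cdot> f) z" and s: "s = \<Gamma> (x, t, g \<cdot> f, z)" using H.G_ex[of s x z "g \<cdot> f"] a z S by auto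
    have g [simp]: "g \<in> Arr M" "Dom M g = Cod M f" "Cod M g = Cod M z" using a S z by simp_all
    note [simp] = fib_squareD(2,4-7)[OF T]
    \<comment> \<open>An acyclic cofibration \<open>r\<close> lifts against the fibration
      \<open>z\<close>; this is the factorization through the lift.\<close>
    obtain l where l: "l \<in> Arr M" "Dom M l = Dom M y" "Cod M l = Dom M z" "l \<cdot> r = t" "z \<cdot> l = g \<cdot> y"
      using lift_ac[OF r, of z t "g \<cdot> y"] fib_squareD(11)[OF T] ry(5) by auto
    have L: "fib_square y l g z" using l by (simp add: fib_square_def)
    show "\<exists>l. l \<in> Arr \<H> \<and> Cod \<H> l = Cod \<H> s \<and> Dom \<H> l = Cod \<H> ?q \<and> AMap (HoF_fb M) l = g \<and>
      l \<cdot>\<^bsub>\<H>\<^esub> ?q = s"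
      using L S z by (intro exI[of _ "\<Gamma> (y, l, g, z)"]) (simp add: s l(4))
  next
    fix s s' assume a: "s \<in> Arr \<H>" "s' \<in> Arr \<H>" "Cod \<H> s = Cod \<H> s'"
      "Dom \<H> s = Cod \<H> ?q" "Dom \<H> s' = Cod \<H> ?q"
      "AMap (HoF_fb M) s = AMap (HoF_fb M) s'" "s \<cdot>\<^bsub>\<H>\<^esub> ?q = s' \<cdot>\<^bsub>\<H>\<^esub> ?q"
    obtain z g where z: "Cod \<H> s' = z" "AMap (HoF_fb M) s' = g" by blast
    obtain l where L: "fib_square y l g z" and s: "s = \<Gamma> (y, l, g, z)" using H.G_ex[of s y z g] a z S by auto
    obtain l' where L': "fib_square y l' g z" and s': "s' = \<Gamma> (y, l', g, z)" using H.G_ex[of s' y z g] a z S by auto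
    have e: "\<Gamma> (x, l \<cdot> r, g \<cdot> f, z) = \<Gamma> (x, l' \<cdot> r, g \<cdot> f, z)" using a(7) unfolding s s' H.G_cmp[OF S L] H.G_cmp[OF S L'] .
    have h: "htpy z (l \<cdot> r) (l' \<cdot> r)" by (rule H.G_eqD(4)[OF e fib_square_cmp[OF S L] fib_square_cmp[OF S L']])
    \<comment> \<open>Uniqueness holds only up to homotopy, by extension of homotopies along
      \<open>r\<close>. This is why the construction is carried out after localization.\<close>
    have "htpy z l l'" by (rule htpy_extend[OF _ r _ _ _ _ _ h]) (use fib_squareD[OF L] fib_squareD[OF L'] in simp_all)
    then show "s = s'" using H.G_eq[OF L L'] s s' by simp
  qed (simp add: S)
  then show ?thesis using S by (intro exI[of _ ?q]) simp
qed

lemma h_eq_fibration_HoF: "h_eq_fibration (HoF_fb M)"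
proof (rule h_eq_fibration.intro[OF H.h_fibration_quotient], rule h_eq_fibration_axioms.intro)
  fix A d T assume d: "is_diagonal \<B> A d" and T: "is_terminal (fiber (HoF_fb M) A) T"
  have "T \<in> Obj (fiber (HoF_fb M) A)" using T by (simp add: is_terminal_def del: fiber_simps)
  then have "T \<in> Fib M \<and> fibrant M (Cod M T) \<and> Cod M T = A" by simp blast
  then have "T \<in> Fib M" "fibrant M (Cod M T)" "Cod M T = A" by blast+
  moreover have "d \<in> Arr M" "Dom M d = A" "fibrant M (Cod M d)" using d by (auto simp: is_diagonal_def)
  ultimately show "\<exists>q. is_cocartesian (HoF_fb M) q \<and> Dom \<H> q = T \<and> AMap (HoF_fb M) q = d" using HoF_cocartesian by simp
qed

section \<open>Preservation by the localization functor\<close>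

lemma Gamma_simps:
  assumes "f \<in> Arr \<F>"
  shows "\<Gamma> f \<in> Arr \<H>" "Dom \<H> (\<Gamma> f) = Dom \<F> f"
    "Cod \<H> (\<Gamma> f) = Cod \<F> f" "AMap (HoF_fb M) (\<Gamma> f) = AMap (F_fb M) f"
proof -
  obtain x t b y where "fib_square x t b y" "f = (x, t, b, y)" using T.G_full[OF assms] by blast
  then show "\<Gamma> f \<in> Arr \<H>" "Dom \<H> (\<Gamma> f) = Dom \<F> f"
    "Cod \<H> (\<Gamma> f) = Cod \<F> f" "AMap (HoF_fb M) (\<Gamma> f) = AMap (F_fb M) f"
    by simp_all
qed

lemma Gamma_cmp:
  assumes "f \<in> Arr \<F>" "g \<in> Arr \<F>" "Cod \<F> f = Dom \<F> g"
  shows "\<Gamma> (g \<cdot>\<^bsub>\<F>\<^esub> f) = \<Gamma> g \<cdot>\<^bsub>\<H>\<^esub> \<Gamma> f"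
  using gamma.amap_cmp[of f "Dom FA f" "Cod FA f" g "Cod FA g"] assms by (simp add: F_fb_simps HoF_fb_simps)

lemma Gamma_idt:
  assumes "x \<in> Obj \<F>"
  shows "\<Gamma> (Idt \<F> x) = Idt \<H> x"
  using gamma.amap_idt[of x] assms by (simp add: F_fb_simps HoF_fb_simps)

text \<open>Vertical isomorphisms compare an arbitrary diagram with a standard one. Since they
  survive the localization, preservation only has to be known for standard diagrams.\<close>

lemma Gamma_viso:
  assumes r: "is_iso (fiber (F_fb M) A) r" and A: "fibrant M A"
  shows "is_iso (fiber (HoF_fb M) A) (\<Gamma> r)" "r \<in> Arr \<F>"
proof -
  have A': "A \<in> Obj (Tgt (F_fb M))" using A by simp
  obtain s where s: "r \<in> Arr \<F>" "s \<in> Arr \<F>" "Dom \<F> s = Cod \<F> r" "Cod \<F> s = Dom \<F> r" "s \<cdot>\<^bsub>\<F>\<^esub> r = Idt \<F> (Dom \<F> r)" "r \<cdot>\<^bsub>\<F>\<^esub> s = Idt \<F> (Cod \<F> r)"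
    "AMap (F_fb M) r = Idt M A" "AMap (F_fb M) s = Idt M A"
    using T.tot.viso_inverse[OF r A'] unfolding T.tgt fibrant_cat_simps by blast
  show "r \<in> Arr \<F>" by (rule s)
  have o: "Dom \<F> r \<in> Obj \<F>" "Cod \<F> r \<in> Obj \<F>" using s(1) category.dom_obj[OF T.category_Src] category.cod_obj[OF T.category_Src] by blast+
  show "is_iso (fiber (HoF_fb M) A) (\<Gamma> r)"
    by (rule H.tot.visoI[of _ "\<Gamma> s"])
      (use A s(3,4,7,8) Gamma_simps[OF s(1)] Gamma_simps[OF s(2)] Gamma_cmp[OF s(1,2)] Gamma_cmp[OF s(2,1)] Gamma_idt[OF o(1)] Gamma_idt[OF o(2)] s(5,6) in simp_all)
qed

text \<open>A cartesian arrow is a pullback square composed with a vertical isomorphism, and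
  pullback squares are cartesian in both fibrations. The preservation lemmas below follow the same
  pattern.\<close>

lemma cartesian_preserved:
  assumes c: "is_cartesian (F_fb M) c"
  shows "is_cartesian (HoF_fb M) (\<Gamma> c)"
proof -
  have ca: "c \<in> Arr \<F>" using T.tot.cartesian_arr[OF c] .
  obtain x t b y where S: "fib_square x t b y" and ce: "c = (x, t, b, y)" using T.G_full[OF ca] by blast
  note s = fib_squareD[OF S]
  have fb: "fibrant M (Dom M b)" using s(3,9) by simp
  obtain t0 x0 where P: "is_pullback M y t0 b x0" and S0: "fib_square x0 t0 b y" using fib_exists_pullback[OF s(2,4,8,10) fb] by blast
  obtain r where r: "is_iso (fiber (F_fb M) (Cod M x0)) r" "Cod \<F> r = x0" "c = (x0, t0, b, y) \<cdot>\<^bsub>\<F>\<^esub> r"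
    using T.tot.cartesian_viso[OF T.G_cartesian(1)[OF P s(2,4) fb] c] S S0 ce by auto
  have A: "fibrant M (Cod M x0)" using fib_squareD(3)[OF S0] .
  note R = Gamma_viso[OF r(1) A]
  have "\<Gamma> c = \<Gamma> (x0, t0, b, y) \<cdot>\<^bsub>\<H>\<^esub> \<Gamma> r"
    unfolding r(3) by (rule Gamma_cmp) (use R(2) S0 r(2) in simp_all)
  then show ?thesis using H.tot.cartesian_comp_viso(1)[OF H.G_cartesian(1)[OF P s(2,4) fb] R(1)] A S0 Gamma_simps(3)[OF R(2)] r(2) by simp
qed

lemma terminal_preserved:
  assumes A: "fibrant M A" and T: "is_terminal (fiber (F_fb M) A) T"
  shows "is_terminal (fiber (HoF_fb M) A) T"
proof -
  have AF: "A \<in> Obj (Tgt (F_fb M))" and AH: "A \<in> Obj \<B>" using A by simp_all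
  interpret CF: category "fiber (F_fb M) A" by (rule T.tot.category_fiber[OF AF])
  interpret CH: category "fiber (HoF_fb M) A" by (rule H.tot.category_fiber[OF AH])
  have "is_terminal (fiber (F_fb M) A) (Idt M A)" using T.tot.strong_terminal_fiber[OF T.std_terminal[OF A]] A by (simp add: fibrant_obj)
  from CF.terminal_unique_iso[OF this T] obtain r where r: "is_iso (fiber (F_fb M) A) r" "Dom \<F> r = Idt M A" "Cod \<F> r = T" by auto
  note R = Gamma_viso[OF r(1) A]
  have I: "is_terminal (fiber (HoF_fb M) A) (Idt M A)" using H.tot.strong_terminal_fiber[OF H.std_terminal[OF A]] A by (simp add: fibrant_obj)
  show ?thesis by (rule CH.terminal_iso[OF I CH.iso_arr[OF R(1)] _ _ R(1)]) (use Gamma_simps[OF R(2)] r in simp_all)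
qed

lemma initial_preserved:
  assumes A: "fibrant M A" and Z: "is_initial (fiber (F_fb M) A) Z"
  shows "is_initial (fiber (HoF_fb M) A) Z"
proof -
  have AF: "A \<in> Obj (Tgt (F_fb M))" and AH: "A \<in> Obj \<B>" using A by simp_all
  interpret CF: category "fiber (F_fb M) A" by (rule T.tot.category_fiber[OF AF])
  interpret CH: category "fiber (HoF_fb M) A" by (rule H.tot.category_fiber[OF AH])
  obtain I where I: "is_initial M I" using initial_exists by blast
  obtain z where z: "z \<in> Arr M" "Dom M z = I" "Cod M z = A" using initial_map[OF I, of A] A by (auto simp: fibrant_obj)
  have "is_initial (fiber (F_fb M) A) z" using T.std_initial[OF I z(1,2)] z A by simp
  from category.terminal_unique_iso[OF CF.category_opp this[unfolded is_initial_def] Z[unfolded is_initial_def]]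
  obtain r where r: "is_iso (fiber (F_fb M) A) r" "Cod \<F> r = z" "Dom \<F> r = Z" by (auto simp: CF.is_iso_opp)
  note R = Gamma_viso[OF r(1) A]
  have i: "is_initial (fiber (HoF_fb M) A) z" using H.std_initial[OF I z(1,2)] z A by simp
  show ?thesis unfolding is_initial_def
    by (rule category.terminal_iso[OF CH.category_opp i[unfolded is_initial_def], of "\<Gamma> r"])
      (use Gamma_simps[OF R(2)] r R(1) CH.iso_arr[OF R(1)] in \<open>simp_all add: CH.is_iso_opp\<close>)
qed

lemma product_preserved:
  assumes A: "fibrant M A" and P: "is_product (fiber (F_fb M) A) P Q R p q"
  shows "is_product (fiber (HoF_fb M) A) P Q R (\<Gamma> p) (\<Gamma> q)"
proof -
  have AF: "A \<in> Obj (Tgt (F_fb M))" and AH: "A \<in> Obj \<B>" using A by simp_all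
  interpret CF: category "fiber (F_fb M) A" by (rule T.tot.category_fiber[OF AF])
  interpret CH: category "fiber (HoF_fb M) A" by (rule H.tot.category_fiber[OF AH])
  have "P \<in> Obj (fiber (F_fb M) A)" "Q \<in> Obj (fiber (F_fb M) A)"
    using CF.cod_obj[OF CF.productD(1)[OF P]] CF.cod_obj[OF CF.productD(4)[OF P]] CF.productD(3,6)[OF P] by metis+
  then have PQ [simp]: "P \<in> Fib M" "Q \<in> Fib M" "Cod M P = A" "Cod M Q = A" by simp_all
  note [simp] = A fibrant_obj[OF A]
  obtain z1 z2 where Z: "is_pullback M P z1 Q z2" using pullback_exists[of P Q] by auto
  have Z': "is_pullback M (Idt M A \<cdot> P) z1 Q z2" using Z by simp
  let ?p = "(P \<cdot> z1, z1, Idt M A, P)" and ?q = "(P \<cdot> z1, z2, Idt M A, Q)"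
  have S: "fib_square (P \<cdot> z1) z1 (Idt M A) P" "fib_square (P \<cdot> z1) z2 (Idt M A) Q" using T.std_fibred_product(2,3)[OF Z'] by simp_all
  have "T.tot.fibred_product (Idt M A) P Q (P \<cdot> z1) ?p ?q" using T.std_fibred_product(1)[OF Z'] by simp
  then have F: "is_product (fiber (F_fb M) A) P Q (P \<cdot> z1) ?p ?q" using T.tot.fibred_product_fiber_idt[of P Q "P \<cdot> z1" ?p ?q] by simp
  \<comment> \<open>The same squares, read in the localization, form the standard product
    there.\<close>
  have "H.tot.fibred_product (Idt M A) P Q (P \<cdot> z1) (\<Gamma> ?p) (\<Gamma> ?q)" using H.std_fibred_product(1)[OF Z'] by simp
  then have H: "is_product (fiber (HoF_fb M) A) P Q (P \<cdot> z1) (\<Gamma> ?p) (\<Gamma> ?q)"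
    using H.tot.fibred_product_fiber_idt[of P Q "P \<cdot> z1" "\<Gamma> ?p" "\<Gamma> ?q"] by simp
  obtain r where r: "is_iso (fiber (F_fb M) A) r" "Dom \<F> r = R" "Cod \<F> r = P \<cdot> z1" "p = ?p \<cdot>\<^bsub>\<F>\<^esub> r" "q = ?q \<cdot>\<^bsub>\<F>\<^esub> r"
    using CF.product_iso[OF F P] unfolding fiber_simps by blast
  note G = Gamma_viso[OF r(1) A]
  have e: "\<Gamma> p = \<Gamma> ?p \<cdot>\<^bsub>\<H>\<^esub> \<Gamma> r"
    "\<Gamma> q = \<Gamma> ?q \<cdot>\<^bsub>\<H>\<^esub> \<Gamma> r"
    unfolding r(4,5) by (rule Gamma_cmp, use G(2) S r(3) in simp_all)+
  show ?thesis using CH.product_comp_iso[OF H G(1)] Gamma_simps[OF G(2)] r(2,3) by (simp add: e)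
qed

lemma coproduct_preserved:
  assumes A: "fibrant M A" and P: "is_coproduct (fiber (F_fb M) A) P Q R p q"
  shows "is_coproduct (fiber (HoF_fb M) A) P Q R (\<Gamma> p) (\<Gamma> q)"
proof -
  have AF: "A \<in> Obj (Tgt (F_fb M))" and AH: "A \<in> Obj \<B>" using A by simp_all
  interpret CF: category "fiber (F_fb M) A" by (rule T.tot.category_fiber[OF AF])
  interpret CH: category "fiber (HoF_fb M) A" by (rule H.tot.category_fiber[OF AH])
  have "P \<in> Obj (fiber (F_fb M) A)" "Q \<in> Obj (fiber (F_fb M) A)"
    using CF.dom_obj[OF CF.coproductD(1)[OF P]] CF.dom_obj[OF CF.coproductD(4)[OF P]] CF.coproductD(3,6)[OF P] by metis+
  then have PQ [simp]: "P \<in> Fib M" "Q \<in> Fib M" "Cod M P = A" "Cod M Q = A" by simp_all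
  note [simp] = A fibrant_obj[OF A]
  obtain S i j where S: "is_coproduct M (Dom M P) (Dom M Q) S i j" using coproduct_exists[of "Dom M P" "Dom M Q"] by auto
  obtain s where s: "s \<in> Arr M" "Dom M s = S" "Cod M s = A" "s \<cdot> i = P" "s \<cdot> j = Q" using coproduct_ex[OF S, of P Q] by auto
  have fs: "s \<cdot> i \<in> Fib M" "s \<cdot> j \<in> Fib M" "fibrant M (Cod M s)" by (simp_all add: s)
  let ?i = "(P, i, Idt M A, s)" and ?j = "(Q, j, Idt M A, s)"
  note F = T.std_coproduct[OF S s(1,2) fs, unfolded s(3-5)] and H = H.std_coproduct(1)[OF S s(1,2) fs, unfolded s(3-5)]
  obtain r where r: "is_iso (fiber (F_fb M) A) r" "Cod \<F> r = R" "Dom \<F> r = s" "p = r \<cdot>\<^bsub>\<F>\<^esub> ?i" "q = r \<cdot>\<^bsub>\<F>\<^esub> ?j"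
    using category.product_iso[OF CF.category_opp F(1)[unfolded is_coproduct_def] P[unfolded is_coproduct_def]]
    unfolding opp_simps CF.is_iso_opp fiber_simps by blast
  note G = Gamma_viso[OF r(1) A]
  have e: "\<Gamma> p = \<Gamma> r \<cdot>\<^bsub>\<H>\<^esub> \<Gamma> ?i"
    "\<Gamma> q = \<Gamma> r \<cdot>\<^bsub>\<H>\<^esub> \<Gamma> ?j"
    unfolding r(4,5) by (rule Gamma_cmp, use G(2) F(2,3) r(3) in simp_all)+
  show ?thesis unfolding is_coproduct_def
    using category.product_comp_iso[OF CH.category_opp H[unfolded is_coproduct_def], of "\<Gamma> r" R] G(1) Gamma_simps[OF G(2)] r(2,3)
    by (simp add: e CH.is_iso_opp)
qed

text \<open>Both the exponential object and the product in the diagram have to be compared with the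
  standard ones, and the images of the comparisons must still commute with projections and
  evaluation.\<close>

lemma exponential_preserved:
  assumes A: "fibrant M A" and X: "is_exponential (fiber (F_fb M) A) P Q X R p q e"
  shows "is_exponential (fiber (HoF_fb M) A) P Q X R (\<Gamma> p) (\<Gamma> q) (\<Gamma> e)"
proof -
  let \<F> = "\<F>" and ?I = "Idt M A"
  have AF: "A \<in> Obj (Tgt (F_fb M))" and AH: "A \<in> Obj \<B>" using A by simp_all
  interpret CF: category "fiber (F_fb M) A" by (rule T.tot.category_fiber[OF AF])
  interpret CH: category "fiber (HoF_fb M) A" by (rule H.tot.category_fiber[OF AH])
  note pD = CF.productD[OF CF.exponentialD(1)[OF X]]
  have "P \<in> Obj (fiber (F_fb M) A)" "Q \<in> Obj (fiber (F_fb M) A)"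
    using CF.cod_obj[OF pD(4)] CF.cod_obj[OF CF.exponentialD(2)[OF X]] pD(6) CF.exponentialD(4)[OF X] by metis+
  then have PQ [simp]: "P \<in> Fib M" "Q \<in> Fib M" "Cod M P = A" "Cod M Q = A" by simp_all
  note [simp] = A fibrant_obj[OF A]
  obtain z1 z2 where Z: "is_pullback M P z1 Q z2" using pullback_exists[of P Q] by auto
  obtain r c s d where R: "slice_Pi M P z1 r c s d" using slice_Pi_exists[of P z1] pullbackD[OF Z] by auto
  have pq: "P \<in> Fib M" "Q \<in> Fib M" "Cod M Q = Cod M P" "fibrant M (Cod M P)" by simp_all
  note F = T.std_exponential[OF pq Z R, unfolded PQ(3)] and H = H.std_exponential[OF pq Z R, unfolded PQ(3)]
  let ?p = "(r \<cdot> c, c, ?I, r)" and ?q = "(r \<cdot> c, s, ?I, P)" and ?e = "(r \<cdot> c, z2 \<cdot> d, ?I, Q)"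
  have FX: "is_exponential (fiber (F_fb M) A) P Q r (r \<cdot> c) ?p ?q ?e" using T.tot.strong_exponential_fiber[OF F(1)] F(3) by simp
  have HX: "is_exponential (fiber (HoF_fb M) A) P Q r (r \<cdot> c) (\<Gamma> ?p) (\<Gamma> ?q) (\<Gamma> ?e)"
    using H.tot.strong_exponential_fiber[OF H(1)] H(3) by simp
  obtain a k where a: "is_iso (fiber (F_fb M) A) a" "Dom \<F> a = X" "Cod \<F> a = r" and k: "is_iso (fiber (F_fb M) A) k" "Dom \<F> k = R" "Cod \<F> k = r \<cdot> c"
    and e: "?p \<cdot>\<^bsub>\<F>\<^esub> k = a \<cdot>\<^bsub>\<F>\<^esub> p" "?q \<cdot>\<^bsub>\<F>\<^esub> k = q" "?e \<cdot>\<^bsub>\<F>\<^esub> k = e"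
    using CF.exponential_iso[OF FX X] unfolding fiber_simps by blast
  note ga = Gamma_viso[OF a(1) A] and gk = Gamma_viso[OF k(1) A]
  have p: "p \<in> Arr \<F>" "Dom \<F> p = R" "Cod \<F> p = X" using pD unfolding fiber_simps by blast+
  have "\<Gamma> (?p \<cdot>\<^bsub>\<F>\<^esub> k) = \<Gamma> ?p \<cdot>\<^bsub>\<H>\<^esub> \<Gamma> k"
    "\<Gamma> (?q \<cdot>\<^bsub>\<F>\<^esub> k) = \<Gamma> ?q \<cdot>\<^bsub>\<H>\<^esub> \<Gamma> k"
    "\<Gamma> (?e \<cdot>\<^bsub>\<F>\<^esub> k) = \<Gamma> ?e \<cdot>\<^bsub>\<H>\<^esub> \<Gamma> k"
    by (rule Gamma_cmp, use gk(2) F(4-6) k(3) in simp_all)+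
  note g = this[unfolded e]
  have ap: "\<Gamma> (a \<cdot>\<^bsub>\<F>\<^esub> p) = \<Gamma> a \<cdot>\<^bsub>\<H>\<^esub> \<Gamma> p" by (rule Gamma_cmp) (use p ga(2) a(2) in simp_all)
  have pv: "AMap (F_fb M) p = ?I" using pD(1) by simp
  show ?thesis
    by (rule CH.exponential_comp_iso[OF HX ga(1) _ _ gk(1)])
      (use Gamma_simps[OF ga(2)] Gamma_simps[OF gk(2)] Gamma_simps[OF p(1)] p(2,3) a(2,3) k(2,3) pv g ap in simp_all)
qed

text \<open>Over a product projection the base arrow is a fibration, so the lift is isomorphic to
  the one given by composition, which is cocartesian in both fibrations.\<close>

lemma cocartesian_preserved:
  assumes q: "is_cocartesian (F_fb M) q" and g: "product_projection (fibrant_cat M) (AMap (F_fb M) q)"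
  shows "is_cocartesian (HoF_fb M) (\<Gamma> q)"
proof -
  have qa: "q \<in> Arr \<F>" using T.tot.cocartesian_arr[OF q] .
  obtain x t b y where S: "fib_square x t b y" and qe: "q = (x, t, b, y)" using T.G_full[OF qa] by blast
  note s = fib_squareD[OF S]
  have b: "b \<in> Fib M" using fibrant_cat_projection_fib[OF g] S qe by simp
  have fb: "fibrant M (Cod M b)" using s(4,10) by simp
  note F = T.std_cocartesian[OF s(1) b s(9) fb] and H = H.std_cocartesian(1)[OF s(1) b s(9) fb]
  let ?q = "(x, Idt M (Dom M x), b, b \<cdot> x)"
  have yA: "Cod M (b \<cdot> x) = Cod M b" using s b by simp
  obtain r where r: "is_iso (fiber (F_fb M) (Cod M b)) r" "Dom \<F> r = b \<cdot> x" "q = r \<cdot>\<^bsub>\<F>\<^esub> ?q"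
    using T.tot.cocartesian_viso[OF F(1) q] F(2) S qe yA by auto
  note R = Gamma_viso[OF r(1) fb]
  have "\<Gamma> q = \<Gamma> r \<cdot>\<^bsub>\<H>\<^esub> \<Gamma> ?q"
    unfolding r(3) by (rule Gamma_cmp) (use R(2) F(2) r(2) in simp_all)
  then show ?thesis using H.tot.viso_comp_cocartesian[OF H R(1)] fb F(2) Gamma_simps(2)[OF R(2)] r(2) by simp
qed

text \<open>The diagram is isomorphic to the one given by \<open>slice_Pi\<close>, whose squares
  form a \<open>\<Prod>\<close>-diagram before and after localization; the projection
  \<open>g\<close> being a fibration is what makes that standard diagram available.\<close>

lemma Pi_preserved:
  assumes P: "is_Pi_diagram (F_fb M) g p c e" and g: "product_projection (fibrant_cat M) g"
  shows "is_Pi_diagram (HoF_fb M) g p (\<Gamma> c) (\<Gamma> e)"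
proof -
  note D = T.tot.Pi_diagramD[OF P]
  have gf: "g \<in> Fib M" using fibrant_cat_projection_fib[OF g] .
  have gB: "g \<in> Arr M" "fibrant M (Dom M g)" "fibrant M (Cod M g)" using D(1) by simp_all
  have "p \<in> Obj \<F>" using category.cod_obj[OF T.category_Src D(5)] D(7) by metis
  then have pf: "p \<in> Fib M" by simp
  have pc: "Cod M p = Dom M g" using T.tot.vertical_objs(2)[of e "Dom M g"] D gB by simp
  obtain r k s d where R: "slice_Pi M g p r k s d" using slice_Pi_exists[of g p] gB pf pc by auto
  note F = T.std_Pi[OF R gf pf gB(3)] and H = H.std_Pi(1)[OF R gf pf gB(3)]
  let ?c = "(s, k, g, r)" and ?e = "(s, d, Idt M (Dom M g), p)"
  obtain a b where a: "is_iso (fiber (F_fb M) (Cod M g)) a" "Dom \<F> a = Cod \<F> c" "Cod \<F> a = Cod \<F> ?c" and b: "is_iso (fiber (F_fb M) (Dom M g)) b"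
    "Dom \<F> b = Dom \<F> c" "Cod \<F> b = Dom \<F> ?c" and e: "?c \<cdot>\<^bsub>\<F>\<^esub> b = a \<cdot>\<^bsub>\<F>\<^esub> c" "?e \<cdot>\<^bsub>\<F>\<^esub> b = e"
    using T.tot.Pi_diagram_iso[OF T.tot.strong_Pi_diagram[OF F(1)] P] unfolding T.tgt fibrant_cat_simps by blast
  note ga = Gamma_viso[OF a(1) gB(3)] and gb = Gamma_viso[OF b(1) gB(2)]
  have ar: "Cod \<F> a = r" "Cod \<F> b = s" using a(3) b(3) F(2) by simp_all
  have gc: "\<Gamma> (?c \<cdot>\<^bsub>\<F>\<^esub> b) = \<Gamma> ?c \<cdot>\<^bsub>\<H>\<^esub> \<Gamma> b"
    "\<Gamma> (?e \<cdot>\<^bsub>\<F>\<^esub> b) = \<Gamma> ?e \<cdot>\<^bsub>\<H>\<^esub> \<Gamma> b"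
    by (rule Gamma_cmp, use gb(2) F(2,3) ar(2) in simp_all)+
  have ac: "\<Gamma> (a \<cdot>\<^bsub>\<F>\<^esub> c) = \<Gamma> a \<cdot>\<^bsub>\<H>\<^esub> \<Gamma> c" by (rule Gamma_cmp) (use D(3) ga(2) a(2) in simp_all)
  note gg = gc[unfolded e]
  have ia: "is_iso (fiber (HoF_fb M) (Cod \<B> g)) (\<Gamma> a)"
    and ib: "is_iso (fiber (HoF_fb M) (Dom \<B> g)) (\<Gamma> b)"
    using ga(1) gb(1) by simp_all
  show ?thesis
    by (rule H.tot.Pi_diagram_comp_viso[OF H.tot.strong_Pi_diagram[OF H] ia _ _ ib])
      (use Gamma_simps[OF ga(2)] Gamma_simps[OF gb(2)] Gamma_simps[OF D(3)] F(2) ar a(2) b(2) gg ac in simp_all)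
qed

lemma h_fibration_morphism_gamma: "h_fibration_morphism (F_fb M) (HoF_fb M) (gamma_fb M)"
proof (rule h_fibration_morphism.intro[OF T.h_fibration_quotient H.h_fibration_quotient gamma.cat_functor_axioms], rule h_fibration_morphism_axioms.intro)
  show "\<B> = Tgt (F_fb M)" "Src (gamma_fb M) = \<F>" "Tgt (gamma_fb M) = \<H>"
    by (simp_all add: F_fb_simps HoF_fb_simps)
  show "AMap (HoF_fb M) (\<Gamma> f) = AMap (F_fb M) f" if "f \<in> Arr \<F>" for f by (rule Gamma_simps[OF that])
qed (simp_all add: cartesian_preserved terminal_preserved initial_preserved product_preserved coproduct_preserved exponential_preserved
  cocartesian_preserved Pi_preserved)

end

theorem theorem3p3p2:
  fixes M :: "('o, 'a) model_cat"
  assumes "suitable_model_category M"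
  shows "h_eq_fibration (HoF_fb M) \<and> h_fibration_morphism (F_fb M) (HoF_fb M) (gamma_fb M)"
proof -
  interpret suitable_model_category M by fact
  obtain cyl pr i0 i1 where "interval_cylinder M cyl pr i0 i1" using interval_cylinder_exists by blast
  then interpret interval_cylinder M cyl pr i0 i1 .
  show ?thesis using h_eq_fibration_HoF h_fibration_morphism_gamma by blast
qed

end
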